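(* Let $(A,\mathfrak{m})$ be a Noetherian local ring, $M$ a finitely generated $A$-module with $\operatorname{depth} M\geq 2$, and $I$ an ideal of definition for $M$. Let $x$ be $M$-superficial with respect to $I$ and set $N = M/xM$. Then there is a long exact sequence of graded $R(I)$-modules $$0\to \mathcal{B}^I(x,M)\to H^0(L^I(M))(-1)\to H^0(L^I(M))\to H^0(L^I(N))\to H^1(L^I(M))(-1)\to H^1(L^I(M))\to H^1(L^I(N))\to\cdots$$ $$\cdots\to H^i(L^I(M))(-1)\to H^i(L^I(M))\to H^i(L^I(N))\to\cdots$$ in which the maps $H^i(L^I(M))(-1)\to H^i(L^I(M))$ are induced by multiplication by $xt\in R(I)_1$ and the maps $H^i(L^I(M))\to H^i(L^I(N))$ are induced by the natural surjection $L^I(M)\to L^I(N)$.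
   Context: $I$ is an ideal of definition for $M$ if $M/IM$ has finite length. $x\in I$ is $M$-superficial with respect to $I$ if there is $c\geq 0$ with $(I^{n+1}M:_M x)\cap I^cM = I^nM$ for all $n\geq c$. $R(I) = \bigoplus_{n\geq 0}I^nt^n$ is the Rees ring, $\mathfrak{M} = \mathfrak{m}\oplus R(I)_+$, and $H^i(-) = H^i_{\mathfrak{M}}(-)$ is graded local cohomology. For a finitely generated $A$-module $E$, $L^I(E) = \bigoplus_{n\geq 0}E/I^{n+1}E$ (degree $n$ component $E/I^{n+1}E$) is the graded $R(I)$-module with $(at^k)\cdot(p+I^{n+1}E) = ap+I^{n+k+1}E$ for $a\in I^k$. $\mathcal{B}^I(x,M) = \bigoplus_{n\geq 0}(I^{n+1}M:_M x)/I^nM$ (the summand indexed by $n$ in degree $n$) is the kernel of multiplication by $xt$, $L^I(M)(-1)\to L^I(M)$. *)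

theory Defs
  imports "HOL-Algebra.UnivPoly" "HOL-Algebra.Ring_Divisibility" "HOL-Algebra.Ideal_Product"
    "HOL-Library.Extended_Nat"
begin

section \<open>Local rings and modules\<close>

definition noetherian_local :: "('a, 'x) ring_scheme \<Rightarrow> 'a set \<Rightarrow> bool" where
  "noetherian_local A \<mm> \<longleftrightarrow>
     cring A \<and> noetherian_ring A \<and> maximalideal \<mm> A \<and> (\<forall>J. maximalideal J A \<longrightarrow> J = \<mm>)"

primrec ideal_pow :: "('a, 'x) ring_scheme \<Rightarrow> 'a set \<Rightarrow> nat \<Rightarrow> 'a set" where
  "ideal_pow A J 0 = carrier A"
| "ideal_pow A J (Suc n) = ideal_prod A J (ideal_pow A J n)"

definition module_span ::
    "('a, 'x) ring_scheme \<Rightarrow> ('a, 'm, 'y) module_scheme \<Rightarrow> 'm set \<Rightarrow> 'm set" where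
  "module_span A M S = \<Inter>{H. submodule H A M \<and> S \<subseteq> H}"

definition fin_gen_module :: "('a, 'x) ring_scheme \<Rightarrow> ('a, 'm, 'y) module_scheme \<Rightarrow> bool" where
  "fin_gen_module A M \<longleftrightarrow>
     module A M \<and> (\<exists>S. finite S \<and> S \<subseteq> carrier M \<and> module_span A M S = carrier M)"

definition ideal_smult ::
    "('a, 'x) ring_scheme \<Rightarrow> 'a set \<Rightarrow> ('a, 'm, 'y) module_scheme \<Rightarrow> 'm set" where
  "ideal_smult A J M = module_span A M {a \<odot>\<^bsub>M\<^esub> m | a m. a \<in> J \<and> m \<in> carrier M}"

text \<open>The library has no quotient modules. The ring components \<open>mult\<close> and \<open>one\<close> of a module
  record carry no meaning. In \<open>smult\<close> all cosets of the union coincide.\<close>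

definition quot_module ::
    "('a, 'm, 'y) module_scheme \<Rightarrow> 'm set \<Rightarrow> ('a, 'm set) module" where
  "quot_module M H =
     \<lparr> carrier = a_rcosets\<^bsub>M\<^esub> H, monoid.mult = undefined, one = undefined,
       zero = H, add = set_add M,
       smult = (\<lambda>a C. \<Union>m\<in>C. H +>\<^bsub>M\<^esub> (a \<odot>\<^bsub>M\<^esub> m)) \<rparr>"

text \<open>Finite length: there is a composition series, listed from \<open>0\<close> to the whole module.\<close>

definition finite_length :: "('a, 'x) ring_scheme \<Rightarrow> ('a, 'm, 'y) module_scheme \<Rightarrow> bool" where
  "finite_length A M \<longleftrightarrow>
     (\<exists>Hs. Hs \<noteq> [] \<and> hd Hs = {\<zero>\<^bsub>M\<^esub>} \<and> last Hs = carrier M \<and>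
       (\<forall>H\<in>set Hs. submodule H A M) \<and>
       (\<forall>i. Suc i < length Hs \<longrightarrow> Hs ! i \<subset> Hs ! Suc i \<and>
          (\<forall>K. submodule K A M \<longrightarrow> Hs ! i \<subseteq> K \<longrightarrow> K \<subseteq> Hs ! Suc i \<longrightarrow> K = Hs ! i \<or> K = Hs ! Suc i)))"

definition ideal_of_definition ::
    "('a, 'x) ring_scheme \<Rightarrow> ('a, 'm, 'y) module_scheme \<Rightarrow> 'a set \<Rightarrow> bool" where
  "ideal_of_definition A M I \<longleftrightarrow>
     ideal I A \<and> finite_length A (quot_module M (ideal_smult A I M))"

definition nonzerodivisor_on ::
    "'a \<Rightarrow> ('a, 'm, 'y) module_scheme \<Rightarrow> bool" where
  "nonzerodivisor_on a M \<longleftrightarrow> (\<forall>m\<in>carrier M. a \<odot>\<^bsub>M\<^esub> m = \<zero>\<^bsub>M\<^esub> \<longrightarrow> m = \<zero>\<^bsub>M\<^esub>)"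

definition regular_sequence ::
    "('a, 'x) ring_scheme \<Rightarrow> ('a, 'm, 'y) module_scheme \<Rightarrow> 'a list \<Rightarrow> bool" where
  "regular_sequence A M xs \<longleftrightarrow>
     set xs \<subseteq> carrier A \<and>
     (\<forall>i<length xs. nonzerodivisor_on (xs ! i)
        (quot_module M (ideal_smult A (Idl\<^bsub>A\<^esub> (set (take i xs))) M))) \<and>
     ideal_smult A (Idl\<^bsub>A\<^esub> (set xs)) M \<noteq> carrier M"

text \<open>The zero module has infinite depth.\<close>

definition depth ::
    "('a, 'x) ring_scheme \<Rightarrow> 'a set \<Rightarrow> ('a, 'm, 'y) module_scheme \<Rightarrow> enat" where
  "depth A \<mm> M =
     (if carrier M = {\<zero>\<^bsub>M\<^esub>} then \<infinity>
      else (SUP xs \<in> {xs. set xs \<subseteq> \<mm> \<and> regular_sequence A M xs}. enat (length xs)))"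

definition colon :: "('a, 'm, 'y) module_scheme \<Rightarrow> 'm set \<Rightarrow> 'a \<Rightarrow> 'm set" where
  "colon M H x = {m \<in> carrier M. x \<odot>\<^bsub>M\<^esub> m \<in> H}"

definition superficial ::
    "('a, 'x) ring_scheme \<Rightarrow> ('a, 'm, 'y) module_scheme \<Rightarrow> 'a set \<Rightarrow> 'a \<Rightarrow> bool" where
  "superficial A M I x \<longleftrightarrow>
     x \<in> I \<and>
     (\<exists>c. \<forall>n\<ge>c. colon M (ideal_smult A (ideal_pow A I (n + 1)) M) x
                   \<inter> ideal_smult A (ideal_pow A I c) M
                 = ideal_smult A (ideal_pow A I n) M)"

section \<open>Graded modules\<close>

text \<open>\<open>hcomp E n\<close> is the homogeneous component of degree \<open>n\<close>. A graded ring is given by a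
  ring \<open>R\<close> together with the family \<open>G\<close> of its homogeneous components.\<close>

record ('r, 'e) graded_module = "('r, 'e) module" +
  hcomp :: "int \<Rightarrow> 'e set"

definition is_graded_module ::
    "('r, 'x) ring_scheme \<Rightarrow> (int \<Rightarrow> 'r set) \<Rightarrow> ('r, 'e) graded_module \<Rightarrow> bool" where
  "is_graded_module R G E \<longleftrightarrow>
     module R E \<and>
     (\<forall>n. additive_subgroup (hcomp E n) E) \<and>
     (\<forall>e\<in>carrier E. \<exists>!c. (\<forall>n. c n \<in> hcomp E n) \<and> finite {n. c n \<noteq> \<zero>\<^bsub>E\<^esub>} \<and>
        e = finsum E c {n. c n \<noteq> \<zero>\<^bsub>E\<^esub>}) \<and>
     (\<forall>i j. \<forall>a\<in>G i. \<forall>e\<in>hcomp E j. a \<odot>\<^bsub>E\<^esub> e \<in> hcomp E (i + j))"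

definition graded_hom ::
    "('r, 'x) ring_scheme \<Rightarrow> ('r, 'e) graded_module \<Rightarrow> ('r, 'f) graded_module \<Rightarrow> ('e \<Rightarrow> 'f) set" where
  "graded_hom R X Y =
     {h. h \<in> carrier X \<rightarrow> carrier Y \<and>
         (\<forall>u\<in>carrier X. \<forall>v\<in>carrier X. h (u \<oplus>\<^bsub>X\<^esub> v) = h u \<oplus>\<^bsub>Y\<^esub> h v) \<and>
         (\<forall>a\<in>carrier R. \<forall>u\<in>carrier X. h (a \<odot>\<^bsub>X\<^esub> u) = a \<odot>\<^bsub>Y\<^esub> h u) \<and>
         (\<forall>n. h ` hcomp X n \<subseteq> hcomp Y n)}"

definition gr_exact ::
    "('r, 'x) ring_scheme \<Rightarrow> (int \<Rightarrow> 'r set) \<Rightarrow> ('r, 'e) graded_module \<Rightarrow> ('e \<Rightarrow> 'f) \<Rightarrow>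
     ('r, 'f) graded_module \<Rightarrow> ('f \<Rightarrow> 'g) \<Rightarrow> ('r, 'g) graded_module \<Rightarrow> bool" where
  "gr_exact R G X f Y g Z \<longleftrightarrow>
     is_graded_module R G X \<and> is_graded_module R G Y \<and> is_graded_module R G Z \<and>
     f \<in> graded_hom R X Y \<and> g \<in> graded_hom R Y Z \<and>
     f ` carrier X = {y \<in> carrier Y. g y = \<zero>\<^bsub>Z\<^esub>}"

definition gr_shift :: "int \<Rightarrow> ('r, 'e) graded_module \<Rightarrow> ('r, 'e) graded_module" where
  "gr_shift k E = E\<lparr>hcomp := (\<lambda>n. hcomp E (n + k))\<rparr>"

definition gr_sub :: "('r, 'e) graded_module \<Rightarrow> 'e set \<Rightarrow> ('r, 'e) graded_module" where
  "gr_sub E H = E\<lparr>carrier := H, hcomp := (\<lambda>n. hcomp E n \<inter> H)\<rparr>"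

definition gr_quot :: "('r, 'e) graded_module \<Rightarrow> 'e set \<Rightarrow> ('r, 'e set) graded_module" where
  "gr_quot E H = module.extend (quot_module E H)
     (graded_module.fields (\<lambda>n. (\<lambda>e. H +>\<^bsub>E\<^esub> e) ` hcomp E n))"

text \<open>Injective objects of the category of graded modules. HOL cannot quantify over types in a
  formula, so the test modules \<open>X\<close>, \<open>Y\<close> live on the element type of \<open>R\<close>. No generality is
  lost: all shifts of \<open>R\<close> and of its homogeneous ideals occur among them, and by the graded
  version of Baer's criterion these already detect injectivity.\<close>

definition gr_injective ::
    "('r, 'x) ring_scheme \<Rightarrow> (int \<Rightarrow> 'r set) \<Rightarrow> ('r, 'e) graded_module \<Rightarrow> bool" where
  "gr_injective R G E \<longleftrightarrow>
     is_graded_module R G E \<and>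
     (\<forall>(X :: ('r, 'r) graded_module) (Y :: ('r, 'r) graded_module) f g.
        is_graded_module R G X \<longrightarrow> is_graded_module R G Y \<longrightarrow>
        f \<in> graded_hom R X Y \<longrightarrow> inj_on f (carrier X) \<longrightarrow> g \<in> graded_hom R X E \<longrightarrow>
        (\<exists>h \<in> graded_hom R Y E. \<forall>u\<in>carrier X. h (f u) = g u))"

section \<open>Graded local cohomology\<close>

text \<open>\<open>0 \<rightarrow> L \<rightarrow> E 0 \<rightarrow> E 1 \<rightarrow> \<dots>\<close> with augmentation \<open>\<epsilon>\<close> and differentials \<open>d\<close>.\<close>

definition gr_injective_resolution ::
    "('r, 'x) ring_scheme \<Rightarrow> (int \<Rightarrow> 'r set) \<Rightarrow> ('r, 'l) graded_module \<Rightarrow>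
     (nat \<Rightarrow> ('r, 'e) graded_module) \<Rightarrow> (nat \<Rightarrow> 'e \<Rightarrow> 'e) \<Rightarrow> ('l \<Rightarrow> 'e) \<Rightarrow> bool" where
  "gr_injective_resolution R G L E d \<epsilon> \<longleftrightarrow>
     (\<forall>i. gr_injective R G (E i)) \<and>
     \<epsilon> \<in> graded_hom R L (E 0) \<and> inj_on \<epsilon> (carrier L) \<and>
     (\<forall>i. d i \<in> graded_hom R (E i) (E (Suc i))) \<and>
     \<epsilon> ` carrier L = {e \<in> carrier (E 0). d 0 e = \<zero>\<^bsub>E (Suc 0)\<^esub>} \<and>
     (\<forall>i. d i ` carrier (E i) = {e \<in> carrier (E (Suc i)). d (Suc i) e = \<zero>\<^bsub>E (Suc (Suc i))\<^esub>})"

text \<open>\<open>\<phi>\<close> is a morphism of complexes \<open>E \<rightarrow> F\<close> lifting \<open>f : K \<rightarrow> L\<close>, where \<open>(E, d, \<epsilon>)\<close> and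
  \<open>(F, d', \<eta>)\<close> are resolutions of \<open>K\<close> and \<open>L\<close>.\<close>

definition gr_lift ::
    "('r, 'x) ring_scheme \<Rightarrow>
     ('r, 'k) graded_module \<Rightarrow> (nat \<Rightarrow> ('r, 'e) graded_module) \<Rightarrow> (nat \<Rightarrow> 'e \<Rightarrow> 'e) \<Rightarrow> ('k \<Rightarrow> 'e) \<Rightarrow>
     (nat \<Rightarrow> ('r, 'f) graded_module) \<Rightarrow> (nat \<Rightarrow> 'f \<Rightarrow> 'f) \<Rightarrow> ('l \<Rightarrow> 'f) \<Rightarrow>
     ('k \<Rightarrow> 'l) \<Rightarrow> (nat \<Rightarrow> 'e \<Rightarrow> 'f) \<Rightarrow> bool" where
  "gr_lift R K E d \<epsilon> F d' \<eta> f \<phi> \<longleftrightarrow>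
     (\<forall>i. \<phi> i \<in> graded_hom R (E i) (F i)) \<and>
     (\<forall>i. \<forall>e\<in>carrier (E i). \<phi> (Suc i) (d i e) = d' i (\<phi> i e)) \<and>
     (\<forall>u\<in>carrier K. \<phi> 0 (\<epsilon> u) = \<eta> (f u))"

text \<open>The section functor \<open>\<Gamma>\<close> with support in the ideal \<open>J\<close>.\<close>

definition torsion ::
    "('r, 'x) ring_scheme \<Rightarrow> 'r set \<Rightarrow> ('r, 'e, 'y) module_scheme \<Rightarrow> 'e set" where
  "torsion R J E = {e \<in> carrier E. \<exists>n. \<forall>a\<in>ideal_pow R J n. a \<odot>\<^bsub>E\<^esub> e = \<zero>\<^bsub>E\<^esub>}"

definition lc_cocycles ::
    "('r, 'x) ring_scheme \<Rightarrow> 'r set \<Rightarrow> (nat \<Rightarrow> ('r, 'e) graded_module) \<Rightarrow> (nat \<Rightarrow> 'e \<Rightarrow> 'e) \<Rightarrow>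
     nat \<Rightarrow> 'e set" where
  "lc_cocycles R J E d i = {e \<in> torsion R J (E i). d i e = \<zero>\<^bsub>E (Suc i)\<^esub>}"

definition lc_coboundaries ::
    "('r, 'x) ring_scheme \<Rightarrow> 'r set \<Rightarrow> (nat \<Rightarrow> ('r, 'e) graded_module) \<Rightarrow> (nat \<Rightarrow> 'e \<Rightarrow> 'e) \<Rightarrow>
     nat \<Rightarrow> 'e set" where
  "lc_coboundaries R J E d i =
     (case i of 0 \<Rightarrow> {\<zero>\<^bsub>E 0\<^esub>} | Suc j \<Rightarrow> d j ` torsion R J (E j))"

text \<open>\<open>local_cohomology R J E d i\<close> is the graded module \<open>H\<^sup>i(\<Gamma>(E))\<close>; for a graded injective
  resolution \<open>(E, d)\<close> of \<open>L\<close> this is the \<open>i\<close>-th right derived functor of \<open>\<Gamma>\<close> at \<open>L\<close>.\<close>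

definition local_cohomology ::
    "('r, 'x) ring_scheme \<Rightarrow> 'r set \<Rightarrow> (nat \<Rightarrow> ('r, 'e) graded_module) \<Rightarrow> (nat \<Rightarrow> 'e \<Rightarrow> 'e) \<Rightarrow>
     nat \<Rightarrow> ('r, 'e set) graded_module" where
  "local_cohomology R J E d i =
     gr_quot (gr_sub (E i) (lc_cocycles R J E d i)) (lc_coboundaries R J E d i)"

text \<open>The map induced on the \<open>i\<close>-th cohomology by a morphism of complexes \<open>\<phi>\<close> into
  \<open>(F, d')\<close>; on a cohomology class \<open>C\<close> all cosets of the union coincide.\<close>

definition lc_map ::
    "('r, 'x) ring_scheme \<Rightarrow> 'r set \<Rightarrow> (nat \<Rightarrow> ('r, 'f) graded_module) \<Rightarrow> (nat \<Rightarrow> 'f \<Rightarrow> 'f) \<Rightarrow>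
     (nat \<Rightarrow> 'e \<Rightarrow> 'f) \<Rightarrow> nat \<Rightarrow> 'e set \<Rightarrow> 'f set" where
  "lc_map R J F d' \<phi> i C = (\<Union>z\<in>C. lc_coboundaries R J F d' i +>\<^bsub>F i\<^esub> \<phi> i z)"

section \<open>The Rees ring and the modules over it\<close>

text \<open>\<open>R(I)\<close> as a subring of the polynomial ring; the elements of \<open>UP A\<close> are the coefficient
  functions.\<close>

definition rees_ring :: "('a, 'x) ring_scheme \<Rightarrow> 'a set \<Rightarrow> ('a, nat \<Rightarrow> 'a) up_ring" where
  "rees_ring A I = (UP A)\<lparr>carrier := {p \<in> carrier (UP A). \<forall>n. p n \<in> ideal_pow A I n}\<rparr>"

definition rees_grading :: "('a, 'x) ring_scheme \<Rightarrow> 'a set \<Rightarrow> int \<Rightarrow> (nat \<Rightarrow> 'a) set" where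
  "rees_grading A I n = {p \<in> carrier (rees_ring A I). \<forall>j. int j \<noteq> n \<longrightarrow> p j = \<zero>\<^bsub>A\<^esub>}"

text \<open>The ideal \<open>\<mm> \<oplus> R(I)\<^sub>+\<close>.\<close>

definition rees_max :: "('a, 'x) ring_scheme \<Rightarrow> 'a set \<Rightarrow> 'a set \<Rightarrow> (nat \<Rightarrow> 'a) set" where
  "rees_max A \<mm> I = {p \<in> carrier (rees_ring A I). p 0 \<in> \<mm>}"

text \<open>For submodules \<open>V n \<subseteq> U n\<close> of \<open>M\<close> with \<open>I\<^sup>k V n \<subseteq> V (n + k)\<close> and
  \<open>I\<^sup>k U n \<subseteq> U (n + k)\<close>, the graded \<open>R(I)\<close>-module \<open>\<Oplus>n. U n / V n\<close>, on which \<open>a t\<^sup>k\<close> with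
  \<open>a \<in> I\<^sup>k\<close> acts by \<open>m + V n \<mapsto> a m + V (n + k)\<close>. Elements are finitely supported families
  of cosets; the components of negative degree are zero.\<close>

definition rees_sum ::
    "('a, 'm, 'y) module_scheme \<Rightarrow> (nat \<Rightarrow> 'm set) \<Rightarrow> (nat \<Rightarrow> 'm set) \<Rightarrow>
     (nat \<Rightarrow> 'a, nat \<Rightarrow> 'm set) graded_module" where
  "rees_sum M U V =
     \<lparr> carrier = {f. (\<forall>n. f n \<in> (\<lambda>m. V n +>\<^bsub>M\<^esub> m) ` U n) \<and> finite {n. f n \<noteq> V n}},
       monoid.mult = undefined, one = undefined,
       zero = V, add = (\<lambda>f g n. f n <+>\<^bsub>M\<^esub> g n),
       smult = (\<lambda>p f n. finsum (quot_module M (V n))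
                  (\<lambda>k. \<Union>m\<in>f (n - k). V n +>\<^bsub>M\<^esub> (p k \<odot>\<^bsub>M\<^esub> m)) {..n}),
       hcomp = (\<lambda>n. {f. (\<forall>j. f j \<in> (\<lambda>m. V j +>\<^bsub>M\<^esub> m) ` U j) \<and>
                         (\<forall>j. int j \<noteq> n \<longrightarrow> f j = V j)}) \<rparr>"

definition L_module ::
    "('a, 'x) ring_scheme \<Rightarrow> 'a set \<Rightarrow> ('a, 'm, 'y) module_scheme \<Rightarrow>
     (nat \<Rightarrow> 'a, nat \<Rightarrow> 'm set) graded_module" where
  "L_module A I M = rees_sum M (\<lambda>n. carrier M) (\<lambda>n. ideal_smult A (ideal_pow A I (n + 1)) M)"

definition B_module ::
    "('a, 'x) ring_scheme \<Rightarrow> 'a set \<Rightarrow> 'a \<Rightarrow> ('a, 'm, 'y) module_scheme \<Rightarrow>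
     (nat \<Rightarrow> 'a, nat \<Rightarrow> 'm set) graded_module" where
  "B_module A I x M =
     rees_sum M (\<lambda>n. colon M (ideal_smult A (ideal_pow A I (n + 1)) M) x)
                (\<lambda>n. ideal_smult A (ideal_pow A I n) M)"

text \<open>The map \<open>L\<^sup>I(M) \<rightarrow> L\<^sup>I(N)\<close> induced by a homomorphism \<open>h : M \<rightarrow> N\<close>.\<close>

definition L_map ::
    "('a, 'x) ring_scheme \<Rightarrow> 'a set \<Rightarrow> ('a, 'n, 'z) module_scheme \<Rightarrow> ('m \<Rightarrow> 'n) \<Rightarrow>
     (nat \<Rightarrow> 'm set) \<Rightarrow> (nat \<Rightarrow> 'n set)" where
  "L_map A I N h f = (\<lambda>n. \<Union>m\<in>f n. ideal_smult A (ideal_pow A I (n + 1)) N +>\<^bsub>N\<^esub> h m)"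

end

theory Submission
  imports Defs "HOL-Algebra.Subrings"
begin

text \<open>Let \<open>\<phi>\<close> and \<open>\<psi>\<close> be the given lifts of multiplication by \<open>x t\<close> and of \<open>L(M) \<rightarrow> L(N)\<close>. Since
  \<open>L(M)(-1) \<rightarrow> L(M) \<rightarrow> L(N) \<rightarrow> 0\<close> is exact with kernel \<open>B\<close> on the left, \<open>\<psi> \<circ> \<phi>\<close> is null-homotopic and a
  homotopy turns \<open>E(-1) \<rightarrow> E \<rightarrow> F\<close> into a total complex \<open>T\<close> of graded injective modules whose only cohomology
  is \<open>B\<close>, in degree \<open>0\<close>. As \<open>I\<close> is an ideal of definition and \<open>x\<close> is superficial, \<open>B\<close> is torsion with
  respect to \<open>\<mm> \<oplus> R(I)\<^sub>+\<close>. Over the Noetherian ring \<open>R(I)\<close> the torsion submodule of a graded injective module is a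
  direct summand, so a resolution of a torsion module by graded injectives stays exact in positive degrees under
  the torsion functor \<open>\<Gamma>\<close>. Exactness of \<open>\<Gamma>(T)\<close> is the long exact sequence; its beginning is
  \<open>B \<subseteq> \<Gamma>(L(M)(-1))\<close>.\<close>

section \<open>Graded modules, componentwise\<close>

text \<open>The resolutions and the lifts \<open>\<phi>\<close>, \<open>\<psi>\<close> are given,
  not chosen. Hence no short exact sequence of resolutions is at hand: \<open>\<phi>\<close> need
  not be injective, \<open>\<psi>\<close> need not be surjective, and their composite vanishes only
  up to homotopy. The total complex absorbs all three defects at once. That torsion keeps it exact
  is a splitting argument, which needs many maps into injective modules. The definition of
  injectivity tests only modules on the element type of the ring, whereas these maps start from
  modules on other types, products included. Injectivity is therefore first reduced to extending
  maps from homogeneous ideals and then recovered for arbitrary types by Baer's criterion. The chain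
  condition on homogeneous ideals enters where the torsion part of an injective module is shown to
  be injective. For the Rees ring it is derived from a graded form of Hilbert's basis theorem,
  carried out on coefficient sets inside \<open>A\<close>.\<close>

lemma module_cong:
  assumes "module R E" "carrier E' = carrier E" "add E' = add E" "zero E' = zero E" "smult E' = smult E"
  shows "module R E'"
proof -
  interpret E: module R E by fact
  show ?thesis
  proof (rule moduleI)
    show "abelian_group E'"
    proof (rule abelian_groupI)
      fix x assume "x \<in> carrier E'"
      then show "\<exists>y\<in>carrier E'. y \<oplus>\<^bsub>E'\<^esub> x = \<zero>\<^bsub>E'\<^esub>"
        using assms E.l_neg by (metis E.a_inv_closed)
    qed (simp_all add: assms E.a_ac)
  qed (simp_all add: assms module.axioms(1)[OF assms(1)] E.smult_l_distr E.smult_r_distr E.smult_assoc1)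
qed

text \<open>A homogeneous ideal is recorded by its components. Closure under negatives is not
  demanded, because multiplication by minus one, an element of degree 0, supplies it.\<close>

definition hideal :: "('r, 'x) ring_scheme \<Rightarrow> (int \<Rightarrow> 'r set) \<Rightarrow> (int \<Rightarrow> 'r set) \<Rightarrow> bool" where
  "hideal R G J \<longleftrightarrow>
     (\<forall>n. J n \<subseteq> G n \<and> \<zero>\<^bsub>R\<^esub> \<in> J n \<and> (\<forall>a\<in>J n. \<forall>b\<in>J n. a \<oplus>\<^bsub>R\<^esub> b \<in> J n)) \<and>
     (\<forall>i n. \<forall>a\<in>G i. \<forall>b\<in>J n. a \<otimes>\<^bsub>R\<^esub> b \<in> J (i + n))"

text \<open>The carrier need not be the sum of the components. This weakening of
  \<open>is_graded_module\<close> lets \<open>gam\<close> and \<open>hzero\<close> shrink the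
  components while the carrier, and with it the module structure, stays fixed.\<close>

definition hmod ::
    "('r, 'x) ring_scheme \<Rightarrow> (int \<Rightarrow> 'r set) \<Rightarrow> ('r, 'e) graded_module \<Rightarrow> bool" where
  "hmod R G E \<longleftrightarrow>
     module R E \<and>
     (\<forall>n. hcomp E n \<subseteq> carrier E \<and> \<zero>\<^bsub>E\<^esub> \<in> hcomp E n \<and>
        (\<forall>u\<in>hcomp E n. \<forall>v\<in>hcomp E n. u \<oplus>\<^bsub>E\<^esub> v \<in> hcomp E n)) \<and>
     (\<forall>i n. \<forall>a\<in>G i. \<forall>u\<in>hcomp E n. a \<odot>\<^bsub>E\<^esub> u \<in> hcomp E (i + n))"

text \<open>Only the components matter: homomorphisms of degree \<open>0\<close> are families of maps between components,
  so that maps can be chosen degree by degree.\<close>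

definition hhom ::
    "(int \<Rightarrow> 'r set) \<Rightarrow> ('r, 'e) graded_module \<Rightarrow> ('r, 'f) graded_module \<Rightarrow>
     (int \<Rightarrow> 'e \<Rightarrow> 'f) \<Rightarrow> bool" where
  "hhom G X Y h \<longleftrightarrow>
     (\<forall>n. \<forall>u\<in>hcomp X n. h n u \<in> hcomp Y n \<and> (\<forall>v\<in>hcomp X n. h n (u \<oplus>\<^bsub>X\<^esub> v) = h n u \<oplus>\<^bsub>Y\<^esub> h n v)) \<and>
     (\<forall>i n. \<forall>a\<in>G i. \<forall>u\<in>hcomp X n. h (i + n) (a \<odot>\<^bsub>X\<^esub> u) = a \<odot>\<^bsub>Y\<^esub> h n u)"

text \<open>A graded submodule of the product of \<open>Y\<close> and \<open>V\<close>, thought of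
  as the graph of a partial homomorphism. With relations, Zorn's lemma runs over plain inclusion of
  sets; being single-valued is the separate condition that zero is related to zero only.\<close>

definition hrel ::
    "(int \<Rightarrow> 'r set) \<Rightarrow> ('r, 'e) graded_module \<Rightarrow> ('r, 'f) graded_module \<Rightarrow>
     (int \<times> 'e \<times> 'f) set \<Rightarrow> bool" where
  "hrel G Y V P \<longleftrightarrow>
     (\<forall>n u v. (n, u, v) \<in> P \<longrightarrow> u \<in> hcomp Y n \<and> v \<in> hcomp V n) \<and>
     (\<forall>n. (n, \<zero>\<^bsub>Y\<^esub>, \<zero>\<^bsub>V\<^esub>) \<in> P) \<and>
     (\<forall>n u v u' v'. (n, u, v) \<in> P \<longrightarrow> (n, u', v') \<in> P \<longrightarrow> (n, u \<oplus>\<^bsub>Y\<^esub> u', v \<oplus>\<^bsub>V\<^esub> v') \<in> P) \<and>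
     (\<forall>i n a u v. a \<in> G i \<longrightarrow> (n, u, v) \<in> P \<longrightarrow> (i + n, a \<odot>\<^bsub>Y\<^esub> u, a \<odot>\<^bsub>V\<^esub> v) \<in> P)"

text \<open>The condition of Baer's criterion. A homomorphism \<open>J \<rightarrow> V\<close> of degree \<open>k\<close> sends \<open>J n\<close>
  to the component of degree \<open>n + k\<close>.\<close>

definition hinj ::
    "('r, 'x) ring_scheme \<Rightarrow> (int \<Rightarrow> 'r set) \<Rightarrow> ('r, 'e) graded_module \<Rightarrow> bool" where
  "hinj R G V \<longleftrightarrow>
     hmod R G V \<and>
     (\<forall>k J u. hideal R G J \<longrightarrow>
        (\<forall>n. \<forall>r\<in>J n. u n r \<in> hcomp V (n + k)) \<longrightarrow>
        (\<forall>n. \<forall>r\<in>J n. \<forall>r'\<in>J n. u n (r \<oplus>\<^bsub>R\<^esub> r') = u n r \<oplus>\<^bsub>V\<^esub> u n r') \<longrightarrow>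
        (\<forall>i n. \<forall>a\<in>G i. \<forall>r\<in>J n. u (i + n) (a \<otimes>\<^bsub>R\<^esub> r) = a \<odot>\<^bsub>V\<^esub> u n r) \<longrightarrow>
        (\<exists>v\<in>hcomp V k. \<forall>n. \<forall>r\<in>J n. u n r = r \<odot>\<^bsub>V\<^esub> v))"

text \<open>\<open>D\<close> lists homogeneous generators \<open>s\<close> of an ideal together with their degrees \<open>i\<close>; the components
  of \<open>gam R D E\<close> are those of the torsion submodule, the carrier is left unchanged.\<close>

definition gam ::
    "('r, 'x) ring_scheme \<Rightarrow> (int \<times> 'r) set \<Rightarrow> ('r, 'e) graded_module \<Rightarrow> ('r, 'e) graded_module" where
  "gam R D E = E\<lparr>hcomp := (\<lambda>n. {e \<in> hcomp E n.
      \<forall>(i, s)\<in>D. \<exists>k::nat. (s [^]\<^bsub>R\<^esub> k) \<odot>\<^bsub>E\<^esub> e = \<zero>\<^bsub>E\<^esub>})\<rparr>"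

text \<open>\<open>acc\<close> is the chain condition for homogeneous ideals only, stated for
  families of components, so that it can be checked on coefficient sets. \<open>D\<close> holds the
  homogeneous elements with respect to which torsion is taken.\<close>

locale graded_scalars = cring R for R (structure) +
  fixes G :: "int \<Rightarrow> 'a set" and D :: "(int \<times> 'a) set"
  assumes G_carrier: "G n \<subseteq> carrier R"
    and G_zero: "\<zero> \<in> G n"
    and G_add: "\<lbrakk>a \<in> G n; b \<in> G n\<rbrakk> \<Longrightarrow> a \<oplus> b \<in> G n"
    and G_neg: "a \<in> G n \<Longrightarrow> \<ominus> a \<in> G n"
    and G_one: "\<one> \<in> G 0"
    and G_mult: "\<lbrakk>a \<in> G i; b \<in> G j\<rbrakk> \<Longrightarrow> a \<otimes> b \<in> G (i + j)"
    and D_G: "(i, s) \<in> D \<Longrightarrow> s \<in> G i"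
    and acc: "\<lbrakk>\<And>k::nat. hideal R G (J k); \<And>k n. J k n \<subseteq> J (Suc k) n\<rbrakk> \<Longrightarrow> \<exists>k0. \<forall>k\<ge>k0. J k = J k0"
begin

lemma Gc [simp, intro]: "a \<in> G n \<Longrightarrow> a \<in> carrier R"
  using G_carrier by blast

lemma G_pow: "s \<in> G i \<Longrightarrow> s [^] (k::nat) \<in> G (int k * i)"
proof (induction k)
  case (Suc k)
  have "s [^] k \<otimes> s \<in> G (int k * i + i)" by (rule G_mult) (use Suc in auto)
  then show ?case by (simp add: algebra_simps)
qed (simp add: G_one)

lemma hmod_module: "hmod R G E \<Longrightarrow> module R E"
  by (simp add: hmod_def)

lemma hmodD:
  assumes "hmod R G E"
  shows "u \<in> hcomp E n \<Longrightarrow> u \<in> carrier E"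
    and "\<zero>\<^bsub>E\<^esub> \<in> hcomp E n"
    and "\<lbrakk>u \<in> hcomp E n; v \<in> hcomp E n\<rbrakk> \<Longrightarrow> u \<oplus>\<^bsub>E\<^esub> v \<in> hcomp E n"
    and "\<lbrakk>a \<in> G i; u \<in> hcomp E n; m = i + n\<rbrakk> \<Longrightarrow> a \<odot>\<^bsub>E\<^esub> u \<in> hcomp E m"
    and "u \<in> hcomp E n \<Longrightarrow> \<ominus>\<^bsub>E\<^esub> u \<in> hcomp E n"
proof -
  show 1: "u \<in> carrier E" if "u \<in> hcomp E n" for u n using assms that by (auto simp: hmod_def)
  show "\<zero>\<^bsub>E\<^esub> \<in> hcomp E n" using assms by (auto simp: hmod_def)
  show "\<lbrakk>u \<in> hcomp E n; v \<in> hcomp E n\<rbrakk> \<Longrightarrow> u \<oplus>\<^bsub>E\<^esub> v \<in> hcomp E n" using assms by (auto simp: hmod_def)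
  show 2: "a \<odot>\<^bsub>E\<^esub> u \<in> hcomp E m" if "a \<in> G i" "u \<in> hcomp E n" "m = i + n" for a i u n m
    using assms that by (auto simp: hmod_def)
  interpret module R E using assms by (rule hmod_module)
  assume u: "u \<in> hcomp E n"
  have "(\<ominus> \<one>) \<odot>\<^bsub>E\<^esub> u \<in> hcomp E n" by (rule 2[of _ 0]) (use u G_neg[OF G_one] in auto)
  then show "\<ominus>\<^bsub>E\<^esub> u \<in> hcomp E n" using 1[OF u] by (simp add: smult_l_minus)
qed

lemma hidealD:
  assumes "hideal R G J"
  shows "a \<in> J n \<Longrightarrow> a \<in> G n"
    and "\<zero> \<in> J n"
    and "\<lbrakk>a \<in> J n; b \<in> J n\<rbrakk> \<Longrightarrow> a \<oplus> b \<in> J n"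
    and "\<lbrakk>a \<in> G i; b \<in> J n; m = i + n\<rbrakk> \<Longrightarrow> a \<otimes> b \<in> J m"
    and "a \<in> J n \<Longrightarrow> \<ominus> a \<in> J n"
proof -
  show 1: "a \<in> G n" if "a \<in> J n" for a n using assms that by (auto simp: hideal_def)
  show "\<zero> \<in> J n" "\<lbrakk>a \<in> J n; b \<in> J n\<rbrakk> \<Longrightarrow> a \<oplus> b \<in> J n" using assms by (auto simp: hideal_def)
  show 2: "a \<otimes> b \<in> J m" if "a \<in> G i" "b \<in> J n" "m = i + n" for a i b n m
    using assms that by (auto simp: hideal_def)
  assume u: "a \<in> J n"
  have "(\<ominus> \<one>) \<otimes> a \<in> J n" by (rule 2[of _ 0]) (use u G_neg[OF G_one] in auto)
  then show "\<ominus> a \<in> J n" using 1[OF u] by (simp add: l_minus Gc)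
qed

lemma hhomD:
  assumes "hhom G X Y h"
  shows "u \<in> hcomp X n \<Longrightarrow> h n u \<in> hcomp Y n"
    and "\<lbrakk>u \<in> hcomp X n; v \<in> hcomp X n\<rbrakk> \<Longrightarrow> h n (u \<oplus>\<^bsub>X\<^esub> v) = h n u \<oplus>\<^bsub>Y\<^esub> h n v"
    and "\<lbrakk>a \<in> G i; u \<in> hcomp X n\<rbrakk> \<Longrightarrow> h (i + n) (a \<odot>\<^bsub>X\<^esub> u) = a \<odot>\<^bsub>Y\<^esub> h n u"
  using assms by (auto simp: hhom_def)

lemma hhom_zero:
  assumes "hmod R G X" "hmod R G Y" "hhom G X Y h"
  shows "h n \<zero>\<^bsub>X\<^esub> = \<zero>\<^bsub>Y\<^esub>"
proof -
  interpret X: module R X using assms(1) by (rule hmod_module)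
  interpret Y: module R Y using assms(2) by (rule hmod_module)
  have "h (0 + n) (\<zero> \<odot>\<^bsub>X\<^esub> \<zero>\<^bsub>X\<^esub>) = \<zero> \<odot>\<^bsub>Y\<^esub> h n \<zero>\<^bsub>X\<^esub>"
    by (rule hhomD[OF assms(3)]) (auto simp: G_zero hmodD[OF assms(1)])
  moreover have "h n \<zero>\<^bsub>X\<^esub> \<in> carrier Y"
    by (intro hmodD(1)[OF assms(2), of _ n] hhomD(1)[OF assms(3)] hmodD(2)[OF assms(1)])
  ultimately show ?thesis by simp
qed

lemma hhom_neg:
  assumes "hmod R G X" "hmod R G Y" "hhom G X Y h" "u \<in> hcomp X n"
  shows "h n (\<ominus>\<^bsub>X\<^esub> u) = \<ominus>\<^bsub>Y\<^esub> h n u"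
proof -
  interpret X: module R X using assms(1) by (rule hmod_module)
  interpret Y: module R Y using assms(2) by (rule hmod_module)
  have "h (0 + n) ((\<ominus> \<one>) \<odot>\<^bsub>X\<^esub> u) = (\<ominus> \<one>) \<odot>\<^bsub>Y\<^esub> h n u"
    by (rule hhomD[OF assms(3)]) (auto simp: G_neg G_one assms(4))
  moreover have "h n u \<in> carrier Y" "u \<in> carrier X"
    using hmodD(1)[OF assms(2) hhomD(1)[OF assms(3,4)]] hmodD(1)[OF assms(1,4)] by auto
  ultimately show ?thesis by (simp add: Y.smult_l_minus X.smult_l_minus)
qed

lemma hhom_minus:
  assumes "hmod R G X" "hmod R G Y" "hhom G X Y h" "u \<in> hcomp X n" "v \<in> hcomp X n"
  shows "h n (u \<ominus>\<^bsub>X\<^esub> v) = h n u \<ominus>\<^bsub>Y\<^esub> h n v"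
  unfolding a_minus_def
  using hhomD(2)[OF assms(3,4) hmodD(5)[OF assms(1,5)]] hhom_neg[OF assms(1-3,5)] by simp

lemma hmod_minus:
  assumes "hmod R G X" "u \<in> hcomp X n" "v \<in> hcomp X n"
  shows "u \<ominus>\<^bsub>X\<^esub> v \<in> hcomp X n"
  unfolding a_minus_def by (intro hmodD(3,5)[OF assms(1)] assms(2,3))

lemma hinjD:
  assumes "hinj R G V" "hideal R G J"
    and "\<And>n r. r \<in> J n \<Longrightarrow> u n r \<in> hcomp V (n + k)"
    and "\<And>n r r'. \<lbrakk>r \<in> J n; r' \<in> J n\<rbrakk> \<Longrightarrow> u n (r \<oplus> r') = u n r \<oplus>\<^bsub>V\<^esub> u n r'"
    and "\<And>i n a r. \<lbrakk>a \<in> G i; r \<in> J n\<rbrakk> \<Longrightarrow> u (i + n) (a \<otimes> r) = a \<odot>\<^bsub>V\<^esub> u n r"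
  obtains v where "v \<in> hcomp V k" "\<And>n r. r \<in> J n \<Longrightarrow> u n r = r \<odot>\<^bsub>V\<^esub> v"
proof -
  have "\<forall>n. \<forall>r\<in>J n. u n r \<in> hcomp V (n + k)"
    "\<forall>n. \<forall>r\<in>J n. \<forall>r'\<in>J n. u n (r \<oplus> r') = u n r \<oplus>\<^bsub>V\<^esub> u n r'"
    "\<forall>i n. \<forall>a\<in>G i. \<forall>r\<in>J n. u (i + n) (a \<otimes> r) = a \<odot>\<^bsub>V\<^esub> u n r"
    using assms(3-5) by blast+
  with assms(1,2) have "\<exists>v\<in>hcomp V k. \<forall>n. \<forall>r\<in>J n. u n r = r \<odot>\<^bsub>V\<^esub> v"
    unfolding hinj_def by simp
  then show ?thesis using that by blast
qed

section \<open>Partial homomorphisms and Baer's criterion\<close>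

lemma hrelD:
  assumes "hrel G Y V P"
  shows "(n, u, v) \<in> P \<Longrightarrow> u \<in> hcomp Y n" "(n, u, v) \<in> P \<Longrightarrow> v \<in> hcomp V n"
    and "(n, \<zero>\<^bsub>Y\<^esub>, \<zero>\<^bsub>V\<^esub>) \<in> P"
    and "\<lbrakk>(n, u, v) \<in> P; (n, u', v') \<in> P\<rbrakk> \<Longrightarrow> (n, u \<oplus>\<^bsub>Y\<^esub> u', v \<oplus>\<^bsub>V\<^esub> v') \<in> P"
    and "\<lbrakk>a \<in> G i; (n, u, v) \<in> P; m = i + n\<rbrakk> \<Longrightarrow> (m, a \<odot>\<^bsub>Y\<^esub> u, a \<odot>\<^bsub>V\<^esub> v) \<in> P"
  using assms unfolding hrel_def by blast+

lemma hrel_neg: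
  assumes Y: "hmod R G Y" and V: "hmod R G V" and P: "hrel G Y V P" and "(n, u, v) \<in> P"
  shows "(n, \<ominus>\<^bsub>Y\<^esub> u, \<ominus>\<^bsub>V\<^esub> v) \<in> P"
proof -
  interpret Y: module R Y using Y by (rule hmod_module)
  interpret V: module R V using V by (rule hmod_module)
  have "(n, (\<ominus> \<one>) \<odot>\<^bsub>Y\<^esub> u, (\<ominus> \<one>) \<odot>\<^bsub>V\<^esub> v) \<in> P"
    by (rule hrelD(5)[OF P _ assms(4), of _ 0]) (auto intro: G_neg G_one)
  then show ?thesis
    using hrelD(1,2)[OF P assms(4)] hmodD(1)[OF Y] hmodD(1)[OF V]
    by (metis Y.smult_l_minus V.smult_l_minus Y.smult_one V.smult_one one_closed)
qed

text \<open>Two pairs with the same first entry have a difference with first entry zero, so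
  uniqueness at zero is uniqueness everywhere.\<close>

lemma hrel_functional:
  assumes Y: "hmod R G Y" and V: "hmod R G V" and P: "hrel G Y V P"
    and single: "\<forall>n v. (n, \<zero>\<^bsub>Y\<^esub>, v) \<in> P \<longrightarrow> v = \<zero>\<^bsub>V\<^esub>"
    and v: "(n, u, v) \<in> P" and w: "(n, u, w) \<in> P"
  shows "v = w"
proof -
  interpret Y: module R Y using Y by (rule hmod_module)
  interpret V: module R V using V by (rule hmod_module)
  have u: "u \<in> carrier Y" and v': "v \<in> carrier V" and w': "w \<in> carrier V"
    using hrelD(1,2)[OF P] v w hmodD(1)[OF Y] hmodD(1)[OF V] by blast+
  have "(n, u \<oplus>\<^bsub>Y\<^esub> \<ominus>\<^bsub>Y\<^esub> u, v \<oplus>\<^bsub>V\<^esub> \<ominus>\<^bsub>V\<^esub> w) \<in> P"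
    by (rule hrelD(4)[OF P v hrel_neg[OF Y V P w]])
  then have "v \<oplus>\<^bsub>V\<^esub> \<ominus>\<^bsub>V\<^esub> w = \<zero>\<^bsub>V\<^esub>" using u single by (simp add: Y.r_neg)
  then show ?thesis using v' w' by (metis V.minus_equality V.minus_minus V.add.inv_closed V.a_comm)
qed

text \<open>The one-element extension in Baer's argument. On the ideal of scalars \<open>r\<close>
  with \<open>r y\<close> in the domain of \<open>P\<close>, injectivity represents \<open>P\<close>
  as multiplication by an element \<open>v0\<close>, and \<open>v0\<close> can then be declared the
  value at \<open>y\<close>.\<close>

lemma hrel_step:
  assumes Y: "hmod R G Y" and V: "hinj R G V" and P: "hrel G Y V P"
    and single: "\<forall>n v. (n, \<zero>\<^bsub>Y\<^esub>, v) \<in> P \<longrightarrow> v = \<zero>\<^bsub>V\<^esub>"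
    and y: "y \<in> hcomp Y k"
  shows "\<exists>v0 P'. hrel G Y V P' \<and> (\<forall>n v. (n, \<zero>\<^bsub>Y\<^esub>, v) \<in> P' \<longrightarrow> v = \<zero>\<^bsub>V\<^esub>) \<and> P \<subseteq> P' \<and> (k, y, v0) \<in> P'"
proof -
  have Vm: "hmod R G V" using V by (simp add: hinj_def)
  interpret Y: module R Y using Y by (rule hmod_module)
  interpret V: module R V using Vm by (rule hmod_module)
  note Yc = hmodD(1)[OF Y] and Vc = hmodD(1)[OF Vm]
  have yc: "y \<in> carrier Y" using Yc y .
  note fn = hrel_functional[OF Y Vm P single]
  note Pc1 = Yc[OF hrelD(1)[OF P]] and Pc2 = Vc[OF hrelD(2)[OF P]]
  \<comment> \<open>The conductor of \<open>y\<close> into the domain of \<open>P\<close>. On it,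
    \<open>u\<close> sends \<open>r\<close> to the value of \<open>P\<close> at \<open>r y\<close>;
    its degree is \<open>k\<close> because \<open>y\<close> has degree \<open>k\<close>.\<close>
  define J where "J n = {r \<in> G n. \<exists>v. (n + k, r \<odot>\<^bsub>Y\<^esub> y, v) \<in> P}" for n
  define u where "u n r = (THE v. (n + k, r \<odot>\<^bsub>Y\<^esub> y, v) \<in> P)" for n r
  have u: "(n + k, r \<odot>\<^bsub>Y\<^esub> y, u n r) \<in> P" if "r \<in> J n" for n r
  proof -
    have "\<exists>!v. (n + k, r \<odot>\<^bsub>Y\<^esub> y, v) \<in> P" using that fn unfolding J_def by blast
    then show ?thesis unfolding u_def by (rule theI')
  qed
  have ueq: "u n r = v" if "r \<in> J n" "(n + k, r \<odot>\<^bsub>Y\<^esub> y, v) \<in> P" for n r v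
    using fn[OF u[OF that(1)] that(2)] .
  have add: "r \<oplus> r' \<in> J n \<and> u n (r \<oplus> r') = u n r \<oplus>\<^bsub>V\<^esub> u n r'" if "r \<in> J n" "r' \<in> J n" for n r r'
  proof -
    have g: "r \<in> G n" "r' \<in> G n" using that by (auto simp: J_def)
    have "(n + k, r \<odot>\<^bsub>Y\<^esub> y \<oplus>\<^bsub>Y\<^esub> r' \<odot>\<^bsub>Y\<^esub> y, u n r \<oplus>\<^bsub>V\<^esub> u n r') \<in> P"
      by (rule hrelD(4)[OF P u[OF that(1)] u[OF that(2)]])
    then have *: "(n + k, (r \<oplus> r') \<odot>\<^bsub>Y\<^esub> y, u n r \<oplus>\<^bsub>V\<^esub> u n r') \<in> P"
      using g yc by (simp add: Y.smult_l_distr Gc)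
    then have "r \<oplus> r' \<in> J n" using g by (auto simp: J_def G_add)
    then show ?thesis using ueq * by blast
  qed
  have sc: "a \<otimes> r \<in> J (i + n) \<and> u (i + n) (a \<otimes> r) = a \<odot>\<^bsub>V\<^esub> u n r" if "a \<in> G i" "r \<in> J n" for a i n r
  proof -
    have g: "r \<in> G n" using that by (auto simp: J_def)
    have "(i + n + k, a \<odot>\<^bsub>Y\<^esub> (r \<odot>\<^bsub>Y\<^esub> y), a \<odot>\<^bsub>V\<^esub> u n r) \<in> P"
      by (rule hrelD(5)[OF P that(1) u[OF that(2)]]) simp
    then have *: "(i + n + k, (a \<otimes> r) \<odot>\<^bsub>Y\<^esub> y, a \<odot>\<^bsub>V\<^esub> u n r) \<in> P"
      using g that yc by (simp add: Y.smult_assoc1 Gc)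
    then have "a \<otimes> r \<in> J (i + n)" using g that by (auto simp: J_def G_mult)
    then show ?thesis using ueq * by blast
  qed
  have z: "\<zero> \<in> J n" for n
    using hrelD(3)[OF P] yc by (auto simp: J_def G_zero)
  have J: "hideal R G J"
    unfolding hideal_def using add sc z by (auto simp: J_def)
  obtain v0 where v0: "v0 \<in> hcomp V k" and uv: "\<And>n r. r \<in> J n \<Longrightarrow> u n r = r \<odot>\<^bsub>V\<^esub> v0"
  proof (rule hinjD[OF V J])
    show "\<And>n r. r \<in> J n \<Longrightarrow> u n r \<in> hcomp V (n + k)" using hrelD(2)[OF P u] .
  qed (use add sc in blast)+
  have v0c: "v0 \<in> carrier V" using Vc v0 .
  define P' where "P' = {(n, p \<oplus>\<^bsub>Y\<^esub> r \<odot>\<^bsub>Y\<^esub> y, v \<oplus>\<^bsub>V\<^esub> r \<odot>\<^bsub>V\<^esub> v0) | n p v r. (n, p, v) \<in> P \<and> r \<in> G (n - k)}"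
  have P'I: "(n, a, b) \<in> P'" if "(n, p, v) \<in> P" "r \<in> G (n - k)" "a = p \<oplus>\<^bsub>Y\<^esub> r \<odot>\<^bsub>Y\<^esub> y" "b = v \<oplus>\<^bsub>V\<^esub> r \<odot>\<^bsub>V\<^esub> v0"
    for n p v r a b using that unfolding P'_def by blast
  have P'E: "\<exists>p v r. (n, p, v) \<in> P \<and> r \<in> G (n - k) \<and> a = p \<oplus>\<^bsub>Y\<^esub> r \<odot>\<^bsub>Y\<^esub> y \<and> b = v \<oplus>\<^bsub>V\<^esub> r \<odot>\<^bsub>V\<^esub> v0"
    if "(n, a, b) \<in> P'" for n a b using that unfolding P'_def by blast
  have "hrel G Y V P'"
    unfolding hrel_def
  proof (intro conjI allI impI)
    fix n a b assume "(n, a, b) \<in> P'"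
    then obtain p v r where h: "(n, p, v) \<in> P" "r \<in> G (n - k)" "a = p \<oplus>\<^bsub>Y\<^esub> r \<odot>\<^bsub>Y\<^esub> y" "b = v \<oplus>\<^bsub>V\<^esub> r \<odot>\<^bsub>V\<^esub> v0"
      using P'E by blast
    show "a \<in> hcomp Y n"
      unfolding h by (rule hmodD(3)[OF Y hrelD(1)[OF P h(1)] hmodD(4)[OF Y h(2) y]]) simp
    show "b \<in> hcomp V n"
      unfolding h by (rule hmodD(3)[OF Vm hrelD(2)[OF P h(1)] hmodD(4)[OF Vm h(2) v0]]) simp
  next
    fix n show "(n, \<zero>\<^bsub>Y\<^esub>, \<zero>\<^bsub>V\<^esub>) \<in> P'"
      by (rule P'I[OF hrelD(3)[OF P] G_zero]) (auto simp: yc v0c)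
  next
    fix n a b a' b' assume "(n, a, b) \<in> P'" "(n, a', b') \<in> P'"
    then obtain p v r p' v' r' where h: "(n, p, v) \<in> P" "r \<in> G (n - k)" "a = p \<oplus>\<^bsub>Y\<^esub> r \<odot>\<^bsub>Y\<^esub> y" "b = v \<oplus>\<^bsub>V\<^esub> r \<odot>\<^bsub>V\<^esub> v0"
      and h': "(n, p', v') \<in> P" "r' \<in> G (n - k)" "a' = p' \<oplus>\<^bsub>Y\<^esub> r' \<odot>\<^bsub>Y\<^esub> y" "b' = v' \<oplus>\<^bsub>V\<^esub> r' \<odot>\<^bsub>V\<^esub> v0"
      using P'E by metis
    show "(n, a \<oplus>\<^bsub>Y\<^esub> a', b \<oplus>\<^bsub>V\<^esub> b') \<in> P'"
      by (rule P'I[OF hrelD(4)[OF P h(1) h'(1)] G_add[OF h(2) h'(2)]])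
         (use h h' Pc1[OF h(1)] Pc1[OF h'(1)] Pc2[OF h(1)] Pc2[OF h'(1)] Gc[OF h(2)] Gc[OF h'(2)] in
           \<open>simp_all add: yc v0c Y.smult_l_distr V.smult_l_distr Y.a_ac V.a_ac\<close>)
  next
    fix i n c a b assume c: "c \<in> G i" and "(n, a, b) \<in> P'"
    then obtain p v r where h: "(n, p, v) \<in> P" "r \<in> G (n - k)" "a = p \<oplus>\<^bsub>Y\<^esub> r \<odot>\<^bsub>Y\<^esub> y" "b = v \<oplus>\<^bsub>V\<^esub> r \<odot>\<^bsub>V\<^esub> v0"
      using P'E by blast
    have r: "c \<otimes> r \<in> G (i + n - k)" using G_mult[OF c h(2)] by (simp add: algebra_simps)
    show "(i + n, c \<odot>\<^bsub>Y\<^esub> a, c \<odot>\<^bsub>V\<^esub> b) \<in> P'"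
      by (rule P'I[OF hrelD(5)[OF P c h(1) refl] r])
         (use h Pc1[OF h(1)] Pc2[OF h(1)] Gc[OF h(2)] Gc[OF c] in
           \<open>simp_all add: yc v0c Y.smult_r_distr V.smult_r_distr Y.smult_assoc1 V.smult_assoc1\<close>)
  qed
  \<comment> \<open>If \<open>p + r y = 0\<close>, then \<open>r\<close> lies in \<open>J\<close>,
    and the value of \<open>P\<close> at \<open>r y\<close> is both \<open>r v0\<close> and
    \<open>-v\<close>. Hence \<open>v + r v0 = 0\<close>; this is what \<open>v0\<close> was chosen
    for.\<close>
  moreover have "b = \<zero>\<^bsub>V\<^esub>" if b: "(n, \<zero>\<^bsub>Y\<^esub>, b) \<in> P'" for n b
  proof -
    obtain p v r where h: "(n, p, v) \<in> P" "r \<in> G (n - k)" "\<zero>\<^bsub>Y\<^esub> = p \<oplus>\<^bsub>Y\<^esub> r \<odot>\<^bsub>Y\<^esub> y" "b = v \<oplus>\<^bsub>V\<^esub> r \<odot>\<^bsub>V\<^esub> v0"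
      using P'E[OF b] by blast
    have "r \<odot>\<^bsub>Y\<^esub> y = \<ominus>\<^bsub>Y\<^esub> p"
      using h Pc1[OF h(1)] yc by (metis Y.minus_equality Y.a_comm Y.smult_closed Gc)
    then have *: "(n - k + k, r \<odot>\<^bsub>Y\<^esub> y, \<ominus>\<^bsub>V\<^esub> v) \<in> P" using hrel_neg[OF Y Vm P h(1)] by simp
    then have "r \<in> J (n - k)" using h by (auto simp: J_def)
    then have "r \<odot>\<^bsub>V\<^esub> v0 = \<ominus>\<^bsub>V\<^esub> v" using ueq[OF _ *] uv by simp
    then show ?thesis using h Pc2[OF h(1)] by (simp add: V.r_neg)
  qed
  moreover have "P \<subseteq> P'"
  proof (rule subrelI)
    fix n q assume q: "(n, q) \<in> P"
    obtain a b where ab: "q = (a, b)" by (cases q)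
    then have "(n, a, b) \<in> P'"
      using q Pc1 Pc2 by (intro P'I[of n a b \<zero>]) (auto simp: G_zero yc v0c)
    then show "(n, q) \<in> P'" using ab by simp
  qed
  moreover have "(k, y, v0) \<in> P'"
    by (rule P'I[OF hrelD(3)[OF P], where r = "\<one>"]) (auto simp: G_one yc v0c)
  ultimately show ?thesis by blast
qed

text \<open>Zorn's lemma for the single-valued relations above \<open>P\<close>: by
  \<open>hrel_step\<close> a maximal one is defined at every homogeneous element. The element types
  of \<open>Y\<close> and \<open>V\<close> are unrestricted, so a condition on ideals of
  \<open>R\<close> controls maps from all graded modules.\<close>

theorem baer:
  assumes Y: "hmod R G Y" and V: "hinj R G V" and P: "hrel G Y V P"
    and single: "\<forall>n v. (n, \<zero>\<^bsub>Y\<^esub>, v) \<in> P \<longrightarrow> v = \<zero>\<^bsub>V\<^esub>"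
  shows "\<exists>h. hhom G Y V h \<and> (\<forall>n u v. (n, u, v) \<in> P \<longrightarrow> h n u = v)"
proof -
  have Vm: "hmod R G V" using V by (simp add: hinj_def)
  define \<A> where "\<A> = {Q. P \<subseteq> Q \<and> hrel G Y V Q \<and> (\<forall>n v. (n, \<zero>\<^bsub>Y\<^esub>, v) \<in> Q \<longrightarrow> v = \<zero>\<^bsub>V\<^esub>)}"
  have "\<exists>M\<in>\<A>. \<forall>X\<in>\<A>. M \<subseteq> X \<longrightarrow> X = M"
  proof (rule subset_Zorn_nonempty)
    show "\<A> \<noteq> {}" using P single unfolding \<A>_def by blast
    fix C assume ne: "C \<noteq> {}" and ch: "subset.chain \<A> C"
    have CA: "\<And>Q. Q \<in> C \<Longrightarrow> Q \<in> \<A>" and tot: "\<And>Q Q'. \<lbrakk>Q \<in> C; Q' \<in> C\<rbrakk> \<Longrightarrow> Q \<subseteq> Q' \<or> Q' \<subseteq> Q"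
      using ch unfolding subset_chain_def by auto
    have h: "hrel G Y V Q" if "Q \<in> C" for Q using CA[OF that] by (simp add: \<A>_def)
    obtain Q0 where Q0: "Q0 \<in> C" using ne by blast
    have "hrel G Y V (\<Union>C)"
      unfolding hrel_def
    proof (intro conjI allI impI)
      show "\<And>n u v. (n, u, v) \<in> \<Union>C \<Longrightarrow> u \<in> hcomp Y n" "\<And>n u v. (n, u, v) \<in> \<Union>C \<Longrightarrow> v \<in> hcomp V n"
        using hrelD(1,2)[OF h] by blast+
      show "\<And>n. (n, \<zero>\<^bsub>Y\<^esub>, \<zero>\<^bsub>V\<^esub>) \<in> \<Union>C" using hrelD(3)[OF h[OF Q0]] Q0 by blast
      show "(n, u \<oplus>\<^bsub>Y\<^esub> u', v \<oplus>\<^bsub>V\<^esub> v') \<in> \<Union>C" if q: "(n, u, v) \<in> \<Union>C" "(n, u', v') \<in> \<Union>C" for n u v u' v'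
      proof -
        obtain Q Q' where "Q \<in> C" "Q' \<in> C" "(n, u, v) \<in> Q" "(n, u', v') \<in> Q'" using q by blast
        then obtain Q'' where "Q'' \<in> C" "(n, u, v) \<in> Q''" "(n, u', v') \<in> Q''"
          using tot[of Q Q'] by blast
        then show ?thesis using hrelD(4)[OF h] by blast
      qed
      show "\<And>i n a u v. a \<in> G i \<Longrightarrow> (n, u, v) \<in> \<Union>C \<Longrightarrow> (i + n, a \<odot>\<^bsub>Y\<^esub> u, a \<odot>\<^bsub>V\<^esub> v) \<in> \<Union>C"
        using hrelD(5)[OF h] by blast
    qed
    then show "\<Union>C \<in> \<A>" using CA Q0 unfolding \<A>_def by blast
  qed
  then obtain Q where "Q \<in> \<A>" and max: "\<And>X. \<lbrakk>X \<in> \<A>; Q \<subseteq> X\<rbrakk> \<Longrightarrow> X = Q" by blast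
  then have PQ: "P \<subseteq> Q" and Q: "hrel G Y V Q" and Qs: "\<forall>n v. (n, \<zero>\<^bsub>Y\<^esub>, v) \<in> Q \<longrightarrow> v = \<zero>\<^bsub>V\<^esub>"
    by (auto simp: \<A>_def)
  have ex: "\<exists>v. (k, y, v) \<in> Q" if y: "y \<in> hcomp Y k" for k y
  proof -
    obtain v0 P' where "hrel G Y V P'" "\<forall>n v. (n, \<zero>\<^bsub>Y\<^esub>, v) \<in> P' \<longrightarrow> v = \<zero>\<^bsub>V\<^esub>" "Q \<subseteq> P'" "(k, y, v0) \<in> P'"
      using hrel_step[OF Y V Q Qs y] by blast
    moreover from this have "P' = Q" using PQ by (intro max) (auto simp: \<A>_def)
    ultimately show ?thesis by blast
  qed
  note fn = hrel_functional[OF Y Vm Q Qs]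
  define h where "h n u = (THE v. (n, u, v) \<in> Q)" for n u
  have heq: "h n u = v" if "(n, u, v) \<in> Q" for n u v
    unfolding h_def using that fn by blast
  have hin: "(n, u, h n u) \<in> Q" if "u \<in> hcomp Y n" for n u
    using ex[OF that] heq by auto
  have "hhom G Y V h"
    unfolding hhom_def
  proof (intro conjI allI ballI)
    fix n u assume u: "u \<in> hcomp Y n"
    show "h n u \<in> hcomp V n" using hrelD(2)[OF Q hin[OF u]] .
    fix v assume v: "v \<in> hcomp Y n"
    show "h n (u \<oplus>\<^bsub>Y\<^esub> v) = h n u \<oplus>\<^bsub>V\<^esub> h n v"
      by (rule heq[OF hrelD(4)[OF Q hin[OF u] hin[OF v]]])
  next
    fix i n a u assume "a \<in> G i" "u \<in> hcomp Y n"
    then show "h (i + n) (a \<odot>\<^bsub>Y\<^esub> u) = a \<odot>\<^bsub>V\<^esub> h n u"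
      by (intro heq hrelD(5)[OF Q _ hin]) auto
  qed
  then show ?thesis using heq PQ by blast
qed

section \<open>Torsion submodules of injective modules\<close>

lemma gam_iff:
  "e \<in> hcomp (gam R D E) n \<longleftrightarrow>
     e \<in> hcomp E n \<and> (\<forall>i s. (i, s) \<in> D \<longrightarrow> (\<exists>k::nat. (s [^] k) \<odot>\<^bsub>E\<^esub> e = \<zero>\<^bsub>E\<^esub>))"
  by (auto simp: gam_def)

lemma gam_simps [simp]:
  "carrier (gam R D E) = carrier E" "add (gam R D E) = add E" "zero (gam R D E) = zero E"
  "smult (gam R D E) = smult E" "a_inv (gam R D E) = a_inv E"
  by (simp_all add: gam_def a_inv_def m_inv_def)

lemma pow_kill_mono:
  assumes "module R E" "s \<in> carrier R" "e \<in> carrier E" "(s [^] (k::nat)) \<odot>\<^bsub>E\<^esub> e = \<zero>\<^bsub>E\<^esub>" "k \<le> l"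
  shows "(s [^] l) \<odot>\<^bsub>E\<^esub> e = \<zero>\<^bsub>E\<^esub>"
proof -
  interpret E: module R E by fact
  have "s [^] l = s [^] (l - k) \<otimes> s [^] k" using assms by (simp add: nat_pow_mult)
  then show ?thesis using assms by (simp add: E.smult_assoc1)
qed

lemma gam_hmod:
  assumes E: "hmod R G E"
  shows "hmod R G (gam R D E)"
proof -
  interpret E: module R E using E by (rule hmod_module)
  note Ec = hmodD(1)[OF E]
  have m: "module R (gam R D E)" by (rule module_cong[OF hmod_module[OF E]]) simp_all
  have add: "u \<oplus>\<^bsub>E\<^esub> v \<in> hcomp (gam R D E) n"
    if u: "u \<in> hcomp (gam R D E) n" and v: "v \<in> hcomp (gam R D E) n" for u v n
    unfolding gam_iff
  proof (intro conjI allI impI)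
    have uE: "u \<in> hcomp E n" and vE: "v \<in> hcomp E n" using u v by (auto simp: gam_iff)
    then show "u \<oplus>\<^bsub>E\<^esub> v \<in> hcomp E n" by (rule hmodD(3)[OF E])
    fix i s assume "(i, s) \<in> D"
    then obtain k l :: nat where k: "(s [^] k) \<odot>\<^bsub>E\<^esub> u = \<zero>\<^bsub>E\<^esub>" and l: "(s [^] l) \<odot>\<^bsub>E\<^esub> v = \<zero>\<^bsub>E\<^esub>"
      and s: "s \<in> carrier R"
      using u v D_G Gc unfolding gam_iff by meson
    have "(s [^] (k + l)) \<odot>\<^bsub>E\<^esub> u = \<zero>\<^bsub>E\<^esub>" "(s [^] (k + l)) \<odot>\<^bsub>E\<^esub> v = \<zero>\<^bsub>E\<^esub>"
      using pow_kill_mono[OF E.module_axioms s Ec[OF uE] k] pow_kill_mono[OF E.module_axioms s Ec[OF vE] l]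
      by auto
    then have "(s [^] (k + l)) \<odot>\<^bsub>E\<^esub> (u \<oplus>\<^bsub>E\<^esub> v) = \<zero>\<^bsub>E\<^esub>"
      using s Ec[OF uE] Ec[OF vE] by (simp add: E.smult_r_distr)
    then show "\<exists>k::nat. (s [^] k) \<odot>\<^bsub>E\<^esub> (u \<oplus>\<^bsub>E\<^esub> v) = \<zero>\<^bsub>E\<^esub>" by blast
  qed
  have sc: "a \<odot>\<^bsub>E\<^esub> u \<in> hcomp (gam R D E) (i + n)"
    if a: "a \<in> G i" and u: "u \<in> hcomp (gam R D E) n" for a u i n
    unfolding gam_iff
  proof (intro conjI allI impI)
    have uE: "u \<in> hcomp E n" using u by (auto simp: gam_iff)
    then show "a \<odot>\<^bsub>E\<^esub> u \<in> hcomp E (i + n)" using hmodD(4)[OF E a] by simp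
    fix j s assume js: "(j, s) \<in> D"
    then obtain k :: nat where k: "(s [^] k) \<odot>\<^bsub>E\<^esub> u = \<zero>\<^bsub>E\<^esub>"
      using u unfolding gam_iff by meson
    have s: "s \<in> carrier R" using D_G[OF js] by auto
    have "(s [^] k) \<odot>\<^bsub>E\<^esub> (a \<odot>\<^bsub>E\<^esub> u) = a \<odot>\<^bsub>E\<^esub> ((s [^] k) \<odot>\<^bsub>E\<^esub> u)"
      using s Ec[OF uE] Gc[OF a] by (simp add: m_comm flip: E.smult_assoc1)
    then show "\<exists>k::nat. (s [^] k) \<odot>\<^bsub>E\<^esub> (a \<odot>\<^bsub>E\<^esub> u) = \<zero>\<^bsub>E\<^esub>" using k a by (intro exI[of _ k]) auto
  qed
  have z: "\<zero>\<^bsub>E\<^esub> \<in> hcomp (gam R D E) n" for n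
    unfolding gam_iff using hmodD(2)[OF E] D_G by (auto intro!: exI[of _ "0::nat"])
  show ?thesis
    unfolding hmod_def using m add sc z Ec by (auto simp: gam_iff)
qed

lemma gam_sub: "e \<in> hcomp (gam R D E) n \<Longrightarrow> e \<in> hcomp E n"
  by (simp add: gam_iff)

lemma gam_hhom:
  assumes X: "hmod R G X" and Y: "hmod R G Y" and h: "hhom G X Y h" and u: "u \<in> hcomp (gam R D X) n"
  shows "h n u \<in> hcomp (gam R D Y) n"
  unfolding gam_iff
proof (intro conjI allI impI)
  have uX: "u \<in> hcomp X n" using u by (rule gam_sub)
  then show "h n u \<in> hcomp Y n" by (rule hhomD(1)[OF h])
  fix i s assume iD: "(i, s) \<in> D"
  then obtain k :: nat where k: "(s [^] k) \<odot>\<^bsub>X\<^esub> u = \<zero>\<^bsub>X\<^esub>"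
    using u unfolding gam_iff by meson
  show "\<exists>k::nat. (s [^] k) \<odot>\<^bsub>Y\<^esub> h n u = \<zero>\<^bsub>Y\<^esub>"
    using hhomD(3)[OF h G_pow[OF D_G[OF iD], of k] uX] k hhom_zero[OF X Y h]
    by (intro exI[of _ k]) simp
qed

text \<open>If every member of the class had a larger one, dependent choice would build a strictly
  ascending chain, against \<open>acc\<close>.\<close>

lemma hideal_maximal:
  assumes "P U0" and P: "\<And>U. P U \<Longrightarrow> hideal R G U"
  obtains U where "P U" "\<And>U'. \<lbrakk>P U'; U \<le> U'\<rbrakk> \<Longrightarrow> U' = U"
proof (rule ccontr)
  note obt = that
  assume *: "\<not> thesis"
  have ex: "\<exists>U'. P U' \<and> U < U'" if U: "P U" for U
  proof (rule ccontr)
    assume "\<nexists>U'. P U' \<and> U < U'"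
    then have "U' = U" if PU': "P U'" "U \<le> U'" for U' using PU' by (auto simp: order_less_le)
    then show False using obt[OF U] * by blast
  qed
  have "\<exists>f. \<forall>n::nat. P (f n) \<and> f n < f (Suc n)"
  proof -
    have "\<exists>f. \<forall>n. P (f n) \<and> (f n < f (Suc n))"
      by (rule dependent_nat_choice[where P = "\<lambda>_. P" and Q = "\<lambda>_ x y. x < y"]) (use ex assms(1) in blast)+
    then show ?thesis by blast
  qed
  then obtain f where f: "\<And>n::nat. P (f n)" "\<And>n. f n < f (Suc n)" by blast
  have "\<exists>k0. \<forall>k\<ge>k0. f k = f k0"
    by (rule acc) (use P f in \<open>auto simp: less_fun_def le_fun_def\<close>)
  then obtain k0 where "\<forall>k\<ge>k0. f k = f k0" by blast
  from spec[OF this, of "Suc k0"] have "f (Suc k0) = f k0" by (metis le_SucI order_refl)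
  then show False using f(2)[of k0] by simp
qed

lemma hidealI:
  assumes "\<And>n a. a \<in> J n \<Longrightarrow> a \<in> G n" "\<And>n. \<zero> \<in> J n"
    and "\<And>n a b. \<lbrakk>a \<in> J n; b \<in> J n\<rbrakk> \<Longrightarrow> a \<oplus> b \<in> J n"
    and "\<And>i n a b. \<lbrakk>a \<in> G i; b \<in> J n\<rbrakk> \<Longrightarrow> a \<otimes> b \<in> J (i + n)"
  shows "hideal R G J"
  unfolding hideal_def using assms by blast

lemma hideal_add:
  assumes J: "hideal R G J" and U: "hideal R G U"
  shows "hideal R G (\<lambda>n. {a \<oplus> w | a w. a \<in> J n \<and> w \<in> U n})"
proof (rule hidealI)
  fix n a assume "a \<in> {a \<oplus> w | a w. a \<in> J n \<and> w \<in> U n}"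
  then show "a \<in> G n" using hidealD(1)[OF J] hidealD(1)[OF U] G_add by auto
next
  fix n show "\<zero> \<in> {a \<oplus> w | a w. a \<in> J n \<and> w \<in> U n}"
    using hidealD(2)[OF J] hidealD(2)[OF U] by force
next
  fix n x y assume "x \<in> {a \<oplus> w | a w. a \<in> J n \<and> w \<in> U n}" "y \<in> {a \<oplus> w | a w. a \<in> J n \<and> w \<in> U n}"
  then obtain a w a' w' where h: "a \<in> J n" "w \<in> U n" "a' \<in> J n" "w' \<in> U n" "x = a \<oplus> w" "y = a' \<oplus> w'" by blast
  have c: "a \<in> carrier R" "w \<in> carrier R" "a' \<in> carrier R" "w' \<in> carrier R"
    using h hidealD(1)[OF J] hidealD(1)[OF U] Gc by blast+
  have "x \<oplus> y = (a \<oplus> a') \<oplus> (w \<oplus> w')" using c h by (simp add: a_ac)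
  then show "x \<oplus> y \<in> {a \<oplus> w | a w. a \<in> J n \<and> w \<in> U n}"
    using hidealD(3)[OF J h(1,3)] hidealD(3)[OF U h(2,4)] by blast
next
  fix i n c x assume ci: "c \<in> G i" and "x \<in> {a \<oplus> w | a w. a \<in> J n \<and> w \<in> U n}"
  then obtain a w where h: "a \<in> J n" "w \<in> U n" "x = a \<oplus> w" by blast
  have c: "a \<in> carrier R" "w \<in> carrier R" "c \<in> carrier R"
    using h ci hidealD(1)[OF J] hidealD(1)[OF U] Gc by blast+
  have "c \<otimes> x = c \<otimes> a \<oplus> c \<otimes> w" using c h by (simp add: r_distr)
  then show "c \<otimes> x \<in> {a \<oplus> w | a w. a \<in> J (i + n) \<and> w \<in> U (i + n)}"
    using hidealD(4)[OF J ci h(1) refl] hidealD(4)[OF U ci h(2) refl] by blast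
qed

lemma hideal_principal:
  assumes t: "t \<in> G j"
  shows "hideal R G (\<lambda>n. {t \<otimes> r | r. r \<in> G (n - j)})"
proof (rule hidealI)
  fix n a assume "a \<in> {t \<otimes> r | r. r \<in> G (n - j)}"
  then show "a \<in> G n" using G_mult[OF t] by force
next
  fix n show "\<zero> \<in> {t \<otimes> r | r. r \<in> G (n - j)}" using G_zero t by force
next
  fix n x y assume "x \<in> {t \<otimes> r | r. r \<in> G (n - j)}" "y \<in> {t \<otimes> r | r. r \<in> G (n - j)}"
  then obtain r r' where h: "r \<in> G (n - j)" "r' \<in> G (n - j)" "x = t \<otimes> r" "y = t \<otimes> r'" by blast
  then have "x \<oplus> y = t \<otimes> (r \<oplus> r')" using t by (simp add: r_distr Gc[OF h(1)] Gc[OF h(2)] Gc[OF t])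
  then show "x \<oplus> y \<in> {t \<otimes> r | r. r \<in> G (n - j)}" using G_add[OF h(1,2)] by blast
next
  fix i n c x assume ci: "c \<in> G i" and "x \<in> {t \<otimes> r | r. r \<in> G (n - j)}"
  then obtain r where h: "r \<in> G (n - j)" "x = t \<otimes> r" by blast
  have "c \<otimes> x = t \<otimes> (c \<otimes> r)" using Gc[OF ci] Gc[OF h(1)] Gc[OF t] h by (simp add: m_lcomm)
  moreover have "c \<otimes> r \<in> G (i + n - j)" using G_mult[OF ci h(1)] by (simp add: algebra_simps)
  ultimately show "c \<otimes> x \<in> {t \<otimes> r | r. r \<in> G (i + n - j)}" by blast
qed

text \<open>An Artin-Rees type statement: a homogeneous ideal \<open>U\<close> that is maximal among those with
  \<open>U \<inter> J = K\<close> contains a power of every homogeneous \<open>s\<close> that has a power mapping \<open>J\<close> into \<open>K\<close>.\<close>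

lemma maximal_contains_power:
  assumes s: "s \<in> G i" and U: "hideal R G U" and J: "hideal R G J"
    and UJ: "\<And>n. U n \<inter> J n = K n"
    and max: "\<And>U'. \<lbrakk>hideal R G U'; \<And>n. U' n \<inter> J n = K n; U \<le> U'\<rbrakk> \<Longrightarrow> U' = U"
    and kill: "\<And>n r. r \<in> J n \<Longrightarrow> s [^] (j0::nat) \<otimes> r \<in> K (int j0 * i + n)"
  shows "\<exists>j::nat. s [^] j \<in> U (int j * i)"
proof -
  have sc: "s \<in> carrier R" using s by auto
  note Uc = Gc[OF hidealD(1)[OF U]]
  \<comment> \<open>The ascending chain of colon ideals of \<open>U\<close> by \<open>s^j\<close>,
    stationary from \<open>j1\<close> on.\<close>
  define C where "C j = (\<lambda>n. {r \<in> G n. s [^] (j::nat) \<otimes> r \<in> U (int j * i + n)})" for j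
  have Cid: "hideal R G (C j)" for j
  proof (rule hidealI)
    show "\<And>n a. a \<in> C j n \<Longrightarrow> a \<in> G n" by (simp add: C_def)
    show "\<zero> \<in> C j n" for n using hidealD(2)[OF U] G_zero sc by (simp add: C_def)
    show "a \<oplus> b \<in> C j n" if "a \<in> C j n" "b \<in> C j n" for a b n
    proof -
      have c: "a \<in> carrier R" "b \<in> carrier R" using that by (auto simp: C_def)
      then show ?thesis using that hidealD(3)[OF U] sc by (simp add: C_def G_add r_distr)
    qed
    show "a \<otimes> b \<in> C j (k + n)" if a: "a \<in> G k" and b: "b \<in> C j n" for a b k n
    proof -
      have "a \<otimes> (s [^] j \<otimes> b) \<in> U (int j * i + (k + n))"
        by (rule hidealD(4)[OF U a]) (use b in \<open>auto simp: C_def\<close>)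
      moreover have "a \<otimes> (s [^] j \<otimes> b) = s [^] j \<otimes> (a \<otimes> b)"
      proof -
        have "a \<in> carrier R" "b \<in> carrier R" using a b by (auto simp: C_def)
        then show ?thesis using sc by (simp add: m_lcomm)
      qed
      ultimately show ?thesis using a b G_mult by (simp add: C_def)
    qed
  qed
  have Cmono: "C j n \<subseteq> C (Suc j) n" for j n
  proof
    fix r assume r: "r \<in> C j n"
    have "s \<otimes> (s [^] j \<otimes> r) \<in> U (int (Suc j) * i + n)"
      by (rule hidealD(4)[OF U s]) (use r in \<open>auto simp: C_def algebra_simps\<close>)
    moreover have "s \<otimes> (s [^] j \<otimes> r) = s [^] Suc j \<otimes> r"
    proof -
      have "r \<in> carrier R" using r by (auto simp: C_def)
      then show ?thesis using sc by (simp add: m_ac)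
    qed
    ultimately show "r \<in> C (Suc j) n" using r by (simp add: C_def)
  qed
  obtain j1 where j1: "\<And>k. k \<ge> j1 \<Longrightarrow> C k = C j1" using acc[of C, OF Cid Cmono] by blast
  \<comment> \<open>One exponent for two purposes: \<open>j \<ge> j0\<close> makes
    \<open>s^j\<close> map \<open>J\<close> into \<open>U\<close>, and \<open>j \<ge> j1\<close>
    makes the colon ideals for \<open>s^j\<close> and \<open>s^(2j)\<close> equal.\<close>
  define j where "j = j0 + j1"
  have Cj: "C (j + j) = C j" using j1[of j] j1[of "j + j"] by (simp add: j_def)
  define T where "T = (\<lambda>n. {s [^] j \<otimes> r | r. r \<in> G (n - int j * i)})"
  have T: "hideal R G T" unfolding T_def by (rule hideal_principal[OF G_pow[OF s]])
  \<comment> \<open>The competitor of \<open>U\<close>: adding the ideal generated by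
    \<open>s^j\<close> turns out not to enlarge the intersection with \<open>J\<close>, so
    maximality forces \<open>s^j\<close> into \<open>U\<close>.\<close>
  define U' where "U' n = {w \<oplus> t | w t. w \<in> U n \<and> t \<in> T n}" for n
  have U': "hideal R G U'" unfolding U'_def by (rule hideal_add[OF U T])
  have le: "U \<le> U'"
  proof (intro le_funI subsetI)
    fix n w assume w: "w \<in> U n"
    have "w = w \<oplus> \<zero>" using Uc[OF w] by simp
    then show "w \<in> U' n" unfolding U'_def using w hidealD(2)[OF T] by blast
  qed
  have "U' n \<inter> J n = K n" for n
  proof
    show "K n \<subseteq> U' n \<inter> J n" using UJ[of n] le by (auto simp: le_fun_def)
    show "U' n \<inter> J n \<subseteq> K n"
    proof
      fix x assume x: "x \<in> U' n \<inter> J n"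
      then obtain w r where w: "w \<in> U n" and r: "r \<in> G (n - int j * i)" and xe: "x = w \<oplus> s [^] j \<otimes> r"
        unfolding U'_def T_def by blast
      have xJ: "x \<in> J n" using x by simp
      have c: "x \<in> carrier R" "w \<in> carrier R" "r \<in> carrier R"
        using hidealD(1)[OF J xJ] Uc[OF w] r by auto
      have "s [^] j1 \<otimes> (s [^] j0 \<otimes> x) \<in> U (int j1 * i + (int j0 * i + n))"
        by (rule hidealD(4)[OF U G_pow[OF s]]) (use kill[OF xJ] UJ in auto)
      moreover have "s [^] j1 \<otimes> (s [^] j0 \<otimes> x) = s [^] j \<otimes> x"
        using sc c by (simp add: j_def nat_pow_mult[symmetric] m_ac)
      ultimately have 1: "s [^] j \<otimes> x \<in> U (int j * i + n)" by (simp add: j_def algebra_simps)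
      have 2: "s [^] j \<otimes> w \<in> U (int j * i + n)" by (rule hidealD(4)[OF U G_pow[OF s] w]) simp
      \<comment> \<open>For \<open>x = w + s^j r\<close> in \<open>J\<close>, both
        \<open>s^j x\<close> and \<open>s^j w\<close> lie in \<open>U\<close>, hence so does
        \<open>s^(2j) r\<close>. Stationarity cancels one factor \<open>s^j\<close>, and
        \<open>x\<close> itself lies in \<open>U\<close>.\<close>
      have "s [^] j \<otimes> x \<oplus> \<ominus> (s [^] j \<otimes> w) = s [^] (j + j) \<otimes> r"
        using c sc by (simp add: xe r_distr nat_pow_mult[symmetric] m_assoc) (simp add: a_ac r_neg1 r_neg2 r_neg)
      then have "s [^] (j + j) \<otimes> r \<in> U (int j * i + n)"
        using hidealD(3)[OF U 1 hidealD(5)[OF U 2]] by simp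
      then have "r \<in> C (j + j) (n - int j * i)" using r by (simp add: C_def algebra_simps)
      then have "s [^] j \<otimes> r \<in> U n" unfolding Cj using r by (simp add: C_def)
      then have "x \<in> U n" unfolding xe by (rule hidealD(3)[OF U w])
      then show "x \<in> K n" using UJ xJ by blast
    qed
  qed
  then have "U' = U" using max[OF U' _ le] by blast
  moreover have "s [^] j \<in> U' (int j * i)"
  proof -
    have "s [^] j = \<zero> \<oplus> s [^] j \<otimes> \<one>" using sc by simp
    moreover have "s [^] j \<otimes> \<one> \<in> T (int j * i)" unfolding T_def using G_one by force
    ultimately show ?thesis unfolding U'_def using hidealD(2)[OF U] by blast
  qed
  ultimately show ?thesis by blast
qed

text \<open>Take \<open>U\<close> maximal among the homogeneous ideals meeting \<open>J\<close> in
  the kernel \<open>K\<close> of \<open>u\<close>, and extend \<open>u\<close> to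
  \<open>J + U\<close> by zero on \<open>U\<close>. Injectivity of \<open>E\<close> represents this
  extension by some \<open>v\<close>. Then \<open>U\<close> annihilates \<open>v\<close> and
  contains a power of every element of \<open>D\<close>, so \<open>v\<close> is torsion.
  Representing \<open>u\<close> on \<open>J\<close> alone would give no control over
  \<open>v\<close>.\<close>

theorem gam_hinj:
  assumes E: "hinj R G E"
  shows "hinj R G (gam R D E)"
  unfolding hinj_def
proof (intro conjI allI impI)
  have Em: "hmod R G E" using E by (simp add: hinj_def)
  then show "hmod R G (gam R D E)" by (rule gam_hmod)
  interpret E: module R E using Em by (rule hmod_module)
  fix k J u
  assume J: "hideal R G J"
    and "\<forall>n. \<forall>r\<in>J n. u n r \<in> hcomp (gam R D E) (n + k)"
    and "\<forall>n. \<forall>r\<in>J n. \<forall>r'\<in>J n. u n (r \<oplus> r') = u n r \<oplus>\<^bsub>gam R D E\<^esub> u n r'"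
    and "\<forall>i n. \<forall>a\<in>G i. \<forall>r\<in>J n. u (i + n) (a \<otimes> r) = a \<odot>\<^bsub>gam R D E\<^esub> u n r"
  then have u: "\<And>n r. r \<in> J n \<Longrightarrow> u n r \<in> hcomp (gam R D E) (n + k)"
    and uadd: "\<And>n r r'. \<lbrakk>r \<in> J n; r' \<in> J n\<rbrakk> \<Longrightarrow> u n (r \<oplus> r') = u n r \<oplus>\<^bsub>E\<^esub> u n r'"
    and usc: "\<And>i n a r. \<lbrakk>a \<in> G i; r \<in> J n\<rbrakk> \<Longrightarrow> u (i + n) (a \<otimes> r) = a \<odot>\<^bsub>E\<^esub> u n r"
    by simp_all
  note Jc = Gc[OF hidealD(1)[OF J]]
  have uE: "u n r \<in> hcomp E (n + k)" if "r \<in> J n" for n r using u[OF that] by (rule gam_sub)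
  note uc = hmodD(1)[OF Em uE]
  have uneg: "u n (\<ominus> r) = \<ominus>\<^bsub>E\<^esub> u n r" if "r \<in> J n" for n r
    using usc[OF G_neg[OF G_one] that] Jc[OF that] uc[OF that] by (simp add: l_minus E.smult_l_minus)
  have uz: "u n \<zero> = \<zero>\<^bsub>E\<^esub>" for n
    using usc[OF G_zero[of 0] hidealD(2)[OF J, of n]] uc[OF hidealD(2)[OF J, of n]] by simp
  define K where "K n = {r \<in> J n. u n r = \<zero>\<^bsub>E\<^esub>}" for n
  have Kid: "hideal R G K"
  proof (rule hidealI)
    show "a \<otimes> b \<in> K (i + n)" if "a \<in> G i" "b \<in> K n" for i n a b
      using that hidealD(4)[OF J that(1)] usc[OF that(1)] by (simp add: K_def Gc[OF that(1)])
  qed (auto simp: K_def uz uadd hidealD(2,3)[OF J] intro: hidealD(1)[OF J])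
  have "\<exists>U. (hideal R G U \<and> (\<forall>n. U n \<inter> J n = K n)) \<and>
    (\<forall>U'. hideal R G U' \<and> (\<forall>n. U' n \<inter> J n = K n) \<longrightarrow> U \<le> U' \<longrightarrow> U' = U)"
    by (rule hideal_maximal[of "\<lambda>U. hideal R G U \<and> (\<forall>n. U n \<inter> J n = K n)" K]) (use Kid in \<open>auto simp: K_def\<close>)
  then obtain U where U: "hideal R G U" and UJ: "\<And>n. U n \<inter> J n = K n"
    and max: "\<And>U'. \<lbrakk>hideal R G U'; \<And>n. U' n \<inter> J n = K n; U \<le> U'\<rbrakk> \<Longrightarrow> U' = U"
    by blast
  note Uc = Gc[OF hidealD(1)[OF U]]
  have pow: "\<exists>j::nat. s [^] j \<in> U (int j * i)" if iD: "(i, s) \<in> D" for i s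
  proof -
    have s: "s \<in> G i" by (rule D_G[OF iD])
    then have sc: "s \<in> carrier R" by auto
    define Q where "Q j = (\<lambda>n. {r \<in> J n. (s [^] (j::nat)) \<odot>\<^bsub>E\<^esub> u n r = \<zero>\<^bsub>E\<^esub>})" for j
    have Qid: "hideal R G (Q j)" for j
    proof (rule hidealI)
      show "\<And>n a. a \<in> Q j n \<Longrightarrow> a \<in> G n" by (simp add: Q_def hidealD(1)[OF J])
      show "\<zero> \<in> Q j n" for n using sc by (simp add: Q_def hidealD(2)[OF J] uz)
      show "a \<oplus> b \<in> Q j n" if "a \<in> Q j n" "b \<in> Q j n" for a b n
        using that sc by (simp add: Q_def hidealD(3)[OF J] uadd E.smult_r_distr uc)
      show "a \<otimes> b \<in> Q j (m + n)" if a: "a \<in> G m" and b: "b \<in> Q j n" for a b m n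
      proof -
        have bJ: "b \<in> J n" and b0: "(s [^] j) \<odot>\<^bsub>E\<^esub> u n b = \<zero>\<^bsub>E\<^esub>" using b by (auto simp: Q_def)
        have "(s [^] j) \<odot>\<^bsub>E\<^esub> (a \<odot>\<^bsub>E\<^esub> u n b) = a \<odot>\<^bsub>E\<^esub> ((s [^] j) \<odot>\<^bsub>E\<^esub> u n b)"
          using sc uc[OF bJ] Gc[OF a] by (simp add: m_comm flip: E.smult_assoc1)
        then show ?thesis using b0 a hidealD(4)[OF J a bJ refl] by (simp add: Q_def usc[OF a bJ] Gc[OF a])
      qed
    qed
    have "Q j n \<subseteq> Q (Suc j) n" for j n
      using pow_kill_mono[OF E.module_axioms sc uc, of _ _ j "Suc j"] by (auto simp: Q_def)
    \<comment> \<open>Torsion gives an exponent for each single value of \<open>u\<close>. The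
      elements of \<open>J\<close> whose value is killed by \<open>s^j\<close> form an ascending
      chain of ideals, so one exponent serves for all of \<open>J\<close>.\<close>
    then obtain j0 where j0: "\<And>j. j \<ge> j0 \<Longrightarrow> Q j = Q j0" using acc[of Q, OF Qid] by blast
    have all: "(s [^] j0) \<odot>\<^bsub>E\<^esub> u n r = \<zero>\<^bsub>E\<^esub>" if r: "r \<in> J n" for n r
    proof -
      obtain l :: nat where "(s [^] l) \<odot>\<^bsub>E\<^esub> u n r = \<zero>\<^bsub>E\<^esub>" using u[OF r] iD unfolding gam_iff by meson
      then have "r \<in> Q (max l j0) n"
        using r pow_kill_mono[OF E.module_axioms sc uc[OF r]] by (simp add: Q_def)
      then have "r \<in> Q j0 n" using j0[of "max l j0"] by simp
      then show ?thesis by (simp add: Q_def)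
    qed
    show ?thesis
    proof (rule maximal_contains_power[OF s U J UJ max])
      fix n r assume r: "r \<in> J n"
      show "s [^] j0 \<otimes> r \<in> K (int j0 * i + n)"
        using all[OF r] usc[OF G_pow[OF s] r] hidealD(4)[OF J G_pow[OF s] r refl] by (simp add: K_def)
    qed auto
  qed
  \<comment> \<open>The extension of \<open>u\<close> by zero on \<open>U\<close>. Two
    decompositions \<open>a + w\<close> of the same element differ by an element of
    \<open>J \<inter> U = K\<close>, on which \<open>u\<close> vanishes.\<close>
  define u' where "u' n x = u n (SOME a. a \<in> J n \<and> (\<exists>w\<in>U n. x = a \<oplus> w))" for n x
  have u'eq: "u' n (a \<oplus> w) = u n a" if a: "a \<in> J n" and w: "w \<in> U n" for n a w
  proof -
    define b where "b = (SOME b. b \<in> J n \<and> (\<exists>w'\<in>U n. a \<oplus> w = b \<oplus> w'))"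
    have "b \<in> J n \<and> (\<exists>w'\<in>U n. a \<oplus> w = b \<oplus> w')" unfolding b_def by (rule someI) (use a w in blast)
    then obtain w' where b: "b \<in> J n" and w': "w' \<in> U n" and eq: "a \<oplus> w = b \<oplus> w'" by blast
    have c: "a \<in> carrier R" "b \<in> carrier R" "w \<in> carrier R" "w' \<in> carrier R"
      using Jc a b Uc w w' by blast+
    have "a \<oplus> \<ominus> b = w' \<oplus> \<ominus> w"
    proof -
      have "a = (b \<oplus> w') \<oplus> \<ominus> w" using eq c by (metis a_inv_closed a_assoc r_neg r_zero)
      then have "a \<oplus> \<ominus> b = (w' \<oplus> \<ominus> w) \<oplus> (b \<oplus> \<ominus> b)" using c by (simp add: a_ac)
      then show ?thesis using c by (simp add: r_neg)
    qed
    moreover have "a \<oplus> \<ominus> b \<in> J n" "w' \<oplus> \<ominus> w \<in> U n"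
      using hidealD(3,5)[OF J] hidealD(3,5)[OF U] a b w w' by blast+
    ultimately have "a \<oplus> \<ominus> b \<in> K n" using UJ by auto
    then have "u n a \<oplus>\<^bsub>E\<^esub> \<ominus>\<^bsub>E\<^esub> u n b = \<zero>\<^bsub>E\<^esub>"
      using uadd[OF a hidealD(5)[OF J b]] uneg[OF b] by (simp add: K_def)
    then have "u n a = u n b" using uc[OF a] uc[OF b] by (metis E.r_neg E.add.inv_closed E.add.right_cancel)
    then show ?thesis by (simp add: u'_def b_def)
  qed
  obtain v where v: "v \<in> hcomp E k"
    and uv: "\<And>n r. r \<in> {a \<oplus> w | a w. a \<in> J n \<and> w \<in> U n} \<Longrightarrow> u' n r = r \<odot>\<^bsub>E\<^esub> v"
  proof (rule hinjD[OF E hideal_add[OF J U], of u' k])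
    fix n r assume "r \<in> {a \<oplus> w | a w. a \<in> J n \<and> w \<in> U n}"
    then show "u' n r \<in> hcomp E (n + k)" using u'eq uE by auto
  next
    fix n x y assume "x \<in> {a \<oplus> w | a w. a \<in> J n \<and> w \<in> U n}" "y \<in> {a \<oplus> w | a w. a \<in> J n \<and> w \<in> U n}"
    then obtain a w a' w' where h: "a \<in> J n" "w \<in> U n" "a' \<in> J n" "w' \<in> U n" "x = a \<oplus> w" "y = a' \<oplus> w'" by blast
    have "x \<oplus> y = (a \<oplus> a') \<oplus> (w \<oplus> w')"
      using Jc[OF h(1)] Jc[OF h(3)] Uc[OF h(2)] Uc[OF h(4)] h by (simp add: a_ac)
    then show "u' n (x \<oplus> y) = u' n x \<oplus>\<^bsub>E\<^esub> u' n y"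
      using h u'eq hidealD(3)[OF J h(1,3)] hidealD(3)[OF U h(2,4)] uadd[OF h(1,3)] by simp
  next
    fix i n c x assume ci: "c \<in> G i" and "x \<in> {a \<oplus> w | a w. a \<in> J n \<and> w \<in> U n}"
    then obtain a w where h: "a \<in> J n" "w \<in> U n" "x = a \<oplus> w" by blast
    have "c \<otimes> x = c \<otimes> a \<oplus> c \<otimes> w" using Jc[OF h(1)] Uc[OF h(2)] Gc[OF ci] h by (simp add: r_distr)
    then show "u' (i + n) (c \<otimes> x) = c \<odot>\<^bsub>E\<^esub> u' n x"
      using h u'eq hidealD(4)[OF J ci h(1) refl] hidealD(4)[OF U ci h(2) refl] usc[OF ci h(1)] by simp
  next
    fix v assume "v \<in> hcomp E k"
      and "\<And>n r. r \<in> {a \<oplus> w | a w. a \<in> J n \<and> w \<in> U n} \<Longrightarrow> u' n r = r \<odot>\<^bsub>E\<^esub> v"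
    then show thesis by (rule that)
  qed
  have uJ: "u n r = r \<odot>\<^bsub>E\<^esub> v" if "r \<in> J n" for n r
  proof -
    have "r = r \<oplus> \<zero>" using Jc[OF that] by simp
    moreover from this have "u' n r = u n r" using u'eq[OF that hidealD(2)[OF U, of n]] by simp
    moreover have "r \<in> {a \<oplus> w | a w. a \<in> J n \<and> w \<in> U n}"
      using \<open>r = r \<oplus> \<zero>\<close> that hidealD(2)[OF U, of n] by blast
    ultimately show ?thesis using uv by simp
  qed
  have uU: "r \<odot>\<^bsub>E\<^esub> v = \<zero>\<^bsub>E\<^esub>" if "r \<in> U n" for n r
  proof -
    have "r = \<zero> \<oplus> r" using Uc[OF that] by simp
    moreover from this have "u' n r = \<zero>\<^bsub>E\<^esub>" using u'eq[OF hidealD(2)[OF J] that] uz by simp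
    moreover have "r \<in> {a \<oplus> w | a w. a \<in> J n \<and> w \<in> U n}"
      using \<open>r = \<zero> \<oplus> r\<close> that hidealD(2)[OF J, of n] by blast
    ultimately show ?thesis using uv by simp
  qed
  have "v \<in> hcomp (gam R D E) k"
    unfolding gam_iff using v pow uU by blast
  then show "\<exists>v\<in>hcomp (gam R D E) k. \<forall>n. \<forall>r\<in>J n. u n r = r \<odot>\<^bsub>gam R D E\<^esub> v"
    using uJ by auto
qed

section \<open>Calculus of homogeneous homomorphisms, factorization and products\<close>

lemma hhomI:
  assumes "\<And>n u. u \<in> hcomp X n \<Longrightarrow> h n u \<in> hcomp Y n"
    and "\<And>n u v. \<lbrakk>u \<in> hcomp X n; v \<in> hcomp X n\<rbrakk> \<Longrightarrow> h n (u \<oplus>\<^bsub>X\<^esub> v) = h n u \<oplus>\<^bsub>Y\<^esub> h n v"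
    and "\<And>i n a u. \<lbrakk>a \<in> G i; u \<in> hcomp X n\<rbrakk> \<Longrightarrow> h (i + n) (a \<odot>\<^bsub>X\<^esub> u) = a \<odot>\<^bsub>Y\<^esub> h n u"
  shows "hhom G X Y h"
  using assms unfolding hhom_def by blast

lemma hhom_id: "hhom G X X (\<lambda>n u. u)"
  by (rule hhomI) simp_all

lemma hhom_comp:
  assumes "hhom G X Y f" "hhom G Y Z g"
  shows "hhom G X Z (\<lambda>n u. g n (f n u))"
  by (rule hhomI) (use hhomD[OF assms(1)] hhomD[OF assms(2)] in simp_all)

lemma hhom_zero_map:
  assumes "hmod R G Y"
  shows "hhom G X Y (\<lambda>n u. \<zero>\<^bsub>Y\<^esub>)"
proof -
  interpret Y: module R Y using assms by (rule hmod_module)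
  show ?thesis by (rule hhomI) (simp_all add: hmodD(2)[OF assms] Y.smult_r_null[OF Gc])
qed

lemma hhom_add:
  assumes "hmod R G Y" "hhom G X Y f" "hhom G X Y g"
  shows "hhom G X Y (\<lambda>n u. f n u \<oplus>\<^bsub>Y\<^esub> g n u)"
proof -
  interpret Y: module R Y using assms(1) by (rule hmod_module)
  note fc = hmodD(1)[OF assms(1) hhomD(1)[OF assms(2)]] and gc = hmodD(1)[OF assms(1) hhomD(1)[OF assms(3)]]
  show ?thesis
  proof (rule hhomI)
    fix n u assume u: "u \<in> hcomp X n"
    show "f n u \<oplus>\<^bsub>Y\<^esub> g n u \<in> hcomp Y n"
      by (rule hmodD(3)[OF assms(1) hhomD(1)[OF assms(2) u] hhomD(1)[OF assms(3) u]])
    fix v assume v: "v \<in> hcomp X n"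
    show "f n (u \<oplus>\<^bsub>X\<^esub> v) \<oplus>\<^bsub>Y\<^esub> g n (u \<oplus>\<^bsub>X\<^esub> v) = f n u \<oplus>\<^bsub>Y\<^esub> g n u \<oplus>\<^bsub>Y\<^esub> (f n v \<oplus>\<^bsub>Y\<^esub> g n v)"
      using fc[OF u] fc[OF v] gc[OF u] gc[OF v]
      by (simp add: hhomD(2)[OF assms(2) u v] hhomD(2)[OF assms(3) u v] Y.a_ac)
  next
    fix i n a u assume a: "a \<in> G i" and u: "u \<in> hcomp X n"
    show "f (i + n) (a \<odot>\<^bsub>X\<^esub> u) \<oplus>\<^bsub>Y\<^esub> g (i + n) (a \<odot>\<^bsub>X\<^esub> u) = a \<odot>\<^bsub>Y\<^esub> (f n u \<oplus>\<^bsub>Y\<^esub> g n u)"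
      using fc[OF u] gc[OF u]
      by (simp add: hhomD(3)[OF assms(2) a u] hhomD(3)[OF assms(3) a u] Y.smult_r_distr Gc[OF a])
  qed
qed

lemma hhom_uminus:
  assumes "hmod R G Y" "hhom G X Y g"
  shows "hhom G X Y (\<lambda>n u. \<ominus>\<^bsub>Y\<^esub> g n u)"
proof -
  interpret Y: module R Y using assms(1) by (rule hmod_module)
  note gc = hmodD(1)[OF assms(1) hhomD(1)[OF assms(2)]]
  show ?thesis
  proof (rule hhomI)
    fix n u assume u: "u \<in> hcomp X n"
    show "\<ominus>\<^bsub>Y\<^esub> g n u \<in> hcomp Y n" by (rule hmodD(5)[OF assms(1) hhomD(1)[OF assms(2) u]])
    fix v assume v: "v \<in> hcomp X n"
    show "\<ominus>\<^bsub>Y\<^esub> g n (u \<oplus>\<^bsub>X\<^esub> v) = \<ominus>\<^bsub>Y\<^esub> g n u \<oplus>\<^bsub>Y\<^esub> \<ominus>\<^bsub>Y\<^esub> g n v"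
      using gc[OF u] gc[OF v] by (simp add: hhomD(2)[OF assms(2) u v] Y.minus_add)
  next
    fix i n a u assume a: "a \<in> G i" and u: "u \<in> hcomp X n"
    show "\<ominus>\<^bsub>Y\<^esub> g (i + n) (a \<odot>\<^bsub>X\<^esub> u) = a \<odot>\<^bsub>Y\<^esub> (\<ominus>\<^bsub>Y\<^esub> g n u)"
      using gc[OF u] by (simp add: hhomD(3)[OF assms(2) a u] Y.smult_r_minus Gc[OF a])
  qed
qed

lemma hhom_diff:
  assumes "hmod R G Y" "hhom G X Y f" "hhom G X Y g"
  shows "hhom G X Y (\<lambda>n u. f n u \<ominus>\<^bsub>Y\<^esub> g n u)"
  unfolding a_minus_def by (rule hhom_add[OF assms(1,2) hhom_uminus[OF assms(1,3)]])

lemma hrelI: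
  assumes "\<And>n u v. (n, u, v) \<in> P \<Longrightarrow> u \<in> hcomp Y n" "\<And>n u v. (n, u, v) \<in> P \<Longrightarrow> v \<in> hcomp V n"
    and "\<And>n. (n, \<zero>\<^bsub>Y\<^esub>, \<zero>\<^bsub>V\<^esub>) \<in> P"
    and "\<And>n u v u' v'. \<lbrakk>(n, u, v) \<in> P; (n, u', v') \<in> P\<rbrakk> \<Longrightarrow> (n, u \<oplus>\<^bsub>Y\<^esub> u', v \<oplus>\<^bsub>V\<^esub> v') \<in> P"
    and "\<And>i n a u v. \<lbrakk>a \<in> G i; (n, u, v) \<in> P\<rbrakk> \<Longrightarrow> (i + n, a \<odot>\<^bsub>Y\<^esub> u, a \<odot>\<^bsub>V\<^esub> v) \<in> P"
  shows "hrel G Y V P"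
  using assms unfolding hrel_def by blast

lemma hrel_image:
  assumes X: "hmod R G X" and Y: "hmod R G Y" and V: "hmod R G V"
    and p: "hhom G X Y p" and q: "hhom G X V q"
  shows "hrel G Y V {(n, p n u, q n u) | n u. u \<in> hcomp X n}"
proof (rule hrelI)
  fix n
  show "(n, \<zero>\<^bsub>Y\<^esub>, \<zero>\<^bsub>V\<^esub>) \<in> {(n, p n u, q n u) | n u. u \<in> hcomp X n}"
    using hmodD(2)[OF X, of n] hhom_zero[OF X Y p, of n] hhom_zero[OF X V q, of n] by force
next
  fix n u v u' v'
  assume "(n, u, v) \<in> {(n, p n u, q n u) | n u. u \<in> hcomp X n}" "(n, u', v') \<in> {(n, p n u, q n u) | n u. u \<in> hcomp X n}"
  then obtain w w' where w: "w \<in> hcomp X n" "w' \<in> hcomp X n" "u = p n w" "v = q n w" "u' = p n w'" "v' = q n w'"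
    by blast
  then have "u \<oplus>\<^bsub>Y\<^esub> u' = p n (w \<oplus>\<^bsub>X\<^esub> w')" "v \<oplus>\<^bsub>V\<^esub> v' = q n (w \<oplus>\<^bsub>X\<^esub> w')"
    using hhomD(2)[OF p w(1,2)] hhomD(2)[OF q w(1,2)] by auto
  then show "(n, u \<oplus>\<^bsub>Y\<^esub> u', v \<oplus>\<^bsub>V\<^esub> v') \<in> {(n, p n u, q n u) | n u. u \<in> hcomp X n}"
    using hmodD(3)[OF X w(1,2)] by blast
next
  fix i n a u v
  assume a: "a \<in> G i" and "(n, u, v) \<in> {(n, p n u, q n u) | n u. u \<in> hcomp X n}"
  then obtain w where w: "w \<in> hcomp X n" "u = p n w" "v = q n w" by blast
  then have "a \<odot>\<^bsub>Y\<^esub> u = p (i + n) (a \<odot>\<^bsub>X\<^esub> w)" "a \<odot>\<^bsub>V\<^esub> v = q (i + n) (a \<odot>\<^bsub>X\<^esub> w)"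
    using hhomD(3)[OF p a w(1)] hhomD(3)[OF q a w(1)] by auto
  then show "(i + n, a \<odot>\<^bsub>Y\<^esub> u, a \<odot>\<^bsub>V\<^esub> v) \<in> {(n, p n u, q n u) | n u. u \<in> hcomp X n}"
    using hmodD(4)[OF X a w(1) refl] by blast
qed (use hhomD(1)[OF p] hhomD(1)[OF q] in auto)

text \<open>The relation formed by the pairs \<open>(p u, q u)\<close> is single-valued by the
  kernel condition, so Baer's criterion extends it to \<open>Y\<close>. With \<open>p\<close> an
  inclusion this produces retractions, with \<open>p\<close> a differential it produces
  homotopies.\<close>

lemma hinj_factor:
  assumes X: "hmod R G X" and Y: "hmod R G Y" and V: "hinj R G V"
    and p: "hhom G X Y p" and q: "hhom G X V q"
    and ker: "\<And>n u. \<lbrakk>u \<in> hcomp X n; p n u = \<zero>\<^bsub>Y\<^esub>\<rbrakk> \<Longrightarrow> q n u = \<zero>\<^bsub>V\<^esub>"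
  obtains h where "hhom G Y V h" "\<And>n u. u \<in> hcomp X n \<Longrightarrow> h n (p n u) = q n u"
proof -
  have Vm: "hmod R G V" using V by (simp add: hinj_def)
  have "\<exists>h. hhom G Y V h \<and> (\<forall>n u v. (n, u, v) \<in> {(n, p n u, q n u) | n u. u \<in> hcomp X n} \<longrightarrow> h n u = v)"
    by (rule baer[OF Y V hrel_image[OF X Y Vm p q]]) (use ker in force)
  then show ?thesis using that by blast
qed

definition hprod :: "('a, 'e) graded_module \<Rightarrow> ('a, 'f) graded_module \<Rightarrow> ('a, 'e \<times> 'f) graded_module" where
  "hprod X Y = \<lparr> carrier = carrier X \<times> carrier Y, monoid.mult = undefined, one = undefined,
     zero = (\<zero>\<^bsub>X\<^esub>, \<zero>\<^bsub>Y\<^esub>), add = (\<lambda>p q. (fst p \<oplus>\<^bsub>X\<^esub> fst q, snd p \<oplus>\<^bsub>Y\<^esub> snd q)),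
     smult = (\<lambda>r p. (r \<odot>\<^bsub>X\<^esub> fst p, r \<odot>\<^bsub>Y\<^esub> snd p)), hcomp = (\<lambda>n. hcomp X n \<times> hcomp Y n) \<rparr>"

lemma hprod_simps [simp]:
  "carrier (hprod X Y) = carrier X \<times> carrier Y"
  "\<zero>\<^bsub>hprod X Y\<^esub> = (\<zero>\<^bsub>X\<^esub>, \<zero>\<^bsub>Y\<^esub>)"
  "p \<oplus>\<^bsub>hprod X Y\<^esub> q = (fst p \<oplus>\<^bsub>X\<^esub> fst q, snd p \<oplus>\<^bsub>Y\<^esub> snd q)"
  "r \<odot>\<^bsub>hprod X Y\<^esub> p = (r \<odot>\<^bsub>X\<^esub> fst p, r \<odot>\<^bsub>Y\<^esub> snd p)"
  "hcomp (hprod X Y) n = hcomp X n \<times> hcomp Y n"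
  by (simp_all add: hprod_def)

lemma hprod_module:
  assumes "module R X" "module R Y"
  shows "module R (hprod X Y)"
proof -
  interpret X: module R X by fact
  interpret Y: module R Y by fact
  show ?thesis
  proof (rule moduleI)
    show "abelian_group (hprod X Y)"
    proof (rule abelian_groupI)
      fix p assume "p \<in> carrier (hprod X Y)"
      then have "(\<ominus>\<^bsub>X\<^esub> fst p, \<ominus>\<^bsub>Y\<^esub> snd p) \<in> carrier (hprod X Y)"
        "(\<ominus>\<^bsub>X\<^esub> fst p, \<ominus>\<^bsub>Y\<^esub> snd p) \<oplus>\<^bsub>hprod X Y\<^esub> p = \<zero>\<^bsub>hprod X Y\<^esub>"
        by (auto simp: X.l_neg Y.l_neg)
      then show "\<exists>q\<in>carrier (hprod X Y). q \<oplus>\<^bsub>hprod X Y\<^esub> p = \<zero>\<^bsub>hprod X Y\<^esub>" by blast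
    qed (auto simp: X.a_ac Y.a_ac)
  qed (auto simp: cring_axioms X.smult_l_distr Y.smult_l_distr X.smult_r_distr Y.smult_r_distr
      X.smult_assoc1 Y.smult_assoc1)
qed

lemma hprod_hmod:
  assumes "hmod R G X" "hmod R G Y"
  shows "hmod R G (hprod X Y)"
  using assms unfolding hmod_def by (auto intro!: hprod_module)

lemma hprod_hinj:
  assumes X: "hinj R G X" and Y: "hinj R G Y"
  shows "hinj R G (hprod X Y)"
  unfolding hinj_def
proof (intro conjI allI impI)
  show "hmod R G (hprod X Y)" by (rule hprod_hmod) (use X Y in \<open>auto simp: hinj_def\<close>)
  fix k J u
  assume J: "hideal R G J"
    and u: "\<forall>n. \<forall>r\<in>J n. u n r \<in> hcomp (hprod X Y) (n + k)"
    "\<forall>n. \<forall>r\<in>J n. \<forall>r'\<in>J n. u n (r \<oplus> r') = u n r \<oplus>\<^bsub>hprod X Y\<^esub> u n r'"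
    "\<forall>i n. \<forall>a\<in>G i. \<forall>r\<in>J n. u (i + n) (a \<otimes> r) = a \<odot>\<^bsub>hprod X Y\<^esub> u n r"
  obtain v where v: "v \<in> hcomp X k" "\<And>n r. r \<in> J n \<Longrightarrow> fst (u n r) = r \<odot>\<^bsub>X\<^esub> v"
    by (rule hinjD[OF X J, of "\<lambda>n r. fst (u n r)" k]) (use u in \<open>auto simp: mem_Times_iff\<close>)
  obtain w where w: "w \<in> hcomp Y k" "\<And>n r. r \<in> J n \<Longrightarrow> snd (u n r) = r \<odot>\<^bsub>Y\<^esub> w"
    by (rule hinjD[OF Y J, of "\<lambda>n r. snd (u n r)" k]) (use u in \<open>auto simp: mem_Times_iff\<close>)
  show "\<exists>v\<in>hcomp (hprod X Y) k. \<forall>n. \<forall>r\<in>J n. u n r = r \<odot>\<^bsub>hprod X Y\<^esub> v"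
    using v w by (intro bexI[of _ "(v, w)"]) (auto simp: prod_eq_iff)
qed

lemma gam_hprod:
  assumes X: "hmod R G X" and Y: "hmod R G Y"
  shows "(a, b) \<in> hcomp (gam R D (hprod X Y)) n \<longleftrightarrow> a \<in> hcomp (gam R D X) n \<and> b \<in> hcomp (gam R D Y) n"
proof
  assume "(a, b) \<in> hcomp (gam R D (hprod X Y)) n"
  then show "a \<in> hcomp (gam R D X) n \<and> b \<in> hcomp (gam R D Y) n" unfolding gam_iff by auto
next
  assume ab: "a \<in> hcomp (gam R D X) n \<and> b \<in> hcomp (gam R D Y) n"
  then have c: "a \<in> carrier X" "b \<in> carrier Y"
    using hmodD(1)[OF X gam_sub] hmodD(1)[OF Y gam_sub] by blast+
  show "(a, b) \<in> hcomp (gam R D (hprod X Y)) n"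
    unfolding gam_iff
  proof (intro conjI allI impI)
    fix i s assume iD: "(i, s) \<in> D"
    then have s: "s \<in> carrier R" using D_G by blast
    obtain k l :: nat where k: "(s [^] k) \<odot>\<^bsub>X\<^esub> a = \<zero>\<^bsub>X\<^esub>" and l: "(s [^] l) \<odot>\<^bsub>Y\<^esub> b = \<zero>\<^bsub>Y\<^esub>"
      using ab iD unfolding gam_iff by meson
    have "(s [^] (k + l)) \<odot>\<^bsub>X\<^esub> a = \<zero>\<^bsub>X\<^esub>" "(s [^] (k + l)) \<odot>\<^bsub>Y\<^esub> b = \<zero>\<^bsub>Y\<^esub>"
      using pow_kill_mono[OF hmod_module[OF X] s c(1) k] pow_kill_mono[OF hmod_module[OF Y] s c(2) l] by auto
    then show "\<exists>k::nat. (s [^] k) \<odot>\<^bsub>hprod X Y\<^esub> (a, b) = \<zero>\<^bsub>hprod X Y\<^esub>" by (intro exI[of _ "k + l"]) simp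
  qed (use ab in \<open>auto dest: gam_sub\<close>)
qed

text \<open>The torsion functor preserves exactness of a resolution of a torsion module. Modulo torsion,
  the resolution splits: by induction on \<open>i\<close> there is an endomorphism of \<open>T i\<close> that projects onto a
  complement of \<open>Z i = \<Gamma>(T i) + d (T (i - 1))\<close>.\<close>

theorem torsion_resolution_exact:
  fixes T :: "nat \<Rightarrow> ('a, 't) graded_module" and d :: "nat \<Rightarrow> int \<Rightarrow> 't \<Rightarrow> 't"
  assumes inj: "\<And>i. hinj R G (T i)" and hom: "\<And>i. hhom G (T i) (T (Suc i)) (d i)"
    and dd: "\<And>i n u. u \<in> hcomp (T i) n \<Longrightarrow> d (Suc i) n (d i n u) = \<zero>\<^bsub>T (Suc (Suc i))\<^esub>"
    and exact: "\<And>i n z. \<lbrakk>z \<in> hcomp (T (Suc i)) n; d (Suc i) n z = \<zero>\<^bsub>T (Suc (Suc i))\<^esub>\<rbrakk>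
      \<Longrightarrow> \<exists>w\<in>hcomp (T i) n. d i n w = z"
    and ker: "\<And>n w. \<lbrakk>w \<in> hcomp (T 0) n; d 0 n w = \<zero>\<^bsub>T (Suc 0)\<^esub>\<rbrakk> \<Longrightarrow> w \<in> hcomp (gam R D (T 0)) n"
    and z: "z \<in> hcomp (gam R D (T (Suc i))) n" and dz: "d (Suc i) n z = \<zero>\<^bsub>T (Suc (Suc i))\<^esub>"
  shows "\<exists>w\<in>hcomp (gam R D (T i)) n. d i n w = z"
proof -
  have Tm: "hmod R G (T i)" for i using inj[of i] by (simp add: hinj_def)
  have ag: "abelian_group (T i)" for i
    using hmod_module[OF Tm[of i]] by (simp add: module_def)
  note Gm = gam_hmod[OF Tm]
  define Z where "Z i n = (case i of 0 \<Rightarrow> hcomp (gam R D (T 0)) n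
    | Suc j \<Rightarrow> {g \<oplus>\<^bsub>T (Suc j)\<^esub> d j n v | g v. g \<in> hcomp (gam R D (T (Suc j))) n \<and> v \<in> hcomp (T j) n})" for i n
  have Z0: "Z 0 n = hcomp (gam R D (T 0)) n" for n by (simp add: Z_def)
  have ZS: "Z (Suc j) n = {g \<oplus>\<^bsub>T (Suc j)\<^esub> d j n v | g v. g \<in> hcomp (gam R D (T (Suc j))) n \<and> v \<in> hcomp (T j) n}" for j n
    by (simp add: Z_def)
  have gZ: "g \<in> Z i n" if g: "g \<in> hcomp (gam R D (T i)) n" for i n g
  proof (cases i)
    case (Suc j)
    interpret T: abelian_group "T (Suc j)" by (rule ag)
    have "g = g \<oplus>\<^bsub>T (Suc j)\<^esub> d j n \<zero>\<^bsub>T j\<^esub>"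
      using hhom_zero[OF Tm Tm hom, of j n] hmodD(1)[OF Tm gam_sub[OF g]] Suc by simp
    then show ?thesis using g hmodD(2)[OF Tm[of j], of n] Suc by (auto simp: ZS)
  qed (use g Z0 in simp)
  have dZ: "d j n v \<in> Z (Suc j) n" if v: "v \<in> hcomp (T j) n" for j n v
  proof -
    interpret T: abelian_group "T (Suc j)" by (rule ag)
    have "d j n v = \<zero>\<^bsub>T (Suc j)\<^esub> \<oplus>\<^bsub>T (Suc j)\<^esub> d j n v"
      using hmodD(1)[OF Tm hhomD(1)[OF hom v]] by simp
    then show ?thesis unfolding ZS using v hmodD(2)[OF Gm[of "Suc j"], of n] by auto
  qed
  have ZT: "w \<in> hcomp (T i) n" if "w \<in> Z i n" for i n w
  proof (cases i)
    case 0 then show ?thesis using that gam_sub by (simp only: Z0)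
  next
    case (Suc j)
    then show ?thesis using that hmodD(3)[OF Tm gam_sub hhomD(1)[OF hom]] unfolding Suc ZS by blast
  qed
  have Zadd: "a \<oplus>\<^bsub>T i\<^esub> b \<in> Z i n" if a: "a \<in> Z i n" and b: "b \<in> Z i n" for i n a b
  proof (cases i)
    case 0 then show ?thesis using a b hmodD(3)[OF Gm[of 0]] by (simp add: Z0)
  next
    case (Suc j)
    interpret T: abelian_group "T (Suc j)" by (rule ag)
    obtain g v g' v' where h: "a = g \<oplus>\<^bsub>T (Suc j)\<^esub> d j n v" "g \<in> hcomp (gam R D (T (Suc j))) n" "v \<in> hcomp (T j) n"
      "b = g' \<oplus>\<^bsub>T (Suc j)\<^esub> d j n v'" "g' \<in> hcomp (gam R D (T (Suc j))) n" "v' \<in> hcomp (T j) n"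
      using a b unfolding Suc ZS by blast
    have "g \<in> carrier (T (Suc j))" "g' \<in> carrier (T (Suc j))" "d j n v \<in> carrier (T (Suc j))" "d j n v' \<in> carrier (T (Suc j))"
      using h hmodD(1)[OF Tm gam_sub] hmodD(1)[OF Tm hhomD(1)[OF hom]] by blast+
    then have "a \<oplus>\<^bsub>T i\<^esub> b = (g \<oplus>\<^bsub>T (Suc j)\<^esub> g') \<oplus>\<^bsub>T (Suc j)\<^esub> d j n (v \<oplus>\<^bsub>T j\<^esub> v')"
      using h hhomD(2)[OF hom h(3,6)] Suc by (simp add: T.a_ac)
    then show ?thesis unfolding Suc ZS using hmodD(3)[OF Gm[of "Suc j"] h(2,5)] hmodD(3)[OF Tm h(3,6)] by auto
  qed
  have Zneg: "\<ominus>\<^bsub>T i\<^esub> a \<in> Z i n" if a: "a \<in> Z i n" for i n a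
  proof (cases i)
    case 0 then show ?thesis using a hmodD(5)[OF Gm[of 0]] by (simp add: Z0)
  next
    case (Suc j)
    interpret T: abelian_group "T (Suc j)" by (rule ag)
    obtain g v where h: "a = g \<oplus>\<^bsub>T (Suc j)\<^esub> d j n v" "g \<in> hcomp (gam R D (T (Suc j))) n" "v \<in> hcomp (T j) n"
      using a unfolding Suc ZS by blast
    have "g \<in> carrier (T (Suc j))" "d j n v \<in> carrier (T (Suc j))"
      using h hmodD(1)[OF Tm gam_sub] hmodD(1)[OF Tm hhomD(1)[OF hom]] by blast+
    then have "\<ominus>\<^bsub>T i\<^esub> a = (\<ominus>\<^bsub>T (Suc j)\<^esub> g) \<oplus>\<^bsub>T (Suc j)\<^esub> d j n (\<ominus>\<^bsub>T j\<^esub> v)"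
      using h hhom_neg[OF Tm Tm hom h(3)] Suc by (simp add: T.minus_add)
    then show ?thesis unfolding Suc ZS using hmodD(5)[OF Gm[of "Suc j"] h(2)] hmodD(5)[OF Tm h(3)] by auto
  qed
  have dZG: "d i n w \<in> hcomp (gam R D (T (Suc i))) n" if w: "w \<in> Z i n" for i n w
  proof (cases i)
    case 0 then show ?thesis using w gam_hhom[OF Tm Tm hom] by (simp add: Z0)
  next
    case (Suc j)
    interpret T: abelian_group "T (Suc (Suc j))" by (rule ag)
    obtain g v where h: "w = g \<oplus>\<^bsub>T (Suc j)\<^esub> d j n v" "g \<in> hcomp (gam R D (T (Suc j))) n" "v \<in> hcomp (T j) n"
      using w unfolding Suc ZS by blast
    have "d (Suc j) n w = d (Suc j) n g"
      using hhomD(2)[OF hom gam_sub[OF h(2)] hhomD(1)[OF hom h(3)]] dd[OF h(3)] h(1)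
        hmodD(1)[OF Tm hhomD(1)[OF hom gam_sub[OF h(2)]]] by simp
    then show ?thesis using gam_hhom[OF Tm Tm hom h(2)] Suc by simp
  qed
  \<comment> \<open>Above degree 0 a cocycle is a coboundary by exactness; in degree 0 it is torsion
    by \<open>ker\<close>.\<close>
  have kerZ: "w \<in> Z i n" if w: "w \<in> hcomp (T i) n" and dw: "d i n w = \<zero>\<^bsub>T (Suc i)\<^esub>" for i n w
  proof (cases i)
    case 0 then show ?thesis using ker w dw by (simp add: Z0)
  next
    case (Suc j) then show ?thesis using exact[of w j n] w dw dZ by auto
  qed
  \<comment> \<open>\<open>r\<close> is zero on \<open>Z i\<close> and the identity modulo
    \<open>Z i\<close>. These two properties already make it idempotent.\<close>
  define good where "good i r \<longleftrightarrow> hhom G (T i) (T i) r \<and> (\<forall>n. \<forall>w\<in>Z i n. r n w = \<zero>\<^bsub>T i\<^esub>) \<and>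
    (\<forall>n. \<forall>w\<in>hcomp (T i) n. r n w \<ominus>\<^bsub>T i\<^esub> w \<in> Z i n)" for i r
  \<comment> \<open>The use of \<open>r\<close>: if \<open>d w\<close> is torsion, suitable
    multiples \<open>s^k w\<close> are cocycles and hence killed by \<open>r\<close>. So
    \<open>r w\<close> is torsion, and \<open>w = r w - (r w - w)\<close> lies in
    \<open>Z i\<close>.\<close>
  have closed: "w \<in> Z i n" if r: "good i r" and w: "w \<in> hcomp (T i) n"
    and dw: "d i n w \<in> hcomp (gam R D (T (Suc i))) n" for i n w r
  proof -
    interpret T: abelian_group "T i" by (rule ag)
    have rh: "hhom G (T i) (T i) r" using r by (simp add: good_def)
    have "r n w \<in> hcomp (gam R D (T i)) n"
      unfolding gam_iff
    proof (intro conjI allI impI hhomD(1)[OF rh w])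
      fix j s assume jD: "(j, s) \<in> D"
      then obtain k :: nat where k: "(s [^] k) \<odot>\<^bsub>T (Suc i)\<^esub> d i n w = \<zero>\<^bsub>T (Suc i)\<^esub>"
        using dw unfolding gam_iff by meson
      have s: "s [^] k \<in> G (int k * j)" by (rule G_pow[OF D_G[OF jD]])
      have "(s [^] k) \<odot>\<^bsub>T i\<^esub> w \<in> Z i (int k * j + n)"
        by (rule kerZ[OF hmodD(4)[OF Tm s w refl]]) (use hhomD(3)[OF hom s w] k in simp)
      then have "r (int k * j + n) ((s [^] k) \<odot>\<^bsub>T i\<^esub> w) = \<zero>\<^bsub>T i\<^esub>" using r by (simp add: good_def)
      then have "(s [^] k) \<odot>\<^bsub>T i\<^esub> r n w = \<zero>\<^bsub>T i\<^esub>" using hhomD(3)[OF rh s w] by simp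
      then show "\<exists>k::nat. (s [^] k) \<odot>\<^bsub>T i\<^esub> r n w = \<zero>\<^bsub>T i\<^esub>" by blast
    qed
    then have "r n w \<in> Z i n" by (rule gZ)
    moreover have "\<ominus>\<^bsub>T i\<^esub> (r n w \<ominus>\<^bsub>T i\<^esub> w) \<in> Z i n"
      by (rule Zneg) (use r w in \<open>auto simp: good_def\<close>)
    ultimately have "r n w \<oplus>\<^bsub>T i\<^esub> \<ominus>\<^bsub>T i\<^esub> (r n w \<ominus>\<^bsub>T i\<^esub> w) \<in> Z i n"
      by (rule Zadd)
    moreover have "r n w \<oplus>\<^bsub>T i\<^esub> \<ominus>\<^bsub>T i\<^esub> (r n w \<ominus>\<^bsub>T i\<^esub> w) = w"
      using hmodD(1)[OF Tm w] hmodD(1)[OF Tm hhomD(1)[OF rh w]]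
      by (simp add: a_minus_def T.minus_add T.r_neg1 T.r_neg2 T.minus_minus)
    ultimately show ?thesis by simp
  qed
  \<comment> \<open>The torsion part is itself injective by \<open>gam_hinj\<close>, so its identity
    extends to a map \<open>p\<close> on all of \<open>T i\<close>; then
    \<open>q = 1 - p\<close>.\<close>
  have proj: "\<exists>q. hhom G (T i) (T i) q \<and> (\<forall>n. \<forall>w\<in>hcomp (gam R D (T i)) n. q n w = \<zero>\<^bsub>T i\<^esub>) \<and>
      (\<forall>n. \<forall>w\<in>hcomp (T i) n. \<exists>g\<in>hcomp (gam R D (T i)) n. q n w = w \<oplus>\<^bsub>T i\<^esub> g)" for i
  proof -
    interpret T: abelian_group "T i" by (rule ag)
    have inc: "hhom G (gam R D (T i)) (T i) (\<lambda>n u. u)" by (rule hhomI) (auto simp: gam_iff)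
    obtain p where p: "hhom G (T i) (gam R D (T i)) p"
      and pe: "\<And>n u. u \<in> hcomp (gam R D (T i)) n \<Longrightarrow> p n u = u"
      by (rule hinj_factor[OF Gm[of i] Tm gam_hinj[OF inj[of i]] inc hhom_id]) auto
    have q: "hhom G (T i) (T i) (\<lambda>n u. u \<ominus>\<^bsub>T i\<^esub> p n u)"
      by (rule hhom_diff[OF Tm hhom_id hhom_comp[OF p inc]])
    show ?thesis
    proof (intro exI[of _ "\<lambda>n u. u \<ominus>\<^bsub>T i\<^esub> p n u"] conjI allI ballI q)
      fix n w assume w: "w \<in> hcomp (gam R D (T i)) n"
      show "w \<ominus>\<^bsub>T i\<^esub> p n w = \<zero>\<^bsub>T i\<^esub>"
        using hmodD(1)[OF Tm gam_sub[OF w]] by (simp add: pe[OF w] a_minus_def T.r_neg)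
    next
      fix n w assume w: "w \<in> hcomp (T i) n"
      show "\<exists>g\<in>hcomp (gam R D (T i)) n. w \<ominus>\<^bsub>T i\<^esub> p n w = w \<oplus>\<^bsub>T i\<^esub> g"
        using hmodD(5)[OF Gm[of i] hhomD(1)[OF p w]] by (auto simp: a_minus_def)
    qed
  qed
  have ex_good: "\<exists>r. good i r" for i
  proof (induction i)
    case 0
    interpret T: abelian_group "T 0" by (rule ag)
    obtain q where q: "hhom G (T 0) (T 0) q" "\<forall>n. \<forall>w\<in>hcomp (gam R D (T 0)) n. q n w = \<zero>\<^bsub>T 0\<^esub>"
      "\<forall>n. \<forall>w\<in>hcomp (T 0) n. \<exists>g\<in>hcomp (gam R D (T 0)) n. q n w = w \<oplus>\<^bsub>T 0\<^esub> g" using proj by blast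
    have "q n w \<ominus>\<^bsub>T 0\<^esub> w \<in> Z 0 n" if w: "w \<in> hcomp (T 0) n" for n w
    proof -
      obtain g where g: "g\<in>hcomp (gam R D (T 0)) n" "q n w = w \<oplus>\<^bsub>T 0\<^esub> g" using q w by blast
      have "q n w \<ominus>\<^bsub>T 0\<^esub> w = g"
        using hmodD(1)[OF Tm w] hmodD(1)[OF Tm gam_sub[OF g(1)]] by (simp add: g a_minus_def T.a_ac T.r_neg T.r_neg1)
      then show ?thesis using g by (simp add: Z0)
    qed
    then have "good 0 q" using q by (auto simp: good_def Z0)
    then show ?case by blast
  next
    case (Suc i)
    then obtain r where r: "good i r" by blast
    have rh: "hhom G (T i) (T i) r" using r by (simp add: good_def)
    interpret T: abelian_group "T (Suc i)" by (rule ag)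
    interpret Ti: abelian_group "T i" by (rule ag)
    let ?X = "hprod (T i) (gam R D (T (Suc i)))"
    have Xm: "hmod R G ?X" by (rule hprod_hmod[OF Tm Gm])
    have f1: "hhom G ?X (T i) (\<lambda>n. fst)" by (rule hhomI) auto
    have f2: "hhom G ?X (T (Suc i)) (\<lambda>n. snd)" by (rule hhomI) (auto simp: gam_iff)
    \<comment> \<open>The prescription is \<open>\<sigma> (d w + g) = r w\<close> for torsion
      \<open>g\<close>. It is consistent: if \<open>d w = -g\<close>, then \<open>d w\<close> is
      torsion, \<open>closed\<close> puts \<open>w\<close> into \<open>Z i\<close>, and
      \<open>r w = 0\<close>.\<close>
    obtain \<sigma> where \<sigma>: "hhom G (T (Suc i)) (T i) \<sigma>"
      and \<sigma>eq: "\<And>n u. u \<in> hcomp ?X n \<Longrightarrow> \<sigma> n (d i n (fst u) \<oplus>\<^bsub>T (Suc i)\<^esub> snd u) = r n (fst u)"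
    proof (rule hinj_factor[OF Xm Tm[of "Suc i"] inj[of i]
          hhom_add[OF Tm hhom_comp[OF f1 hom] f2] hhom_comp[OF f1 rh]])
      fix n u assume u: "u \<in> hcomp ?X n" and "d i n (fst u) \<oplus>\<^bsub>T (Suc i)\<^esub> snd u = \<zero>\<^bsub>T (Suc i)\<^esub>"
      have w: "fst u \<in> hcomp (T i) n" and g: "snd u \<in> hcomp (gam R D (T (Suc i))) n" using u by auto
      have "d i n (fst u) = \<ominus>\<^bsub>T (Suc i)\<^esub> snd u"
        using \<open>d i n (fst u) \<oplus>\<^bsub>T (Suc i)\<^esub> snd u = \<zero>\<^bsub>T (Suc i)\<^esub>\<close>
          T.minus_equality hmodD(1)[OF Tm hhomD(1)[OF hom w]] hmodD(1)[OF Tm gam_sub[OF g]] by metis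
      then have "d i n (fst u) \<in> hcomp (gam R D (T (Suc i))) n"
        using hmodD(5)[OF Gm[of "Suc i"] g] by simp
      then have "fst u \<in> Z i n" by (rule closed[OF r w])
      then show "r n (fst u) = \<zero>\<^bsub>T i\<^esub>" using r by (simp add: good_def)
    qed blast
    obtain q where q: "hhom G (T (Suc i)) (T (Suc i)) q"
      and q0: "\<And>n w. w\<in>hcomp (gam R D (T (Suc i))) n \<Longrightarrow> q n w = \<zero>\<^bsub>T (Suc i)\<^esub>"
      and qg: "\<And>n w. w\<in>hcomp (T (Suc i)) n \<Longrightarrow> \<exists>g\<in>hcomp (gam R D (T (Suc i))) n. q n w = w \<oplus>\<^bsub>T (Suc i)\<^esub> g"
      using proj[of "Suc i"] by blast
    have e: "hhom G (T (Suc i)) (T (Suc i)) (\<lambda>n u. u \<ominus>\<^bsub>T (Suc i)\<^esub> d i n (\<sigma> n u))"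
      by (rule hhom_diff[OF Tm hhom_id hhom_comp[OF \<sigma> hom]])
    \<comment> \<open>On \<open>g + d v\<close> the map \<open>1 - d \<sigma>\<close> takes the
      value \<open>g - d (r v - v)\<close>. It is torsion because \<open>d\<close> maps
      \<open>Z i\<close> into the torsion part, and so it is killed by \<open>q\<close>.\<close>
    have "good (Suc i) (\<lambda>n u. q n (u \<ominus>\<^bsub>T (Suc i)\<^esub> d i n (\<sigma> n u)))"
      unfolding good_def
    proof (intro conjI allI ballI hhom_comp[OF e q])
      fix n w assume "w \<in> Z (Suc i) n"
      then obtain g v where h: "w = g \<oplus>\<^bsub>T (Suc i)\<^esub> d i n v" "g \<in> hcomp (gam R D (T (Suc i))) n" "v \<in> hcomp (T i) n"
        unfolding ZS by blast
      have c: "g \<in> carrier (T (Suc i))" "d i n v \<in> carrier (T (Suc i))" "d i n (r n v) \<in> carrier (T (Suc i))"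
        using h hmodD(1)[OF Tm gam_sub] hmodD(1)[OF Tm hhomD(1)[OF hom]] hhomD(1)[OF rh] by blast+
      have "\<sigma> n w = r n v" using \<sigma>eq[of "(v, g)" n] h c by (simp add: T.a_comm)
      then have "w \<ominus>\<^bsub>T (Suc i)\<^esub> d i n (\<sigma> n w) = g \<oplus>\<^bsub>T (Suc i)\<^esub> \<ominus>\<^bsub>T (Suc i)\<^esub> d i n (r n v \<ominus>\<^bsub>T i\<^esub> v)"
        using c h(1) by (simp add: hhom_minus[OF Tm Tm hom hhomD(1)[OF rh h(3)] h(3)])
          (simp add: a_minus_def T.minus_add T.minus_minus T.a_ac)
      moreover have "\<dots> \<in> hcomp (gam R D (T (Suc i))) n"
        using hmodD(3)[OF Gm[of "Suc i"] h(2)] hmodD(5)[OF Gm[of "Suc i"] dZG] r h(3) by (simp add: good_def)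
      ultimately show "q n (w \<ominus>\<^bsub>T (Suc i)\<^esub> d i n (\<sigma> n w)) = \<zero>\<^bsub>T (Suc i)\<^esub>" using q0 by simp
    next
      fix n w assume w: "w \<in> hcomp (T (Suc i)) n"
      let ?y = "w \<ominus>\<^bsub>T (Suc i)\<^esub> d i n (\<sigma> n w)"
      have \<sigma>w: "\<sigma> n w \<in> hcomp (T i) n" by (rule hhomD(1)[OF \<sigma> w])
      have "?y \<in> hcomp (T (Suc i)) n" by (rule hhomD(1)[OF e w])
      then obtain g where g: "g\<in>hcomp (gam R D (T (Suc i))) n" "q n ?y = ?y \<oplus>\<^bsub>T (Suc i)\<^esub> g" using qg by blast
      have c: "w \<in> carrier (T (Suc i))" "g \<in> carrier (T (Suc i))" "d i n (\<sigma> n w) \<in> carrier (T (Suc i))"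
        using w hmodD(1)[OF Tm] gam_sub[OF g(1)] hhomD(1)[OF hom \<sigma>w] by blast+
      have "q n ?y \<ominus>\<^bsub>T (Suc i)\<^esub> w = g \<oplus>\<^bsub>T (Suc i)\<^esub> d i n (\<ominus>\<^bsub>T i\<^esub> \<sigma> n w) \<oplus>\<^bsub>T (Suc i)\<^esub> (w \<oplus>\<^bsub>T (Suc i)\<^esub> \<ominus>\<^bsub>T (Suc i)\<^esub> w)"
        unfolding g(2) using c by (simp add: hhom_neg[OF Tm Tm hom \<sigma>w] a_minus_def T.a_ac)
      then have "q n ?y \<ominus>\<^bsub>T (Suc i)\<^esub> w = g \<oplus>\<^bsub>T (Suc i)\<^esub> d i n (\<ominus>\<^bsub>T i\<^esub> \<sigma> n w)"
        using c by (simp add: T.r_neg hhom_neg[OF Tm Tm hom \<sigma>w])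
      then show "q n ?y \<ominus>\<^bsub>T (Suc i)\<^esub> w \<in> Z (Suc i) n"
        unfolding ZS using g hmodD(5)[OF Tm \<sigma>w] by blast
    qed
    then show ?case by blast
  qed
  \<comment> \<open>Any preimage \<open>w\<close> of \<open>z\<close> lies in \<open>Z i\<close> by
    \<open>closed\<close>, since \<open>z\<close> is torsion. Dropping its coboundary part does not
    change \<open>d w\<close> and leaves a torsion preimage.\<close>
  obtain w where w: "w \<in> hcomp (T i) n" and dw: "d i n w = z" using exact[OF gam_sub[OF z] dz] by blast
  obtain r where "good i r" using ex_good by blast
  then have wZ: "w \<in> Z i n" using closed w dw z by blast
  show ?thesis
  proof (cases i)
    case 0 then show ?thesis using wZ dw by (auto simp: Z0)
  next
    case (Suc j)
    interpret T: abelian_group "T (Suc (Suc j))" by (rule ag)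
    obtain g v where h: "w = g \<oplus>\<^bsub>T (Suc j)\<^esub> d j n v" "g \<in> hcomp (gam R D (T (Suc j))) n" "v \<in> hcomp (T j) n"
      using wZ unfolding Suc ZS by blast
    have "d (Suc j) n w = d (Suc j) n g"
      using hhomD(2)[OF hom gam_sub[OF h(2)] hhomD(1)[OF hom h(3)]] dd[OF h(3)] h(1)
        hmodD(1)[OF Tm hhomD(1)[OF hom gam_sub[OF h(2)]]] by simp
    then show ?thesis using h dw Suc by auto
  qed
qed

end

section \<open>Null-homotopic compositions and the total complex\<close>

lemma gr_shift_simps [simp]:
  "carrier (gr_shift k E) = carrier E" "add (gr_shift k E) = add E" "zero (gr_shift k E) = zero E"
  "smult (gr_shift k E) = smult E" "a_inv (gr_shift k E) = a_inv E"
  "a_minus (gr_shift k E) = a_minus E" "hcomp (gr_shift k E) n = hcomp E (n + k)"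
  by (simp_all add: gr_shift_def a_inv_def m_inv_def a_minus_def fun_eq_iff)

text \<open>The zero module as far as components are concerned, on the carrier and type of
  \<open>E\<close>. It continues a complex below degree 0 without leaving the element type.\<close>

definition hzero :: "('r, 'e) graded_module \<Rightarrow> ('r, 'e) graded_module" where
  "hzero E = E\<lparr>hcomp := (\<lambda>n. {\<zero>\<^bsub>E\<^esub>})\<rparr>"

lemma hzero_simps [simp]:
  "carrier (hzero E) = carrier E" "add (hzero E) = add E" "zero (hzero E) = zero E"
  "smult (hzero E) = smult E" "a_inv (hzero E) = a_inv E"
  "a_minus (hzero E) = a_minus E" "hcomp (hzero E) n = {\<zero>\<^bsub>E\<^esub>}"
  by (simp_all add: hzero_def a_inv_def m_inv_def a_minus_def fun_eq_iff)

context graded_scalars begin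

lemma hmod_shift:
  assumes E: "hmod R G E"
  shows "hmod R G (gr_shift k E)"
proof -
  have "module R (gr_shift k E)" by (rule module_cong[OF hmod_module[OF E]]) simp_all
  then show ?thesis using E unfolding hmod_def by (auto simp: add.assoc)
qed

lemma hinj_shift:
  assumes E: "hinj R G E"
  shows "hinj R G (gr_shift m E)"
  unfolding hinj_def
proof (intro conjI allI impI)
  show "hmod R G (gr_shift m E)" using E by (simp add: hinj_def hmod_shift)
  fix k J u
  assume J: "hideal R G J"
    and u: "\<forall>n. \<forall>r\<in>J n. u n r \<in> hcomp (gr_shift m E) (n + k)"
    "\<forall>n. \<forall>r\<in>J n. \<forall>r'\<in>J n. u n (r \<oplus> r') = u n r \<oplus>\<^bsub>gr_shift m E\<^esub> u n r'"
    "\<forall>i n. \<forall>a\<in>G i. \<forall>r\<in>J n. u (i + n) (a \<otimes> r) = a \<odot>\<^bsub>gr_shift m E\<^esub> u n r"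
  obtain v where v: "v \<in> hcomp E (k + m)" "\<And>n r. r \<in> J n \<Longrightarrow> u n r = r \<odot>\<^bsub>E\<^esub> v"
    by (rule hinjD[OF E J, of u "k + m"]) (use u in \<open>auto simp: add.assoc\<close>)
  then show "\<exists>v\<in>hcomp (gr_shift m E) k. \<forall>n. \<forall>r\<in>J n. u n r = r \<odot>\<^bsub>gr_shift m E\<^esub> v" by auto
qed

lemma hmod_hzero:
  assumes E: "hmod R G E"
  shows "hmod R G (hzero E)"
proof -
  interpret E: module R E using E by (rule hmod_module)
  have "module R (hzero E)" by (rule module_cong[OF hmod_module[OF E]]) simp_all
  then show ?thesis unfolding hmod_def by (auto simp: E.smult_r_null[OF Gc])
qed

lemma hinj_hzero:
  assumes E: "hmod R G E"
  shows "hinj R G (hzero E)"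
proof -
  interpret E: module R E using E by (rule hmod_module)
  show ?thesis
    unfolding hinj_def
  proof (intro conjI allI impI hmod_hzero E)
    fix k J u
    assume J: "hideal R G J" and u: "\<forall>n. \<forall>r\<in>J n. u n r \<in> hcomp (hzero E) (n + k)"
    show "\<exists>v\<in>hcomp (hzero E) k. \<forall>n. \<forall>r\<in>J n. u n r = r \<odot>\<^bsub>hzero E\<^esub> v"
      using u E.smult_r_null[OF Gc[OF hidealD(1)[OF J]]] by (intro bexI[of _ "\<zero>\<^bsub>E\<^esub>"]) auto
  qed
qed

lemma hhom_pair:
  assumes "hhom G X Y f" "hhom G X Z g"
  shows "hhom G X (hprod Y Z) (\<lambda>n u. (f n u, g n u))"
  by (rule hhomI) (simp_all add: hhomD[OF assms(1)] hhomD[OF assms(2)])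

lemma gam_shift: "hcomp (gam R D (gr_shift k E)) n = hcomp (gam R D E) (n + k)"
  by (simp add: gam_def)

lemma gam_hzero:
  assumes E: "hmod R G E"
  shows "hcomp (gam R D (hzero E)) n = {\<zero>\<^bsub>E\<^esub>}"
  using hmodD(2)[OF gam_hmod[OF hmod_hzero[OF E]]] by (auto simp: gam_iff)

end

text \<open>The exact sequence of the resolved modules is expressed inside the resolutions: the
  kernels of \<open>d 0\<close> and \<open>d' 0\<close> stand for \<open>L(M)\<close> and
  \<open>L(N)\<close>. The \<open>base_\<close> assumptions say that multiplication by
  \<open>x t\<close> has torsion kernel, that the composite is zero, and that the sequence is exact
  in the middle and on the right.\<close>

locale double_lift = graded_scalars R G D for R (structure) and G D +
  fixes E :: "nat \<Rightarrow> ('a, 'e) graded_module" and d :: "nat \<Rightarrow> 'e \<Rightarrow> 'e"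
    and F :: "nat \<Rightarrow> ('a, 'f) graded_module" and d' :: "nat \<Rightarrow> 'f \<Rightarrow> 'f"
    and \<phi> :: "nat \<Rightarrow> 'e \<Rightarrow> 'e" and \<psi> :: "nat \<Rightarrow> 'e \<Rightarrow> 'f"
  assumes E_inj: "hinj R G (E i)" and F_inj: "hinj R G (F i)"
    and d_hom: "hhom G (E i) (E (Suc i)) (\<lambda>n. d i)" and d'_hom: "hhom G (F i) (F (Suc i)) (\<lambda>n. d' i)"
    and \<phi>_hom: "hhom G (gr_shift (-1) (E i)) (E i) (\<lambda>n. \<phi> i)" and \<psi>_hom: "hhom G (E i) (F i) (\<lambda>n. \<psi> i)"
    and dd: "e \<in> hcomp (E i) n \<Longrightarrow> d (Suc i) (d i e) = \<zero>\<^bsub>E (Suc (Suc i))\<^esub>"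
    and d'd': "f \<in> hcomp (F i) n \<Longrightarrow> d' (Suc i) (d' i f) = \<zero>\<^bsub>F (Suc (Suc i))\<^esub>"
    and E_exact: "\<lbrakk>e \<in> hcomp (E (Suc i)) n; d (Suc i) e = \<zero>\<^bsub>E (Suc (Suc i))\<^esub>\<rbrakk> \<Longrightarrow> \<exists>u\<in>hcomp (E i) n. d i u = e"
    and F_exact: "\<lbrakk>f \<in> hcomp (F (Suc i)) n; d' (Suc i) f = \<zero>\<^bsub>F (Suc (Suc i))\<^esub>\<rbrakk> \<Longrightarrow> \<exists>u\<in>hcomp (F i) n. d' i u = f"
    and \<phi>_d: "e \<in> hcomp (E i) n \<Longrightarrow> \<phi> (Suc i) (d i e) = d i (\<phi> i e)"
    and \<psi>_d: "e \<in> hcomp (E i) n \<Longrightarrow> \<psi> (Suc i) (d i e) = d' i (\<psi> i e)"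
    and base_kernel: "\<lbrakk>a \<in> hcomp (E 0) n; d 0 a = \<zero>\<^bsub>E (Suc 0)\<^esub>; \<phi> 0 a = \<zero>\<^bsub>E 0\<^esub>\<rbrakk> \<Longrightarrow> a \<in> hcomp (gam R D (E 0)) n"
    and base_zero: "\<lbrakk>a \<in> hcomp (E 0) n; d 0 a = \<zero>\<^bsub>E (Suc 0)\<^esub>\<rbrakk> \<Longrightarrow> \<psi> 0 (\<phi> 0 a) = \<zero>\<^bsub>F 0\<^esub>"
    and base_exact: "\<lbrakk>b \<in> hcomp (E 0) n; d 0 b = \<zero>\<^bsub>E (Suc 0)\<^esub>; \<psi> 0 b = \<zero>\<^bsub>F 0\<^esub>\<rbrakk>
      \<Longrightarrow> \<exists>a\<in>hcomp (E 0) (n - 1). d 0 a = \<zero>\<^bsub>E (Suc 0)\<^esub> \<and> \<phi> 0 a = b"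
    and base_surj: "\<lbrakk>c \<in> hcomp (F 0) n; d' 0 c = \<zero>\<^bsub>F (Suc 0)\<^esub>\<rbrakk>
      \<Longrightarrow> \<exists>b\<in>hcomp (E 0) n. d 0 b = \<zero>\<^bsub>E (Suc 0)\<^esub> \<and> \<psi> 0 b = c"
begin

abbreviation S :: "nat \<Rightarrow> ('a, 'e) graded_module" where "S i \<equiv> gr_shift (-1) (E i)"

lemma Em: "hmod R G (E i)" using E_inj by (simp add: hinj_def)
lemma Fm: "hmod R G (F i)" using F_inj by (simp add: hinj_def)
lemma Sm: "hmod R G (S i)" by (rule hmod_shift[OF Em])

lemma E_ag: "abelian_group (E i)" using hmod_module[OF Em] by (simp add: module_def)
lemma F_ag: "abelian_group (F i)" using hmod_module[OF Fm] by (simp add: module_def)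

lemma dS_hom: "hhom G (S i) (S (Suc i)) (\<lambda>n. d i)"
  using hhomD[OF d_hom[of i]] by (intro hhomI) (auto simp: add.assoc)

lemma \<phi>_in: "a \<in> hcomp (E i) (n - 1) \<Longrightarrow> \<phi> i a \<in> hcomp (E i) n"
  using hhomD(1)[OF \<phi>_hom, of a i n] by simp

lemma \<psi>\<phi>_hom: "hhom G (S i) (F i) (\<lambda>n a. \<psi> i (\<phi> i a))"
  by (rule hhom_comp[OF \<phi>_hom \<psi>_hom])

text \<open>Both \<open>\<psi> \<circ> \<phi>\<close> and \<open>0\<close> lift the zero map, hence they are homotopic.\<close>

lemma homotopy:
  obtains s :: "nat \<Rightarrow> int \<Rightarrow> 'e \<Rightarrow> 'f" where
    "\<And>i. hhom G (S (Suc i)) (F i) (s i)"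
    "\<And>n a. a \<in> hcomp (S 0) n \<Longrightarrow> \<psi> 0 (\<phi> 0 a) = s 0 n (d 0 a)"
    "\<And>i n a. a \<in> hcomp (S (Suc i)) n \<Longrightarrow>
       \<psi> (Suc i) (\<phi> (Suc i) a) = s (Suc i) n (d (Suc i) a) \<oplus>\<^bsub>F (Suc i)\<^esub> d' i (s i n a)"
proof -
  \<comment> \<open>The clause on cocycles is what keeps the recursion going: it makes
    \<open>\<psi> \<phi> - d' s\<close> vanish on the kernel of \<open>d\<close>, so that this
    difference factors through \<open>d\<close> and defines the next map.\<close>
  define P where "P i s \<longleftrightarrow> hhom G (S (Suc i)) (F i) s \<and>
    (\<forall>n. \<forall>a\<in>hcomp (S (Suc i)) n. d (Suc i) a = \<zero>\<^bsub>E (Suc (Suc i))\<^esub> \<longrightarrow>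
        \<psi> (Suc i) (\<phi> (Suc i) a) = d' i (s n a)) \<and>
    (i = 0 \<longrightarrow> (\<forall>n. \<forall>a\<in>hcomp (S 0) n. \<psi> 0 (\<phi> 0 a) = s n (d 0 a)))" for i and s :: "int \<Rightarrow> 'e \<Rightarrow> 'f"
  define Q where "Q i s s' \<longleftrightarrow> (\<forall>n. \<forall>a\<in>hcomp (S (Suc i)) n.
      \<psi> (Suc i) (\<phi> (Suc i) a) = s' n (d (Suc i) a) \<oplus>\<^bsub>F (Suc i)\<^esub> d' i (s n a))"
    for i and s s' :: "int \<Rightarrow> 'e \<Rightarrow> 'f"
  have S_exact: "\<exists>u\<in>hcomp (S i) n. d i u = e"
    if "e \<in> hcomp (S (Suc i)) n" "d (Suc i) e = \<zero>\<^bsub>E (Suc (Suc i))\<^esub>" for e i n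
    using E_exact[of e i "n + -1"] that by simp
  have comm: "\<psi> (Suc i) (\<phi> (Suc i) (d i a)) = d' i (\<psi> i (\<phi> i a))" if "a \<in> hcomp (S i) n" for i n a
    using that \<phi>_d[of a i "n - 1"] \<psi>_d[OF \<phi>_in[of a i n]] by simp
  have base: "\<exists>s. P 0 s"
  proof -
    obtain s where s: "hhom G (S (Suc 0)) (F 0) s" "\<And>n a. a \<in> hcomp (S 0) n \<Longrightarrow> s n (d 0 a) = \<psi> 0 (\<phi> 0 a)"
      by (rule hinj_factor[OF Sm Sm F_inj dS_hom \<psi>\<phi>_hom]) (use base_zero in auto)
    have "\<psi> (Suc 0) (\<phi> (Suc 0) a) = d' 0 (s n a)"
      if a: "a \<in> hcomp (S (Suc 0)) n" "d (Suc 0) a = \<zero>\<^bsub>E (Suc (Suc 0))\<^esub>" for n a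
    proof -
      obtain u where u: "u \<in> hcomp (S 0) n" "d 0 u = a" using S_exact[OF a] by blast
      show ?thesis using comm[OF u(1)] s(2)[OF u(1)] u(2) by simp
    qed
    then have "P 0 s" unfolding P_def using s by simp
    then show ?thesis by blast
  qed
  have step: "\<exists>s'. P (Suc i) s' \<and> Q i s s'" if P: "P i s" for i s
  proof -
    interpret F: abelian_group "F (Suc i)" by (rule F_ag)
    have sh: "hhom G (S (Suc i)) (F i) s" using P by (simp add: P_def)
    have q: "hhom G (S (Suc i)) (F (Suc i)) (\<lambda>n a. \<psi> (Suc i) (\<phi> (Suc i) a) \<ominus>\<^bsub>F (Suc i)\<^esub> d' i (s n a))"
      by (rule hhom_diff[OF Fm \<psi>\<phi>_hom hhom_comp[OF sh d'_hom]])
    have c: "\<psi> (Suc i) (\<phi> (Suc i) a) \<in> carrier (F (Suc i))" "d' i (s n a) \<in> carrier (F (Suc i))"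
      if "a \<in> hcomp (S (Suc i)) n" for a n
      using hmodD(1)[OF Fm hhomD(1)[OF \<psi>\<phi>_hom that]] hmodD(1)[OF Fm hhomD(1)[OF hhom_comp[OF sh d'_hom] that]] by auto
    obtain s' where s': "hhom G (S (Suc (Suc i))) (F (Suc i)) s'"
      and eq: "\<And>n a. a \<in> hcomp (S (Suc i)) n \<Longrightarrow>
        s' n (d (Suc i) a) = \<psi> (Suc i) (\<phi> (Suc i) a) \<ominus>\<^bsub>F (Suc i)\<^esub> d' i (s n a)"
    proof (rule hinj_factor[OF Sm Sm F_inj dS_hom q])
      fix n u assume u: "u \<in> hcomp (S (Suc i)) n" "d (Suc i) u = \<zero>\<^bsub>S (Suc (Suc i))\<^esub>"
      then have "\<psi> (Suc i) (\<phi> (Suc i) u) = d' i (s n u)" using P by (simp add: P_def)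
      then show "\<psi> (Suc i) (\<phi> (Suc i) u) \<ominus>\<^bsub>F (Suc i)\<^esub> d' i (s n u) = \<zero>\<^bsub>F (Suc i)\<^esub>"
        using c[OF u(1)] by (simp add: a_minus_def F.r_neg)
    qed blast
    have Q: "Q i s s'"
      unfolding Q_def
    proof (intro allI ballI)
      fix n a assume a: "a \<in> hcomp (S (Suc i)) n"
      show "\<psi> (Suc i) (\<phi> (Suc i) a) = s' n (d (Suc i) a) \<oplus>\<^bsub>F (Suc i)\<^esub> d' i (s n a)"
        using c[OF a] by (simp add: eq[OF a] a_minus_def F.a_assoc F.l_neg)
    qed
    have "\<psi> (Suc (Suc i)) (\<phi> (Suc (Suc i)) a) = d' (Suc i) (s' n a)"
      if a: "a \<in> hcomp (S (Suc (Suc i))) n" "d (Suc (Suc i)) a = \<zero>\<^bsub>E (Suc (Suc (Suc i)))\<^esub>" for n a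
    proof -
      interpret F2: abelian_group "F (Suc (Suc i))" by (rule F_ag)
      obtain u where u: "u \<in> hcomp (S (Suc i)) n" "d (Suc i) u = a" using S_exact[OF a] by blast
      have s'u: "s' n a \<in> hcomp (F (Suc i)) n" by (rule hhomD(1)[OF s' a(1)])
      have su: "s n u \<in> hcomp (F i) n" by (rule hhomD(1)[OF sh u(1)])
      have "\<psi> (Suc (Suc i)) (\<phi> (Suc (Suc i)) a) = d' (Suc i) (s' n a \<oplus>\<^bsub>F (Suc i)\<^esub> d' i (s n u))"
        using comm[OF u(1)] Q u unfolding Q_def by auto
      also have "\<dots> = d' (Suc i) (s' n a)"
        using hhomD(2)[OF d'_hom s'u hhomD(1)[OF d'_hom su]] d'd'[OF su]
          hmodD(1)[OF Fm hhomD(1)[OF d'_hom s'u]] by simp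
      finally show ?thesis .
    qed
    then have "P (Suc i) s'" unfolding P_def using s' by simp
    then show ?thesis using Q by blast
  qed
  obtain s where s: "\<And>i. P i (s i)" "\<And>i. Q i (s i) (s (Suc i))"
    using dependent_nat_choice[of P Q, OF base step] by blast
  show ?thesis
  proof (rule that)
    show "\<And>i. hhom G (S (Suc i)) (F i) (s i)" using s(1) by (simp add: P_def)
    show "\<And>n a. a \<in> hcomp (S 0) n \<Longrightarrow> \<psi> 0 (\<phi> 0 a) = s 0 n (d 0 a)" using s(1)[of 0] by (simp add: P_def)
    show "\<And>i n a. a \<in> hcomp (S (Suc i)) n \<Longrightarrow>
       \<psi> (Suc i) (\<phi> (Suc i) a) = s (Suc i) n (d (Suc i) a) \<oplus>\<^bsub>F (Suc i)\<^esub> d' i (s i n a)"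
      using s(2) by (simp add: Q_def)
  qed
qed

end

section \<open>The total complex of a homotopy\<close>

locale homotopy_lift = double_lift +
  fixes s :: "nat \<Rightarrow> int \<Rightarrow> 'c \<Rightarrow> 'd"
  assumes s_hom: "hhom G (gr_shift (-1) (E (Suc i))) (F i) (s i)"
    and s_0: "a \<in> hcomp (gr_shift (-1) (E 0)) n \<Longrightarrow> \<psi> 0 (\<phi> 0 a) = s 0 n (d 0 a)"
    and s_Suc: "a \<in> hcomp (gr_shift (-1) (E (Suc i))) n \<Longrightarrow>
       \<psi> (Suc i) (\<phi> (Suc i) a) = s (Suc i) n (d (Suc i) a) \<oplus>\<^bsub>F (Suc i)\<^esub> d' i (s i n a)"
begin

text \<open>The total complex has the terms \<open>E(-1)\<^sub>i \<oplus> E\<^sub>i\<^sub>-\<^sub>1 \<oplus> F\<^sub>i\<^sub>-\<^sub>2\<close>; below degree zero \<open>E\<close> and \<open>F\<close> are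
  continued by zero.\<close>

definition E1 :: "nat \<Rightarrow> ('a, 'c) graded_module" where
  "E1 i = (case i of 0 \<Rightarrow> hzero (E 0) | Suc j \<Rightarrow> E j)"
definition F2 :: "nat \<Rightarrow> ('a, 'd) graded_module" where
  "F2 i = (case i of 0 \<Rightarrow> hzero (F 0) | Suc j \<Rightarrow> (case j of 0 \<Rightarrow> hzero (F 0) | Suc k \<Rightarrow> F k))"
definition e1 :: "nat \<Rightarrow> 'c \<Rightarrow> 'c" where
  "e1 i = (case i of 0 \<Rightarrow> (\<lambda>b. \<zero>\<^bsub>E 0\<^esub>) | Suc j \<Rightarrow> d j)"
definition f2 :: "nat \<Rightarrow> 'd \<Rightarrow> 'd" where
  "f2 i = (case i of 0 \<Rightarrow> (\<lambda>c. \<zero>\<^bsub>F 0\<^esub>) | Suc j \<Rightarrow> (case j of 0 \<Rightarrow> (\<lambda>c. \<zero>\<^bsub>F 0\<^esub>) | Suc k \<Rightarrow> d' k))"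
definition p1 :: "nat \<Rightarrow> 'c \<Rightarrow> 'd" where
  "p1 i = (case i of 0 \<Rightarrow> (\<lambda>b. \<zero>\<^bsub>F 0\<^esub>) | Suc j \<Rightarrow> \<psi> j)"
definition s2 :: "nat \<Rightarrow> int \<Rightarrow> 'c \<Rightarrow> 'd" where
  "s2 i = (case i of 0 \<Rightarrow> (\<lambda>n a. \<zero>\<^bsub>F 0\<^esub>) | Suc j \<Rightarrow> s j)"

lemma E1_simps [simp]: "E1 0 = hzero (E 0)" "E1 (Suc i) = E i" by (simp_all add: E1_def)
lemma F2_simps [simp]: "F2 0 = hzero (F 0)" "F2 (Suc 0) = hzero (F 0)" "F2 (Suc (Suc i)) = F i"
  by (simp_all add: F2_def)
lemma e1_simps [simp]: "e1 0 b = \<zero>\<^bsub>E 0\<^esub>" "e1 (Suc i) = d i" by (simp_all add: e1_def)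
lemma f2_simps [simp]: "f2 0 c = \<zero>\<^bsub>F 0\<^esub>" "f2 (Suc 0) c = \<zero>\<^bsub>F 0\<^esub>" "f2 (Suc (Suc i)) = d' i"
  by (simp_all add: f2_def)
lemma p1_simps [simp]: "p1 0 b = \<zero>\<^bsub>F 0\<^esub>" "p1 (Suc i) = \<psi> i" by (simp_all add: p1_def)
lemma s2_simps [simp]: "s2 0 n a = \<zero>\<^bsub>F 0\<^esub>" "s2 (Suc i) = s i" by (simp_all add: s2_def)

lemma E1_inj: "hinj R G (E1 i)" by (cases i) (simp_all add: E_inj hinj_hzero Em)
lemma F2_inj: "hinj R G (F2 i)"
proof (cases i)
  case (Suc j) then show ?thesis by (cases j) (simp_all add: F_inj hinj_hzero Fm)
qed (simp add: hinj_hzero Fm)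
lemma E1m: "hmod R G (E1 i)" using E1_inj by (simp add: hinj_def)
lemma F2m: "hmod R G (F2 i)" using F2_inj by (simp add: hinj_def)

lemma const_zero_hom: "hmod R G Y \<Longrightarrow> z = \<zero>\<^bsub>Y\<^esub> \<Longrightarrow> hhom G X Y (\<lambda>n u. z)"
  using hhom_zero_map by blast

lemma e1_hom: "hhom G (E1 i) (E1 (Suc i)) (\<lambda>n. e1 i)"
proof (cases i)
  case 0 then show ?thesis using const_zero_hom[OF Em[of 0] refl] by (simp add: e1_def)
qed (simp add: d_hom)

lemma f2_hom: "hhom G (F2 i) (F2 (Suc i)) (\<lambda>n. f2 i)"
proof (cases i)
  case 0 then show ?thesis by (simp add: f2_def const_zero_hom[OF F2m[of "Suc 0"], simplified])
next
  case (Suc j) then show ?thesis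
  proof (cases j)
    case 0 then show ?thesis using const_zero_hom[OF Fm[of 0] refl] Suc by (simp add: f2_def)
  qed (simp add: d'_hom)
qed

lemma p1_hom: "hhom G (E1 i) (F2 (Suc i)) (\<lambda>n. p1 i)"
proof (cases i)
  case 0 then show ?thesis by (simp add: p1_def const_zero_hom[OF F2m[of "Suc 0"], simplified])
qed (simp add: \<psi>_hom)

lemma s2_hom: "hhom G (S i) (F2 (Suc i)) (s2 i)"
proof (cases i)
  case 0 then show ?thesis by (simp add: s2_def const_zero_hom[OF F2m[of "Suc 0"], simplified])
qed (simp add: s_hom)

lemma d_zero: "d i \<zero>\<^bsub>E i\<^esub> = \<zero>\<^bsub>E (Suc i)\<^esub>"
  using hhom_zero[OF Em Em d_hom] by blast
lemma d'_zero: "d' i \<zero>\<^bsub>F i\<^esub> = \<zero>\<^bsub>F (Suc i)\<^esub>"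
  using hhom_zero[OF Fm Fm d'_hom] by blast
lemma \<psi>_zero: "\<psi> i \<zero>\<^bsub>E i\<^esub> = \<zero>\<^bsub>F i\<^esub>"
  using hhom_zero[OF Em Fm \<psi>_hom] by blast
lemma \<phi>_zero: "\<phi> i \<zero>\<^bsub>E i\<^esub> = \<zero>\<^bsub>E i\<^esub>"
  using hhom_zero[OF Sm Em \<phi>_hom] by simp
lemma s2_zero: "s2 i n \<zero>\<^bsub>E i\<^esub> = \<zero>\<^bsub>F2 (Suc i)\<^esub>"
  using hhom_zero[OF Sm F2m s2_hom, of i n] by simp

lemma e1_e1: "b \<in> hcomp (E1 i) n \<Longrightarrow> e1 (Suc i) (e1 i b) = \<zero>\<^bsub>E (Suc i)\<^esub>"
  by (cases i) (auto simp: d_zero dd)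
lemma f2_f2: "c \<in> hcomp (F2 i) n \<Longrightarrow> f2 (Suc i) (f2 i c) = \<zero>\<^bsub>F2 (Suc (Suc i))\<^esub>"
proof (cases i)
  case (Suc j) then show "c \<in> hcomp (F2 i) n \<Longrightarrow> ?thesis" by (cases j) (auto simp: d'_zero d'd')
qed simp
lemma p1_e1: "b \<in> hcomp (E1 i) n \<Longrightarrow> \<psi> i (e1 i b) = f2 (Suc i) (p1 i b)"
  by (cases i) (auto simp: \<psi>_zero \<psi>_d)
text \<open>Since \<open>s2 0\<close> and \<open>f2 (Suc 0)\<close> are zero, the initial and the
  general homotopy formula become one.\<close>

lemma homotopy2:
  assumes a: "a \<in> hcomp (S i) n"
  shows "\<psi> i (\<phi> i a) = s2 (Suc i) n (d i a) \<oplus>\<^bsub>F i\<^esub> f2 (Suc i) (s2 i n a)"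
proof (cases i)
  case 0
  interpret F0: abelian_group "F 0" by (rule F_ag)
  have "s 0 n (d 0 a) \<in> carrier (F 0)"
    using hmodD(1)[OF Fm hhomD(1)[OF s_hom hhomD(1)[OF dS_hom]]] a 0 by blast
  then show ?thesis using s_0 a 0 by simp
qed (use s_Suc a in simp)

definition T :: "nat \<Rightarrow> ('a, 'c \<times> 'c \<times> 'd) graded_module" where
  "T i = hprod (S i) (hprod (E1 i) (F2 i))"

text \<open>The signs make the square vanish: the minus at \<open>d\<close> cancels
  \<open>\<phi> d\<close> against \<open>d \<phi>\<close>, and the minus at \<open>f2\<close> turns
  the last component of the square into the homotopy formula. The entry \<open>s2\<close> is needed
  because \<open>\<psi> \<phi>\<close> itself is not zero.\<close>

definition DT :: "nat \<Rightarrow> int \<Rightarrow> 'c \<times> 'c \<times> 'd \<Rightarrow> 'c \<times> 'c \<times> 'd" where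
  "DT i n = (\<lambda>(a, b, c). (\<ominus>\<^bsub>E (Suc i)\<^esub> d i a, \<phi> i a \<oplus>\<^bsub>E i\<^esub> e1 i b,
     s2 i n a \<oplus>\<^bsub>F2 (Suc i)\<^esub> p1 i b \<ominus>\<^bsub>F2 (Suc i)\<^esub> f2 i c))"

lemma T_inj: "hinj R G (T i)"
  unfolding T_def by (intro hprod_hinj hinj_shift E_inj E1_inj F2_inj)

lemma DT_hom: "hhom G (T i) (T (Suc i)) (DT i)"
proof -
  have f: "hhom G (T i) (S i) (\<lambda>n. fst)" "hhom G (T i) (E1 i) (\<lambda>n u. fst (snd u))"
    "hhom G (T i) (F2 i) (\<lambda>n u. snd (snd u))"
    by (rule hhomI; auto simp: T_def)+
  have "hhom G (T i) (T (Suc i)) (\<lambda>n u. (\<ominus>\<^bsub>S (Suc i)\<^esub> d i (fst u), \<phi> i (fst u) \<oplus>\<^bsub>E i\<^esub> e1 i (fst (snd u)),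
     s2 i n (fst u) \<oplus>\<^bsub>F2 (Suc i)\<^esub> p1 i (fst (snd u)) \<ominus>\<^bsub>F2 (Suc i)\<^esub> f2 i (snd (snd u))))"
    unfolding T_def[of "Suc i"]
  proof (intro hhom_pair)
    show "hhom G (T i) (S (Suc i)) (\<lambda>n u. \<ominus>\<^bsub>S (Suc i)\<^esub> d i (fst u))"
      by (rule hhom_uminus[OF Sm hhom_comp[OF f(1) dS_hom]])
    show "hhom G (T i) (E1 (Suc i)) (\<lambda>n u. \<phi> i (fst u) \<oplus>\<^bsub>E i\<^esub> e1 i (fst (snd u)))"
      using hhom_add[OF Em hhom_comp[OF f(1) \<phi>_hom]] hhom_comp[OF f(2) e1_hom] by simp
    show "hhom G (T i) (F2 (Suc i)) (\<lambda>n u. s2 i n (fst u) \<oplus>\<^bsub>F2 (Suc i)\<^esub> p1 i (fst (snd u))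
        \<ominus>\<^bsub>F2 (Suc i)\<^esub> f2 i (snd (snd u)))"
      by (rule hhom_diff[OF F2m hhom_add[OF F2m hhom_comp[OF f(1) s2_hom] hhom_comp[OF f(2) p1_hom]]
            hhom_comp[OF f(3) f2_hom]])
  qed
  moreover have "(\<lambda>n u. (\<ominus>\<^bsub>S (Suc i)\<^esub> d i (fst u), \<phi> i (fst u) \<oplus>\<^bsub>E i\<^esub> e1 i (fst (snd u)),
     s2 i n (fst u) \<oplus>\<^bsub>F2 (Suc i)\<^esub> p1 i (fst (snd u)) \<ominus>\<^bsub>F2 (Suc i)\<^esub> f2 i (snd (snd u)))) = DT i"
    by (simp add: DT_def fun_eq_iff)
  ultimately show ?thesis by simp
qed

lemma T_iff: "(a, b, c) \<in> hcomp (T i) n \<longleftrightarrow> a \<in> hcomp (E i) (n - 1) \<and> b \<in> hcomp (E1 i) n \<and> c \<in> hcomp (F2 i) n"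
  by (simp add: T_def)

lemma gamT_iff: "(a, b, c) \<in> hcomp (gam R D (T i)) n \<longleftrightarrow>
    a \<in> hcomp (gam R D (E i)) (n - 1) \<and> b \<in> hcomp (gam R D (E1 i)) n \<and> c \<in> hcomp (gam R D (F2 i)) n"
  by (simp add: T_def gam_hprod Sm hprod_hmod E1m F2m gam_shift)

lemma DT_zero_iff: "DT i n (a, b, c) = \<zero>\<^bsub>T (Suc i)\<^esub> \<longleftrightarrow>
    \<ominus>\<^bsub>E (Suc i)\<^esub> d i a = \<zero>\<^bsub>E (Suc i)\<^esub> \<and> \<phi> i a \<oplus>\<^bsub>E i\<^esub> e1 i b = \<zero>\<^bsub>E i\<^esub> \<and>
     s2 i n a \<oplus>\<^bsub>F2 (Suc i)\<^esub> p1 i b \<ominus>\<^bsub>F2 (Suc i)\<^esub> f2 i c = \<zero>\<^bsub>F2 (Suc i)\<^esub>"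
  by (simp add: DT_def T_def)

lemma F2_ag: "abelian_group (F2 i)" using hmod_module[OF F2m] by (simp add: module_def)

lemma dE_in: "a \<in> hcomp (E i) m \<Longrightarrow> d i a \<in> hcomp (E (Suc i)) m" by (rule hhomD(1)[OF d_hom])
lemma e1_in: "b \<in> hcomp (E1 i) n \<Longrightarrow> e1 i b \<in> hcomp (E i) n" using hhomD(1)[OF e1_hom] by simp
lemma s2_in: "a \<in> hcomp (E i) (n - 1) \<Longrightarrow> s2 i n a \<in> hcomp (F2 (Suc i)) n"
  using hhomD(1)[OF s2_hom, of a i n] by simp
lemma p1_in: "b \<in> hcomp (E1 i) n \<Longrightarrow> p1 i b \<in> hcomp (F2 (Suc i)) n" by (rule hhomD(1)[OF p1_hom])
lemma f2_in: "c \<in> hcomp (F2 i) n \<Longrightarrow> f2 i c \<in> hcomp (F2 (Suc i)) n" by (rule hhomD(1)[OF f2_hom])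
lemma f2_add: "\<lbrakk>c \<in> hcomp (F2 i) n; c' \<in> hcomp (F2 i) n\<rbrakk> \<Longrightarrow> f2 i (c \<oplus>\<^bsub>F2 i\<^esub> c') = f2 i c \<oplus>\<^bsub>F2 (Suc i)\<^esub> f2 i c'"
  by (rule hhomD(2)[OF f2_hom])
lemma f2_neg: "c \<in> hcomp (F2 i) n \<Longrightarrow> f2 i (\<ominus>\<^bsub>F2 i\<^esub> c) = \<ominus>\<^bsub>F2 (Suc i)\<^esub> f2 i c"
  by (rule hhom_neg[OF F2m F2m f2_hom])
lemma d_neg: "a \<in> hcomp (E i) n \<Longrightarrow> d i (\<ominus>\<^bsub>E i\<^esub> a) = \<ominus>\<^bsub>E (Suc i)\<^esub> d i a"
  by (rule hhom_neg[OF Em Em d_hom])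
lemma \<phi>_neg: "a \<in> hcomp (E i) (n - 1) \<Longrightarrow> \<phi> i (\<ominus>\<^bsub>E i\<^esub> a) = \<ominus>\<^bsub>E i\<^esub> \<phi> i a"
  using hhom_neg[OF Sm Em \<phi>_hom, of a i n] by simp
lemma s2_neg: "a \<in> hcomp (E i) (n - 1) \<Longrightarrow> s2 i n (\<ominus>\<^bsub>E i\<^esub> a) = \<ominus>\<^bsub>F2 (Suc i)\<^esub> s2 i n a"
  using hhom_neg[OF Sm F2m s2_hom, of a i n] by simp
lemmas Ec = hmodD(1)[OF Em] and Fc = hmodD(1)[OF F2m]

lemma homotopy3: "a \<in> hcomp (E i) (n - 1) \<Longrightarrow>
    \<psi> i (\<phi> i a) = s2 (Suc i) n (d i a) \<oplus>\<^bsub>F i\<^esub> f2 (Suc i) (s2 i n a)"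
  using homotopy2[of a i n] by simp

lemma DT_DT:
  assumes u: "u \<in> hcomp (T i) n"
  shows "DT (Suc i) n (DT i n u) = \<zero>\<^bsub>T (Suc (Suc i))\<^esub>"
proof -
  obtain a b c where uabc: "u = (a, b, c)" by (cases u)
  have a: "a \<in> hcomp (E i) (n - 1)" and b: "b \<in> hcomp (E1 i) n" and c: "c \<in> hcomp (F2 i) n"
    using u by (auto simp: uabc T_iff)
  interpret E2: abelian_group "E (Suc (Suc i))" by (rule E_ag)
  interpret E1: abelian_group "E (Suc i)" by (rule E_ag)
  interpret Fi: abelian_group "F i" by (rule F_ag)
  have da: "d i a \<in> hcomp (E (Suc i)) (n - 1)" by (rule dE_in[OF a])
  have eq1: "\<ominus>\<^bsub>E (Suc (Suc i))\<^esub> d (Suc i) (\<ominus>\<^bsub>E (Suc i)\<^esub> d i a) = \<zero>\<^bsub>E (Suc (Suc i))\<^esub>"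
    using a by (simp add: d_neg[OF da] dd E2.minus_minus)
  have \<phi>a: "\<phi> i a \<in> hcomp (E i) n" by (rule \<phi>_in[OF a])
  have "d i (\<phi> i a \<oplus>\<^bsub>E i\<^esub> e1 i b) = d i (\<phi> i a)"
    using hhomD(2)[OF d_hom \<phi>a e1_in[OF b]] e1_e1[OF b] Ec[OF dE_in[OF \<phi>a]] by simp
  then have eq2: "\<phi> (Suc i) (\<ominus>\<^bsub>E (Suc i)\<^esub> d i a) \<oplus>\<^bsub>E (Suc i)\<^esub> d i (\<phi> i a \<oplus>\<^bsub>E i\<^esub> e1 i b) = \<zero>\<^bsub>E (Suc i)\<^esub>"
    using Ec[OF dE_in[OF \<phi>a]] by (simp add: \<phi>_neg[OF da] \<phi>_d[OF a] E1.l_neg)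
  have in1: "s2 (Suc i) n (d i a) \<in> hcomp (F i) n" using s2_in[OF da] by simp
  have in2: "f2 (Suc i) (s2 i n a) \<in> hcomp (F i) n" using f2_in[OF s2_in[OF a]] by simp
  have in3: "f2 (Suc i) (p1 i b) \<in> hcomp (F i) n" using f2_in[OF p1_in[OF b]] by simp
  note in_c = hmodD(1)[OF Fm in1] hmodD(1)[OF Fm in2] hmodD(1)[OF Fm in3]
  have "f2 (Suc i) (s2 i n a \<oplus>\<^bsub>F2 (Suc i)\<^esub> p1 i b \<ominus>\<^bsub>F2 (Suc i)\<^esub> f2 i c)
      = f2 (Suc i) (s2 i n a) \<oplus>\<^bsub>F i\<^esub> f2 (Suc i) (p1 i b)"
    using f2_add[OF hmodD(3)[OF F2m s2_in[OF a] p1_in[OF b]] hmodD(5)[OF F2m f2_in[OF c]]]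
      f2_add[OF s2_in[OF a] p1_in[OF b]] f2_neg[OF f2_in[OF c]] f2_f2[OF c] in_c
    by (simp add: a_minus_def)
  moreover have "\<psi> i (\<phi> i a \<oplus>\<^bsub>E i\<^esub> e1 i b) = s2 (Suc i) n (d i a) \<oplus>\<^bsub>F i\<^esub> f2 (Suc i) (s2 i n a) \<oplus>\<^bsub>F i\<^esub> f2 (Suc i) (p1 i b)"
    using hhomD(2)[OF \<psi>_hom \<phi>a e1_in[OF b]] homotopy3[OF a] p1_e1[OF b] by simp
  ultimately have eq3: "s2 (Suc i) n (\<ominus>\<^bsub>E (Suc i)\<^esub> d i a) \<oplus>\<^bsub>F i\<^esub> \<psi> i (\<phi> i a \<oplus>\<^bsub>E i\<^esub> e1 i b)
      \<ominus>\<^bsub>F i\<^esub> f2 (Suc i) (s2 i n a \<oplus>\<^bsub>F2 (Suc i)\<^esub> p1 i b \<ominus>\<^bsub>F2 (Suc i)\<^esub> f2 i c) = \<zero>\<^bsub>F i\<^esub>"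
    using in_c s2_neg[OF da] by (simp add: a_minus_def Fi.minus_add Fi.a_ac Fi.r_neg1 Fi.r_neg2 Fi.r_neg Fi.l_neg)
  show ?thesis using eq1 eq2 eq3 by (simp add: uabc DT_def T_def)
qed

text \<open>The part \<open>(b, c)\<close> of the total complex is the cone of \<open>\<psi>\<close>.\<close>

lemma cone_exact:
  assumes b: "b \<in> hcomp (E i) n" and c: "c \<in> hcomp (F2 (Suc i)) n"
    and db: "d i b = \<zero>\<^bsub>E (Suc i)\<^esub>" and bc: "\<psi> i b = f2 (Suc i) c"
  shows "\<exists>a1 b1 c1. a1 \<in> hcomp (E i) (n - 1) \<and> b1 \<in> hcomp (E1 i) n \<and> c1 \<in> hcomp (F2 i) n \<and>
    d i a1 = \<zero>\<^bsub>E (Suc i)\<^esub> \<and> \<phi> i a1 \<oplus>\<^bsub>E i\<^esub> e1 i b1 = b \<and>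
    s2 i n a1 \<oplus>\<^bsub>F2 (Suc i)\<^esub> p1 i b1 \<ominus>\<^bsub>F2 (Suc i)\<^esub> f2 i c1 = c"
proof (cases i)
  case 0
  interpret E0: abelian_group "E 0" by (rule E_ag)
  interpret F0: abelian_group "F 0" by (rule F_ag)
  \<comment> \<open>At the beginning the right-hand side \<open>f2 (Suc 0) c\<close> is zero, so
    \<open>b\<close> is a cocycle in the kernel of \<open>\<psi>\<close>, and exactness of the
    resolved modules gives a preimage under \<open>\<phi>\<close>.\<close>
  obtain a where a: "a \<in> hcomp (E 0) (n - 1)" "d 0 a = \<zero>\<^bsub>E (Suc 0)\<^esub>" "\<phi> 0 a = b"
    using base_exact[of b n] b db bc 0 by auto
  have "b \<in> carrier (E 0)" using Ec[OF b] 0 by simp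
  then show ?thesis using a c 0 by (intro exI[of _ a] exI[of _ "\<zero>\<^bsub>E 0\<^esub>"] exI[of _ "\<zero>\<^bsub>F 0\<^esub>"]) (simp add: a_minus_def)
next
  case (Suc j)
  interpret Ei: abelian_group "E i" by (rule E_ag)
  interpret Fj: abelian_group "F j" by (rule F_ag)
  have cF: "c \<in> hcomp (F j) n" using c Suc by simp
  obtain b0 where b0: "b0 \<in> hcomp (E j) n" "d j b0 = b" using E_exact[of b j n] b db Suc by auto
  \<comment> \<open>\<open>b0\<close> solves the equation for \<open>b\<close>, and \<open>x\<close>
    is the resulting error in the equation for \<open>c\<close>, a cocycle of
    \<open>F\<close>.\<close>
  define x where "x = c \<ominus>\<^bsub>F j\<^esub> \<psi> j b0"
  have \<psi>b0: "\<psi> j b0 \<in> hcomp (F j) n" by (rule hhomD(1)[OF \<psi>_hom b0(1)])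
  have x: "x \<in> hcomp (F j) n" unfolding x_def by (rule hmod_minus[OF Fm cF \<psi>b0])
  note car = hmodD(1)[OF Fm cF] hmodD(1)[OF Fm \<psi>b0] hmodD(1)[OF Fm x]
  have "d' j c = d' j (\<psi> j b0)" using bc \<psi>_d[OF b0(1)] b0(2) Suc by simp
  then have "d' j x = \<zero>\<^bsub>F (Suc j)\<^esub>"
  proof -
    interpret F: abelian_group "F (Suc j)" by (rule F_ag)
    show ?thesis
      using hhom_minus[OF Fm Fm d'_hom cF \<psi>b0] \<open>d' j c = d' j (\<psi> j b0)\<close>
        hmodD(1)[OF Fm hhomD(1)[OF d'_hom \<psi>b0]] by (simp add: x_def a_minus_def F.r_neg)
  qed
  moreover have cx: "c = \<psi> j b0 \<oplus>\<^bsub>F j\<^esub> x" using car by (simp add: x_def a_minus_def Fj.a_ac Fj.r_neg1 Fj.r_neg Fj.r_neg2)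
  \<comment> \<open>The error is removed in one of two ways. For \<open>j = 0\<close> it is the
    image of a cocycle of \<open>E 0\<close> by \<open>base_surj\<close>, which is added to
    \<open>b0\<close>; for larger \<open>j\<close> it is a coboundary by \<open>F_exact\<close>,
    which is absorbed in \<open>c1\<close>.\<close>
  ultimately have "\<exists>b1 c1. b1 \<in> hcomp (E j) n \<and> d j b1 = b \<and> c1 \<in> hcomp (F2 i) n \<and> \<psi> j b1 \<ominus>\<^bsub>F j\<^esub> f2 i c1 = c"
  proof (cases j)
    case 0
    interpret E1: abelian_group "E (Suc 0)" by (rule E_ag)
    obtain y where y: "y \<in> hcomp (E 0) n" "d 0 y = \<zero>\<^bsub>E (Suc 0)\<^esub>" "\<psi> 0 y = x"
      using base_surj[of x n] x \<open>d' j x = \<zero>\<^bsub>F (Suc j)\<^esub>\<close> 0 by auto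
    have b0': "b0 \<in> hcomp (E 0) n" using b0 0 by simp
    have "b \<in> carrier (E (Suc 0))" using Ec[OF b] Suc 0 by simp
    then have "d 0 (b0 \<oplus>\<^bsub>E 0\<^esub> y) = b" using hhomD(2)[OF d_hom b0' y(1)] y b0 0 by simp
    moreover have "\<psi> 0 (b0 \<oplus>\<^bsub>E 0\<^esub> y) = c" using hhomD(2)[OF \<psi>_hom b0' y(1)] y cx 0 by simp
    moreover have "b0 \<oplus>\<^bsub>E 0\<^esub> y \<in> hcomp (E 0) n" by (rule hmodD(3)[OF Em b0' y(1)])
    moreover have "c \<ominus>\<^bsub>F 0\<^esub> \<zero>\<^bsub>F 0\<^esub> = c"
      using Fj.minus_equality[of "\<zero>\<^bsub>F j\<^esub>" "\<zero>\<^bsub>F j\<^esub>"] Fj.zero_closed Fj.r_zero[OF car(1)] 0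
      unfolding a_minus_def by (metis Fj.l_zero)
    ultimately show ?thesis using 0 Suc car
      by (intro exI[of _ "b0 \<oplus>\<^bsub>E 0\<^esub> y"] exI[of _ "\<zero>\<^bsub>F 0\<^esub>"]) simp
  next
    case (Suc k)
    obtain c0 where c0: "c0 \<in> hcomp (F k) n" "d' k c0 = x" using F_exact[of x k n] x \<open>d' j x = _\<close> Suc by auto
    have "f2 i (\<ominus>\<^bsub>F k\<^esub> c0) = \<ominus>\<^bsub>F j\<^esub> x" using hhom_neg[OF Fm Fm d'_hom c0(1)] c0 Suc \<open>i = Suc j\<close> by simp
    moreover have "\<ominus>\<^bsub>F k\<^esub> c0 \<in> hcomp (F2 i) n" using hmodD(5)[OF Fm c0(1)] Suc \<open>i = Suc j\<close> by simp
    ultimately show ?thesis using b0 cx car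
      by (intro exI[of _ b0] exI[of _ "\<ominus>\<^bsub>F k\<^esub> c0"]) (simp add: a_minus_def Fj.minus_minus)
  qed
  then obtain b1 c1 where h: "b1 \<in> hcomp (E j) n" "d j b1 = b" "c1 \<in> hcomp (F2 i) n" "\<psi> j b1 \<ominus>\<^bsub>F j\<^esub> f2 i c1 = c" by blast
  have "\<psi> j b1 \<in> carrier (F j)" by (rule hmodD(1)[OF Fm hhomD(1)[OF \<psi>_hom h(1)]])
  then show ?thesis
    using h Suc Ei.l_zero[OF Ec[OF b]] d_zero[of i] \<phi>_zero[of i] s2_zero[of i n] hmodD(2)[OF Em[of i], of "n - 1"] Ec[OF b]
    by (rule_tac x = "\<zero>\<^bsub>E i\<^esub>" in exI, rule_tac x = b1 in exI, rule_tac x = c1 in exI) simp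
qed

text \<open>Projection to the first coordinate has the cone as its kernel. A preimage
  \<open>a0\<close> of the cocycle \<open>a\<close> reduces to first coordinate zero, and
  \<open>cone_exact\<close> treats the rest.\<close>

lemma DT_exact:
  assumes u: "u \<in> hcomp (T (Suc i)) n" and Du: "DT (Suc i) n u = \<zero>\<^bsub>T (Suc (Suc i))\<^esub>"
  shows "\<exists>w\<in>hcomp (T i) n. DT i n w = u"
proof -
  obtain a b c where uabc: "u = (a, b, c)" by (cases u)
  have a: "a \<in> hcomp (E (Suc i)) (n - 1)" and b: "b \<in> hcomp (E i) n" and c: "c \<in> hcomp (F2 (Suc i)) n"
    using u by (auto simp: uabc T_iff)
  interpret E2: abelian_group "E (Suc (Suc i))" by (rule E_ag)
  interpret E1: abelian_group "E (Suc i)" by (rule E_ag)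
  interpret E0: abelian_group "E i" by (rule E_ag)
  interpret Fi: abelian_group "F i" by (rule F_ag)
  interpret F2i: abelian_group "F2 (Suc i)" by (rule F2_ag)
  have D: "\<ominus>\<^bsub>E (Suc (Suc i))\<^esub> d (Suc i) a = \<zero>\<^bsub>E (Suc (Suc i))\<^esub>" "\<phi> (Suc i) a \<oplus>\<^bsub>E (Suc i)\<^esub> d i b = \<zero>\<^bsub>E (Suc i)\<^esub>"
    "s2 (Suc i) n a \<oplus>\<^bsub>F i\<^esub> \<psi> i b \<ominus>\<^bsub>F i\<^esub> f2 (Suc i) c = \<zero>\<^bsub>F i\<^esub>"
    using Du by (auto simp: uabc DT_zero_iff)
  have "d (Suc i) a = \<zero>\<^bsub>E (Suc (Suc i))\<^esub>"
    using D(1) Ec[OF dE_in[OF a]] by (simp add: E2.add.inv_eq_1_iff)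
  then obtain a0 where a0: "a0 \<in> hcomp (E i) (n - 1)" "d i a0 = a" using E_exact[OF a] by blast
  note \<phi>a0 = \<phi>_in[OF a0(1)] and sa0 = s2_in[OF a0(1)]
  \<comment> \<open>\<open>(0, b', c')\<close> is \<open>u\<close> minus the differential of
    \<open>(-a0, 0, 0)\<close>.\<close>
  define b' where "b' = b \<oplus>\<^bsub>E i\<^esub> \<phi> i a0"
  define c' where "c' = c \<oplus>\<^bsub>F2 (Suc i)\<^esub> s2 i n a0"
  have b': "b' \<in> hcomp (E i) n" unfolding b'_def by (rule hmodD(3)[OF Em b \<phi>a0])
  have c': "c' \<in> hcomp (F2 (Suc i)) n" unfolding c'_def by (rule hmodD(3)[OF F2m c sa0])
  have "d i b' = \<zero>\<^bsub>E (Suc i)\<^esub>"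
    using hhomD(2)[OF d_hom b \<phi>a0] \<phi>_d[OF a0(1)] a0(2) D(2) Ec[OF dE_in[OF b]] Ec[OF dE_in[OF \<phi>a0]]
    by (simp add: b'_def E1.a_comm)
  moreover have "\<psi> i b' = f2 (Suc i) c'"
  proof -
    have i1: "s2 (Suc i) n a \<in> carrier (F i)" using Fc[OF s2_in[OF a]] by simp
    have i2: "\<psi> i b \<in> carrier (F i)" by (rule hmodD(1)[OF Fm hhomD(1)[OF \<psi>_hom b]])
    have i3: "f2 (Suc i) c \<in> carrier (F i)" using Fc[OF f2_in[OF c]] by simp
    have i4: "f2 (Suc i) (s2 i n a0) \<in> carrier (F i)" using Fc[OF f2_in[OF sa0]] by simp
    have "f2 (Suc i) c = s2 (Suc i) n a \<oplus>\<^bsub>F i\<^esub> \<psi> i b"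
      using D(3) i1 i2 i3 unfolding a_minus_def
      by (metis Fi.a_closed Fi.a_inv_closed Fi.minus_equality Fi.minus_minus)
    moreover have "f2 (Suc i) c' = f2 (Suc i) c \<oplus>\<^bsub>F i\<^esub> f2 (Suc i) (s2 i n a0)"
      using f2_add[OF c sa0] by (simp add: c'_def)
    moreover have "\<psi> i b' = \<psi> i b \<oplus>\<^bsub>F i\<^esub> (s2 (Suc i) n a \<oplus>\<^bsub>F i\<^esub> f2 (Suc i) (s2 i n a0))"
      using hhomD(2)[OF \<psi>_hom b \<phi>a0] homotopy3[OF a0(1)] a0(2) by (simp add: b'_def)
    ultimately show ?thesis using i1 i2 i4 by (simp add: Fi.a_ac)
  qed
  ultimately obtain a1 b1 c1 where h: "a1 \<in> hcomp (E i) (n - 1)" "b1 \<in> hcomp (E1 i) n" "c1 \<in> hcomp (F2 i) n"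
    "d i a1 = \<zero>\<^bsub>E (Suc i)\<^esub>" "\<phi> i a1 \<oplus>\<^bsub>E i\<^esub> e1 i b1 = b'"
    "s2 i n a1 \<oplus>\<^bsub>F2 (Suc i)\<^esub> p1 i b1 \<ominus>\<^bsub>F2 (Suc i)\<^esub> f2 i c1 = c'" using cone_exact[OF b' c'] by blast
  define w where "w = (a1 \<oplus>\<^bsub>E i\<^esub> \<ominus>\<^bsub>E i\<^esub> a0, b1, c1)"
  have na0: "\<ominus>\<^bsub>E i\<^esub> a0 \<in> hcomp (E i) (n - 1)" by (rule hmodD(5)[OF Em a0(1)])
  have w: "w \<in> hcomp (T i) n" using h hmodD(3)[OF Em h(1) na0] by (simp add: w_def T_iff)
  have e1: "\<ominus>\<^bsub>E (Suc i)\<^esub> d i (a1 \<oplus>\<^bsub>E i\<^esub> \<ominus>\<^bsub>E i\<^esub> a0) = a"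
    using hhomD(2)[OF d_hom h(1) na0] d_neg[OF a0(1)] a0(2) h(4) Ec[OF a] by (simp add: E1.minus_minus)
  have \<phi>a1: "\<phi> i a1 \<in> hcomp (E i) n" by (rule \<phi>_in[OF h(1)])
  have "\<phi> i (a1 \<oplus>\<^bsub>E i\<^esub> \<ominus>\<^bsub>E i\<^esub> a0) = \<phi> i a1 \<oplus>\<^bsub>E i\<^esub> \<ominus>\<^bsub>E i\<^esub> \<phi> i a0"
    using hhomD(2)[OF \<phi>_hom, of a1 i n "\<ominus>\<^bsub>E i\<^esub> a0"] h(1) na0 \<phi>_neg[OF a0(1)] by simp
  then have "\<phi> i (a1 \<oplus>\<^bsub>E i\<^esub> \<ominus>\<^bsub>E i\<^esub> a0) \<oplus>\<^bsub>E i\<^esub> e1 i b1 = (\<phi> i a1 \<oplus>\<^bsub>E i\<^esub> e1 i b1) \<oplus>\<^bsub>E i\<^esub> \<ominus>\<^bsub>E i\<^esub> \<phi> i a0"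
    using Ec[OF \<phi>a1] Ec[OF \<phi>a0] Ec[OF e1_in[OF h(2)]] by (simp add: E0.a_ac)
  then have e2: "\<phi> i (a1 \<oplus>\<^bsub>E i\<^esub> \<ominus>\<^bsub>E i\<^esub> a0) \<oplus>\<^bsub>E i\<^esub> e1 i b1 = b"
    unfolding h(5) b'_def using Ec[OF b] Ec[OF \<phi>a0] by (simp add: E0.a_assoc E0.r_neg)
  have sa1: "s2 i n a1 \<in> hcomp (F2 (Suc i)) n" by (rule s2_in[OF h(1)])
  have "s2 i n (a1 \<oplus>\<^bsub>E i\<^esub> \<ominus>\<^bsub>E i\<^esub> a0) = s2 i n a1 \<oplus>\<^bsub>F2 (Suc i)\<^esub> \<ominus>\<^bsub>F2 (Suc i)\<^esub> s2 i n a0"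
    using hhomD(2)[OF s2_hom, of a1 i n "\<ominus>\<^bsub>E i\<^esub> a0"] h(1) na0 s2_neg[OF a0(1)] by simp
  then have "s2 i n (a1 \<oplus>\<^bsub>E i\<^esub> \<ominus>\<^bsub>E i\<^esub> a0) \<oplus>\<^bsub>F2 (Suc i)\<^esub> p1 i b1 \<ominus>\<^bsub>F2 (Suc i)\<^esub> f2 i c1
      = (s2 i n a1 \<oplus>\<^bsub>F2 (Suc i)\<^esub> p1 i b1 \<ominus>\<^bsub>F2 (Suc i)\<^esub> f2 i c1) \<oplus>\<^bsub>F2 (Suc i)\<^esub> \<ominus>\<^bsub>F2 (Suc i)\<^esub> s2 i n a0"
    using Fc[OF sa1] Fc[OF sa0] Fc[OF p1_in[OF h(2)]] Fc[OF f2_in[OF h(3)]] by (simp add: a_minus_def F2i.a_ac)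
  then have e3: "s2 i n (a1 \<oplus>\<^bsub>E i\<^esub> \<ominus>\<^bsub>E i\<^esub> a0) \<oplus>\<^bsub>F2 (Suc i)\<^esub> p1 i b1 \<ominus>\<^bsub>F2 (Suc i)\<^esub> f2 i c1 = c"
    unfolding h(6) c'_def using Fc[OF c] Fc[OF sa0] by (simp add: F2i.a_assoc F2i.r_neg)
  have "DT i n w = u" using e1 e2 e3 by (simp add: w_def uabc DT_def)
  then show ?thesis using w by blast
qed

text \<open>In degree 0 the coordinates \<open>b\<close> and \<open>c\<close> live in zero modules,
  so the kernel consists of the cocycles killed by \<open>\<phi> 0\<close>. This is the copy of
  \<open>B\<close>, torsion by \<open>base_kernel\<close>.\<close>

lemma DT_kernel:
  assumes u: "u \<in> hcomp (T 0) n" and Du: "DT 0 n u = \<zero>\<^bsub>T (Suc 0)\<^esub>"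
  shows "u \<in> hcomp (gam R D (T 0)) n"
proof -
  interpret E0: abelian_group "E 0" by (rule E_ag)
  interpret E1: abelian_group "E (Suc 0)" by (rule E_ag)
  obtain a b c where uabc: "u = (a, b, c)" by (cases u)
  have a: "a \<in> hcomp (E 0) (n - 1)" and bc: "b = \<zero>\<^bsub>E 0\<^esub>" "c = \<zero>\<^bsub>F 0\<^esub>"
    using u by (auto simp: uabc T_iff)
  have "\<ominus>\<^bsub>E (Suc 0)\<^esub> d 0 a = \<zero>\<^bsub>E (Suc 0)\<^esub>" "\<phi> 0 a = \<zero>\<^bsub>E 0\<^esub>"
    using Du Ec[OF \<phi>_in[OF a]] by (auto simp: uabc DT_zero_iff)
  moreover from this have "d 0 a = \<zero>\<^bsub>E (Suc 0)\<^esub>"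
    using Ec[OF dE_in[OF a]] by (simp add: E1.add.inv_eq_1_iff)
  ultimately have "a \<in> hcomp (gam R D (E 0)) (n - 1)" using base_kernel[OF a] by blast
  then show ?thesis unfolding uabc gamT_iff by (simp add: bc gam_hzero Em Fm)
qed

text \<open>Exactness of the torsion part of the total complex in coordinates. Setting various
  coordinates to zero gives exactness at \<open>H^i(L(M))\<close>, existence of the connecting map,
  and its independence of choices.\<close>

lemma gam_exact:
  assumes a: "a \<in> hcomp (gam R D (E (Suc i))) (n - 1)" and b: "b \<in> hcomp (gam R D (E i)) n"
    and c: "c \<in> hcomp (gam R D (F2 (Suc i))) n"
    and D: "d (Suc i) a = \<zero>\<^bsub>E (Suc (Suc i))\<^esub>" "\<phi> (Suc i) a \<oplus>\<^bsub>E (Suc i)\<^esub> d i b = \<zero>\<^bsub>E (Suc i)\<^esub>"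
    "s2 (Suc i) n a \<oplus>\<^bsub>F i\<^esub> \<psi> i b = f2 (Suc i) c"
  obtains a1 b1 c1 where "a1 \<in> hcomp (gam R D (E i)) (n - 1)" "b1 \<in> hcomp (gam R D (E1 i)) n"
    "c1 \<in> hcomp (gam R D (F2 i)) n" "a = \<ominus>\<^bsub>E (Suc i)\<^esub> d i a1" "b = \<phi> i a1 \<oplus>\<^bsub>E i\<^esub> e1 i b1"
    "c = s2 i n a1 \<oplus>\<^bsub>F2 (Suc i)\<^esub> p1 i b1 \<ominus>\<^bsub>F2 (Suc i)\<^esub> f2 i c1"
proof -
  interpret E2: abelian_group "E (Suc (Suc i))" by (rule E_ag)
  interpret Fi: abelian_group "F i" by (rule F_ag)
  have f2c: "f2 (Suc i) c \<in> carrier (F i)" using Fc[OF f2_in[OF gam_sub[OF c]]] by simp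
  have "\<exists>w\<in>hcomp (gam R D (T i)) n. DT i n w = (a, b, c)"
  proof (rule torsion_resolution_exact[OF T_inj DT_hom DT_DT DT_exact DT_kernel])
    show "(a, b, c) \<in> hcomp (gam R D (T (Suc i))) n" using a b c by (simp add: gamT_iff)
    show "DT (Suc i) n (a, b, c) = \<zero>\<^bsub>T (Suc (Suc i))\<^esub>"
      using D f2c by (simp add: DT_zero_iff a_minus_def Fi.r_neg)
  qed
  then obtain a1 b1 c1 where "(a1, b1, c1) \<in> hcomp (gam R D (T i)) n" "DT i n (a1, b1, c1) = (a, b, c)"
    by (metis prod_cases3)
  then show ?thesis using that by (auto simp: gamT_iff DT_def)
qed

end

section \<open>Homogeneous cocycles and the connecting relation\<close>

context graded_scalars begin

definition hcocycles :: "(nat \<Rightarrow> ('a, 'e) graded_module) \<Rightarrow> (nat \<Rightarrow> 'e \<Rightarrow> 'e) \<Rightarrow> nat \<Rightarrow> int \<Rightarrow> 'e set" where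
  "hcocycles E d i n = {e \<in> hcomp (gam R D (E i)) n. d i e = \<zero>\<^bsub>E (Suc i)\<^esub>}"

definition hcobounds :: "(nat \<Rightarrow> ('a, 'e) graded_module) \<Rightarrow> (nat \<Rightarrow> 'e \<Rightarrow> 'e) \<Rightarrow> nat \<Rightarrow> int \<Rightarrow> 'e set" where
  "hcobounds E d i n = (case i of 0 \<Rightarrow> {\<zero>\<^bsub>E 0\<^esub>} | Suc j \<Rightarrow> d j ` hcomp (gam R D (E j)) n)"

end

context homotopy_lift begin

abbreviation "ZE \<equiv> hcocycles E d"
abbreviation "BE \<equiv> hcobounds E d"
abbreviation "ZF \<equiv> hcocycles F d'"
abbreviation "BF \<equiv> hcobounds F d'"

text \<open>The continuation by zero pays off here: coboundaries in degree 0 need no separate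
  treatment in what follows.\<close>

lemma BE_eq: "BE i n = e1 i ` hcomp (gam R D (E1 i)) n"
  by (cases i) (auto simp: hcobounds_def gam_hzero Em)

lemma BF_eq: "BF i n = f2 (Suc i) ` hcomp (gam R D (F2 (Suc i))) n"
  by (cases i) (auto simp: hcobounds_def gam_hzero Fm)

lemma ZE_iff: "e \<in> ZE i n \<longleftrightarrow> e \<in> hcomp (gam R D (E i)) n \<and> d i e = \<zero>\<^bsub>E (Suc i)\<^esub>"
  by (simp add: hcocycles_def)
lemma ZF_iff: "e \<in> ZF i n \<longleftrightarrow> e \<in> hcomp (gam R D (F i)) n \<and> d' i e = \<zero>\<^bsub>F (Suc i)\<^esub>"
  by (simp add: hcocycles_def)

lemma gEm: "hmod R G (gam R D (E i))" by (rule gam_hmod[OF Em])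
lemma gFm: "hmod R G (gam R D (F i))" by (rule gam_hmod[OF Fm])

lemma g\<phi>: "a \<in> hcomp (gam R D (E i)) (n - 1) \<Longrightarrow> \<phi> i a \<in> hcomp (gam R D (E i)) n"
  using gam_hhom[OF Sm Em \<phi>_hom, of a i n] by (simp add: gam_shift)
lemma g\<psi>: "a \<in> hcomp (gam R D (E i)) n \<Longrightarrow> \<psi> i a \<in> hcomp (gam R D (F i)) n"
  by (rule gam_hhom[OF Em Fm \<psi>_hom])
lemma gd: "a \<in> hcomp (gam R D (E i)) n \<Longrightarrow> d i a \<in> hcomp (gam R D (E (Suc i))) n"
  by (rule gam_hhom[OF Em Em d_hom])
lemma gs2: "a \<in> hcomp (gam R D (E i)) (n - 1) \<Longrightarrow> s2 i n a \<in> hcomp (gam R D (F2 (Suc i))) n"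
  using gam_hhom[OF Sm F2m s2_hom, of a i n] by (simp add: gam_shift)
lemma gf2: "a \<in> hcomp (gam R D (F2 i)) n \<Longrightarrow> f2 i a \<in> hcomp (gam R D (F2 (Suc i))) n"
  by (rule gam_hhom[OF F2m F2m f2_hom])

lemma BF_zero: "\<zero>\<^bsub>F i\<^esub> \<in> BF i n"
  unfolding BF_eq using hhom_zero[OF F2m F2m f2_hom, of "Suc i"] hmodD(2)[OF gam_hmod[OF F2m[of "Suc i"]], of n]
  by (metis F2_simps(3) gam_simps(3) image_eqI)

lemma BF_add: "\<lbrakk>x \<in> BF i n; y \<in> BF i n\<rbrakk> \<Longrightarrow> x \<oplus>\<^bsub>F i\<^esub> y \<in> BF i n"
  unfolding BF_eq
proof (elim imageE)
  fix u v assume h: "x = f2 (Suc i) u" "u \<in> hcomp (gam R D (F2 (Suc i))) n" "y = f2 (Suc i) v" "v \<in> hcomp (gam R D (F2 (Suc i))) n"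
  have "x \<oplus>\<^bsub>F i\<^esub> y = f2 (Suc i) (u \<oplus>\<^bsub>F2 (Suc i)\<^esub> v)"
    using f2_add[OF gam_sub[OF h(2)] gam_sub[OF h(4)]] h by simp
  moreover have "u \<oplus>\<^bsub>F2 (Suc i)\<^esub> v \<in> hcomp (gam R D (F2 (Suc i))) n"
    using hmodD(3)[OF gam_hmod[OF F2m] h(2,4)] by simp
  ultimately show "x \<oplus>\<^bsub>F i\<^esub> y \<in> f2 (Suc i) ` hcomp (gam R D (F2 (Suc i))) n" by blast
qed

lemma BF_smult: "\<lbrakk>r \<in> G k; x \<in> BF i n\<rbrakk> \<Longrightarrow> r \<odot>\<^bsub>F i\<^esub> x \<in> BF i (k + n)"
  unfolding BF_eq
proof (elim imageE)
  fix u assume h: "r \<in> G k" "x = f2 (Suc i) u" "u \<in> hcomp (gam R D (F2 (Suc i))) n"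
  have "r \<odot>\<^bsub>F i\<^esub> x = f2 (Suc i) (r \<odot>\<^bsub>F2 (Suc i)\<^esub> u)"
    using hhomD(3)[OF f2_hom h(1) gam_sub[OF h(3)]] h by simp
  moreover have "r \<odot>\<^bsub>F2 (Suc i)\<^esub> u \<in> hcomp (gam R D (F2 (Suc i))) (k + n)"
    using hmodD(4)[OF gam_hmod[OF F2m] h(1,3) refl] by simp
  ultimately show "r \<odot>\<^bsub>F i\<^esub> x \<in> f2 (Suc i) ` hcomp (gam R D (F2 (Suc i))) (k + n)" by blast
qed

lemma BF_gam: "x \<in> BF i n \<Longrightarrow> x \<in> hcomp (gam R D (F i)) n"
  unfolding BF_eq using gf2[of _ "Suc i" n] by auto

lemma BF_neg: assumes x: "x \<in> BF i n" shows "\<ominus>\<^bsub>F i\<^esub> x \<in> BF i n"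
proof -
  interpret module R "F i" by (rule hmod_module[OF Fm])
  have "(\<ominus> \<one>) \<odot>\<^bsub>F i\<^esub> x \<in> BF i (0 + n)" by (rule BF_smult[OF G_neg[OF G_one] x])
  then show ?thesis using hmodD(1)[OF Fm gam_sub[OF BF_gam[OF x]]] by (simp add: smult_l_minus)
qed

text \<open>This is \<open>gam_exact\<close> for the triple \<open>(0, b, c)\<close>, where the
  torsion element \<open>c\<close> witnesses that \<open>\<psi> b\<close> is a coboundary.\<close>

lemma exact_middle:
  assumes b: "b \<in> ZE i n" and \<psi>b: "\<psi> i b \<in> BF i n"
  shows "\<exists>a\<in>ZE i (n - 1). \<exists>\<beta>\<in>BE i n. b = \<phi> i a \<oplus>\<^bsub>E i\<^esub> \<beta>"
proof -
  interpret E1: abelian_group "E (Suc i)" by (rule E_ag)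
  interpret Fi: abelian_group "F i" by (rule F_ag)
  obtain c where c: "c \<in> hcomp (gam R D (F2 (Suc i))) n" "\<psi> i b = f2 (Suc i) c" using \<psi>b by (auto simp: BF_eq)
  have bg: "b \<in> hcomp (gam R D (E i)) n" "d i b = \<zero>\<^bsub>E (Suc i)\<^esub>" using b by (auto simp: ZE_iff)
  have z: "\<zero>\<^bsub>E (Suc i)\<^esub> \<in> hcomp (gam R D (E (Suc i))) (n - 1)" using hmodD(2)[OF gEm[of "Suc i"]] by simp
  have \<psi>c: "\<psi> i b \<in> carrier (F i)" by (rule hmodD(1)[OF Fm gam_sub[OF g\<psi>[OF bg(1)]]])
  have s0: "s i n \<zero>\<^bsub>E (Suc i)\<^esub> = \<zero>\<^bsub>F i\<^esub>" using s2_zero[of "Suc i" n] by simp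
  have eqA: "s2 (Suc i) n \<zero>\<^bsub>E (Suc i)\<^esub> \<oplus>\<^bsub>F i\<^esub> \<psi> i b = f2 (Suc i) c" using s0 \<psi>c c by simp
  have eqB: "\<phi> (Suc i) \<zero>\<^bsub>E (Suc i)\<^esub> \<oplus>\<^bsub>E (Suc i)\<^esub> d i b = \<zero>\<^bsub>E (Suc i)\<^esub>" by (simp add: \<phi>_zero bg)
  obtain a1 b1 c1 where h: "a1 \<in> hcomp (gam R D (E i)) (n - 1)" "b1 \<in> hcomp (gam R D (E1 i)) n"
    "\<zero>\<^bsub>E (Suc i)\<^esub> = \<ominus>\<^bsub>E (Suc i)\<^esub> d i a1" "b = \<phi> i a1 \<oplus>\<^bsub>E i\<^esub> e1 i b1"
    by (rule gam_exact[OF z bg(1) c(1) d_zero eqB eqA])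
  have "d i a1 = \<zero>\<^bsub>E (Suc i)\<^esub>"
    using h(3)[symmetric] Ec[OF dE_in[OF gam_sub[OF h(1)]]] by (simp add: E1.add.inv_eq_1_iff)
  then show ?thesis using h by (auto simp: ZE_iff BE_eq)
qed

text \<open>For a cocycle \<open>a\<close> the term of the homotopy formula containing
  \<open>d a\<close> drops out; the other term is the differential of a torsion element.\<close>

lemma comp_cobound:
  assumes a: "a \<in> ZE i (n - 1)"
  shows "\<psi> i (\<phi> i a) \<in> BF i n"
proof -
  interpret Fi: abelian_group "F i" by (rule F_ag)
  have ag: "a \<in> hcomp (gam R D (E i)) (n - 1)" "d i a = \<zero>\<^bsub>E (Suc i)\<^esub>" using a by (auto simp: ZE_iff)
  have "f2 (Suc i) (s2 i n a) \<in> carrier (F i)" using Fc[OF f2_in[OF gam_sub[OF gs2[OF ag(1)]]]] by simp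
  then have "\<psi> i (\<phi> i a) = f2 (Suc i) (s2 i n a)"
    using homotopy3[OF gam_sub[OF ag(1)]] ag(2) s2_zero[of "Suc i" n] by simp
  then show ?thesis using gs2[OF ag(1)] by (auto simp: BF_eq)
qed

text \<open>The snake relation: \<open>c\<close> is related to \<open>a\<close> if
  \<open>(0, 0, c)\<close> is the differential of a torsion triple \<open>(a, b, c1)\<close> in the
  total complex; \<open>\<gamma>\<close> stands for \<open>-f2 c1\<close>. A relation is used
  because the choices of \<open>a\<close>, \<open>b\<close> and \<open>\<gamma>\<close> matter until
  classes are formed.\<close>

definition conn :: "nat \<Rightarrow> int \<Rightarrow> 'd \<Rightarrow> 'c \<Rightarrow> bool" where
  "conn i n c a \<longleftrightarrow> c \<in> ZF i n \<and> a \<in> ZE (Suc i) (n - 1) \<and>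
     (\<exists>b\<in>hcomp (gam R D (E i)) n. \<exists>\<gamma>\<in>BF i n.
        \<phi> (Suc i) a \<oplus>\<^bsub>E (Suc i)\<^esub> d i b = \<zero>\<^bsub>E (Suc i)\<^esub> \<and> c = s i n a \<oplus>\<^bsub>F i\<^esub> \<psi> i b \<oplus>\<^bsub>F i\<^esub> \<gamma>)"

lemma gs: "a \<in> hcomp (gam R D (E (Suc i))) (n - 1) \<Longrightarrow> s i n a \<in> hcomp (gam R D (F i)) n"
  using gs2[of a "Suc i" n] by simp

lemmas gEc = hmodD(1)[OF Em gam_sub] and gFc = hmodD(1)[OF Fm gam_sub]

text \<open>This is \<open>gam_exact\<close>, one degree higher, for \<open>(0, 0, c)\<close>, which
  is a cocycle of the total complex because \<open>c\<close> is one of \<open>F\<close>.\<close>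

lemma conn_total:
  assumes c: "c \<in> ZF i n"
  shows "\<exists>a. conn i n c a"
proof -
  interpret E2: abelian_group "E (Suc (Suc i))" by (rule E_ag)
  interpret E1: abelian_group "E (Suc i)" by (rule E_ag)
  interpret Fi: abelian_group "F i" by (rule F_ag)
  interpret F1: abelian_group "F (Suc i)" by (rule F_ag)
  have cg: "c \<in> hcomp (gam R D (F i)) n" "d' i c = \<zero>\<^bsub>F (Suc i)\<^esub>" using c by (auto simp: ZF_iff)
  have z: "\<zero>\<^bsub>E (Suc (Suc i))\<^esub> \<in> hcomp (gam R D (E (Suc (Suc i)))) (n - 1)"
    "\<zero>\<^bsub>E (Suc i)\<^esub> \<in> hcomp (gam R D (E (Suc i))) n"
    using hmodD(2)[OF gEm[of "Suc (Suc i)"]] hmodD(2)[OF gEm[of "Suc i"]] by auto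
  have s0: "s2 (Suc (Suc i)) n \<zero>\<^bsub>E (Suc (Suc i))\<^esub> \<oplus>\<^bsub>F (Suc i)\<^esub> \<psi> (Suc i) \<zero>\<^bsub>E (Suc i)\<^esub> = f2 (Suc (Suc i)) c"
    using s2_zero[of "Suc (Suc i)" n] cg(2) by (simp add: \<psi>_zero)
  have c2: "c \<in> hcomp (gam R D (F2 (Suc (Suc i)))) n" using cg by simp
  obtain a1 b1 c1 where h: "a1 \<in> hcomp (gam R D (E (Suc i))) (n - 1)" "b1 \<in> hcomp (gam R D (E1 (Suc i))) n"
    "c1 \<in> hcomp (gam R D (F2 (Suc i))) n"
    "\<zero>\<^bsub>E (Suc (Suc i))\<^esub> = \<ominus>\<^bsub>E (Suc (Suc i))\<^esub> d (Suc i) a1" "\<zero>\<^bsub>E (Suc i)\<^esub> = \<phi> (Suc i) a1 \<oplus>\<^bsub>E (Suc i)\<^esub> e1 (Suc i) b1"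
    "c = s2 (Suc i) n a1 \<oplus>\<^bsub>F2 (Suc (Suc i))\<^esub> p1 (Suc i) b1 \<ominus>\<^bsub>F2 (Suc (Suc i))\<^esub> f2 (Suc i) c1"
    by (rule gam_exact[OF z(1,2) c2 d_zero _ s0]) (simp_all add: \<phi>_zero d_zero)
  have "d (Suc i) a1 = \<zero>\<^bsub>E (Suc (Suc i))\<^esub>"
    using h(4)[symmetric] Ec[OF dE_in[OF gam_sub[OF h(1)]]] by (simp add: E2.add.inv_eq_1_iff)
  then have a1: "a1 \<in> ZE (Suc i) (n - 1)" using h by (simp add: ZE_iff)
  have "\<ominus>\<^bsub>F i\<^esub> f2 (Suc i) c1 \<in> BF i n" using h(3) by (intro BF_neg) (auto simp: BF_eq)
  then have "conn i n c a1"
    unfolding conn_def using c a1 h by (intro conjI bexI[of _ b1] bexI[of _ "\<ominus>\<^bsub>F i\<^esub> f2 (Suc i) c1"]) (simp_all add: a_minus_def)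
  then show ?thesis by blast
qed

lemma ZF_add: "\<lbrakk>x \<in> ZF i n; y \<in> ZF i n\<rbrakk> \<Longrightarrow> x \<oplus>\<^bsub>F i\<^esub> y \<in> ZF i n"
proof -
  interpret F1: abelian_group "F (Suc i)" by (rule F_ag)
  assume x: "x \<in> ZF i n" and y: "y \<in> ZF i n"
  then show ?thesis using hmodD(3)[OF gFm[of i]] hhomD(2)[OF d'_hom[of i] gam_sub gam_sub, of x n y]
    by (simp add: ZF_iff)
qed
lemma ZE_add: "\<lbrakk>x \<in> ZE i n; y \<in> ZE i n\<rbrakk> \<Longrightarrow> x \<oplus>\<^bsub>E i\<^esub> y \<in> ZE i n"
proof -
  interpret E1: abelian_group "E (Suc i)" by (rule E_ag)
  assume x: "x \<in> ZE i n" and y: "y \<in> ZE i n"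
  then show ?thesis using hmodD(3)[OF gEm[of i]] hhomD(2)[OF d_hom[of i] gam_sub gam_sub, of x n y]
    by (simp add: ZE_iff)
qed
lemma ZF_smult: "\<lbrakk>r \<in> G k; x \<in> ZF i n\<rbrakk> \<Longrightarrow> r \<odot>\<^bsub>F i\<^esub> x \<in> ZF i (k + n)"
proof -
  interpret F1: module R "F (Suc i)" by (rule hmod_module[OF Fm])
  assume r: "r \<in> G k" and x: "x \<in> ZF i n"
  then show ?thesis using hmodD(4)[OF gFm[of i] r] hhomD(3)[OF d'_hom[of i] r gam_sub, of x n]
    by (simp add: ZF_iff F1.smult_r_null[OF Gc[OF r]])
qed
lemma ZE_smult: "\<lbrakk>r \<in> G k; x \<in> ZE i n; m = k + n\<rbrakk> \<Longrightarrow> r \<odot>\<^bsub>E i\<^esub> x \<in> ZE i m"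
proof -
  interpret E1: module R "E (Suc i)" by (rule hmod_module[OF Em])
  assume r: "r \<in> G k" and x: "x \<in> ZE i n" and m: "m = k + n"
  then show ?thesis using hmodD(4)[OF gEm[of i] r] hhomD(3)[OF d_hom[of i] r gam_sub, of x n]
    by (simp add: ZE_iff E1.smult_r_null[OF Gc[OF r]])
qed

lemma conn_add:
  assumes 1: "conn i n c a" and 2: "conn i n c' a'"
  shows "conn i n (c \<oplus>\<^bsub>F i\<^esub> c') (a \<oplus>\<^bsub>E (Suc i)\<^esub> a')"
proof -
  interpret E1: abelian_group "E (Suc i)" by (rule E_ag)
  interpret Fi: abelian_group "F i" by (rule F_ag)
  obtain b \<gamma> where h: "c \<in> ZF i n" "a \<in> ZE (Suc i) (n - 1)" "b\<in>hcomp (gam R D (E i)) n" "\<gamma>\<in>BF i n"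
    "\<phi> (Suc i) a \<oplus>\<^bsub>E (Suc i)\<^esub> d i b = \<zero>\<^bsub>E (Suc i)\<^esub>" "c = s i n a \<oplus>\<^bsub>F i\<^esub> \<psi> i b \<oplus>\<^bsub>F i\<^esub> \<gamma>"
    using 1 unfolding conn_def by blast
  obtain b' \<gamma>' where h': "c' \<in> ZF i n" "a' \<in> ZE (Suc i) (n - 1)" "b'\<in>hcomp (gam R D (E i)) n" "\<gamma>'\<in>BF i n"
    "\<phi> (Suc i) a' \<oplus>\<^bsub>E (Suc i)\<^esub> d i b' = \<zero>\<^bsub>E (Suc i)\<^esub>" "c' = s i n a' \<oplus>\<^bsub>F i\<^esub> \<psi> i b' \<oplus>\<^bsub>F i\<^esub> \<gamma>'"
    using 2 unfolding conn_def by blast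
  have ag: "a \<in> hcomp (gam R D (E (Suc i))) (n - 1)" "a' \<in> hcomp (gam R D (E (Suc i))) (n - 1)"
    using h h' by (auto simp: ZE_iff)
  note bb = gam_sub[OF h(3)] gam_sub[OF h'(3)] and aa = gam_sub[OF ag(1)] gam_sub[OF ag(2)]
  have "\<phi> (Suc i) (a \<oplus>\<^bsub>E (Suc i)\<^esub> a') = \<phi> (Suc i) a \<oplus>\<^bsub>E (Suc i)\<^esub> \<phi> (Suc i) a'"
    using hhomD(2)[OF \<phi>_hom[of "Suc i"], of a n a'] aa by simp
  moreover have "d i (b \<oplus>\<^bsub>E i\<^esub> b') = d i b \<oplus>\<^bsub>E (Suc i)\<^esub> d i b'" by (rule hhomD(2)[OF d_hom bb])
  ultimately have "\<phi> (Suc i) (a \<oplus>\<^bsub>E (Suc i)\<^esub> a') \<oplus>\<^bsub>E (Suc i)\<^esub> d i (b \<oplus>\<^bsub>E i\<^esub> b')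
    = (\<phi> (Suc i) a \<oplus>\<^bsub>E (Suc i)\<^esub> d i b) \<oplus>\<^bsub>E (Suc i)\<^esub> (\<phi> (Suc i) a' \<oplus>\<^bsub>E (Suc i)\<^esub> d i b')"
    using gEc[OF g\<phi>[OF ag(1)]] gEc[OF g\<phi>[OF ag(2)]] gEc[OF gd[OF h(3)]] gEc[OF gd[OF h'(3)]] by (simp add: E1.a_ac)
  then have 3: "\<phi> (Suc i) (a \<oplus>\<^bsub>E (Suc i)\<^esub> a') \<oplus>\<^bsub>E (Suc i)\<^esub> d i (b \<oplus>\<^bsub>E i\<^esub> b') = \<zero>\<^bsub>E (Suc i)\<^esub>"
    by (simp add: h(5) h'(5))
  have "s i n (a \<oplus>\<^bsub>E (Suc i)\<^esub> a') = s i n a \<oplus>\<^bsub>F i\<^esub> s i n a'"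
    using hhomD(2)[OF s_hom[of i], of a n a'] aa by simp
  moreover have "\<psi> i (b \<oplus>\<^bsub>E i\<^esub> b') = \<psi> i b \<oplus>\<^bsub>F i\<^esub> \<psi> i b'" by (rule hhomD(2)[OF \<psi>_hom bb])
  ultimately have "c \<oplus>\<^bsub>F i\<^esub> c' = s i n (a \<oplus>\<^bsub>E (Suc i)\<^esub> a') \<oplus>\<^bsub>F i\<^esub> \<psi> i (b \<oplus>\<^bsub>E i\<^esub> b') \<oplus>\<^bsub>F i\<^esub> (\<gamma> \<oplus>\<^bsub>F i\<^esub> \<gamma>')"
    using gFc[OF gs[OF ag(1)]] gFc[OF gs[OF ag(2)]] gFc[OF g\<psi>[OF h(3)]] gFc[OF g\<psi>[OF h'(3)]]
      gFc[OF BF_gam[OF h(4)]] gFc[OF BF_gam[OF h'(4)]] h(6) h'(6)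
    by (simp add: Fi.a_ac)
  moreover have "b \<oplus>\<^bsub>E i\<^esub> b' \<in> hcomp (gam R D (E i)) n" using hmodD(3)[OF gEm h(3) h'(3)] by simp
  ultimately show ?thesis
    unfolding conn_def using 3 ZF_add[OF h(1) h'(1)] ZE_add[OF h(2) h'(2)] BF_add[OF h(4) h'(4)] by blast
qed

lemma conn_smult:
  assumes r: "r \<in> G k" and 1: "conn i n c a"
  shows "conn i (k + n) (r \<odot>\<^bsub>F i\<^esub> c) (r \<odot>\<^bsub>E (Suc i)\<^esub> a)"
proof -
  interpret E1: module R "E (Suc i)" by (rule hmod_module[OF Em])
  interpret Fi: module R "F i" by (rule hmod_module[OF Fm])
  obtain b \<gamma> where h: "c \<in> ZF i n" "a \<in> ZE (Suc i) (n - 1)" "b\<in>hcomp (gam R D (E i)) n" "\<gamma>\<in>BF i n"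
    "\<phi> (Suc i) a \<oplus>\<^bsub>E (Suc i)\<^esub> d i b = \<zero>\<^bsub>E (Suc i)\<^esub>" "c = s i n a \<oplus>\<^bsub>F i\<^esub> \<psi> i b \<oplus>\<^bsub>F i\<^esub> \<gamma>"
    using 1 unfolding conn_def by blast
  have ag: "a \<in> hcomp (gam R D (E (Suc i))) (n - 1)" using h by (auto simp: ZE_iff)
  note bb = gam_sub[OF h(3)] and aa = gam_sub[OF ag] and rc = Gc[OF r]
  have "\<phi> (Suc i) (r \<odot>\<^bsub>E (Suc i)\<^esub> a) \<oplus>\<^bsub>E (Suc i)\<^esub> d i (r \<odot>\<^bsub>E i\<^esub> b)
    = r \<odot>\<^bsub>E (Suc i)\<^esub> (\<phi> (Suc i) a \<oplus>\<^bsub>E (Suc i)\<^esub> d i b)"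
    using hhomD(3)[OF \<phi>_hom[of "Suc i"] r, of a n] hhomD(3)[OF d_hom r bb] aa rc
      gEc[OF g\<phi>[OF ag]] gEc[OF gd[OF h(3)]] by (simp add: E1.smult_r_distr)
  then have 3: "\<phi> (Suc i) (r \<odot>\<^bsub>E (Suc i)\<^esub> a) \<oplus>\<^bsub>E (Suc i)\<^esub> d i (r \<odot>\<^bsub>E i\<^esub> b) = \<zero>\<^bsub>E (Suc i)\<^esub>"
    using h(5) rc by simp
  have "r \<odot>\<^bsub>F i\<^esub> c = s i (k + n) (r \<odot>\<^bsub>E (Suc i)\<^esub> a) \<oplus>\<^bsub>F i\<^esub> \<psi> i (r \<odot>\<^bsub>E i\<^esub> b) \<oplus>\<^bsub>F i\<^esub> (r \<odot>\<^bsub>F i\<^esub> \<gamma>)"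
    using hhomD(3)[OF s_hom[of i] r, of a n] hhomD(3)[OF \<psi>_hom r bb] aa rc
      gFc[OF gs[OF ag]] gFc[OF g\<psi>[OF h(3)]] gFc[OF BF_gam[OF h(4)]] h(6)
    by (simp add: Fi.smult_r_distr)
  moreover have "r \<odot>\<^bsub>E i\<^esub> b \<in> hcomp (gam R D (E i)) (k + n)" using hmodD(4)[OF gEm r h(3) refl] by simp
  moreover have "r \<odot>\<^bsub>E (Suc i)\<^esub> a \<in> ZE (Suc i) (k + n - 1)" by (rule ZE_smult[OF r h(2)]) simp
  ultimately show ?thesis
    unfolding conn_def using 3 ZF_smult[OF r h(1)] BF_smult[OF r h(4)] by blast
qed

text \<open>If \<open>c\<close> is a coboundary, so is \<open>s a + \<psi> b\<close>, and
  \<open>(a, b, c2)\<close> is a cocycle of the torsion complex. The first coordinate of a preimage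
  exhibits \<open>a\<close> as a coboundary. Together with additivity this makes the connecting map
  well defined on classes.\<close>

lemma conn_cobound:
  assumes 1: "conn i n c a" and c: "c \<in> BF i n"
  shows "a \<in> BE (Suc i) (n - 1)"
proof -
  interpret Fi: abelian_group "F i" by (rule F_ag)
  obtain b \<gamma> where h: "a \<in> ZE (Suc i) (n - 1)" "b\<in>hcomp (gam R D (E i)) n" "\<gamma>\<in>BF i n"
    "\<phi> (Suc i) a \<oplus>\<^bsub>E (Suc i)\<^esub> d i b = \<zero>\<^bsub>E (Suc i)\<^esub>" "c = s i n a \<oplus>\<^bsub>F i\<^esub> \<psi> i b \<oplus>\<^bsub>F i\<^esub> \<gamma>"
    using 1 unfolding conn_def by blast
  have ag: "a \<in> hcomp (gam R D (E (Suc i))) (n - 1)" "d (Suc i) a = \<zero>\<^bsub>E (Suc (Suc i))\<^esub>" using h by (auto simp: ZE_iff)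
  have "c \<oplus>\<^bsub>F i\<^esub> \<ominus>\<^bsub>F i\<^esub> \<gamma> \<in> BF i n" by (rule BF_add[OF c BF_neg[OF h(3)]])
  moreover have "c \<oplus>\<^bsub>F i\<^esub> \<ominus>\<^bsub>F i\<^esub> \<gamma> = s i n a \<oplus>\<^bsub>F i\<^esub> \<psi> i b"
    using gFc[OF gs[OF ag(1)]] gFc[OF g\<psi>[OF h(2)]] gFc[OF BF_gam[OF h(3)]] h(5)
    by (simp add: Fi.a_assoc Fi.r_neg)
  ultimately obtain c2 where c2: "c2 \<in> hcomp (gam R D (F2 (Suc i))) n" "s2 (Suc i) n a \<oplus>\<^bsub>F i\<^esub> \<psi> i b = f2 (Suc i) c2"
    by (auto simp: BF_eq)
  obtain a1 where a1: "a1 \<in> hcomp (gam R D (E i)) (n - 1)" "a = \<ominus>\<^bsub>E (Suc i)\<^esub> d i a1"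
    by (rule gam_exact[OF ag(1) h(2) c2(1) ag(2) h(4) c2(2)])
  then have "a = d i (\<ominus>\<^bsub>E i\<^esub> a1)" using d_neg[OF gam_sub[OF a1(1)]] by simp
  then show ?thesis using hmodD(5)[OF gEm[of i] a1(1)] by (auto simp: hcobounds_def)
qed

lemma conn_\<psi>:
  assumes b: "b \<in> ZE i n"
  shows "conn i n (\<psi> i b) \<zero>\<^bsub>E (Suc i)\<^esub>"
proof -
  interpret E1: abelian_group "E (Suc i)" by (rule E_ag)
  interpret Fi: abelian_group "F i" by (rule F_ag)
  have bg: "b \<in> hcomp (gam R D (E i)) n" "d i b = \<zero>\<^bsub>E (Suc i)\<^esub>" using b by (auto simp: ZE_iff)
  have "\<psi> i b \<in> ZF i n" using bg g\<psi> \<psi>_d[OF gam_sub[OF bg(1)]] by (simp add: ZF_iff \<psi>_zero)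
  moreover have "\<zero>\<^bsub>E (Suc i)\<^esub> \<in> ZE (Suc i) (n - 1)" using hmodD(2)[OF gEm[of "Suc i"]] by (simp add: ZE_iff d_zero)
  moreover have "\<psi> i b = s i n \<zero>\<^bsub>E (Suc i)\<^esub> \<oplus>\<^bsub>F i\<^esub> \<psi> i b \<oplus>\<^bsub>F i\<^esub> \<zero>\<^bsub>F i\<^esub>"
    using s2_zero[of "Suc i" n] gFc[OF g\<psi>[OF bg(1)]] by simp
  moreover have "\<phi> (Suc i) \<zero>\<^bsub>E (Suc i)\<^esub> \<oplus>\<^bsub>E (Suc i)\<^esub> d i b = \<zero>\<^bsub>E (Suc i)\<^esub>" by (simp add: bg \<phi>_zero)
  ultimately show ?thesis unfolding conn_def using BF_zero[of i n] bg by blast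
qed

text \<open>If \<open>a = d a1\<close>, then \<open>b' = b + \<phi> a1\<close> is a cocycle, and by
  the homotopy formula \<open>\<psi> b'\<close> differs from \<open>s a + \<psi> b\<close> only by
  the coboundary \<open>f2 (s2 a1)\<close>.\<close>

lemma conn_kernel:
  assumes 1: "conn i n c a" and a: "a \<in> BE (Suc i) (n - 1)"
  shows "\<exists>b\<in>ZE i n. \<exists>\<gamma>\<in>BF i n. c = \<psi> i b \<oplus>\<^bsub>F i\<^esub> \<gamma>"
proof -
  interpret E1: abelian_group "E (Suc i)" by (rule E_ag)
  interpret Fi: abelian_group "F i" by (rule F_ag)
  obtain b \<gamma> where h: "a \<in> ZE (Suc i) (n - 1)" "b\<in>hcomp (gam R D (E i)) n" "\<gamma>\<in>BF i n"
    "\<phi> (Suc i) a \<oplus>\<^bsub>E (Suc i)\<^esub> d i b = \<zero>\<^bsub>E (Suc i)\<^esub>" "c = s i n a \<oplus>\<^bsub>F i\<^esub> \<psi> i b \<oplus>\<^bsub>F i\<^esub> \<gamma>"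
    using 1 unfolding conn_def by blast
  obtain a1 where a1: "a1 \<in> hcomp (gam R D (E i)) (n - 1)" "a = d i a1" using a by (auto simp: hcobounds_def)
  define b' where "b' = b \<oplus>\<^bsub>E i\<^esub> \<phi> i a1"
  note \<phi>a1 = g\<phi>[OF a1(1)]
  have b': "b' \<in> hcomp (gam R D (E i)) n" using hmodD(3)[OF gEm h(2) \<phi>a1] by (simp add: b'_def)
  have "d i b' = \<zero>\<^bsub>E (Suc i)\<^esub>"
    using hhomD(2)[OF d_hom gam_sub[OF h(2)] gam_sub[OF \<phi>a1]] \<phi>_d[OF gam_sub[OF a1(1)]] a1(2) h(4)
      gEc[OF gd[OF h(2)]] gEc[OF gd[OF \<phi>a1]] by (simp add: b'_def E1.a_comm)
  then have bZ: "b' \<in> ZE i n" using b' by (simp add: ZE_iff)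
  let ?t = "f2 (Suc i) (s2 i n a1)"
  have t: "?t \<in> BF i n" using gs2[OF a1(1)] by (auto simp: BF_eq)
  have sa: "s i n a \<in> carrier (F i)" using gFc[OF gs] h(1) by (auto simp: ZE_iff)
  have "\<psi> i b' = \<psi> i b \<oplus>\<^bsub>F i\<^esub> (s i n a \<oplus>\<^bsub>F i\<^esub> ?t)"
    using hhomD(2)[OF \<psi>_hom gam_sub[OF h(2)] gam_sub[OF \<phi>a1]] homotopy3[OF gam_sub[OF a1(1)]] a1(2) by (simp add: b'_def)
  then have "\<psi> i b' \<oplus>\<^bsub>F i\<^esub> (\<gamma> \<oplus>\<^bsub>F i\<^esub> \<ominus>\<^bsub>F i\<^esub> ?t) = (s i n a \<oplus>\<^bsub>F i\<^esub> \<psi> i b \<oplus>\<^bsub>F i\<^esub> \<gamma>) \<oplus>\<^bsub>F i\<^esub> (?t \<oplus>\<^bsub>F i\<^esub> \<ominus>\<^bsub>F i\<^esub> ?t)"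
    using sa gFc[OF g\<psi>[OF h(2)]] gFc[OF BF_gam[OF h(3)]] gFc[OF BF_gam[OF t]] by (simp add: Fi.a_ac)
  then have "c = \<psi> i b' \<oplus>\<^bsub>F i\<^esub> (\<gamma> \<oplus>\<^bsub>F i\<^esub> \<ominus>\<^bsub>F i\<^esub> ?t)"
    using sa gFc[OF g\<psi>[OF h(2)]] gFc[OF BF_gam[OF h(3)]] gFc[OF BF_gam[OF t]] h(5) by (simp add: Fi.r_neg)
  then show ?thesis using bZ BF_add[OF h(3) BF_neg[OF t]] by blast
qed

lemma conn_\<phi>:
  assumes 1: "conn i n c a"
  shows "\<phi> (Suc i) a \<in> BE (Suc i) n"
proof -
  interpret E1: abelian_group "E (Suc i)" by (rule E_ag)
  obtain b where h: "a \<in> ZE (Suc i) (n - 1)" "b\<in>hcomp (gam R D (E i)) n"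
    "\<phi> (Suc i) a \<oplus>\<^bsub>E (Suc i)\<^esub> d i b = \<zero>\<^bsub>E (Suc i)\<^esub>"
    using 1 unfolding conn_def by blast
  have "\<phi> (Suc i) a \<in> carrier (E (Suc i))" using gEc[OF g\<phi>] h(1) by (auto simp: ZE_iff)
  then have "\<phi> (Suc i) a = d i (\<ominus>\<^bsub>E i\<^esub> b)"
    using h(3) d_neg[OF gam_sub[OF h(2)]] gEc[OF gd[OF h(2)]] E1.minus_equality by metis
  then show ?thesis using hmodD(5)[OF gEm[of i] h(2)] by (auto simp: hcobounds_def)
qed

text \<open>If \<open>\<phi> a = d b0\<close>, put \<open>b = -b0\<close> and
  \<open>c = s a + \<psi> b\<close>. The homotopy formula for the cocycle \<open>a\<close> shows
  that \<open>c\<close> is a cocycle.\<close>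

lemma conn_image:
  assumes a: "a \<in> ZE (Suc i) (n - 1)" and \<phi>a: "\<phi> (Suc i) a \<in> BE (Suc i) n"
  shows "\<exists>c. conn i n c a"
proof -
  interpret E1: abelian_group "E (Suc i)" by (rule E_ag)
  interpret Fi: abelian_group "F i" by (rule F_ag)
  interpret F1: abelian_group "F (Suc i)" by (rule F_ag)
  have ag: "a \<in> hcomp (gam R D (E (Suc i))) (n - 1)" "d (Suc i) a = \<zero>\<^bsub>E (Suc (Suc i))\<^esub>" using a by (auto simp: ZE_iff)
  obtain b0 where b0: "b0 \<in> hcomp (gam R D (E i)) n" "\<phi> (Suc i) a = d i b0" using \<phi>a by (auto simp: hcobounds_def)
  define b where "b = \<ominus>\<^bsub>E i\<^esub> b0"
  have b: "b \<in> hcomp (gam R D (E i)) n" using hmodD(5)[OF gEm[of i] b0(1)] by (simp add: b_def)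
  have db: "d i b = \<ominus>\<^bsub>E (Suc i)\<^esub> \<phi> (Suc i) a" using d_neg[OF gam_sub[OF b0(1)]] b0(2) by (simp add: b_def)
  define c where "c = s i n a \<oplus>\<^bsub>F i\<^esub> \<psi> i b"
  have c: "c \<in> hcomp (gam R D (F i)) n" using hmodD(3)[OF gFm gs[OF ag(1)] g\<psi>[OF b]] by (simp add: c_def)
  have d's: "d' i (s i n a) \<in> carrier (F (Suc i))"
    by (rule hmodD(1)[OF Fm hhomD(1)[OF d'_hom gam_sub[OF gs[OF ag(1)]]]])
  have "\<psi> (Suc i) (\<phi> (Suc i) a) = d' i (s i n a)"
    using homotopy3[OF gam_sub[OF ag(1)]] ag(2) s2_zero[of "Suc (Suc i)" n] d's by simp
  then have "d' i (\<psi> i b) = \<ominus>\<^bsub>F (Suc i)\<^esub> d' i (s i n a)"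
    using \<psi>_d[OF gam_sub[OF b]] db hhom_neg[OF Em Fm \<psi>_hom gam_sub[OF g\<phi>[OF ag(1)]]] by simp
  then have "d' i c = \<zero>\<^bsub>F (Suc i)\<^esub>"
    using hhomD(2)[OF d'_hom gam_sub[OF gs[OF ag(1)]] gam_sub[OF g\<psi>[OF b]]] d's by (simp add: c_def F1.r_neg)
  then have "c \<in> ZF i n" using c by (simp add: ZF_iff)
  moreover have "\<phi> (Suc i) a \<oplus>\<^bsub>E (Suc i)\<^esub> d i b = \<zero>\<^bsub>E (Suc i)\<^esub>"
    using gEc[OF g\<phi>[OF ag(1)]] db by (simp add: E1.r_neg)
  moreover have "c = s i n a \<oplus>\<^bsub>F i\<^esub> \<psi> i b \<oplus>\<^bsub>F i\<^esub> \<zero>\<^bsub>F i\<^esub>"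
    using gFc[OF gs[OF ag(1)]] gFc[OF g\<psi>[OF b]] by (simp add: c_def)
  ultimately show ?thesis unfolding conn_def using a b BF_zero[of i n] by blast
qed

end

lemma additive_subgroup_iff:
  assumes "abelian_group M"
  shows "additive_subgroup H M \<longleftrightarrow> H \<subseteq> carrier M \<and> \<zero>\<^bsub>M\<^esub> \<in> H \<and> (\<forall>x\<in>H. \<forall>y\<in>H. x \<oplus>\<^bsub>M\<^esub> y \<in> H) \<and> (\<forall>x\<in>H. \<ominus>\<^bsub>M\<^esub> x \<in> H)"
proof -
  interpret abelian_group M by fact
  show ?thesis
  proof
    assume "additive_subgroup H M"
    then interpret additive_subgroup H M .
    show "H \<subseteq> carrier M \<and> \<zero>\<^bsub>M\<^esub> \<in> H \<and> (\<forall>x\<in>H. \<forall>y\<in>H. x \<oplus>\<^bsub>M\<^esub> y \<in> H) \<and> (\<forall>x\<in>H. \<ominus>\<^bsub>M\<^esub> x \<in> H)"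
      using a_subset a_inv_closed by auto
  next
    assume "H \<subseteq> carrier M \<and> \<zero>\<^bsub>M\<^esub> \<in> H \<and> (\<forall>x\<in>H. \<forall>y\<in>H. x \<oplus>\<^bsub>M\<^esub> y \<in> H) \<and> (\<forall>x\<in>H. \<ominus>\<^bsub>M\<^esub> x \<in> H)"
    then show "additive_subgroup H M"
      by (intro additive_subgroupI) (auto simp: subgroup_def a_inv_def)
  qed
qed

section \<open>Quotient modules\<close>

lemma submodule_iff:
  assumes "module R M"
  shows "submodule H R M \<longleftrightarrow> H \<subseteq> carrier M \<and> \<zero>\<^bsub>M\<^esub> \<in> H \<and> (\<forall>x\<in>H. \<forall>y\<in>H. x \<oplus>\<^bsub>M\<^esub> y \<in> H) \<and>
    (\<forall>a\<in>carrier R. \<forall>x\<in>H. a \<odot>\<^bsub>M\<^esub> x \<in> H)"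
proof -
  interpret module R M by fact
  show ?thesis
  proof
    assume H: "submodule H R M"
    obtain x where x: "x \<in> H" using submoduleE(2)[OF H] by blast
    then have "\<zero>\<^bsub>R\<^esub> \<odot>\<^bsub>M\<^esub> x \<in> H" by (intro submoduleE(4)[OF H]) auto
    then have "\<zero>\<^bsub>M\<^esub> \<in> H" using x submoduleE(1)[OF H] by (simp add: subset_iff)
    then show "H \<subseteq> carrier M \<and> \<zero>\<^bsub>M\<^esub> \<in> H \<and> (\<forall>x\<in>H. \<forall>y\<in>H. x \<oplus>\<^bsub>M\<^esub> y \<in> H) \<and>
      (\<forall>a\<in>carrier R. \<forall>x\<in>H. a \<odot>\<^bsub>M\<^esub> x \<in> H)"
      using submoduleE[OF H] x by (auto simp: subset_iff)
  next
    assume H: "H \<subseteq> carrier M \<and> \<zero>\<^bsub>M\<^esub> \<in> H \<and> (\<forall>x\<in>H. \<forall>y\<in>H. x \<oplus>\<^bsub>M\<^esub> y \<in> H) \<and>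
      (\<forall>a\<in>carrier R. \<forall>x\<in>H. a \<odot>\<^bsub>M\<^esub> x \<in> H)"
    have "\<ominus>\<^bsub>M\<^esub> x \<in> H" if "x \<in> H" for x
    proof -
      have "(\<ominus>\<^bsub>R\<^esub> \<one>\<^bsub>R\<^esub>) \<odot>\<^bsub>M\<^esub> x \<in> H" using H that by simp
      moreover have "x \<in> carrier M" using H that by blast
      ultimately show ?thesis by (simp add: smult_l_minus)
    qed
    then show "submodule H R M" using H by (intro submoduleI) auto
  qed
qed

locale module_quot = module R M for R (structure) and M (structure) +
  fixes H
  assumes H: "submodule H R M"
begin

lemma H_sub: "h \<in> H \<Longrightarrow> h \<in> carrier M"
  and H_zero: "\<zero>\<^bsub>M\<^esub> \<in> H"
  and H_add: "\<lbrakk>h \<in> H; k \<in> H\<rbrakk> \<Longrightarrow> h \<oplus>\<^bsub>M\<^esub> k \<in> H"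
  and H_smult: "\<lbrakk>a \<in> carrier R; h \<in> H\<rbrakk> \<Longrightarrow> a \<odot>\<^bsub>M\<^esub> h \<in> H"
  and H_neg: "h \<in> H \<Longrightarrow> \<ominus>\<^bsub>M\<^esub> h \<in> H"
  using H submoduleE(3)[OF H] unfolding submodule_iff[OF module_axioms] by auto

lemma H_ag: "abelian_subgroup H M"
  by (rule abelian_subgroupI3)
    (auto simp: additive_subgroup_iff[OF abelian_group_axioms] H_zero H_add H_neg abelian_group_axioms H_sub)

sublocale Hs: abelian_subgroup H M by (rule H_ag)

lemma coset_eq_iff:
  assumes "m \<in> carrier M" "m' \<in> carrier M"
  shows "H +>\<^bsub>M\<^esub> m = H +>\<^bsub>M\<^esub> m' \<longleftrightarrow> m \<ominus>\<^bsub>M\<^esub> m' \<in> H"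
proof
  assume "H +>\<^bsub>M\<^esub> m = H +>\<^bsub>M\<^esub> m'"
  then have "m \<in> H +>\<^bsub>M\<^esub> m'" using Hs.a_rcos_self assms by metis
  then show "m \<ominus>\<^bsub>M\<^esub> m' \<in> H" using Hs.a_rcos_module_minus[of m' m] assms ring_axioms
    by (metis Hs.a_rcos_module a_minus_def)
next
  assume "m \<ominus>\<^bsub>M\<^esub> m' \<in> H"
  then have "m \<in> H +>\<^bsub>M\<^esub> m'" using Hs.a_rcos_module assms by (metis a_minus_def)
  then show "H +>\<^bsub>M\<^esub> m = H +>\<^bsub>M\<^esub> m'" using Hs.a_repr_independence' assms by metis
qed

lemma coset_zero: "H +>\<^bsub>M\<^esub> \<zero>\<^bsub>M\<^esub> = H"
  using a_coset_add_zero[of H] H_sub by (simp add: subset_iff)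

lemma coset_eq_H_iff:
  assumes "m \<in> carrier M"
  shows "H +>\<^bsub>M\<^esub> m = H \<longleftrightarrow> m \<in> H"
proof -
  have "m \<ominus>\<^bsub>M\<^esub> \<zero>\<^bsub>M\<^esub> = m" using assms by (simp add: a_minus_def)
  then show ?thesis using coset_eq_iff[OF assms M.zero_closed] by (simp add: coset_zero)
qed

lemma coset_memI: "m \<in> carrier M \<Longrightarrow> m \<in> H +>\<^bsub>M\<^esub> m"
  by (rule Hs.a_rcos_self)

lemma coset_memD:
  assumes "m \<in> carrier M" "x \<in> H +>\<^bsub>M\<^esub> m"
  shows "\<exists>h\<in>H. x = h \<oplus>\<^bsub>M\<^esub> m" "x \<in> carrier M" "H +>\<^bsub>M\<^esub> x = H +>\<^bsub>M\<^esub> m"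
proof -
  show 1: "\<exists>h\<in>H. x = h \<oplus>\<^bsub>M\<^esub> m" using assms(2) by (auto simp: a_r_coset_def')
  then show "x \<in> carrier M" using assms H_sub by auto
  show "H +>\<^bsub>M\<^esub> x = H +>\<^bsub>M\<^esub> m" using Hs.a_repr_independence'[OF assms(2,1)] by simp
qed

abbreviation Q where "Q \<equiv> quot_module M H"

lemma Q_carrier: "carrier Q = (\<lambda>m. H +>\<^bsub>M\<^esub> m) ` carrier M"
  by (auto simp: quot_module_def A_RCOSETS_def' image_iff)

lemma Q_carrierE: assumes "C \<in> carrier Q" obtains m where "m \<in> carrier M" "C = H +>\<^bsub>M\<^esub> m"
  using assms by (auto simp: Q_carrier)

lemma Q_carrierI: "m \<in> carrier M \<Longrightarrow> H +>\<^bsub>M\<^esub> m \<in> carrier Q"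
  by (auto simp: Q_carrier)

lemma Q_zero: "\<zero>\<^bsub>Q\<^esub> = H"
  by (simp add: quot_module_def)

lemma set_add_coset: "\<lbrakk>m \<in> carrier M; m' \<in> carrier M\<rbrakk> \<Longrightarrow> (H +>\<^bsub>M\<^esub> m) <+>\<^bsub>M\<^esub> (H +>\<^bsub>M\<^esub> m') = H +>\<^bsub>M\<^esub> (m \<oplus>\<^bsub>M\<^esub> m')"
  by (rule Hs.a_rcos_sum)

lemma Q_add: "\<lbrakk>m \<in> carrier M; m' \<in> carrier M\<rbrakk> \<Longrightarrow> (H +>\<^bsub>M\<^esub> m) \<oplus>\<^bsub>Q\<^esub> (H +>\<^bsub>M\<^esub> m') = H +>\<^bsub>M\<^esub> (m \<oplus>\<^bsub>M\<^esub> m')"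
  by (simp add: quot_module_def set_add_coset)

text \<open>The unions in the definitions of \<open>quot_module\<close>, \<open>rees_sum\<close>, \<open>L_map\<close> and \<open>lc_map\<close> are over equal sets.\<close>

lemma UN_coset:
  assumes m: "m \<in> carrier M"
    and f: "\<And>x. x \<in> H +>\<^bsub>M\<^esub> m \<Longrightarrow> f x = K"
  shows "(\<Union>x\<in>H +>\<^bsub>M\<^esub> m. f x) = K"
  using f coset_memI[OF m] by auto

lemma Q_smult:
  assumes a: "a \<in> carrier R" and m: "m \<in> carrier M"
  shows "a \<odot>\<^bsub>Q\<^esub> (H +>\<^bsub>M\<^esub> m) = H +>\<^bsub>M\<^esub> (a \<odot>\<^bsub>M\<^esub> m)"
proof -
  have "H +>\<^bsub>M\<^esub> (a \<odot>\<^bsub>M\<^esub> x) = H +>\<^bsub>M\<^esub> (a \<odot>\<^bsub>M\<^esub> m)" if x: "x \<in> H +>\<^bsub>M\<^esub> m" for x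
  proof -
    obtain h where h: "h \<in> H" "x = h \<oplus>\<^bsub>M\<^esub> m" using coset_memD[OF m x] by blast
    have "a \<odot>\<^bsub>M\<^esub> x \<ominus>\<^bsub>M\<^esub> a \<odot>\<^bsub>M\<^esub> m = a \<odot>\<^bsub>M\<^esub> h"
      using h a m H_sub by (simp add: smult_r_distr a_minus_def M.a_assoc M.r_neg)
    then show ?thesis using coset_eq_iff[of "a \<odot>\<^bsub>M\<^esub> x" "a \<odot>\<^bsub>M\<^esub> m"] H_smult[OF a h(1)] a m coset_memD(2)[OF m x] by simp
  qed
  then have "(\<Union>x\<in>H +>\<^bsub>M\<^esub> m. H +>\<^bsub>M\<^esub> (a \<odot>\<^bsub>M\<^esub> x)) = H +>\<^bsub>M\<^esub> (a \<odot>\<^bsub>M\<^esub> m)" by (rule UN_coset[OF m])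
  then show ?thesis by (simp add: quot_module_def)
qed

lemma Q_module: "module R Q"
proof (rule moduleI)
  show "cring R" by (rule cring_axioms)
  show "abelian_group Q"
  proof (rule abelian_groupI)
    fix C assume "C \<in> carrier Q"
    then obtain m where m: "m \<in> carrier M" "C = H +>\<^bsub>M\<^esub> m" by (rule Q_carrierE)
    have "(H +>\<^bsub>M\<^esub> (\<ominus>\<^bsub>M\<^esub> m)) \<oplus>\<^bsub>Q\<^esub> C = \<zero>\<^bsub>Q\<^esub>" using m by (simp add: Q_add Q_zero M.l_neg coset_zero)
    then show "\<exists>D\<in>carrier Q. D \<oplus>\<^bsub>Q\<^esub> C = \<zero>\<^bsub>Q\<^esub>" using Q_carrierI[of "\<ominus>\<^bsub>M\<^esub> m"] m by blast
    show "\<zero>\<^bsub>Q\<^esub> \<oplus>\<^bsub>Q\<^esub> C = C" using Q_add[of "\<zero>\<^bsub>M\<^esub>" m] m by (simp add: Q_zero coset_zero)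
  next
    show "\<zero>\<^bsub>Q\<^esub> \<in> carrier Q" using Q_carrierI[of "\<zero>\<^bsub>M\<^esub>"] by (simp add: Q_zero coset_zero)
  qed (auto elim!: Q_carrierE simp: Q_add Q_carrierI M.a_ac)
qed (auto elim!: Q_carrierE simp: Q_add Q_smult Q_carrierI smult_l_distr smult_r_distr smult_assoc1)

end

lemma module_quotI: "module R M \<Longrightarrow> submodule H R M \<Longrightarrow> module_quot R M H"
  by (simp add: module_quot_def module_quot_axioms_def)

section \<open>Graded modules and their homogeneous components\<close>

text \<open>A family of projections makes the unique decomposition automatic: applied to a finite
  sum of homogeneous elements, \<open>prj k\<close> returns the summand of degree \<open>k\<close>,
  and an element with all projections zero is zero.\<close>

lemma graded_moduleI:
  fixes E :: "('r, 'e) graded_module"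
  assumes m: "module R E"
    and sub: "\<And>n. additive_subgroup (hcomp E n) E"
    and sc: "\<And>i j a e. \<lbrakk>a \<in> G i; e \<in> hcomp E j\<rbrakk> \<Longrightarrow> a \<odot>\<^bsub>E\<^esub> e \<in> hcomp E (i + j)"
    and prj_in: "\<And>n e. e \<in> carrier E \<Longrightarrow> prj n e \<in> hcomp E n"
    and prj_add: "\<And>n e f. \<lbrakk>e \<in> carrier E; f \<in> carrier E\<rbrakk> \<Longrightarrow> prj n (e \<oplus>\<^bsub>E\<^esub> f) = prj n e \<oplus>\<^bsub>E\<^esub> prj n f"
    and prj_hom: "\<And>n k e. e \<in> hcomp E n \<Longrightarrow> prj k e = (if k = n then e else \<zero>\<^bsub>E\<^esub>)"
    and prj_fin: "\<And>e. e \<in> carrier E \<Longrightarrow> finite {n. prj n e \<noteq> \<zero>\<^bsub>E\<^esub>}"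
    and prj_ext: "\<And>e. \<lbrakk>e \<in> carrier E; \<And>n. prj n e = \<zero>\<^bsub>E\<^esub>\<rbrakk> \<Longrightarrow> e = \<zero>\<^bsub>E\<^esub>"
  shows "is_graded_module R G E"
  unfolding is_graded_module_def
proof (intro conjI allI ballI m sub sc)
  interpret module R E by (rule m)
  have hc: "x \<in> carrier E" if "x \<in> hcomp E n" for x n
    using sub[of n] that unfolding additive_subgroup_iff[OF abelian_group_axioms] by auto
  have h0: "\<zero>\<^bsub>E\<^esub> \<in> hcomp E n" for n using sub[of n] unfolding additive_subgroup_iff[OF abelian_group_axioms] by auto
  have prj0: "prj n \<zero>\<^bsub>E\<^esub> = \<zero>\<^bsub>E\<^esub>" for n using prj_hom[OF h0] by simp
  have prj_sum: "prj k (finsum E c A) = (if k \<in> A then c k else \<zero>\<^bsub>E\<^esub>)" if "finite A" "\<And>n. c n \<in> hcomp E n" for A c k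
    using that(1)
  proof (induction A)
    case (insert a A)
    have c: "c \<in> A \<rightarrow> carrier E" "c a \<in> carrier E" using hc that(2) by blast+
    then have "prj k (finsum E c (insert a A)) = prj k (c a) \<oplus>\<^bsub>E\<^esub> prj k (finsum E c A)"
      using insert prj_add by simp
    then show ?case using insert prj_hom[OF that(2), of k a] hc(1)[OF that(2)] by auto
  qed (simp add: prj0)
  fix e assume e: "e \<in> carrier E"
  let ?c = "\<lambda>n. prj n e" and ?A = "{n. prj n e \<noteq> \<zero>\<^bsub>E\<^esub>}"
  have cc: "?c \<in> ?A \<rightarrow> carrier E" by (rule funcsetI) (rule hc[OF prj_in[OF e]])
  show "\<exists>!c. (\<forall>n. c n \<in> hcomp E n) \<and> finite {n. c n \<noteq> \<zero>\<^bsub>E\<^esub>} \<and> e = finsum E c {n. c n \<noteq> \<zero>\<^bsub>E\<^esub>}"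
  proof (rule ex1I[of _ ?c], intro conjI allI prj_in prj_fin e)
    let ?f = "finsum E ?c ?A"
    have f: "?f \<in> carrier E" using cc by simp
    have "prj n (e \<oplus>\<^bsub>E\<^esub> \<ominus>\<^bsub>E\<^esub> ?f) = \<zero>\<^bsub>E\<^esub>" for n
    proof -
      have "prj n (\<ominus>\<^bsub>E\<^esub> ?f) \<oplus>\<^bsub>E\<^esub> prj n ?f = \<zero>\<^bsub>E\<^esub>"
        using prj_add[of "\<ominus>\<^bsub>E\<^esub> ?f" ?f n] f prj0 by (simp add: M.l_neg)
      moreover have "prj n ?f = prj n e" using prj_sum[OF prj_fin[OF e] prj_in[OF e], of n] by (simp split: if_splits)
      ultimately show ?thesis using prj_add[OF e, of "\<ominus>\<^bsub>E\<^esub> ?f" n] f hc prj_in[OF e] prj_in[of "\<ominus>\<^bsub>E\<^esub> ?f"]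
        by (metis M.a_comm M.a_inv_closed)
    qed
    then have "e \<oplus>\<^bsub>E\<^esub> \<ominus>\<^bsub>E\<^esub> ?f = \<zero>\<^bsub>E\<^esub>" using e f by (rule_tac prj_ext[of "e \<oplus>\<^bsub>E\<^esub> \<ominus>\<^bsub>E\<^esub> ?f"]) simp_all
    then show "e = ?f" using e f \<open>e \<oplus>\<^bsub>E\<^esub> \<ominus>\<^bsub>E\<^esub> ?f = \<zero>\<^bsub>E\<^esub>\<close> M.minus_equality[of e "\<ominus>\<^bsub>E\<^esub> ?f"] by simp
  next
    fix c assume c: "(\<forall>n. c n \<in> hcomp E n) \<and> finite {n. c n \<noteq> \<zero>\<^bsub>E\<^esub>} \<and> e = finsum E c {n. c n \<noteq> \<zero>\<^bsub>E\<^esub>}"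
    show "c = ?c"
    proof
      fix n
      have "prj n (finsum E c {n. c n \<noteq> \<zero>\<^bsub>E\<^esub>}) = c n" using prj_sum[of "{n. c n \<noteq> \<zero>\<^bsub>E\<^esub>}" c n] c by simp
      moreover have "e = finsum E c {n. c n \<noteq> \<zero>\<^bsub>E\<^esub>}" using c by blast
      ultimately show "c n = prj n e" by metis
    qed
  qed
qed

definition gcomp :: "('r, 'e) graded_module \<Rightarrow> 'e \<Rightarrow> int \<Rightarrow> 'e" where
  "gcomp E e = (THE c. (\<forall>n. c n \<in> hcomp E n) \<and> finite {n. c n \<noteq> \<zero>\<^bsub>E\<^esub>} \<and> e = finsum E c {n. c n \<noteq> \<zero>\<^bsub>E\<^esub>})"

locale graded_mod =
  fixes R :: "('r, 'x) ring_scheme" and G :: "int \<Rightarrow> 'r set" and E :: "('r, 'e) graded_module"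
  assumes graded: "is_graded_module R G E"
begin

sublocale module R E using graded by (simp add: is_graded_module_def)

lemma sub: "additive_subgroup (hcomp E n) E"
  using graded by (simp add: is_graded_module_def)

lemma hc: "u \<in> hcomp E n \<Longrightarrow> u \<in> carrier E"
  and h0: "\<zero>\<^bsub>E\<^esub> \<in> hcomp E n"
  and hadd: "\<lbrakk>u \<in> hcomp E n; v \<in> hcomp E n\<rbrakk> \<Longrightarrow> u \<oplus>\<^bsub>E\<^esub> v \<in> hcomp E n"
  and hneg: "u \<in> hcomp E n \<Longrightarrow> \<ominus>\<^bsub>E\<^esub> u \<in> hcomp E n"
  using sub[of n] unfolding additive_subgroup_iff[OF abelian_group_axioms] by auto

lemma hsmult: "\<lbrakk>a \<in> G i; u \<in> hcomp E n; k = i + n\<rbrakk> \<Longrightarrow> a \<odot>\<^bsub>E\<^esub> u \<in> hcomp E k"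
  using graded by (auto simp: is_graded_module_def)

lemma hmod: "hmod R G E"
  unfolding hmod_def using hc h0 hadd hsmult module_axioms by auto

lemma gcomp:
  assumes "e \<in> carrier E"
  shows "gcomp E e n \<in> hcomp E n" "finite {n. gcomp E e n \<noteq> \<zero>\<^bsub>E\<^esub>}"
    "e = finsum E (gcomp E e) {n. gcomp E e n \<noteq> \<zero>\<^bsub>E\<^esub>}"
proof -
  have "\<exists>!c. (\<forall>n. c n \<in> hcomp E n) \<and> finite {n. c n \<noteq> \<zero>\<^bsub>E\<^esub>} \<and> e = finsum E c {n. c n \<noteq> \<zero>\<^bsub>E\<^esub>}"
    using graded assms unfolding is_graded_module_def by blast
  from theI'[OF this] show "gcomp E e n \<in> hcomp E n" "finite {n. gcomp E e n \<noteq> \<zero>\<^bsub>E\<^esub>}"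
    "e = finsum E (gcomp E e) {n. gcomp E e n \<noteq> \<zero>\<^bsub>E\<^esub>}" unfolding gcomp_def[symmetric] by auto
qed

lemma gcomp_carrier: "e \<in> carrier E \<Longrightarrow> gcomp E e n \<in> carrier E"
  using gcomp(1) hc by blast

lemma finsum_superset:
  assumes "finite A" "\<And>n. c n \<in> carrier E" "{n. c n \<noteq> \<zero>\<^bsub>E\<^esub>} \<subseteq> A"
  shows "finsum E c A = finsum E c {n. c n \<noteq> \<zero>\<^bsub>E\<^esub>}"
  by (rule add.finprod_mono_neutral_cong_right) (use assms in auto)

text \<open>\<open>A\<close> may contain degrees outside the support, which spares computing the
  support of a sum.\<close>

lemma gcomp_unique:
  assumes c: "\<And>n. c n \<in> hcomp E n" and A: "finite A" and e: "e = finsum E c A"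
  shows "gcomp E e n = (if n \<in> A then c n else \<zero>\<^bsub>E\<^esub>)"
proof -
  define c' where "c' n = (if n \<in> A then c n else \<zero>\<^bsub>E\<^esub>)" for n
  have c': "c' n \<in> hcomp E n" for n using c h0 by (simp add: c'_def)
  have sup: "{n. c' n \<noteq> \<zero>\<^bsub>E\<^esub>} \<subseteq> A" by (auto simp: c'_def)
  have "finsum E c A = finsum E c' A" by (rule finsum_cong') (use hc[OF c] in \<open>auto simp: c'_def\<close>)
  also have "\<dots> = finsum E c' {n. c' n \<noteq> \<zero>\<^bsub>E\<^esub>}" by (rule finsum_superset[OF A hc[OF c'] sup])
  finally have e': "e = finsum E c' {n. c' n \<noteq> \<zero>\<^bsub>E\<^esub>}" using e by simp
  have "e \<in> carrier E" using e hc[OF c] by auto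
  then have "\<exists>!c. (\<forall>n. c n \<in> hcomp E n) \<and> finite {n. c n \<noteq> \<zero>\<^bsub>E\<^esub>} \<and> e = finsum E c {n. c n \<noteq> \<zero>\<^bsub>E\<^esub>}"
    using graded unfolding is_graded_module_def by blast
  then have "gcomp E e = c'"
    unfolding gcomp_def by (rule the1_equality) (use c' e' finite_subset[OF sup A] in blast)
  then show ?thesis by (simp add: c'_def)
qed

lemma gcomp_hom:
  assumes "e \<in> hcomp E n"
  shows "gcomp E e k = (if k = n then e else \<zero>\<^bsub>E\<^esub>)"
proof -
  have "gcomp E e k = (if k \<in> {n} then (\<lambda>i. if i = n then e else \<zero>\<^bsub>E\<^esub>) k else \<zero>\<^bsub>E\<^esub>)"
    by (rule gcomp_unique) (use assms h0 hc in auto)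
  then show ?thesis by simp
qed

lemma gcomp_add:
  assumes "e \<in> carrier E" "f \<in> carrier E"
  shows "gcomp E (e \<oplus>\<^bsub>E\<^esub> f) n = gcomp E e n \<oplus>\<^bsub>E\<^esub> gcomp E f n"
proof -
  let ?A = "{n. gcomp E e n \<noteq> \<zero>\<^bsub>E\<^esub>} \<union> {n. gcomp E f n \<noteq> \<zero>\<^bsub>E\<^esub>}"
  have fin: "finite ?A" using gcomp(2) assms by blast
  have "e = finsum E (gcomp E e) ?A" "f = finsum E (gcomp E f) ?A"
    using finsum_superset[OF fin, of "gcomp E e"] finsum_superset[OF fin, of "gcomp E f"]
      gcomp_carrier assms gcomp(3)[OF assms(1)] gcomp(3)[OF assms(2)] by auto
  then have "e \<oplus>\<^bsub>E\<^esub> f = finsum E (\<lambda>n. gcomp E e n \<oplus>\<^bsub>E\<^esub> gcomp E f n) ?A"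
    using finsum_addf[of "gcomp E e" ?A "gcomp E f"] gcomp_carrier assms by (simp add: Pi_def)
  then have "gcomp E (e \<oplus>\<^bsub>E\<^esub> f) n = (if n \<in> ?A then gcomp E e n \<oplus>\<^bsub>E\<^esub> gcomp E f n else \<zero>\<^bsub>E\<^esub>)"
    by (intro gcomp_unique fin hadd gcomp(1) assms)
  then show ?thesis by auto
qed

text \<open>Only the components of this one \<open>e\<close> have to satisfy \<open>P\<close>. This
  is the form needed when \<open>P\<close> is membership in a submodule or an image, which fails for
  other homogeneous elements.\<close>

lemma sum_induct:
  assumes e: "e \<in> carrier E" and prj: "\<And>n. P (gcomp E e n)" and zero: "P \<zero>\<^bsub>E\<^esub>"
    and add: "\<And>a b. \<lbrakk>a \<in> carrier E; b \<in> carrier E; P a; P b\<rbrakk> \<Longrightarrow> P (a \<oplus>\<^bsub>E\<^esub> b)"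
  shows "P e"
proof -
  have "P (finsum E (gcomp E e) A)" if "finite A" for A
    using that
  proof (induction A)
    case (insert x A)
    then show ?case using gcomp_carrier[OF e] prj by (simp add: Pi_def add)
  qed (simp add: zero)
  then show ?thesis using gcomp[OF e] by metis
qed

lemma graded_induct [consumes 1, case_names hom add]:
  assumes e: "e \<in> carrier E" and hom: "\<And>n u. u \<in> hcomp E n \<Longrightarrow> P u"
    and add: "\<And>a b. \<lbrakk>a \<in> carrier E; b \<in> carrier E; P a; P b\<rbrakk> \<Longrightarrow> P (a \<oplus>\<^bsub>E\<^esub> b)"
  shows "P e"
  by (rule sum_induct[OF e]) (use hom gcomp(1)[OF e] h0 add in blast)+

lemma gcomp_zero: "gcomp E \<zero>\<^bsub>E\<^esub> n = \<zero>\<^bsub>E\<^esub>"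
  using gcomp_hom[OF h0[of n]] by simp

lemma gcomp_smult:
  assumes a: "a \<in> G i" "a \<in> carrier R" and e: "e \<in> carrier E"
  shows "gcomp E (a \<odot>\<^bsub>E\<^esub> e) n = a \<odot>\<^bsub>E\<^esub> gcomp E e (n - i)"
  using e
proof (induction rule: graded_induct)
  case (hom k u)
  then show ?case using gcomp_hom[OF hsmult[OF a(1) hom refl], of n] gcomp_hom[OF hom, of "n - i"] a by auto
next
  case (add u v)
  then show ?case using a gcomp_carrier by (simp add: gcomp_add smult_r_distr)
qed

lemma gcomp_ext:
  assumes e: "e \<in> carrier E" and "\<And>n. gcomp E e n = \<zero>\<^bsub>E\<^esub>"
  shows "e = \<zero>\<^bsub>E\<^esub>"
  using gcomp(3)[OF e] assms(2) by simp

end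

lemma graded_homD:
  assumes "h \<in> graded_hom R X Y"
  shows "u \<in> carrier X \<Longrightarrow> h u \<in> carrier Y"
    and "\<lbrakk>u \<in> carrier X; v \<in> carrier X\<rbrakk> \<Longrightarrow> h (u \<oplus>\<^bsub>X\<^esub> v) = h u \<oplus>\<^bsub>Y\<^esub> h v"
    and "\<lbrakk>a \<in> carrier R; u \<in> carrier X\<rbrakk> \<Longrightarrow> h (a \<odot>\<^bsub>X\<^esub> u) = a \<odot>\<^bsub>Y\<^esub> h u"
    and "u \<in> hcomp X n \<Longrightarrow> h u \<in> hcomp Y n"
  using assms unfolding graded_hom_def by blast+

lemma graded_homI:
  assumes "\<And>u. u \<in> carrier X \<Longrightarrow> h u \<in> carrier Y"
    and "\<And>u v. \<lbrakk>u \<in> carrier X; v \<in> carrier X\<rbrakk> \<Longrightarrow> h (u \<oplus>\<^bsub>X\<^esub> v) = h u \<oplus>\<^bsub>Y\<^esub> h v"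
    and "\<And>a u. \<lbrakk>a \<in> carrier R; u \<in> carrier X\<rbrakk> \<Longrightarrow> h (a \<odot>\<^bsub>X\<^esub> u) = a \<odot>\<^bsub>Y\<^esub> h u"
    and "\<And>n u. u \<in> hcomp X n \<Longrightarrow> h u \<in> hcomp Y n"
  shows "h \<in> graded_hom R X Y"
  using assms by (auto simp: graded_hom_def)

lemma module_hom_zero:
  assumes X: "module R X" and Y: "module R Y" and h: "h \<in> graded_hom R X Y"
  shows "h \<zero>\<^bsub>X\<^esub> = \<zero>\<^bsub>Y\<^esub>"
proof -
  interpret X: module R X by fact
  interpret Y: module R Y by fact
  have "h (\<zero>\<^bsub>R\<^esub> \<odot>\<^bsub>X\<^esub> \<zero>\<^bsub>X\<^esub>) = \<zero>\<^bsub>R\<^esub> \<odot>\<^bsub>Y\<^esub> h \<zero>\<^bsub>X\<^esub>" using graded_homD(3)[OF h] by blast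
  then show ?thesis using graded_homD(1)[OF h X.M.zero_closed] by simp
qed

lemma gcomp_graded_hom:
  assumes X: "is_graded_module R G X" and Y: "is_graded_module R G Y" and h: "h \<in> graded_hom R X Y"
    and e: "e \<in> carrier X"
  shows "gcomp Y (h e) n = h (gcomp X e n)"
proof -
  interpret X: graded_mod R G X using X by (simp add: graded_mod_def)
  interpret Y: graded_mod R G Y using Y by (simp add: graded_mod_def)
  show ?thesis
    using e
  proof (induction rule: X.graded_induct)
    case (hom k u)
    then show ?case using X.gcomp_hom[OF hom] Y.gcomp_hom[OF graded_homD(4)[OF h hom]]
        module_hom_zero[OF X.module_axioms Y.module_axioms h] by simp
  next
    case (add u v)
    then show ?case using graded_homD[OF h] X.gcomp_carrier by (simp add: X.gcomp_add Y.gcomp_add)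
  qed
qed

text \<open>Homomorphisms commute with taking components, so the components of a kernel element lie
  in the kernel; preimages of the components add up to a preimage.\<close>

lemma gr_exactI:
  assumes X: "is_graded_module R G X" and Y: "is_graded_module R G Y" and Z: "is_graded_module R G Z"
    and f: "f \<in> graded_hom R X Y" and g: "g \<in> graded_hom R Y Z"
    and gf: "\<And>n u. u \<in> hcomp X n \<Longrightarrow> g (f u) = \<zero>\<^bsub>Z\<^esub>"
    and ex: "\<And>n y. \<lbrakk>y \<in> hcomp Y n; g y = \<zero>\<^bsub>Z\<^esub>\<rbrakk> \<Longrightarrow> \<exists>u\<in>hcomp X n. f u = y"
  shows "gr_exact R G X f Y g Z"
proof -
  interpret X: graded_mod R G X using X by (simp add: graded_mod_def)
  interpret Y: graded_mod R G Y using Y by (simp add: graded_mod_def)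
  interpret Z: graded_mod R G Z using Z by (simp add: graded_mod_def)
  have "g (f u) = \<zero>\<^bsub>Z\<^esub>" if "u \<in> carrier X" for u
    using that
  proof (induction rule: X.graded_induct)
    case (add a b) then show ?case by (simp add: graded_homD[OF f] graded_homD[OF g])
  qed (rule gf)
  moreover have "y \<in> f ` carrier X" if y: "y \<in> carrier Y" "g y = \<zero>\<^bsub>Z\<^esub>" for y
    using y(1)
  proof (rule Y.sum_induct)
    fix n
    have "g (gcomp Y y n) = \<zero>\<^bsub>Z\<^esub>" using gcomp_graded_hom[OF Y Z g y(1)] y(2) Z.gcomp_zero by metis
    then obtain u where "u \<in> hcomp X n" "f u = gcomp Y y n" using ex[OF Y.gcomp(1)[OF y(1)]] by blast
    then show "gcomp Y y n \<in> f ` carrier X" using X.hc by (metis image_eqI)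
  next
    show "\<zero>\<^bsub>Y\<^esub> \<in> f ` carrier X" using module_hom_zero[OF X.module_axioms Y.module_axioms f] by (metis X.M.zero_closed image_eqI)
  next
    fix a b assume "a \<in> f ` carrier X" "b \<in> f ` carrier X"
    then show "a \<oplus>\<^bsub>Y\<^esub> b \<in> f ` carrier X" using graded_homD(2)[OF f] by (metis (no_types, lifting) X.M.a_closed image_iff)
  qed
  ultimately show ?thesis
    unfolding gr_exact_def using X Y Z f g graded_homD(1)[OF f] by auto
qed

text \<open>The component of degree \<open>n\<close> of any preimage is again a preimage.\<close>

lemma graded_hom_image:
  assumes X: "is_graded_module R G X" and Y: "is_graded_module R G Y" and f: "f \<in> graded_hom R X Y"
    and y: "y \<in> hcomp Y n" "y \<in> f ` carrier X"
  shows "\<exists>u\<in>hcomp X n. f u = y"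
proof -
  interpret X: graded_mod R G X using X by (simp add: graded_mod_def)
  interpret Y: graded_mod R G Y using Y by (simp add: graded_mod_def)
  obtain u where u: "u \<in> carrier X" "y = f u" using y by blast
  have "f (gcomp X u n) = y" using gcomp_graded_hom[OF X Y f u(1), of n] Y.gcomp_hom[OF y(1)] u by simp
  then show ?thesis using X.gcomp(1)[OF u(1)] by blast
qed

lemma graded_hom_hhom:
  assumes X: "is_graded_module R G X" and G: "\<And>n. G n \<subseteq> carrier R" and h: "h \<in> graded_hom R X Y"
  shows "hhom G X Y (\<lambda>n. h)"
proof -
  interpret X: graded_mod R G X using X by (simp add: graded_mod_def)
  show ?thesis unfolding hhom_def using graded_homD[OF h] X.hc G by (auto simp: subset_iff)
qed

text \<open>A grading of the ring is just the family \<open>G\<close>, without axioms. That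
  \<open>regular_module\<close> is a graded module is what allows scalars to be split into
  homogeneous ones.\<close>

definition regular_module :: "('r, 'x) ring_scheme \<Rightarrow> (int \<Rightarrow> 'r set) \<Rightarrow> ('r, 'r) graded_module" where
  "regular_module R G = \<lparr> carrier = carrier R, monoid.mult = undefined, one = undefined, zero = \<zero>\<^bsub>R\<^esub>,
     add = add R, smult = mult R, hcomp = G \<rparr>"

lemma regular_module_simps [simp]:
  "carrier (regular_module R G) = carrier R" "zero (regular_module R G) = zero R"
  "add (regular_module R G) = add R" "smult (regular_module R G) = mult R" "hcomp (regular_module R G) = G"
  by (simp_all add: regular_module_def)

text \<open>The way back from maps between components to a homomorphism: apply \<open>h\<close> to
  the components and add. Linearity is shown for homogeneous scalars first, then in general by
  decomposing the scalar in \<open>regular_module\<close>.\<close>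

lemma graded_hom_extend:
  assumes RR: "is_graded_module R G (regular_module R G)"
    and X: "is_graded_module R G X" and Y: "is_graded_module R G Y"
    and h: "hhom G X Y h"
  shows "\<exists>f\<in>graded_hom R X Y. \<forall>n. \<forall>u\<in>hcomp X n. f u = h n u"
proof -
  interpret RR: graded_mod R G "regular_module R G" using RR by (simp add: graded_mod_def)
  interpret X: graded_mod R G X using X by (simp add: graded_mod_def)
  interpret Y: graded_mod R G Y using Y by (simp add: graded_mod_def)
  have h_in: "\<And>n u. u \<in> hcomp X n \<Longrightarrow> h n u \<in> hcomp Y n"
    and h_add: "\<And>n u v. \<lbrakk>u \<in> hcomp X n; v \<in> hcomp X n\<rbrakk> \<Longrightarrow> h n (u \<oplus>\<^bsub>X\<^esub> v) = h n u \<oplus>\<^bsub>Y\<^esub> h n v"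
    and h_sc: "\<And>i n a u. \<lbrakk>a \<in> G i; u \<in> hcomp X n\<rbrakk> \<Longrightarrow> h (i + n) (a \<odot>\<^bsub>X\<^esub> u) = a \<odot>\<^bsub>Y\<^esub> h n u"
    using h unfolding hhom_def by blast+
  have Gc: "a \<in> carrier R" if "a \<in> G i" for a i using RR.hc[of a i] that by simp
  have h0: "h n \<zero>\<^bsub>X\<^esub> = \<zero>\<^bsub>Y\<^esub>" for n
    using h_add[OF X.h0 X.h0, of n] Y.hc[OF h_in[OF X.h0, of n]] by (metis X.M.l_zero X.M.zero_closed Y.M.add.r_cancel_one')
  define f where "f u = finsum Y (\<lambda>n. h n (gcomp X u n)) {n. gcomp X u n \<noteq> \<zero>\<^bsub>X\<^esub>}" for u
  have hg: "h n (gcomp X u n) \<in> carrier Y" if "u \<in> carrier X" for u n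
    using Y.hc h_in X.gcomp(1)[OF that] by blast
  have f_sup: "f u = finsum Y (\<lambda>n. h n (gcomp X u n)) A"
    if u: "u \<in> carrier X" and A: "finite A" "{n. gcomp X u n \<noteq> \<zero>\<^bsub>X\<^esub>} \<subseteq> A" for u A
    unfolding f_def by (rule Y.M.add.finprod_mono_neutral_cong_left) (use u A hg h0 in auto)
  have f_hom: "f u = h n u" if u: "u \<in> hcomp X n" for n u
  proof -
    have "f u = finsum Y (\<lambda>n. h n (gcomp X u n)) {n}"
      by (rule f_sup[OF X.hc[OF u]]) (auto simp: X.gcomp_hom[OF u])
    then show ?thesis using Y.hc[OF h_in[OF u]] by (simp add: X.gcomp_hom[OF u])
  qed
  have f_c: "f u \<in> carrier Y" if "u \<in> carrier X" for u
    unfolding f_def using hg[OF that] by auto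
  have f_add: "f (u \<oplus>\<^bsub>X\<^esub> v) = f u \<oplus>\<^bsub>Y\<^esub> f v" if u: "u \<in> carrier X" and v: "v \<in> carrier X" for u v
  proof -
    let ?A = "{n. gcomp X u n \<noteq> \<zero>\<^bsub>X\<^esub>} \<union> {n. gcomp X v n \<noteq> \<zero>\<^bsub>X\<^esub>}"
    have A: "finite ?A" using X.gcomp(2) u v by blast
    have "f (u \<oplus>\<^bsub>X\<^esub> v) = finsum Y (\<lambda>n. h n (gcomp X (u \<oplus>\<^bsub>X\<^esub> v) n)) ?A"
      by (rule f_sup) (use A u v in \<open>auto simp: X.gcomp_add\<close>)
    also have "\<dots> = finsum Y (\<lambda>n. h n (gcomp X u n) \<oplus>\<^bsub>Y\<^esub> h n (gcomp X v n)) ?A"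
      using u v by (simp add: X.gcomp_add h_add[OF X.gcomp(1) X.gcomp(1)])
    also have "\<dots> = f u \<oplus>\<^bsub>Y\<^esub> f v"
      using Y.M.finsum_addf[of "\<lambda>n. h n (gcomp X u n)" ?A "\<lambda>n. h n (gcomp X v n)"] hg u v f_sup[OF u A] f_sup[OF v A]
      by (simp add: Pi_def)
    finally show ?thesis .
  qed
  have f_sc1: "f (a \<odot>\<^bsub>X\<^esub> u) = a \<odot>\<^bsub>Y\<^esub> f u" if a: "a \<in> G i" and u: "u \<in> carrier X" for a i u
    using u
  proof (induction rule: X.graded_induct)
    case (hom n u)
    then show ?case using f_hom[OF X.hsmult[OF a hom refl]] f_hom[OF hom] h_sc[OF a hom] by simp
  next
    case (add u v)
    then show ?case using Gc[OF a] f_c by (simp add: X.smult_r_distr Y.smult_r_distr f_add)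
  qed
  have f_sc: "f (a \<odot>\<^bsub>X\<^esub> u) = a \<odot>\<^bsub>Y\<^esub> f u" if a: "a \<in> carrier R" and u: "u \<in> carrier X" for a u
  proof -
    have "a \<in> carrier (regular_module R G)" using a by simp
    then show ?thesis
    proof (induction rule: RR.graded_induct)
      case (hom n r) then show ?case using f_sc1 u by simp
    next
      case (add r r')
      then show ?case using u f_c by (simp add: X.smult_l_distr Y.smult_l_distr f_add)
    qed
  qed
  have "f \<in> graded_hom R X Y"
    by (rule graded_homI) (use f_c f_add f_sc f_hom h_in in auto)
  then show ?thesis using f_hom by blast
qed

lemma gr_shift_graded:
  assumes "is_graded_module R G E"
  shows "is_graded_module R G (gr_shift k E)"
proof -
  interpret E: graded_mod R G E using assms by (simp add: graded_mod_def)
  have m: "module R (gr_shift k E)" by (rule module_cong[OF E.module_axioms]) simp_all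
  show ?thesis
  proof (rule graded_moduleI[OF m, where prj = "\<lambda>n e. gcomp E e (n + k)"])
    have ag: "abelian_group (gr_shift k E)" using m by (simp add: module_def)
    show "additive_subgroup (hcomp (gr_shift k E) n) (gr_shift k E)" for n
      unfolding additive_subgroup_iff[OF ag] using E.hc E.h0 E.hadd E.hneg by auto
    show "finite {n. gcomp E e (n + k) \<noteq> \<zero>\<^bsub>gr_shift k E\<^esub>}" if "e \<in> carrier (gr_shift k E)" for e
    proof -
      have "finite ((\<lambda>n. n + k) -` {n. gcomp E e n \<noteq> \<zero>\<^bsub>E\<^esub>})"
        by (rule finite_vimageI) (use E.gcomp(2)[of e] that in \<open>auto simp: inj_def\<close>)
      then show ?thesis by (simp add: vimage_def)
    qed
    show "e = \<zero>\<^bsub>gr_shift k E\<^esub>" if "e \<in> carrier (gr_shift k E)" "\<And>n. gcomp E e (n + k) = \<zero>\<^bsub>gr_shift k E\<^esub>" for e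
    proof -
      have "gcomp E e n = \<zero>\<^bsub>E\<^esub>" for n using that(2)[of "n - k"] by simp
      then show ?thesis using E.gcomp_ext[of e] that(1) by simp
    qed
  qed (auto simp: E.gcomp(1) E.gcomp_add E.gcomp_hom E.hsmult)
qed

lemma gr_sub_simps [simp]:
  "carrier (gr_sub E H) = H" "add (gr_sub E H) = add E" "zero (gr_sub E H) = zero E"
  "smult (gr_sub E H) = smult E" "hcomp (gr_sub E H) n = hcomp E n \<inter> H"
  by (simp_all add: gr_sub_def)

lemma gr_sub_graded:
  assumes E: "is_graded_module R G E" and H: "submodule H R E"
    and hom: "\<And>e n. e \<in> H \<Longrightarrow> gcomp E e n \<in> H" and G: "\<And>n. G n \<subseteq> carrier R"
  shows "is_graded_module R G (gr_sub E H)"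
proof -
  interpret E: graded_mod R G E using E by (simp add: graded_mod_def)
  have Hs: "H \<subseteq> carrier E" "\<zero>\<^bsub>E\<^esub> \<in> H" "\<And>x y. \<lbrakk>x \<in> H; y \<in> H\<rbrakk> \<Longrightarrow> x \<oplus>\<^bsub>E\<^esub> y \<in> H"
    "\<And>a x. \<lbrakk>a \<in> carrier R; x \<in> H\<rbrakk> \<Longrightarrow> a \<odot>\<^bsub>E\<^esub> x \<in> H"
    using H unfolding submodule_iff[OF E.module_axioms] by auto
  have m: "module R (gr_sub E H)"
    by (rule module_cong[OF submodule.submodule_is_module[OF H E.module_axioms]]) simp_all
  interpret S: module R "gr_sub E H" by (rule m)
  have neg: "\<ominus>\<^bsub>gr_sub E H\<^esub> x = \<ominus>\<^bsub>E\<^esub> x" if "x \<in> H" for x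
    using S.M.l_neg[of x] S.M.a_inv_closed[of x] that Hs by (intro E.M.minus_equality[symmetric]) auto
  show ?thesis
  proof (rule graded_moduleI[OF m, where prj = "\<lambda>n e. gcomp E e n"])
    show "additive_subgroup (hcomp (gr_sub E H) n) (gr_sub E H)" for n
      unfolding additive_subgroup_iff[OF S.abelian_group_axioms]
      using E.hc E.h0 E.hadd E.hneg Hs neg S.M.a_inv_closed by auto
  qed (use Hs hom G in \<open>auto simp: E.gcomp subset_iff E.gcomp_add E.gcomp_hom E.hsmult intro: E.gcomp_ext\<close>)
qed

lemma gr_quot_simps [simp]:
  "carrier (gr_quot E H) = carrier (quot_module E H)" "add (gr_quot E H) = add (quot_module E H)"
  "zero (gr_quot E H) = zero (quot_module E H)" "smult (gr_quot E H) = smult (quot_module E H)"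
  "hcomp (gr_quot E H) n = (\<lambda>e. H +>\<^bsub>E\<^esub> e) ` hcomp E n"
  by (simp_all add: gr_quot_def module.extend_def graded_module.fields_def)

lemma gr_quot_graded:
  assumes E: "is_graded_module R G E" and H: "submodule H R E"
    and hom: "\<And>e n. e \<in> H \<Longrightarrow> gcomp E e n \<in> H" and G: "\<And>n. G n \<subseteq> carrier R"
  shows "is_graded_module R G (gr_quot E H)"
proof -
  interpret E: graded_mod R G E using E by (simp add: graded_mod_def)
  interpret Q: module_quot R E H by (rule module_quotI[OF E.module_axioms H])
  have m: "module R (gr_quot E H)" by (rule module_cong[OF Q.Q_module]) simp_all
  have ag: "abelian_group (gr_quot E H)" using m by (simp add: module_def)
  interpret QM: module R "gr_quot E H" by (rule m)
  \<comment> \<open>The component of an arbitrary representative. Two representatives differ by an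
    element of \<open>H\<close>, whose components lie in \<open>H\<close> again.\<close>
  define prj where "prj n C = H +>\<^bsub>E\<^esub> gcomp E (SOME e. e \<in> C) n" for n C
  have prj: "prj n (H +>\<^bsub>E\<^esub> e) = H +>\<^bsub>E\<^esub> gcomp E e n" if e: "e \<in> carrier E" for n e
  proof -
    let ?x = "SOME x. x \<in> H +>\<^bsub>E\<^esub> e"
    have "?x \<in> H +>\<^bsub>E\<^esub> e" using Q.coset_memI[OF e] by (rule someI)
    then obtain h where h: "h \<in> H" "?x = h \<oplus>\<^bsub>E\<^esub> e" using Q.coset_memD(1)[OF e] by blast
    have "gcomp E ?x n \<ominus>\<^bsub>E\<^esub> gcomp E e n = gcomp E h n"
      using Q.H_sub[OF h(1)] e E.gcomp_carrier by (simp add: h(2) E.gcomp_add a_minus_def E.M.a_assoc E.M.r_neg)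
    then have "H +>\<^bsub>E\<^esub> gcomp E ?x n = H +>\<^bsub>E\<^esub> gcomp E e n"
      using Q.coset_eq_iff[of "gcomp E ?x n" "gcomp E e n"] hom[OF h(1)] E.gcomp_carrier e h Q.H_sub by simp
    then show ?thesis by (simp add: prj_def)
  qed
  show ?thesis
  proof (rule graded_moduleI[OF m, where prj = prj])
    have neg: "\<ominus>\<^bsub>gr_quot E H\<^esub> (H +>\<^bsub>E\<^esub> e) = H +>\<^bsub>E\<^esub> (\<ominus>\<^bsub>E\<^esub> e)" if e: "e \<in> carrier E" for e
    proof (rule QM.M.minus_equality)
      show "(H +>\<^bsub>E\<^esub> (\<ominus>\<^bsub>E\<^esub> e)) \<oplus>\<^bsub>gr_quot E H\<^esub> (H +>\<^bsub>E\<^esub> e) = \<zero>\<^bsub>gr_quot E H\<^esub>"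
        using e by (simp add: Q.Q_add Q.Q_zero E.M.l_neg Q.coset_zero)
    qed (use e Q.Q_carrierI in auto)
    show "additive_subgroup (hcomp (gr_quot E H) n) (gr_quot E H)" for n
      unfolding additive_subgroup_iff[OF ag]
    proof (intro conjI ballI)
      show "\<zero>\<^bsub>gr_quot E H\<^esub> \<in> hcomp (gr_quot E H) n"
        using E.h0[of n] Q.coset_zero by (force simp: Q.Q_zero)
    qed (auto simp: Q.Q_carrierI E.hc Q.Q_add E.hadd neg E.hneg)
    show "a \<odot>\<^bsub>gr_quot E H\<^esub> e \<in> hcomp (gr_quot E H) (i + j)" if "a \<in> G i" "e \<in> hcomp (gr_quot E H) j" for i j a e
      using that G[of i] by (auto simp: Q.Q_smult E.hc subset_iff E.hsmult)
    show "prj n C \<in> hcomp (gr_quot E H) n" if "C \<in> carrier (gr_quot E H)" for n C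
      using that by (auto elim!: Q.Q_carrierE simp: prj E.gcomp(1))
    show "prj n (C \<oplus>\<^bsub>gr_quot E H\<^esub> C') = prj n C \<oplus>\<^bsub>gr_quot E H\<^esub> prj n C'"
      if "C \<in> carrier (gr_quot E H)" "C' \<in> carrier (gr_quot E H)" for n C C'
      using that by (auto elim!: Q.Q_carrierE simp: prj Q.Q_add E.gcomp_add E.gcomp_carrier)
    show "prj k C = (if k = n then C else \<zero>\<^bsub>gr_quot E H\<^esub>)" if "C \<in> hcomp (gr_quot E H) n" for n k C
      using that by (auto simp: prj E.hc E.gcomp_hom Q.Q_zero Q.coset_zero)
    show "finite {n. prj n C \<noteq> \<zero>\<^bsub>gr_quot E H\<^esub>}" if C: "C \<in> carrier (gr_quot E H)" for C
    proof -
      obtain e where e: "e \<in> carrier E" "C = H +>\<^bsub>E\<^esub> e" using C by (auto elim: Q.Q_carrierE)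
      have "{n. prj n C \<noteq> \<zero>\<^bsub>gr_quot E H\<^esub>} \<subseteq> {n. gcomp E e n \<noteq> \<zero>\<^bsub>E\<^esub>}"
        using e by (auto simp: prj Q.Q_zero Q.coset_zero)
      then show ?thesis using E.gcomp(2)[OF e(1)] finite_subset by blast
    qed
    show "C = \<zero>\<^bsub>gr_quot E H\<^esub>" if C: "C \<in> carrier (gr_quot E H)" and 0: "\<And>n. prj n C = \<zero>\<^bsub>gr_quot E H\<^esub>" for C
    proof -
      obtain e where e: "e \<in> carrier E" "C = H +>\<^bsub>E\<^esub> e" using C by (auto elim: Q.Q_carrierE)
      have "gcomp E e n \<in> H" for n
        using 0[of n] e Q.coset_eq_H_iff[OF E.gcomp_carrier[OF e(1)]] by (simp add: prj Q.Q_zero)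
      then have "e \<in> H" using E.sum_induct[OF e(1), of "\<lambda>x. x \<in> H"] Q.H_zero Q.H_add by blast
      then show ?thesis using e Q.coset_eq_H_iff[OF e(1)] by (simp add: Q.Q_zero)
    qed
  qed
qed

section \<open>The ascending chain condition for the Rees ring\<close>

context ring begin

lemma ideal_pow_ideal: "ideal J R \<Longrightarrow> ideal (ideal_pow R J n) R"
  by (induction n) (simp_all add: oneideal ideal_prod_is_ideal)

end

context cring begin

lemma idealD:
  assumes "ideal J R"
  shows "x \<in> J \<Longrightarrow> x \<in> carrier R" "\<zero> \<in> J" "\<lbrakk>x \<in> J; y \<in> J\<rbrakk> \<Longrightarrow> x \<oplus> y \<in> J"
    "x \<in> J \<Longrightarrow> \<ominus> x \<in> J" "\<lbrakk>a \<in> carrier R; x \<in> J\<rbrakk> \<Longrightarrow> a \<otimes> x \<in> J" "\<lbrakk>a \<in> carrier R; x \<in> J\<rbrakk> \<Longrightarrow> x \<otimes> a \<in> J"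
  using assms by (auto simp: ideal.Icarr ideal.I_l_closed ideal.I_r_closed additive_subgroup.zero_closed
      additive_subgroup.a_closed ideal.axioms(1) additive_subgroup.a_inv_closed abelian_group_axioms)

lemma ideal_pow_mult:
  assumes J: "ideal J R" and x: "x \<in> ideal_pow R J m" and y: "y \<in> ideal_pow R J n"
  shows "x \<otimes> y \<in> ideal_pow R J (m + n)"
  using x
proof (induction m arbitrary: x)
  case 0
  then show ?case using idealD(5)[OF ideal_pow_ideal[OF J] _ y] by simp
next
  case (Suc m)
  note pc = idealD(1)[OF ideal_pow_ideal[OF J]]
  have yc: "y \<in> carrier R" by (rule pc[OF y])
  have "x \<in> ideal_prod R J (ideal_pow R J m)" using Suc.prems by simp
  then have "x \<in> carrier R \<and> x \<otimes> y \<in> ideal_prod R J (ideal_pow R J (m + n))"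
  proof (induction x rule: ideal_prod.induct)
    case (prod i j)
    have "i \<in> carrier R" "j \<in> carrier R" using prod idealD(1)[OF J] pc by auto
    then show ?case using ideal_prod.prod[OF prod(1) Suc.IH[OF prod(2)], of R] yc by (simp add: m_assoc)
  next
    case (sum s1 s2)
    then show ?case using ideal_prod.sum yc by (auto simp: l_distr)
  qed
  then show ?case by simp
qed

lemma ideal_pow_mono:
  assumes J: "ideal J R"
  shows "m \<le> n \<Longrightarrow> ideal_pow R J n \<subseteq> ideal_pow R J m"
proof (induction n rule: dec_induct)
  case (step n)
  have "ideal_pow R J (Suc n) \<subseteq> ideal_pow R J n"
    using ideal_prod_inter[OF J ideal_pow_ideal[OF J]] by auto
  then show ?case using step by blast
qed simp

lemma ideal_pow_one: "ideal J R \<Longrightarrow> x \<in> J \<Longrightarrow> x \<in> ideal_pow R J (Suc 0)"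
  using ideal_prod.prod[of x J \<one> "carrier R" R] idealD(1)[of J x] by simp

lemma ideal_pow_nat_pow:
  assumes J: "ideal J R" and x: "x \<in> ideal_pow R J m"
  shows "x [^] (k::nat) \<in> ideal_pow R J (m * k)"
proof (induction k)
  case (Suc k)
  then show ?case using ideal_pow_mult[OF J Suc x] by (simp add: algebra_simps)
qed simp

text \<open>The graded algebra with components \<open>P n t^n\<close> is represented by its
  coefficient sets \<open>P n\<close> inside \<open>R\<close>, and homogeneous ideals likewise, so
  that all computations take place in \<open>R\<close>. The case \<open>J = P\<close> expresses that
  \<open>P\<close> is closed under sums and products.\<close>

definition graded_ideal :: "(nat \<Rightarrow> 'a set) \<Rightarrow> (nat \<Rightarrow> 'a set) \<Rightarrow> bool" where
  "graded_ideal P J \<longleftrightarrow> (\<forall>n. J n \<subseteq> P n \<and> \<zero> \<in> J n \<and> (\<forall>a\<in>J n. \<forall>b\<in>J n. a \<oplus> b \<in> J n)) \<and>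
     (\<forall>m n. \<forall>a\<in>P m. \<forall>b\<in>J n. a \<otimes> b \<in> J (m + n))"

definition graded_acc :: "(nat \<Rightarrow> 'a set) \<Rightarrow> bool" where
  "graded_acc P \<longleftrightarrow> (\<forall>J::nat \<Rightarrow> nat \<Rightarrow> 'a set. (\<forall>k. graded_ideal P (J k)) \<longrightarrow>
     (\<forall>k n. J k n \<subseteq> J (Suc k) n) \<longrightarrow> (\<exists>k0. \<forall>k\<ge>k0. J k = J k0))"

definition graded_algebra :: "(nat \<Rightarrow> 'a set) \<Rightarrow> bool" where
  "graded_algebra P \<longleftrightarrow> P 0 = carrier R \<and> graded_ideal P P \<and> (\<forall>n. P n \<subseteq> carrier R)"

text \<open>The subalgebra generated by \<open>P\<close> and an element \<open>y\<close> of degree one, in Horner form.\<close>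

primrec adjoin :: "(nat \<Rightarrow> 'a set) \<Rightarrow> 'a \<Rightarrow> nat \<Rightarrow> 'a set" where
  "adjoin P y 0 = P 0"
| "adjoin P y (Suc n) = {c \<oplus> y \<otimes> w | c w. c \<in> P (Suc n) \<and> w \<in> adjoin P y n}"

text \<open>The multiples of \<open>y\<close> in the Horner form, that is, the terms of positive
  order. As \<open>y\<close> is an element of \<open>R\<close> and not an indeterminate, the
  splitting of an element into a coefficient and a tail is not unique.\<close>

definition tail :: "(nat \<Rightarrow> 'a set) \<Rightarrow> 'a \<Rightarrow> nat \<Rightarrow> 'a set" where
  "tail P y n = (case n of 0 \<Rightarrow> {\<zero>} | Suc m \<Rightarrow> {y \<otimes> w | w. w \<in> adjoin P y m})"

lemma graded_idealD:
  assumes "graded_ideal P J"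
  shows "a \<in> J n \<Longrightarrow> a \<in> P n" "\<zero> \<in> J n" "\<lbrakk>a \<in> J n; b \<in> J n\<rbrakk> \<Longrightarrow> a \<oplus> b \<in> J n"
    "\<lbrakk>a \<in> P m; b \<in> J n; k = m + n\<rbrakk> \<Longrightarrow> a \<otimes> b \<in> J k"
  using assms unfolding graded_ideal_def by blast+

lemma graded_algebraD:
  assumes "graded_algebra P"
  shows "P 0 = carrier R" "graded_ideal P P" "a \<in> P n \<Longrightarrow> a \<in> carrier R"
  using assms unfolding graded_algebra_def by blast+

lemma graded_ideal_neg:
  assumes P: "graded_algebra P" and J: "graded_ideal P J" and a: "a \<in> J n"
  shows "\<ominus> a \<in> J n"
proof -
  have "(\<ominus> \<one>) \<otimes> a \<in> J n" by (rule graded_idealD(4)[OF J _ a, of _ 0]) (simp_all add: graded_algebraD(1)[OF P])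
  moreover have "a \<in> carrier R" using graded_algebraD(3)[OF P graded_idealD(1)[OF J a]] .
  ultimately show ?thesis by (simp add: l_minus)
qed

lemma adjoin_props:
  assumes P: "graded_algebra P" and y: "y \<in> carrier R"
  shows "u \<in> adjoin P y n \<Longrightarrow> u \<in> carrier R" "\<zero> \<in> adjoin P y n"
    "\<lbrakk>u \<in> adjoin P y n; v \<in> adjoin P y n\<rbrakk> \<Longrightarrow> u \<oplus> v \<in> adjoin P y n"
    "\<lbrakk>a \<in> P m; u \<in> adjoin P y n\<rbrakk> \<Longrightarrow> a \<otimes> u \<in> adjoin P y (m + n)"
    "c \<in> P n \<Longrightarrow> c \<in> adjoin P y n"
    "u \<in> adjoin P y n \<Longrightarrow> y \<otimes> u \<in> adjoin P y (Suc n)"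
proof -
  note PP = graded_idealD[OF graded_algebraD(2)[OF P]] and Pc = graded_algebraD(3)[OF P] and P0 = graded_algebraD(1)[OF P]
  show c: "u \<in> carrier R" if "u \<in> adjoin P y n" for u n
    using that Pc y by (induction n arbitrary: u) auto
  show z: "\<zero> \<in> adjoin P y n" for n
  proof (induction n)
    case (Suc n)
    have "\<zero> = \<zero> \<oplus> y \<otimes> \<zero>" using y by simp
    then show ?case using Suc PP(2)[of "Suc n"] by auto
  qed (simp add: P0)
  show "u \<oplus> v \<in> adjoin P y n" if "u \<in> adjoin P y n" "v \<in> adjoin P y n"
    using that
  proof (induction n arbitrary: u v)
    case (Suc n)
    obtain a w b t where h: "u = a \<oplus> y \<otimes> w" "a \<in> P (Suc n)" "w \<in> adjoin P y n" "v = b \<oplus> y \<otimes> t" "b \<in> P (Suc n)" "t \<in> adjoin P y n"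
      using Suc.prems by auto
    have "u \<oplus> v = (a \<oplus> b) \<oplus> y \<otimes> (w \<oplus> t)"
      using h Pc[OF h(2)] Pc[OF h(5)] c[OF h(3)] c[OF h(6)] y by (simp add: r_distr a_ac)
    then show ?case using Suc.IH[OF h(3,6)] PP(3)[OF h(2,5)] by auto
  qed (simp add: P0)
  show sub: "c \<in> adjoin P y n" if "c \<in> P n" for c n
  proof (cases n)
    case (Suc m)
    have "c = c \<oplus> y \<otimes> \<zero>" using that Pc y by simp
    then show ?thesis using that z[of m] Suc by auto
  qed (use that in simp)
  show "a \<otimes> u \<in> adjoin P y (m + n)" if a: "a \<in> P m" and u: "u \<in> adjoin P y n"
    using u
  proof (induction n arbitrary: u)
    case 0 then show ?case using sub PP(4)[OF a, of u 0] by simp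
  next
    case (Suc n)
    obtain b w where h: "u = b \<oplus> y \<otimes> w" "b \<in> P (Suc n)" "w \<in> adjoin P y n" using Suc.prems by auto
    have "a \<otimes> u = a \<otimes> b \<oplus> y \<otimes> (a \<otimes> w)"
      using h Pc[OF h(2)] Pc[OF a] c[OF h(3)] y by (simp add: r_distr m_lcomm)
    then show ?case using Suc.IH[OF h(3)] PP(4)[OF a h(2)] by auto
  qed
  show "y \<otimes> u \<in> adjoin P y (Suc n)" if "u \<in> adjoin P y n"
  proof -
    have "y \<otimes> u = \<zero> \<oplus> y \<otimes> u" using that c y by simp
    then show ?thesis using that PP(2)[of "Suc n"] by auto
  qed
qed

text \<open>Serves the generators adjoined before \<open>y\<close>: a multiplier of degree
  \<open>k\<close> on \<open>P\<close> remains one on the larger algebra.\<close>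

lemma adjoin_closed_mult:
  assumes P: "graded_algebra P" and y: "y \<in> carrier R"
    and mult: "\<And>n c. c \<in> P n \<Longrightarrow> z \<otimes> c \<in> P (k + n)" and z: "z \<in> carrier R"
    and u: "u \<in> adjoin P y n"
  shows "z \<otimes> u \<in> adjoin P y (k + n)"
  using u
proof (induction n arbitrary: u)
  case 0 then show ?case using mult[of u 0] adjoin_props(5)[OF P y] by simp
next
  case (Suc n)
  obtain b w where h: "u = b \<oplus> y \<otimes> w" "b \<in> P (Suc n)" "w \<in> adjoin P y n" using Suc.prems by auto
  have "z \<otimes> u = z \<otimes> b \<oplus> y \<otimes> (z \<otimes> w)"
    using h graded_algebraD(3)[OF P h(2)] adjoin_props(1)[OF P y h(3)] y z by (simp add: r_distr m_lcomm)
  then show ?case using Suc.IH[OF h(3)] mult[OF h(2)] by auto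
qed

lemma adjoin_mult:
  assumes P: "graded_algebra P" and y: "y \<in> carrier R"
    and u: "u \<in> adjoin P y m" and v: "v \<in> adjoin P y n"
  shows "u \<otimes> v \<in> adjoin P y (m + n)"
  using u
proof (induction m arbitrary: u)
  case 0
  then show ?case using adjoin_props(4)[OF P y _ v, of u 0] by simp
next
  case (Suc m)
  obtain b w where h: "u = b \<oplus> y \<otimes> w" "b \<in> P (Suc m)" "w \<in> adjoin P y m" using Suc.prems by auto
  have "u \<otimes> v = b \<otimes> v \<oplus> y \<otimes> (w \<otimes> v)"
    using h graded_algebraD(3)[OF P h(2)] adjoin_props(1)[OF P y h(3)] adjoin_props(1)[OF P y v] y by (simp add: l_distr m_assoc)
  moreover have "b \<otimes> v \<in> adjoin P y (Suc m + n)" by (rule adjoin_props(4)[OF P y h(2) v])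
  moreover have "y \<otimes> (w \<otimes> v) \<in> adjoin P y (Suc (m + n))" by (rule adjoin_props(6)[OF P y Suc.IH[OF h(3)]])
  ultimately show ?case using adjoin_props(3)[OF P y, of "b \<otimes> v" "Suc m + n" "y \<otimes> (w \<otimes> v)"] by (simp only: add_Suc)
qed

lemma adjoin_algebra:
  assumes P: "graded_algebra P" and y: "y \<in> carrier R"
  shows "graded_algebra (adjoin P y)"
  unfolding graded_algebra_def graded_ideal_def
  using adjoin_props[OF P y] adjoin_mult[OF P y] graded_algebraD(1)[OF P] by auto

lemma adjoin_decomp:
  assumes P: "graded_algebra P" and y: "y \<in> carrier R"
  shows "u \<in> adjoin P y n \<longleftrightarrow> (\<exists>c\<in>P n. \<exists>w\<in>tail P y n. u = c \<oplus> w)"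
proof (cases n)
  case 0 then show ?thesis using graded_algebraD(1)[OF P] by (auto simp: tail_def)
next
  case (Suc m) then show ?thesis by (auto simp: tail_def)
qed

lemma tail_props:
  assumes P: "graded_algebra P" and y: "y \<in> carrier R"
  shows "w \<in> tail P y n \<Longrightarrow> w \<in> carrier R" "\<zero> \<in> tail P y n"
    "\<lbrakk>w \<in> tail P y n; v \<in> tail P y n\<rbrakk> \<Longrightarrow> w \<oplus> v \<in> tail P y n"
    "w \<in> tail P y n \<Longrightarrow> \<ominus> w \<in> tail P y n"
    "\<lbrakk>a \<in> P m; w \<in> tail P y n\<rbrakk> \<Longrightarrow> a \<otimes> w \<in> tail P y (m + n)"
proof -
  note ap = adjoin_props[OF P y] and Pc = graded_algebraD(3)[OF P]
  show c: "w \<in> carrier R" if "w \<in> tail P y n" for w n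
    using that ap(1) y by (cases n) (auto simp: tail_def)
  show z: "\<zero> \<in> tail P y n" for n
  proof (cases n)
    case (Suc m)
    have "\<zero> = y \<otimes> \<zero>" using y by simp
    then show ?thesis using ap(2)[of m] Suc by (auto simp: tail_def)
  qed (simp add: tail_def)
  show "w \<oplus> v \<in> tail P y n" if wv: "w \<in> tail P y n" "v \<in> tail P y n"
  proof (cases n)
    case (Suc m)
    then obtain w' v' where "w = y \<otimes> w'" "w' \<in> adjoin P y m" "v = y \<otimes> v'" "v' \<in> adjoin P y m"
      using wv by (auto simp: tail_def)
    moreover from this have "w \<oplus> v = y \<otimes> (w' \<oplus> v')" using ap(1) y by (simp add: r_distr)
    ultimately show ?thesis using ap(3) Suc by (auto simp: tail_def)
  qed (use wv in \<open>simp add: tail_def\<close>)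
  show t: "a \<otimes> w \<in> tail P y (m + n)" if a: "a \<in> P m" and w: "w \<in> tail P y n" for a w m n
  proof (cases n)
    case 0
    then show ?thesis using w Pc[OF a] z[of m] by (simp add: tail_def[of _ _ 0])
  next
    case (Suc k)
    then obtain w' where w': "w = y \<otimes> w'" "w' \<in> adjoin P y k" using w by (auto simp: tail_def)
    then have "a \<otimes> w = y \<otimes> (a \<otimes> w')" using ap(1) y Pc[OF a] by (simp add: m_lcomm)
    then show ?thesis using ap(4)[OF a w'(2)] Suc by (auto simp: tail_def)
  qed
  show "\<ominus> w \<in> tail P y n" if w: "w \<in> tail P y n"
    using t[of "\<ominus> \<one>" 0 w n] w c[OF w] graded_algebraD(1)[OF P] by (simp add: l_minus)
qed

text \<open>The analogue of the leading coefficient ideals in Hilbert's proof, for elements of order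
  at least \<open>i\<close> in \<open>y\<close>. The degree \<open>i + n\<close> reflects that
  \<open>y\<close> has degree one.\<close>

definition lowest :: "(nat \<Rightarrow> 'a set) \<Rightarrow> 'a \<Rightarrow> nat \<Rightarrow> (nat \<Rightarrow> 'a set) \<Rightarrow> nat \<Rightarrow> 'a set" where
  "lowest P y i J n = {c \<in> P n. \<exists>w\<in>tail P y n. y [^] i \<otimes> (c \<oplus> w) \<in> J (i + n)}"

lemma lowest_ideal:
  assumes P: "graded_algebra P" and y: "y \<in> carrier R" and J: "graded_ideal (adjoin P y) J"
  shows "graded_ideal P (lowest P y i J)"
proof -
  note PP = graded_idealD[OF graded_algebraD(2)[OF P]] and Pc = graded_algebraD(3)[OF P]
    and tp = tail_props[OF P y] and Jd = graded_idealD[OF J]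
  have "a \<oplus> b \<in> lowest P y i J n" if ab: "a \<in> lowest P y i J n" "b \<in> lowest P y i J n" for a b n
  proof -
    obtain w v where h: "a \<in> P n" "w \<in> tail P y n" "y [^] i \<otimes> (a \<oplus> w) \<in> J (i + n)"
      "b \<in> P n" "v \<in> tail P y n" "y [^] i \<otimes> (b \<oplus> v) \<in> J (i + n)"
      using ab unfolding lowest_def by blast
    have "y [^] i \<otimes> ((a \<oplus> b) \<oplus> (w \<oplus> v)) = y [^] i \<otimes> (a \<oplus> w) \<oplus> y [^] i \<otimes> (b \<oplus> v)"
      using y Pc[OF h(1)] Pc[OF h(4)] tp(1)[OF h(2)] tp(1)[OF h(5)] by (simp add: r_distr a_ac)
    then have "y [^] i \<otimes> ((a \<oplus> b) \<oplus> (w \<oplus> v)) \<in> J (i + n)" using Jd(3)[OF h(3,6)] by simp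
    then show ?thesis unfolding lowest_def using PP(3)[OF h(1,4)] tp(3)[OF h(2,5)] by blast
  qed
  moreover have "\<zero> \<in> lowest P y i J n" for n
  proof -
    have "y [^] i \<otimes> (\<zero> \<oplus> \<zero>) \<in> J (i + n)" using y Jd(2) by simp
    then show ?thesis unfolding lowest_def using PP(2) tp(2) by blast
  qed
  moreover have "a \<otimes> b \<in> lowest P y i J (m + n)" if a: "a \<in> P m" and b: "b \<in> lowest P y i J n" for a b m n
  proof -
    obtain w where h: "b \<in> P n" "w \<in> tail P y n" "y [^] i \<otimes> (b \<oplus> w) \<in> J (i + n)"
      using b unfolding lowest_def by blast
    have "a \<otimes> (y [^] i \<otimes> (b \<oplus> w)) \<in> J (i + (m + n))"
      by (rule Jd(4)[OF adjoin_props(5)[OF P y a] h(3)]) simp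
    moreover have "a \<otimes> (y [^] i \<otimes> (b \<oplus> w)) = y [^] i \<otimes> (a \<otimes> b \<oplus> a \<otimes> w)"
      using y Pc[OF h(1)] Pc[OF a] tp(1)[OF h(2)] by (simp add: r_distr m_lcomm)
    ultimately show ?thesis unfolding lowest_def using PP(4)[OF a h(1) refl] tp(5)[OF a h(2)] by auto
  qed
  ultimately show ?thesis unfolding graded_ideal_def by (auto simp: lowest_def)
qed

lemma lowest_Suc:
  assumes P: "graded_algebra P" and y: "y \<in> carrier R" and J: "graded_ideal (adjoin P y) J"
  shows "lowest P y i J n \<subseteq> lowest P y (Suc i) J n"
proof
  fix c assume "c \<in> lowest P y i J n"
  then obtain w where h: "c \<in> P n" "w \<in> tail P y n" "y [^] i \<otimes> (c \<oplus> w) \<in> J (i + n)"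
    unfolding lowest_def by blast
  have "y \<otimes> \<one> \<in> adjoin P y (Suc 0)" using adjoin_props(6)[OF P y, of \<one> 0] graded_algebraD(1)[OF P] by simp
  then have "y \<otimes> (y [^] i \<otimes> (c \<oplus> w)) \<in> J (Suc i + n)"
    using y by (intro graded_idealD(4)[OF J _ h(3), of _ "Suc 0"]) auto
  moreover have "y \<otimes> (y [^] i \<otimes> (c \<oplus> w)) = y [^] Suc i \<otimes> (c \<oplus> w)"
    using y graded_algebraD(3)[OF P h(1)] tail_props(1)[OF P y h(2)] by (simp add: m_ac)
  ultimately show "c \<in> lowest P y (Suc i) J n" unfolding lowest_def using h by auto
qed

text \<open>From \<open>y^i u\<close> in \<open>J'\<close> subtract an element
  \<open>y^i (c + w')\<close> of \<open>J\<close> with the same lowest coefficient; what remains is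
  \<open>y^(i+1) v\<close> with \<open>v\<close> of smaller degree than \<open>u\<close>. The degree
  of the cofactor bounds the number of such steps, and in degree 0 there is no tail left.\<close>

lemma lowest_determines:
  assumes P: "graded_algebra P" and y: "y \<in> carrier R"
    and J: "graded_ideal (adjoin P y) J" and J': "graded_ideal (adjoin P y) J'"
    and le: "\<And>n. J n \<subseteq> J' n" and low: "\<And>i n. lowest P y i J' n \<subseteq> lowest P y i J n"
  shows "J = J'"
proof -
  note Pc = graded_algebraD(3)[OF P] and tp = tail_props[OF P y]
  have *: "y [^] i \<otimes> u \<in> J (i + n)" if "u \<in> adjoin P y n" "y [^] i \<otimes> u \<in> J' (i + n)" for i n u
    using that
  proof (induction n arbitrary: i u)
    case n: 0
    obtain c where c: "c \<in> P 0" "u = c \<oplus> \<zero>" using n(1) adjoin_decomp[OF P y, of u 0] by (auto simp: tail_def)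
    then have "c \<in> lowest P y i J' 0" using n(2) unfolding lowest_def by (auto simp: tail_def)
    then have "c \<in> lowest P y i J 0" using low by blast
    then show ?case using c by (auto simp: lowest_def tail_def)
  next
    case (Suc m)
    obtain c w where c: "c \<in> P (Suc m)" "w \<in> tail P y (Suc m)" "u = c \<oplus> w"
      using Suc.prems(1) adjoin_decomp[OF P y] by blast
    then have "c \<in> lowest P y i J' (Suc m)" using Suc.prems(2) unfolding lowest_def by blast
    then obtain w' where w': "w' \<in> tail P y (Suc m)" "y [^] i \<otimes> (c \<oplus> w') \<in> J (i + Suc m)"
      using low unfolding lowest_def by blast
    have "w \<oplus> \<ominus> w' \<in> tail P y (Suc m)" using tp(3,4) c w' by blast
    then obtain v where v: "v \<in> adjoin P y m" "w \<oplus> \<ominus> w' = y \<otimes> v" by (auto simp: tail_def)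
    have car: "c \<in> carrier R" "w \<in> carrier R" "w' \<in> carrier R" "v \<in> carrier R" "y [^] i \<in> carrier R"
      using Pc[OF c(1)] tp(1)[OF c(2)] tp(1)[OF w'(1)] adjoin_props(1)[OF P y v(1)] y by auto
    have yv: "y [^] Suc i \<otimes> v = y [^] i \<otimes> (w \<oplus> \<ominus> w')" using car y v by (simp add: m_assoc)
    have "u \<oplus> \<ominus> (c \<oplus> w') = (w \<oplus> \<ominus> w') \<oplus> (c \<oplus> \<ominus> c)"
      using car by (simp add: c minus_add a_ac)
    then have eq: "u \<oplus> \<ominus> (c \<oplus> w') = w \<oplus> \<ominus> w'" using car by (simp add: r_neg)
    have e2: "y [^] i \<otimes> (w \<oplus> \<ominus> w') = y [^] i \<otimes> u \<oplus> \<ominus> (y [^] i \<otimes> (c \<oplus> w'))"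
      unfolding eq[symmetric] using car c by (simp add: r_distr r_minus)
    then have "y [^] Suc i \<otimes> v \<in> J' (Suc i + m)"
      unfolding yv using graded_idealD(3)[OF J' Suc.prems(2) graded_ideal_neg[OF adjoin_algebra[OF P y] J']] w'(2) le
      by (metis add_Suc add_Suc_right subsetD)
    then have "y [^] i \<otimes> (w \<oplus> \<ominus> w') \<in> J (i + Suc m)"
      using Suc.IH[OF v(1), of "Suc i"] unfolding yv by simp
    then have "y [^] i \<otimes> (c \<oplus> w') \<oplus> y [^] i \<otimes> (w \<oplus> \<ominus> w') \<in> J (i + Suc m)"
      by (rule graded_idealD(3)[OF J w'(2)])
    moreover have "y [^] i \<otimes> (c \<oplus> w') \<oplus> y [^] i \<otimes> (w \<oplus> \<ominus> w') = y [^] i \<otimes> u"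
      unfolding e2
    proof -
      have "x \<oplus> (z \<oplus> \<ominus> x) = z" if "x \<in> carrier R" "z \<in> carrier R" for x z
        using that by (metis a_inv_closed a_lcomm r_neg r_zero)
      then show "y [^] i \<otimes> (c \<oplus> w') \<oplus> (y [^] i \<otimes> u \<oplus> \<ominus> (y [^] i \<otimes> (c \<oplus> w'))) = y [^] i \<otimes> u"
        using car c by simp
    qed
    ultimately show ?case by simp
  qed
  have "u \<in> J n" if "u \<in> J' n" for u n
  proof -
    have "u \<in> adjoin P y n" by (rule graded_idealD(1)[OF J' that])
    then show ?thesis using *[of u n 0] that adjoin_props(1)[OF P y] by simp
  qed
  then show ?thesis using le by blast
qed

text \<open>Hilbert's basis theorem for \<open>P[y]\<close>, with coefficients of lowest instead of highest order in \<open>y\<close>.\<close>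

theorem adjoin_acc:
  assumes P: "graded_algebra P" and y: "y \<in> carrier R" and acc: "graded_acc P"
  shows "graded_acc (adjoin P y)"
  unfolding graded_acc_def
proof (intro allI impI)
  fix J :: "nat \<Rightarrow> nat \<Rightarrow> 'a set"
  assume "\<forall>k. graded_ideal (adjoin P y) (J k)" and Jmono: "\<forall>k n. J k n \<subseteq> J (Suc k) n"
  then have J: "graded_ideal (adjoin P y) (J k)" for k by blast
  have Jle: "J k n \<subseteq> J l n" if "k \<le> l" for k l n
    by (rule lift_Suc_mono_le[of "\<lambda>k. J k n", OF _ that]) (use Jmono in blast)
  define C where "C i k = lowest P y i (J k)" for i k
  have Cid: "graded_ideal P (C i k)" for i k unfolding C_def by (rule lowest_ideal[OF P y J])
  have C1: "C i k n \<subseteq> C j k n" if "i \<le> j" for i j k n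
    unfolding C_def by (rule lift_Suc_mono_le[of "\<lambda>i. lowest P y i (J k) n", OF lowest_Suc[OF P y J] that])
  have C2: "C i k n \<subseteq> C i l n" if "k \<le> l" for i k l n
    using Jle[OF that] unfolding C_def lowest_def by blast
  have C12: "C i k n \<subseteq> C j l n" if "i \<le> j" "k \<le> l" for i j k l n
    using C1[OF that(1)] C2[OF that(2)] by blast
  have st: "\<exists>k0. \<forall>k\<ge>k0. f k = f k0" if "\<And>k. graded_ideal P (f k)" "\<And>k n. f k n \<subseteq> f (Suc k) n" for f
    using acc that unfolding graded_acc_def by blast
  \<comment> \<open>The array \<open>C i k\<close> grows in both indices, so its diagonal is an
    ascending chain, stationary from \<open>k1\<close> on.\<close>
  obtain k1 where k1: "\<And>k. k \<ge> k1 \<Longrightarrow> C k k = C k1 k1"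
    using st[of "\<lambda>k. C k k"] Cid C12 by (metis le_SucI order_refl)
  have "\<exists>m. \<forall>k\<ge>m. C i k = C i m" for i
    using st[of "\<lambda>k. C i k"] Cid C12 by (metis le_SucI order_refl)
  then obtain m where m: "\<And>i k. k \<ge> m i \<Longrightarrow> C i k = C i (m i)" by metis
  \<comment> \<open>The finitely many rows with \<open>i < k1\<close> are stationary from
    \<open>m i\<close> on. In the rows with \<open>i \<ge> k1\<close>, every entry from column
    \<open>k1\<close> on lies between \<open>C k1 k1\<close> and a later diagonal entry, which are
    equal.\<close>
  define k0 where "k0 = Max (insert k1 (m ` {..<k1}))"
  have k0: "k1 \<le> k0" "\<And>i. i < k1 \<Longrightarrow> m i \<le> k0" unfolding k0_def by (auto intro!: Max_ge)
  have "J k = J k0" if k: "k \<ge> k0" for k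
  proof (rule sym, rule lowest_determines[OF P y J J Jle[OF k]])
    fix i n
    show "lowest P y i (J k) n \<subseteq> lowest P y i (J k0) n"
    proof (cases "i < k1")
      case True
      then have "C i k = C i k0" using m[of i k] m[of i k0] k0(2)[OF True] k by simp
      then show ?thesis by (simp add: C_def)
    next
      case False
      have "C i k n \<subseteq> C (max i k) (max i k) n" by (rule C12) auto
      also have "\<dots> = C k1 k1 n" using k1[of "max i k"] False by simp
      also have "\<dots> \<subseteq> C i k0 n" by (rule C12) (use False k0 in auto)
      finally show ?thesis by (simp add: C_def)
    qed
  qed
  then show "\<exists>k0. \<forall>k\<ge>k0. J k = J k0" by blast
qed

text \<open>A union that is itself a member of the chain is its largest member, and from that member
  on the chain is constant.\<close>

lemma noetherian_chain:
  fixes J :: "nat \<Rightarrow> 'a set"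
  assumes N: "noetherian_ring R" and J: "\<And>k. ideal (J k) R" and mono: "\<And>k. J k \<subseteq> J (Suc k)"
  shows "\<exists>k0. \<forall>k\<ge>k0. J k = J k0"
proof -
  have le: "J k \<subseteq> J l" if "k \<le> l" for k l by (rule lift_Suc_mono_le[of J, OF mono that])
  have "\<Union>(range J) \<in> range J"
  proof (rule noetherian_ring.ideal_chain_is_trivial[OF N])
    show "subset.chain {I. ideal I R} (range J)"
      unfolding subset_chain_def using J le by (auto, metis nat_le_linear subsetD)
  qed simp
  then obtain k0 where "\<Union>(range J) = J k0" by blast
  then have "J k = J k0" if "k \<ge> k0" for k using le[OF that] by blast
  then show ?thesis by blast
qed

definition base_algebra :: "nat \<Rightarrow> 'a set" where
  "base_algebra n = (if n = 0 then carrier R else {\<zero>})"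

lemma base_algebra: "graded_algebra base_algebra"
  unfolding graded_algebra_def graded_ideal_def base_algebra_def by auto

lemma base_acc:
  assumes N: "noetherian_ring R"
  shows "graded_acc base_algebra"
  unfolding graded_acc_def
proof (intro allI impI)
  fix J :: "nat \<Rightarrow> nat \<Rightarrow> 'a set"
  assume "\<forall>k. graded_ideal base_algebra (J k)" and mono: "\<forall>k n. J k n \<subseteq> J (Suc k) n"
  then have J: "graded_ideal base_algebra (J k)" for k by blast
  have "ideal (J k 0) R" for k
  proof (rule idealI)
    show "subgroup (J k 0) (add_monoid R)"
      using graded_idealD(1)[OF J[of k], of _ 0] graded_idealD(2,3)[OF J[of k]] graded_ideal_neg[OF base_algebra J[of k]]
      by (auto simp: subgroup_def base_algebra_def a_inv_def[symmetric])
    fix a x assume a: "a \<in> J k 0" "x \<in> carrier R"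
    show "x \<otimes> a \<in> J k 0" using graded_idealD(4)[OF J[of k], of x 0 a 0] a by (simp add: base_algebra_def)
    moreover have "a \<in> carrier R" using graded_idealD(1)[OF J[of k] a(1)] by (simp add: base_algebra_def)
    ultimately show "a \<otimes> x \<in> J k 0" using a by (simp add: m_comm)
  qed (rule ring_axioms)
  then obtain k0 where k0: "\<And>k. k \<ge> k0 \<Longrightarrow> J k 0 = J k0 0"
    using noetherian_chain[OF N, of "\<lambda>k. J k 0"] mono by blast
  have "J k n = {\<zero>}" if "n > 0" for k n
  proof -
    have "J k n \<subseteq> base_algebra n" "\<zero> \<in> J k n" using graded_idealD(1,2)[OF J[of k]] by blast+
    then show ?thesis using that by (auto simp: base_algebra_def)
  qed
  then have "J k = J k0" if "k \<ge> k0" for k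
    using k0[OF that] by (intro ext) (metis neq0_conv)
  then show "\<exists>k0. \<forall>k\<ge>k0. J k = J k0" by blast
qed

text \<open>In coefficients, the algebra generated over \<open>R\<close> by the elements
  \<open>y t\<close> with \<open>y\<close> in \<open>xs\<close>. The head of the list is adjoined
  last.\<close>

definition adjoin_list :: "'a list \<Rightarrow> nat \<Rightarrow> 'a set" where
  "adjoin_list xs = foldr (\<lambda>y P. adjoin P y) xs base_algebra"

text \<open>The last two facts are made for the two inclusions between \<open>adjoin_list xs\<close>
  and the powers of an ideal generated by \<open>xs\<close>.\<close>

lemma adjoin_list_props:
  assumes "set xs \<subseteq> carrier R"
  shows "graded_algebra (adjoin_list xs)" "noetherian_ring R \<Longrightarrow> graded_acc (adjoin_list xs)"
    "\<lbrakk>y \<in> set xs; u \<in> adjoin_list xs n\<rbrakk> \<Longrightarrow> y \<otimes> u \<in> adjoin_list xs (Suc n)"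
    "\<lbrakk>ideal I R; set xs \<subseteq> I; u \<in> adjoin_list xs n\<rbrakk> \<Longrightarrow> u \<in> ideal_pow R I n"
  using assms
proof (induction xs arbitrary: u n)
  case Nil
  { case 1 show ?case by (simp add: adjoin_list_def base_algebra) }
  { case 2 then show ?case by (simp add: adjoin_list_def base_acc) }
  { case 3 then show ?case by simp }
  { case 4 then show ?case
      using idealD(2)[OF ideal_pow_ideal] by (cases n) (auto simp: adjoin_list_def base_algebra_def simp del: ideal_pow.simps(2)) }
next
  case (Cons x xs)
  have e: "adjoin_list (x # xs) = adjoin (adjoin_list xs) x" by (simp add: adjoin_list_def)
  have xs: "set xs \<subseteq> carrier R" "x \<in> carrier R" if "set (x # xs) \<subseteq> carrier R" using that by auto
  { case 1 then show ?case unfolding e using Cons.IH(1) adjoin_algebra by auto }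
  { case 2 then show ?case unfolding e using Cons.IH(1,2) adjoin_acc by auto }
  { case 3
    have P: "graded_algebra (adjoin_list xs)" using Cons.IH(1) 3 by auto
    show ?case
    proof (cases "y = x")
      case True
      then show ?thesis using 3 adjoin_props(6)[OF P] unfolding e by auto
    next
      case False
      then have y: "y \<in> set xs" using 3 by auto
      have "y \<otimes> c \<in> adjoin_list xs (1 + n)" if "c \<in> adjoin_list xs n" for c n
        using Cons.IH(3)[OF y that] 3 by simp
      then have "y \<otimes> u \<in> adjoin (adjoin_list xs) x (1 + n)"
        using 3 y unfolding e by (intro adjoin_closed_mult[OF P]) auto
      then show ?thesis unfolding e by simp
    qed }
  { case 4
    have P: "graded_algebra (adjoin_list xs)" using Cons.IH(1) 4 by auto
    have IH: "c \<in> ideal_pow R I n" if "c \<in> adjoin_list xs n" for c n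
      using Cons.IH(4)[OF _ _ that] 4 by auto
    have "u \<in> ideal_pow R I n" if "u \<in> adjoin (adjoin_list xs) x n" for u n
      using that
    proof (induction n arbitrary: u)
      case 0 then show ?case using IH[of u 0] by simp
    next
      case (Suc n)
      obtain b w where h: "u = b \<oplus> x \<otimes> w" "b \<in> adjoin_list xs (Suc n)" "w \<in> adjoin (adjoin_list xs) x n"
        using Suc.prems by auto
      have "x \<in> I" using 4 by auto
      then have "x \<otimes> w \<in> ideal_pow R I (Suc n)" using Suc.IH[OF h(3)] by (simp add: ideal_prod.prod)
      then show ?case unfolding h(1) using IH[OF h(2)] idealD(3)[OF ideal_pow_ideal[OF 4(1)]] by blast
    qed
    then show ?case using 4 unfolding e by blast }
qed

text \<open>The Rees ring is generated over degree 0 by the elements \<open>y t\<close> for finitely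
  many generators \<open>y\<close> of \<open>I\<close>. So its coefficient sets are those of
  \<open>adjoin_list\<close>, to which the basis theorem applies once per generator.\<close>

theorem ideal_pow_acc:
  assumes N: "noetherian_ring R" and I: "ideal I R"
  shows "graded_acc (ideal_pow R I)"
proof -
  obtain S where S: "S \<subseteq> carrier R" "finite S" "I = Idl S"
    using noetherian_ring.finetely_gen[OF N I] by blast
  obtain xs where xs: "set xs = S" using S(2) finite_list by blast
  have xc: "set xs \<subseteq> carrier R" using S xs by simp
  note al = adjoin_list_props[OF xc]
  have SI: "set xs \<subseteq> I" using genideal_self[OF S(1)] S xs by simp
  have "a \<in> adjoin_list xs n" if "a \<in> ideal_pow R I n" for a n
    using that
  proof (induction n arbitrary: a)
    case 0 then show ?case using graded_algebraD(1)[OF al(1)] by simp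
  next
    case (Suc n)
    note ga = graded_idealD[OF graded_algebraD(2)[OF al(1)]] and gc = graded_algebraD(3)[OF al(1)]
      and gneg = graded_ideal_neg[OF al(1) graded_algebraD(2)[OF al(1)]]
    have *: "i \<otimes> j \<in> adjoin_list xs (Suc n)" if i: "i \<in> I" and j: "j \<in> adjoin_list xs n" for i j
    proof -
      have jc: "j \<in> carrier R" by (rule gc[OF j])
      \<comment> \<open>The multipliers of \<open>j\<close> into the next degree form an ideal; it
        contains the generators of \<open>I\<close> and hence \<open>I\<close>.\<close>
      let ?K = "{i \<in> carrier R. i \<otimes> j \<in> adjoin_list xs (Suc n)}"
      have "ideal ?K R"
      proof (rule idealI)
        show "subgroup ?K (add_monoid R)"
          using ga(2,3) gneg jc by (auto simp: subgroup_def l_distr l_minus a_inv_def[symmetric])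
        fix a x assume a: "a \<in> ?K" "x \<in> carrier R"
        have "x \<otimes> (a \<otimes> j) \<in> adjoin_list xs (Suc n)"
          using a graded_algebraD(1)[OF al(1)] by (intro ga(4)[of x 0]) auto
        then show "x \<otimes> a \<in> ?K" using a jc by (simp add: m_assoc)
        then show "a \<otimes> x \<in> ?K" using a by (simp add: m_comm)
      qed (rule ring_axioms)
      moreover have "S \<subseteq> ?K" using al(3)[OF _ j] xs S by auto
      ultimately have "I \<subseteq> ?K" using genideal_minimal S(3) by blast
      then show ?thesis using i by blast
    qed
    have "a \<in> ideal_prod R I (ideal_pow R I n)" using Suc.prems by simp
    then show ?case
      by (induction a rule: ideal_prod.induct) (use * Suc.IH ga(3) in auto)
  qed
  then have "ideal_pow R I = adjoin_list xs" using al(4)[OF I SI] by (intro ext) blast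
  then show ?thesis using al(2)[OF N] by simp
qed

end

section \<open>Torsion with respect to homogeneous generators\<close>

lemma torsion_iff:
  "e \<in> torsion R J E \<longleftrightarrow> e \<in> carrier E \<and> (\<exists>n. \<forall>a\<in>ideal_pow R J n. a \<odot>\<^bsub>E\<^esub> e = \<zero>\<^bsub>E\<^esub>)"
  by (simp add: torsion_def)

context module begin

lemma torsion_submodule:
  assumes J: "ideal J R"
  shows "submodule (torsion R J M) R M"
  unfolding submodule_iff[OF module_axioms]
proof (intro conjI ballI)
  note pc = R.idealD(1)[OF R.ideal_pow_ideal[OF J]]
  show "torsion R J M \<subseteq> carrier M" by (auto simp: torsion_iff)
  show "\<zero>\<^bsub>M\<^esub> \<in> torsion R J M" using pc by (auto simp: torsion_iff)
  fix u assume u: "u \<in> torsion R J M"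
  then obtain k where k: "u \<in> carrier M" "\<And>a. a \<in> ideal_pow R J k \<Longrightarrow> a \<odot>\<^bsub>M\<^esub> u = \<zero>\<^bsub>M\<^esub>" by (auto simp: torsion_iff)
  show "u \<oplus>\<^bsub>M\<^esub> v \<in> torsion R J M" if v: "v \<in> torsion R J M" for v
  proof -
    obtain l where l: "v \<in> carrier M" "\<And>a. a \<in> ideal_pow R J l \<Longrightarrow> a \<odot>\<^bsub>M\<^esub> v = \<zero>\<^bsub>M\<^esub>" using v by (auto simp: torsion_iff)
    have "a \<odot>\<^bsub>M\<^esub> (u \<oplus>\<^bsub>M\<^esub> v) = \<zero>\<^bsub>M\<^esub>" if a: "a \<in> ideal_pow R J (max k l)" for a
    proof -
      have "a \<in> ideal_pow R J k" "a \<in> ideal_pow R J l"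
        using R.ideal_pow_mono[OF J, of k "max k l"] R.ideal_pow_mono[OF J, of l "max k l"] a by auto
      then show ?thesis using k l pc[OF a] by (simp add: smult_r_distr)
    qed
    then show ?thesis using k l unfolding torsion_iff by blast
  qed
  fix a assume a: "a \<in> carrier R"
  have "b \<odot>\<^bsub>M\<^esub> (a \<odot>\<^bsub>M\<^esub> u) = \<zero>\<^bsub>M\<^esub>" if b: "b \<in> ideal_pow R J k" for b
  proof -
    have "b \<odot>\<^bsub>M\<^esub> (a \<odot>\<^bsub>M\<^esub> u) = a \<odot>\<^bsub>M\<^esub> (b \<odot>\<^bsub>M\<^esub> u)"
      using pc[OF b] a k(1) by (simp add: R.m_comm flip: smult_assoc1)
    then show ?thesis using k(2)[OF b] a by simp
  qed
  then show "a \<odot>\<^bsub>M\<^esub> u \<in> torsion R J M" using a k(1) unfolding torsion_iff by blast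
qed

text \<open>With \<open>N\<close> the largest of the exponents for the finitely many generators,
  \<open>J^N\<close> annihilates \<open>J e\<close>, so \<open>J^(N+1)\<close> annihilates
  \<open>e\<close>.\<close>

lemma torsion_generators:
  assumes S: "finite S" "S \<subseteq> carrier R" and J: "J = Idl S" and e: "e \<in> carrier M"
    and Se: "\<And>s. s \<in> S \<Longrightarrow> s \<odot>\<^bsub>M\<^esub> e \<in> torsion R J M"
  shows "e \<in> torsion R J M"
proof -
  have Ji: "ideal J R" unfolding J by (rule R.genideal_ideal[OF S(2)])
  note pc = R.idealD(1)[OF R.ideal_pow_ideal[OF Ji]]
  have "\<forall>s\<in>S. \<exists>n. \<forall>a\<in>ideal_pow R J n. a \<odot>\<^bsub>M\<^esub> (s \<odot>\<^bsub>M\<^esub> e) = \<zero>\<^bsub>M\<^esub>" using Se by (simp add: torsion_iff)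
  then obtain f where f: "\<And>s a. \<lbrakk>s \<in> S; a \<in> ideal_pow R J (f s)\<rbrakk> \<Longrightarrow> a \<odot>\<^bsub>M\<^esub> (s \<odot>\<^bsub>M\<^esub> e) = \<zero>\<^bsub>M\<^esub>" by metis
  define N where "N = Max (insert 0 (f ` S))"
  have N: "f s \<le> N" if "s \<in> S" for s unfolding N_def using S that by (intro Max_ge) auto
  define K where "K = {r \<in> carrier R. \<forall>a\<in>ideal_pow R J N. a \<odot>\<^bsub>M\<^esub> (r \<odot>\<^bsub>M\<^esub> e) = \<zero>\<^bsub>M\<^esub>}"
  have "ideal K R"
  proof (rule idealI)
    show "subgroup K (add_monoid R)"
      using e pc by (auto simp: K_def subgroup_def smult_l_distr smult_r_distr smult_l_minus smult_r_minus
          a_inv_def[symmetric] M.minus_equality)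
    fix r x assume r: "r \<in> K" "x \<in> carrier R"
    have rc: "r \<in> carrier R" using r by (simp add: K_def)
    have "a \<odot>\<^bsub>M\<^esub> ((x \<otimes> r) \<odot>\<^bsub>M\<^esub> e) = \<zero>\<^bsub>M\<^esub>" if a: "a \<in> ideal_pow R J N" for a
    proof -
      have "a \<odot>\<^bsub>M\<^esub> ((x \<otimes> r) \<odot>\<^bsub>M\<^esub> e) = (a \<otimes> x) \<odot>\<^bsub>M\<^esub> (r \<odot>\<^bsub>M\<^esub> e)"
        using e r rc pc[OF a] by (simp add: smult_assoc1)
      also have "\<dots> = x \<odot>\<^bsub>M\<^esub> (a \<odot>\<^bsub>M\<^esub> (r \<odot>\<^bsub>M\<^esub> e))"
        using e r rc pc[OF a] by (simp add: R.m_comm[of a x] smult_assoc1)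
      finally show ?thesis using r a by (simp add: K_def)
    qed
    then show "x \<otimes> r \<in> K" using r rc by (simp add: K_def)
    then show "r \<otimes> x \<in> K" using r rc by (simp add: R.m_comm)
  qed (rule R.ring_axioms)
  moreover have "S \<subseteq> K" using f R.ideal_pow_mono[OF Ji N] S by (auto simp: K_def)
  ultimately have JK: "J \<subseteq> K" unfolding J by (rule R.genideal_minimal)
  have "b \<in> carrier R \<and> b \<odot>\<^bsub>M\<^esub> e = \<zero>\<^bsub>M\<^esub>" if "b \<in> ideal_prod R J (ideal_pow R J N)" for b
    using that
  proof (induction b rule: ideal_prod.induct)
    case (prod i j)
    have c: "i \<in> carrier R" "j \<in> carrier R" using R.idealD(1)[OF Ji prod(1)] pc[OF prod(2)] by auto
    have "(i \<otimes> j) \<odot>\<^bsub>M\<^esub> e = j \<odot>\<^bsub>M\<^esub> (i \<odot>\<^bsub>M\<^esub> e)" using c e by (simp add: R.m_comm[of i j] smult_assoc1)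
    also have "\<dots> = \<zero>\<^bsub>M\<^esub>" using JK prod by (auto simp: K_def)
    finally show ?case using c by simp
  next
    case (sum s1 s2) then show ?case using e by (simp add: smult_l_distr)
  qed
  then show ?thesis unfolding torsion_iff using e by (intro conjI exI[of _ "Suc N"]) auto
qed

text \<open>Passes from powers of single generators to a power of the ideal. Instead of counting
  exponents in monomials, one generator after the other is shown to send \<open>e\<close> into the
  torsion submodule, until \<open>torsion_generators\<close> applies.\<close>

lemma torsion_nilpotent:
  assumes S: "finite S" "S \<subseteq> carrier R" and J: "J = Idl S" and e: "e \<in> carrier M"
    and nil: "\<And>s. s \<in> S \<Longrightarrow> \<exists>k::nat. (s [^] k) \<odot>\<^bsub>M\<^esub> e = \<zero>\<^bsub>M\<^esub>"
  shows "e \<in> torsion R J M"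
proof -
  have Ji: "ideal J R" unfolding J by (rule R.genideal_ideal[OF S(2)])
  let ?\<Gamma> = "torsion R J M"
  have \<Gamma>: "\<zero>\<^bsub>M\<^esub> \<in> ?\<Gamma>" "\<And>a u. \<lbrakk>a \<in> carrier R; u \<in> ?\<Gamma>\<rbrakk> \<Longrightarrow> a \<odot>\<^bsub>M\<^esub> u \<in> ?\<Gamma>"
    using torsion_submodule[OF Ji] unfolding submodule_iff[OF module_axioms] by auto
  \<comment> \<open>\<open>T\<close> collects the generators \<open>s\<close> for which
    \<open>s e\<close> is not yet known to be torsion. To remove \<open>t\<close> from it, descend
    along \<open>t^j e\<close>: once \<open>t^(j+1) e\<close> is torsion, the induction hypothesis
    applies to \<open>t^j e\<close> with the smaller set.\<close>
  have claim: "e \<in> ?\<Gamma>" if "finite T" "e \<in> carrier M" "\<forall>s\<in>S. \<exists>k::nat. (s [^] k) \<odot>\<^bsub>M\<^esub> e \<in> ?\<Gamma>"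
      "\<forall>s\<in>S - T. s \<odot>\<^bsub>M\<^esub> e \<in> ?\<Gamma>" for T e
    using that
  proof (induction T arbitrary: e)
    case empty then show ?case by (rule_tac torsion_generators[OF S J]) auto
  next
    case (insert t T)
    show ?case
    proof (cases "t \<in> S")
      case False
      then have "S - insert t T = S - T" by blast
      then show ?thesis using insert.prems by (intro insert.IH) auto
    next
      case tS: True
      then have tc: "t \<in> carrier R" using S by blast
      have "(t [^] j) \<odot>\<^bsub>M\<^esub> e \<in> ?\<Gamma> \<Longrightarrow> e \<in> ?\<Gamma>" for j :: nat
      proof (induction j)
        case 0 then show ?case using insert.prems by simp
      next
        case (Suc j)
        let ?e = "(t [^] j) \<odot>\<^bsub>M\<^esub> e"
        have swap: "r \<odot>\<^bsub>M\<^esub> ?e = (t [^] j) \<odot>\<^bsub>M\<^esub> (r \<odot>\<^bsub>M\<^esub> e)" if "r \<in> carrier R" for r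
          using that tc insert.prems(1) by (simp add: R.m_comm flip: smult_assoc1)
        have "?e \<in> ?\<Gamma>"
        proof (rule insert.IH)
          show "?e \<in> carrier M" using tc insert.prems by simp
          show "\<forall>s\<in>S. \<exists>k::nat. (s [^] k) \<odot>\<^bsub>M\<^esub> ?e \<in> ?\<Gamma>"
          proof
            fix s assume s: "s \<in> S"
            then obtain k :: nat where "(s [^] k) \<odot>\<^bsub>M\<^esub> e \<in> ?\<Gamma>" using insert.prems(2) by blast
            moreover have "s \<in> carrier R" using s S by blast
            ultimately have "(s [^] k) \<odot>\<^bsub>M\<^esub> ?e \<in> ?\<Gamma>" using swap[of "s [^] k"] \<Gamma>(2) tc by simp
            then show "\<exists>k::nat. (s [^] k) \<odot>\<^bsub>M\<^esub> ?e \<in> ?\<Gamma>" by blast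
          qed
          show "\<forall>s\<in>S - T. s \<odot>\<^bsub>M\<^esub> ?e \<in> ?\<Gamma>"
          proof
            fix s assume s: "s \<in> S - T"
            then have sc: "s \<in> carrier R" using S by blast
            show "s \<odot>\<^bsub>M\<^esub> ?e \<in> ?\<Gamma>"
            proof (cases "s = t")
              case True
              have "t \<odot>\<^bsub>M\<^esub> ?e = (t [^] Suc j) \<odot>\<^bsub>M\<^esub> e"
                using tc insert.prems(1) by (simp add: R.m_comm flip: smult_assoc1)
              then show ?thesis using Suc.prems True by simp
            next
              case False
              then show ?thesis using s insert.prems(3) swap[OF sc] \<Gamma>(2) tc by simp
            qed
          qed
        qed
        then show ?case by (rule Suc.IH)
      qed
      then show ?thesis using insert.prems(2) tS by blast
    qed
  qed
  show ?thesis
  proof (rule claim[OF S(1) e])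
    show "\<forall>s\<in>S. \<exists>k::nat. (s [^] k) \<odot>\<^bsub>M\<^esub> e \<in> ?\<Gamma>" using nil \<Gamma>(1) by metis
  qed simp
qed

end

locale homogeneous_generators = graded_scalars R G D for R (structure) and G D +
  fixes J
  assumes regular: "is_graded_module R G (regular_module R G)"
    and D_finite: "finite D" and J: "J = Idl (snd ` D)"
begin

lemma D_carrier: "snd ` D \<subseteq> carrier R" using D_G by force

lemma J_ideal: "ideal J R" unfolding J by (rule genideal_ideal[OF D_carrier])

lemma torsion_power:
  assumes "e \<in> torsion R J E" "(i, s) \<in> D"
  shows "\<exists>k::nat. (s [^] k) \<odot>\<^bsub>E\<^esub> e = \<zero>\<^bsub>E\<^esub>"
proof -
  obtain k where k: "\<And>a. a \<in> ideal_pow R J k \<Longrightarrow> a \<odot>\<^bsub>E\<^esub> e = \<zero>\<^bsub>E\<^esub>" using assms by (auto simp: torsion_iff)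
  have "s \<in> J" unfolding J using genideal_self[OF D_carrier] assms(2) by force
  then have "s [^] k \<in> ideal_pow R J (Suc 0 * k)" by (rule ideal_pow_nat_pow[OF J_ideal ideal_pow_one[OF J_ideal]])
  then show ?thesis using k by auto
qed

text \<open>The link between \<open>torsion\<close> and the componentwise \<open>gam\<close>: powers
  of generators lie in powers of \<open>J\<close>, and conversely nilpotent action of the finitely
  many generators suffices.\<close>

lemma torsion_hom_iff:
  assumes E: "hmod R G E" and e: "e \<in> hcomp E n"
  shows "e \<in> torsion R J E \<longleftrightarrow> e \<in> hcomp (gam R D E) n"
proof
  assume t: "e \<in> torsion R J E"
  show "e \<in> hcomp (gam R D E) n" unfolding gam_iff by (intro conjI allI impI e torsion_power[OF t])
next
  assume g: "e \<in> hcomp (gam R D E) n"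
  interpret module R E using E by (rule hmod_module)
  show "e \<in> torsion R J E"
    by (rule torsion_nilpotent[OF _ D_carrier J hmodD(1)[OF E e]])
      (use D_finite g in \<open>auto simp: gam_iff\<close>)
qed

text \<open>The generators are homogeneous, so a power of one that annihilates \<open>e\<close>
  annihilates each component of \<open>e\<close>.\<close>

lemma torsion_gcomp:
  assumes E: "is_graded_module R G E" and e: "e \<in> torsion R J E"
  shows "gcomp E e n \<in> torsion R J E"
proof -
  interpret E: graded_mod R G E using E by (simp add: graded_mod_def)
  have ec: "e \<in> carrier E" using e by (simp add: torsion_iff)
  have "gcomp E e n \<in> hcomp (gam R D E) n"
    unfolding gam_iff
  proof (intro conjI allI impI E.gcomp(1)[OF ec])
    fix i s assume iD: "(i, s) \<in> D"
    obtain k :: nat where k: "(s [^] k) \<odot>\<^bsub>E\<^esub> e = \<zero>\<^bsub>E\<^esub>" using torsion_power[OF e iD] by blast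
    have sk: "s [^] k \<in> G (int k * i)" by (rule G_pow[OF D_G[OF iD]])
    have "(s [^] k) \<odot>\<^bsub>E\<^esub> gcomp E e n = \<zero>\<^bsub>E\<^esub>"
      using E.gcomp_smult[OF sk Gc[OF sk] ec, of "n + int k * i"] k E.gcomp_zero by simp
    then show "\<exists>k::nat. (s [^] k) \<odot>\<^bsub>E\<^esub> gcomp E e n = \<zero>\<^bsub>E\<^esub>" by blast
  qed
  then show ?thesis using torsion_hom_iff[OF E.hmod E.gcomp(1)[OF ec]] by blast
qed

text \<open>A map of degree \<open>k\<close> on a homogeneous ideal becomes one of degree 0 after a
  shift by \<open>-k\<close>. The ideal and the ring live on the element type of \<open>R\<close>,
  so \<open>gr_injective\<close> applies, and the value at 1 of the extended map is the required
  element.\<close>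

lemma gr_injective_hinj:
  assumes E: "gr_injective R G E"
  shows "hinj R G E"
  unfolding hinj_def
proof (intro conjI allI impI)
  have Eg: "is_graded_module R G E" using E by (simp add: gr_injective_def)
  interpret E: graded_mod R G E using Eg by (simp add: graded_mod_def)
  show "hmod R G E" by (rule E.hmod)
  interpret RR: graded_mod R G "regular_module R G" using regular by (simp add: graded_mod_def)
  fix k and J :: "int \<Rightarrow> 'a set" and u
  assume J: "hideal R G J"
    and u: "\<forall>n. \<forall>r\<in>J n. u n r \<in> hcomp E (n + k)"
    "\<forall>n. \<forall>r\<in>J n. \<forall>r'\<in>J n. u n (r \<oplus> r') = u n r \<oplus>\<^bsub>E\<^esub> u n r'"
    "\<forall>i n. \<forall>a\<in>G i. \<forall>r\<in>J n. u (i + n) (a \<otimes> r) = a \<odot>\<^bsub>E\<^esub> u n r"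
  let ?RR = "regular_module R G"
  \<comment> \<open>The ideal with components \<open>J n\<close> as an actual set of ring elements;
    \<open>HJ\<close> below recovers the components from it.\<close>
  define H where "H = {p \<in> carrier R. \<forall>n. gcomp ?RR p n \<in> J n}"
  note Jd = hidealD[OF J]
  have GcR: "\<And>n. G n \<subseteq> carrier R" by (rule G_carrier)
  have comp_smult: "gcomp ?RR (a \<otimes> p) n \<in> J n" if a: "a \<in> carrier R" and p: "p \<in> H" for a p n
  proof -
    have pc: "p \<in> carrier R" using p by (simp add: H_def)
    have "a \<in> carrier ?RR" using a by simp
    then have "a \<in> carrier R \<and> gcomp ?RR (a \<otimes> p) n \<in> J n"
    proof (induction a rule: RR.graded_induct)
      case (hom i a)
      then have ai: "a \<in> G i" by simp
      have "gcomp ?RR (a \<otimes> p) n = a \<otimes> gcomp ?RR p (n - i)"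
        using RR.gcomp_smult[OF ai Gc[OF ai], of p n] pc by simp
      then show ?case using Jd(4)[OF ai, of "gcomp ?RR p (n - i)" "n - i" n] p Gc[OF ai] by (simp add: H_def)
    next
      case (add a b)
      then show ?case using RR.gcomp_add[of "a \<otimes> p" "b \<otimes> p" n] pc Jd(3) by (simp add: l_distr)
    qed
    then show ?thesis by blast
  qed
  have Hsub: "submodule H R ?RR"
    unfolding submodule_iff[OF RR.module_axioms]
    using comp_smult RR.gcomp_zero Jd(2,3) RR.gcomp_add by (auto simp: H_def)
  have Hcomp: "gcomp ?RR p n \<in> H" if "p \<in> H" for p n
  proof -
    have pn: "gcomp ?RR p n \<in> J n" "p \<in> carrier R" using that by (auto simp: H_def)
    have "gcomp ?RR p n \<in> hcomp ?RR n" using RR.gcomp(1)[of p n] pn by simp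
    then show ?thesis using RR.gcomp_hom[of "gcomp ?RR p n" n] pn Jd(2) RR.gcomp_carrier[of p n] by (simp add: H_def)
  qed
  have HJ: "G n \<inter> H = J n" for n
  proof
    show "G n \<inter> H \<subseteq> J n"
    proof
      fix p assume p: "p \<in> G n \<inter> H"
      then have "gcomp ?RR p n = p" using RR.gcomp_hom[of p n n] by simp
      moreover have "gcomp ?RR p n \<in> J n" using p by (simp add: H_def)
      ultimately show "p \<in> J n" by simp
    qed
    show "J n \<subseteq> G n \<inter> H"
    proof
      fix p assume p: "p \<in> J n"
      then have "p \<in> hcomp ?RR n" using Jd(1) by simp
      then show "p \<in> G n \<inter> H" using RR.gcomp_hom[of p n] p Jd(1,2) Gc by (auto simp: H_def)
    qed
  qed
  define X where "X = gr_shift (- k) (gr_sub ?RR H)"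
  define Y where "Y = gr_shift (- k) ?RR"
  have X: "is_graded_module R G X"
    unfolding X_def by (intro gr_shift_graded gr_sub_graded regular Hsub Hcomp G_carrier)
  have Y: "is_graded_module R G Y" unfolding Y_def by (intro gr_shift_graded regular)
  have Hc: "p \<in> carrier R" if "p \<in> H" for p using that by (simp add: H_def)
  have hX: "hcomp X n = J (n - k)" for n by (simp add: X_def HJ)
  have uX: "hhom G X E (\<lambda>n. u (n - k))"
    unfolding hhom_def hX
  proof (intro conjI allI ballI)
    fix n r assume r: "r \<in> J (n - k)"
    show "u (n - k) r \<in> hcomp E n" using u(1) r by force
    show "u (n - k) (r \<oplus>\<^bsub>X\<^esub> v) = u (n - k) r \<oplus>\<^bsub>E\<^esub> u (n - k) v" if "v \<in> J (n - k)" for v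
      using u(2) r that by (simp add: X_def)
  next
    fix i n a r assume a: "a \<in> G i" and r: "r \<in> J (n - k)"
    have "u (i + (n - k)) (a \<otimes> r) = a \<odot>\<^bsub>E\<^esub> u (n - k) r" using u(3) a r by blast
    then show "u (i + n - k) (a \<odot>\<^bsub>X\<^esub> r) = a \<odot>\<^bsub>E\<^esub> u (n - k) r" by (simp add: X_def add_diff_eq)
  qed
  obtain g where g: "g \<in> graded_hom R X E" "\<And>n r. r \<in> hcomp X n \<Longrightarrow> g r = u (n - k) r"
    using graded_hom_extend[OF regular X Eg uX] by blast
  have inc: "(\<lambda>p. p) \<in> graded_hom R X Y" by (rule graded_homI) (auto simp: X_def Y_def Hc)
  have "\<exists>h\<in>graded_hom R Y E. \<forall>u\<in>carrier X. h ((\<lambda>p. p) u) = g u"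
    using E[unfolded gr_injective_def] X Y inc g(1) inj_on_id2[of "carrier X"] by blast
  then obtain h where h: "h \<in> graded_hom R Y E" "\<And>p. p \<in> carrier X \<Longrightarrow> h p = g p" by auto
  have "h \<one> \<in> hcomp E k" by (rule graded_homD(4)[OF h(1)]) (simp add: Y_def G_one)
  moreover have "u n r = r \<odot>\<^bsub>E\<^esub> h \<one>" if r: "r \<in> J n" for n r
  proof -
    have rc: "r \<in> carrier R" using Jd(1)[OF r] by auto
    have rX: "r \<in> hcomp X (n + k)" using r by (simp add: hX)
    have "r \<in> carrier X" using r HJ[of n] by (auto simp: X_def)
    then have "u n r = h r" using h(2) g(2)[OF rX] by simp
    also have "\<dots> = h (r \<odot>\<^bsub>Y\<^esub> \<one>)" using rc by (simp add: Y_def)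
    also have "\<dots> = r \<odot>\<^bsub>E\<^esub> h \<one>" using rc by (intro graded_homD(3)[OF h(1)]) (simp_all add: Y_def)
    finally show ?thesis .
  qed
  ultimately show "\<exists>v\<in>hcomp E k. \<forall>n. \<forall>r\<in>J n. u n r = r \<odot>\<^bsub>E\<^esub> v" by blast
qed

end

section \<open>The Rees ring\<close>

lemma (in cring) ideal_criterion:
  assumes "J \<subseteq> carrier R" "\<zero> \<in> J" and add: "\<And>x y. \<lbrakk>x \<in> J; y \<in> J\<rbrakk> \<Longrightarrow> x \<oplus> y \<in> J"
    and mult: "\<And>a x. \<lbrakk>a \<in> carrier R; x \<in> J\<rbrakk> \<Longrightarrow> a \<otimes> x \<in> J"
  shows "ideal J R"
proof (rule idealI)
  have "\<ominus> x \<in> J" if "x \<in> J" for x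
    using mult[of "\<ominus> \<one>" x] that assms(1) by (auto simp: l_minus subset_iff)
  then show "subgroup J (add_monoid R)" using assms by (auto simp: subgroup_def a_inv_def[symmetric])
  fix a x assume "a \<in> J" "x \<in> carrier R"
  then show "x \<otimes> a \<in> J" "a \<otimes> x \<in> J" using mult[of x a] m_comm[of a x] assms(1) by auto
qed (rule ring_axioms)

locale rees = A?: cring A for A (structure) +
  fixes I
  assumes I: "ideal I A"
begin

abbreviation R where "R \<equiv> rees_ring A I"
abbreviation G where "G \<equiv> rees_grading A I"
abbreviation Ip where "Ip n \<equiv> ideal_pow A I n"

sublocale U: UP_cring A "UP A" by (simp add: UP_cring_def cring_axioms)

text \<open>The monomial \<open>a t^n\<close>, free of the restriction to coefficients in the
  carrier that \<open>up_ring.monom\<close> carries.\<close>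

definition mon :: "'a \<Rightarrow> nat \<Rightarrow> nat \<Rightarrow> 'a" where
  "mon a n = (\<lambda>i. if i = n then a else \<zero>)"

lemmas Ip_ideal = ideal_pow_ideal[OF I]
lemmas IpD = idealD[OF Ip_ideal]

lemma monom_eq: "a \<in> carrier A \<Longrightarrow> up_ring.monom (UP A) a n = mon a n"
  by (simp add: UP_def mon_def fun_eq_iff)

lemma UP_carrier: "carrier (UP A) = up A" by (simp add: UP_def)

lemma R_carrier: "p \<in> carrier R \<longleftrightarrow> p \<in> carrier (UP A) \<and> (\<forall>n. p n \<in> Ip n)"
  by (simp add: rees_ring_def)

lemma R_simps [simp]: "add R = add (UP A)" "mult R = mult (UP A)" "zero R = zero (UP A)" "one R = one (UP A)"
  by (simp_all add: rees_ring_def)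

lemma coeff_eq: "p \<in> carrier (UP A) \<Longrightarrow> coeff (UP A) p n = p n"
  by (simp add: UP_def)

lemma UP_add_apply: "\<lbrakk>p \<in> carrier (UP A); q \<in> carrier (UP A)\<rbrakk> \<Longrightarrow> (p \<oplus>\<^bsub>UP A\<^esub> q) n = p n \<oplus> q n"
  using U.coeff_add[of p q n] by (simp add: coeff_eq)
lemma UP_mult_apply: "\<lbrakk>p \<in> carrier (UP A); q \<in> carrier (UP A)\<rbrakk> \<Longrightarrow>
    (p \<otimes>\<^bsub>UP A\<^esub> q) n = (\<Oplus>i\<in>{..n}. p i \<otimes> q (n - i))"
  using U.coeff_mult[of p q n] by (simp add: coeff_eq)
lemma UP_zero_apply: "\<zero>\<^bsub>UP A\<^esub> n = \<zero>" by (simp add: UP_def)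
lemma UP_one_apply: "\<one>\<^bsub>UP A\<^esub> n = (if n = 0 then \<one> else \<zero>)" by (simp add: UP_def)
lemma UP_neg_apply: "p \<in> carrier (UP A) \<Longrightarrow> (\<ominus>\<^bsub>UP A\<^esub> p) n = \<ominus> p n"
  using U.coeff_a_inv[of p n] by (simp add: coeff_eq)
lemma UP_apply_closed: "p \<in> carrier (UP A) \<Longrightarrow> p n \<in> carrier A"
  by (auto simp: UP_carrier)

lemma finsum_ideal:
  assumes J: "ideal J A" and "finite S" "\<And>i. i \<in> S \<Longrightarrow> f i \<in> J"
  shows "(\<Oplus>i\<in>S. f i) \<in> J"
  using assms(2,3)
proof (induction S)
  case (insert x S)
  then have "f \<in> S \<rightarrow> carrier A" "f x \<in> carrier A" using idealD(1)[OF J] by auto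
  then show ?case using insert idealD(3)[OF J] by simp
qed (simp add: idealD(2)[OF J])

lemma R_cring: "cring R"
proof -
  let ?H = "{p \<in> carrier (UP A). \<forall>n. p n \<in> Ip n}"
  have "subring ?H (UP A)"
  proof (rule ring.subringI[OF U.UP_ring])
    show "?H \<subseteq> carrier (UP A)" by auto
    show "\<one>\<^bsub>UP A\<^esub> \<in> ?H" using IpD(2) by (auto simp: UP_one_apply)
    show "\<ominus>\<^bsub>UP A\<^esub> h \<in> ?H" if "h \<in> ?H" for h
      using that IpD(4) U.UP_a_inv_closed by (auto simp: UP_neg_apply)
    show "h1 \<otimes>\<^bsub>UP A\<^esub> h2 \<in> ?H" if "h1 \<in> ?H" "h2 \<in> ?H" for h1 h2
    proof -
      have "(h1 \<otimes>\<^bsub>UP A\<^esub> h2) n \<in> Ip n" for n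
      proof -
        have "h1 i \<otimes> h2 (n - i) \<in> Ip n" if "i \<le> n" for i
          using ideal_pow_mult[OF I, of "h1 i" i "h2 (n - i)" "n - i"] \<open>h1 \<in> ?H\<close> \<open>h2 \<in> ?H\<close> that by simp
        then show ?thesis using \<open>h1 \<in> ?H\<close> \<open>h2 \<in> ?H\<close> by (auto simp: UP_mult_apply intro!: finsum_ideal[OF Ip_ideal])
      qed
      then show ?thesis using that by auto
    qed
    show "h1 \<oplus>\<^bsub>UP A\<^esub> h2 \<in> ?H" if "h1 \<in> ?H" "h2 \<in> ?H" for h1 h2
      using that IpD(3) by (auto simp: UP_add_apply)
  qed
  then have "subcring ?H (UP A)" by (rule cring.subcringI'[OF U.UP_cring])
  then show ?thesis
    using ring.subcring_iff[OF U.UP_ring, of ?H] by (auto simp: rees_ring_def)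
qed

sublocale RR: cring R by (rule R_cring)

lemma G_iff: "p \<in> G n \<longleftrightarrow> p \<in> carrier R \<and> (\<forall>j. int j \<noteq> n \<longrightarrow> p j = \<zero>)"
  by (simp add: rees_grading_def)

lemma mon_UP: "a \<in> carrier A \<Longrightarrow> mon a n \<in> carrier (UP A)"
  using U.monom_closed[of a n] by (simp add: monom_eq)

lemma mon_R: "a \<in> Ip n \<Longrightarrow> mon a n \<in> carrier R"
  using IpD(1,2) by (auto simp: R_carrier mon_UP) (simp add: mon_def)

lemma mon_G: "a \<in> Ip n \<Longrightarrow> mon a n \<in> G (int n)"
  using mon_R by (simp add: G_iff) (simp add: mon_def)

lemma G_mon: "p \<in> G (int n) \<Longrightarrow> p n \<in> Ip n \<and> p = mon (p n) n"
  by (auto simp: G_iff R_carrier mon_def fun_eq_iff)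

lemma G_neg: "n < 0 \<Longrightarrow> G n = {\<zero>\<^bsub>R\<^esub>}"
  using RR.zero_closed by (auto simp: G_iff UP_zero_apply fun_eq_iff)

lemma mon_mult: "\<lbrakk>a \<in> carrier A; b \<in> carrier A\<rbrakk> \<Longrightarrow> mon a m \<otimes>\<^bsub>R\<^esub> mon b n = mon (a \<otimes> b) (m + n)"
  using U.monom_mult[of a b m n] by (simp add: monom_eq)

lemma mon_add: "\<lbrakk>a \<in> carrier A; b \<in> carrier A\<rbrakk> \<Longrightarrow> mon a n \<oplus>\<^bsub>R\<^esub> mon b n = mon (a \<oplus> b) n"
  using U.monom_add[of a b n] by (simp add: monom_eq)

lemma mon_zero: "mon \<zero> n = \<zero>\<^bsub>R\<^esub>"
  by (auto simp: mon_def UP_zero_apply fun_eq_iff)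

lemma mon_one: "mon \<one> 0 = \<one>\<^bsub>R\<^esub>"
  by (auto simp: mon_def UP_one_apply fun_eq_iff)

lemma mon_neg: "a \<in> carrier A \<Longrightarrow> \<ominus>\<^bsub>R\<^esub> mon a n = mon (\<ominus> a) n" if "a \<in> Ip n"
proof -
  assume a: "a \<in> carrier A"
  have "mon (\<ominus> a) n \<oplus>\<^bsub>R\<^esub> mon a n = \<zero>\<^bsub>R\<^esub>" using a by (simp only: mon_add a_inv_closed l_neg mon_zero)
  then show ?thesis using mon_R[OF that] mon_R[OF IpD(4)[OF that]] by (rule RR.minus_equality)
qed

lemma mon_pow: "a \<in> carrier A \<Longrightarrow> mon a n [^]\<^bsub>R\<^esub> (k::nat) = mon (a [^] k) (n * k)"
proof (induction k)
  case 0 then show ?case using mon_one by simp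
next
  case (Suc k) then show ?case using mon_mult[of "a [^] k" a "n * k" n] by (simp add: algebra_simps)
qed

lemma R_apply: "p \<in> carrier R \<Longrightarrow> p n \<in> Ip n" "p \<in> carrier R \<Longrightarrow> p n \<in> carrier A"
  by (auto simp: R_carrier UP_apply_closed)

lemma R_finite: "p \<in> carrier R \<Longrightarrow> finite {n. p n \<noteq> \<zero>}"
proof -
  assume "p \<in> carrier R"
  then obtain n where "bound \<zero> n p" by (auto simp: R_carrier UP_carrier)
  then have "{n. p n \<noteq> \<zero>} \<subseteq> {..n}" by (auto simp: bound_def) (meson not_le)
  then show ?thesis using finite_subset by blast
qed

lemma regular: "is_graded_module R G (regular_module R G)"
proof -
  have m: "module R (regular_module R G)"
  proof (rule moduleI)
    show "abelian_group (regular_module R G)"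
    proof (rule abelian_groupI)
      fix x assume "x \<in> carrier (regular_module R G)"
      then show "\<exists>y\<in>carrier (regular_module R G). y \<oplus>\<^bsub>regular_module R G\<^esub> x = \<zero>\<^bsub>regular_module R G\<^esub>"
        using RR.l_neg RR.a_inv_closed unfolding regular_module_simps by blast
    qed (simp_all only: regular_module_simps RR.a_ac RR.a_closed RR.zero_closed RR.l_zero RR.r_zero)
  qed (simp_all only: regular_module_simps R_cring RR.m_closed RR.l_distr RR.r_distr RR.m_assoc RR.l_one)
  interpret M: module R "regular_module R G" by (rule m)
  define pr where "pr n p = (\<lambda>j. if int j = n then p j else \<zero>)" for n p
  have pr: "pr n p = (if n < 0 then \<zero>\<^bsub>R\<^esub> else mon (p (nat n)) (nat n))" for n p
    by (auto simp: pr_def mon_def UP_zero_apply fun_eq_iff)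
  have pr_in: "pr n p \<in> G n" if p: "p \<in> carrier R" for n p
  proof (cases "n < 0")
    case True then show ?thesis using G_neg by (simp add: pr)
  next
    case False then show ?thesis using mon_G[of "p (nat n)" "nat n"] R_apply(1)[OF p] by (simp add: pr)
  qed
  have GR: "p \<in> carrier R" if "p \<in> G n" for p n using that by (simp add: G_iff)
  have Gz: "\<zero>\<^bsub>R\<^esub> \<in> G n" for n using RR.zero_closed by (simp add: G_iff UP_zero_apply)
  have Ga: "p \<oplus>\<^bsub>R\<^esub> q \<in> G n" if "p \<in> G n" "q \<in> G n" for p q n
    using that RR.a_closed[of p q] by (auto simp: G_iff UP_add_apply R_carrier)
  have Gn: "\<ominus>\<^bsub>R\<^esub> p \<in> G n" if "p \<in> G n" for p n
  proof (cases "n < 0")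
    case True then show ?thesis using that G_neg RR.minus_zero by auto
  next
    case False
    then show ?thesis using G_mon[of p "nat n"] that mon_neg[of "p (nat n)" "nat n"] mon_G[OF IpD(4)] IpD(1)
      by (metis int_nat_eq not_less)
  qed
  have neg: "\<ominus>\<^bsub>regular_module R G\<^esub> p = \<ominus>\<^bsub>R\<^esub> p" for p by (simp add: a_inv_def m_inv_def)
  show ?thesis
  proof (rule graded_moduleI[OF m, where prj = pr])
    show "additive_subgroup (hcomp (regular_module R G) n) (regular_module R G)" for n
      unfolding additive_subgroup_iff[OF M.abelian_group_axioms] neg
      using GR Gz Ga Gn by auto
    show "a \<odot>\<^bsub>regular_module R G\<^esub> e \<in> hcomp (regular_module R G) (i + j)"
      if "a \<in> G i" "e \<in> hcomp (regular_module R G) j" for i j a e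
    proof (cases "i < 0 \<or> j < 0")
      case True
      then have "a = \<zero>\<^bsub>R\<^esub> \<or> e = \<zero>\<^bsub>R\<^esub>" using that G_neg by auto
      then have "a \<otimes>\<^bsub>R\<^esub> e = \<zero>\<^bsub>R\<^esub>" using that GR RR.l_null RR.r_null by (auto simp del: R_simps)
      then show ?thesis using Gz[of "i + j"] by simp
    next
      case False
      then obtain m n where mn: "i = int m" "j = int n" by (metis nonneg_int_cases not_less)
      have h: "a m \<in> Ip m" "a = mon (a m) m" "e n \<in> Ip n" "e = mon (e n) n"
        using G_mon[of a m] G_mon[of e n] that mn by auto
      have "a \<otimes>\<^bsub>R\<^esub> e = mon (a m \<otimes> e n) (m + n)"
        using mon_mult[OF IpD(1)[OF h(1)] IpD(1)[OF h(3)], of m n] h(2,4) by metis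
      then show ?thesis using mon_G[OF ideal_pow_mult[OF I h(1,3)]] mn by simp
    qed
    show "pr n e \<in> hcomp (regular_module R G) n" if "e \<in> carrier (regular_module R G)" for n e
      using pr_in that by simp
    show "pr n (e \<oplus>\<^bsub>regular_module R G\<^esub> f) = pr n e \<oplus>\<^bsub>regular_module R G\<^esub> pr n f"
      if "e \<in> carrier (regular_module R G)" "f \<in> carrier (regular_module R G)" for n e f
    proof
      fix j
      have ef: "e \<in> carrier R" "f \<in> carrier R" using that by auto
      have "pr n e \<in> carrier (UP A)" "pr n f \<in> carrier (UP A)" "e \<in> carrier (UP A)" "f \<in> carrier (UP A)"
        using GR[OF pr_in[OF ef(1)]] GR[OF pr_in[OF ef(2)]] ef by (auto simp: R_carrier)
      then show "pr n (e \<oplus>\<^bsub>regular_module R G\<^esub> f) j = (pr n e \<oplus>\<^bsub>regular_module R G\<^esub> pr n f) j"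
        by (simp add: UP_add_apply) (simp add: pr_def UP_add_apply)
    qed
    show "pr k e = (if k = n then e else \<zero>\<^bsub>regular_module R G\<^esub>)" if "e \<in> hcomp (regular_module R G) n" for n k e
      using that by (auto simp: G_iff pr_def UP_zero_apply fun_eq_iff)
    show "finite {n. pr n e \<noteq> \<zero>\<^bsub>regular_module R G\<^esub>}" if "e \<in> carrier (regular_module R G)" for e
    proof -
      have "{n. pr n e \<noteq> \<zero>\<^bsub>regular_module R G\<^esub>} \<subseteq> int ` {n. e n \<noteq> \<zero>}"
        by (auto simp: pr_def UP_zero_apply fun_eq_iff split: if_splits)
      then show ?thesis using R_finite[of e] that finite_subset by auto
    qed
    show "e = \<zero>\<^bsub>regular_module R G\<^esub>" if "e \<in> carrier (regular_module R G)"
      "\<And>n. pr n e = \<zero>\<^bsub>regular_module R G\<^esub>" for e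
    proof
      fix j show "e j = \<zero>\<^bsub>regular_module R G\<^esub> j"
        using fun_cong[OF that(2)[of "int j"], of j] by (simp add: pr_def)
    qed
  qed
qed

sublocale RG: graded_mod R G "regular_module R G" by (simp add: graded_mod_def regular)

text \<open>Via \<open>mon\<close> the component of degree \<open>n\<close> is a copy of
  \<open>I^n\<close>, and components of negative degree are zero. Homogeneous ideals thus become
  families of coefficient sets, and \<open>ideal_pow_acc\<close> gives the chain condition.\<close>

lemma rees_graded_scalars:
  assumes N: "noetherian_ring A" and D: "\<And>i s. (i, s) \<in> D \<Longrightarrow> s \<in> G i"
  shows "graded_scalars R G D"
proof (rule graded_scalars.intro[OF R_cring], unfold_locales)
  show "G n \<subseteq> carrier R" for n by (auto simp: G_iff)
  show "\<zero>\<^bsub>R\<^esub> \<in> G n" "\<And>a b. a \<in> G n \<Longrightarrow> b \<in> G n \<Longrightarrow> a \<oplus>\<^bsub>R\<^esub> b \<in> G n" for n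
    using RG.h0[of n] RG.hadd[of _ n] by auto
  show "\<ominus>\<^bsub>R\<^esub> a \<in> G n" if "a \<in> G n" for a n
    using RG.hneg[of a n] that by (simp add: a_inv_def m_inv_def)
  show "\<one>\<^bsub>R\<^esub> \<in> G 0" using mon_G[of \<one> 0] mon_one by simp
  show "a \<otimes>\<^bsub>R\<^esub> b \<in> G (i + j)" if "a \<in> G i" "b \<in> G j" for a b i j
    using RG.hsmult[of a i b j "i + j"] that by simp
  show "s \<in> G i" if "(i, s) \<in> D" for i s by (rule D[OF that])
  fix J :: "nat \<Rightarrow> int \<Rightarrow> (nat \<Rightarrow> 'a) set"
  assume J: "\<And>k. hideal R G (J k)" and mono: "\<And>k n. J k n \<subseteq> J (Suc k) n"
  have J1: "a \<in> J k n \<Longrightarrow> a \<in> G n" and J2: "\<zero>\<^bsub>R\<^esub> \<in> J k n" and J3: "\<lbrakk>a \<in> J k n; b \<in> J k n\<rbrakk> \<Longrightarrow> a \<oplus>\<^bsub>R\<^esub> b \<in> J k n"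
    and J4: "\<lbrakk>r \<in> G i; b \<in> J k n\<rbrakk> \<Longrightarrow> r \<otimes>\<^bsub>R\<^esub> b \<in> J k (i + n)" for k n a b r i
    using J[of k] unfolding hideal_def by blast+
  define K where "K k n = {a \<in> Ip n. mon a n \<in> J k (int n)}" for k n
  have K: "graded_ideal Ip (K k)" for k
    unfolding graded_ideal_def
  proof (intro conjI allI ballI)
    show "K k n \<subseteq> Ip n" for n by (auto simp: K_def)
    show "\<zero> \<in> K k n" for n using J2 IpD(2) by (simp add: K_def mon_zero)
    show "a \<oplus> b \<in> K k n" if "a \<in> K k n" "b \<in> K k n" for a b n
    proof -
      have ab: "a \<in> Ip n" "b \<in> Ip n" "mon a n \<in> J k (int n)" "mon b n \<in> J k (int n)" using that by (auto simp: K_def)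
      then show ?thesis
        using J3[OF ab(3,4)] mon_add[OF IpD(1)[OF ab(1)] IpD(1)[OF ab(2)], of n] IpD(3)[OF ab(1,2)] unfolding K_def by simp
    qed
    show "a \<otimes> b \<in> K k (m + n)" if "a \<in> Ip m" "b \<in> K k n" for a b m n
    proof -
      have b: "b \<in> Ip n" "mon b n \<in> J k (int n)" using that by (auto simp: K_def)
      have "mon (a \<otimes> b) (m + n) \<in> J k (int m + int n)"
        using J4[OF mon_G[OF that(1)] b(2)] mon_mult[OF IpD(1)[OF that(1)] IpD(1)[OF b(1)], of m n] by simp
      then show ?thesis using ideal_pow_mult[OF I that(1) b(1)] by (simp add: K_def)
    qed
  qed
  have "K k n \<subseteq> K (Suc k) n" for k n using mono[of k "int n"] by (auto simp: K_def)
  then have "\<exists>k0. \<forall>k\<ge>k0. K k = K k0"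
    using ideal_pow_acc[OF N I, unfolded graded_acc_def, rule_format, of K] K by blast
  then obtain k0 where k0: "\<And>k. k \<ge> k0 \<Longrightarrow> K k = K k0" by blast
  have JK: "J k (int n) = (\<lambda>a. mon a n) ` K k n" for k n
    using J1[of _ k "int n"] G_mon[of _ n] by (force simp: K_def)
  have Jneg: "J k n = {\<zero>\<^bsub>R\<^esub>}" if "n < 0" for k n using J1[of _ k n] J2[of k n] G_neg[OF that] by blast
  have "J k = J k0" if "k \<ge> k0" for k
  proof
    fix n show "J k n = J k0 n"
      using Jneg[of n] JK k0[OF that] by (cases "n < 0") (auto simp: not_less elim!: nonneg_int_cases)
  qed
  then show "\<exists>k0. \<forall>k\<ge>k0. J k = J k0" by blast
qed

lemma rees_max_ideal:
  assumes m: "ideal \<mm> A"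
  shows "ideal (rees_max A \<mm> I) R"
proof (rule RR.ideal_criterion)
  show "rees_max A \<mm> I \<subseteq> carrier R" by (auto simp: rees_max_def)
  show "\<zero>\<^bsub>R\<^esub> \<in> rees_max A \<mm> I"
    using RR.zero_closed idealD(2)[OF m] by (simp add: rees_max_def UP_zero_apply)
  show "x \<oplus>\<^bsub>R\<^esub> y \<in> rees_max A \<mm> I" if "x \<in> rees_max A \<mm> I" "y \<in> rees_max A \<mm> I" for x y
    using that RR.a_closed[of x y] idealD(3)[OF m] UP_add_apply[of x y 0] by (auto simp: rees_max_def R_carrier)
  fix x a assume x: "x \<in> carrier R" and a: "a \<in> rees_max A \<mm> I"
  have "(x \<otimes>\<^bsub>UP A\<^esub> a) 0 = x 0 \<otimes> a 0"
    using UP_mult_apply[of x a 0] a x UP_apply_closed by (simp add: rees_max_def R_carrier)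
  then show "x \<otimes>\<^bsub>R\<^esub> a \<in> rees_max A \<mm> I"
    using a x RR.m_closed[of x a] idealD(5)[OF m] R_apply(2)[OF x] by (simp add: rees_max_def)
qed

text \<open>Allows membership of the monomials \<open>c t^n\<close>, for \<open>c\<close> running
  through an ideal, to be checked on generators of that ideal by minimality.\<close>

lemma ideal_mon:
  assumes K: "ideal K R" and J: "ideal J A"
  shows "ideal {c \<in> J. c \<in> Ip n \<and> mon c n \<in> K} A"
proof (rule ideal_criterion)
  note Kd = RR.idealD[OF K] and Jd = idealD[OF J]
  show "{c \<in> J. c \<in> Ip n \<and> mon c n \<in> K} \<subseteq> carrier A" using Jd(1) by blast
  show "\<zero> \<in> {c \<in> J. c \<in> Ip n \<and> mon c n \<in> K}" using Jd(2) IpD(2) Kd(2) mon_zero by simp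
  show "x \<oplus> y \<in> {c \<in> J. c \<in> Ip n \<and> mon c n \<in> K}"
    if "x \<in> {c \<in> J. c \<in> Ip n \<and> mon c n \<in> K}" "y \<in> {c \<in> J. c \<in> Ip n \<and> mon c n \<in> K}" for x y
  proof -
    have h: "x \<in> J" "x \<in> Ip n" "mon x n \<in> K" "y \<in> J" "y \<in> Ip n" "mon y n \<in> K" using that by auto
    show ?thesis using Jd(3)[OF h(1,4)] IpD(3)[OF h(2,5)] Kd(3)[OF h(3,6)] mon_add[OF Jd(1)[OF h(1)] Jd(1)[OF h(4)], of n] by simp
  qed
  fix r c assume r: "r \<in> carrier A" and "c \<in> {c \<in> J. c \<in> Ip n \<and> mon c n \<in> K}"
  then have c: "c \<in> J" "c \<in> Ip n" "mon c n \<in> K" by auto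
  have "mon r 0 \<otimes>\<^bsub>R\<^esub> mon c n \<in> K" using mon_R[of r 0] r c by (intro Kd(5)) auto
  then have "mon (r \<otimes> c) n \<in> K" using mon_mult[of r c 0 n] r Jd(1)[OF c(1)] by simp
  then show "r \<otimes> c \<in> {c \<in> J. c \<in> Ip n \<and> mon c n \<in> K}" using Jd(5)[OF r c(1)] IpD(5)[OF r c(2)] by simp
qed

text \<open>Degree 0 is covered by generators of \<open>\<mm>\<close>, degree 1 by generators of
  \<open>I\<close>, and higher degrees follow from \<open>I^(n+1) = I I^n\<close>. An arbitrary
  element is the sum of its components.\<close>

lemma rees_max_generators:
  assumes m: "ideal \<mm> A" and C: "C \<subseteq> carrier A" "\<mm> = Idl C" and C': "C' \<subseteq> carrier A" "I = Idl C'"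
  shows "rees_max A \<mm> I = Idl\<^bsub>R\<^esub> ((\<lambda>c. mon c 0) ` C \<union> (\<lambda>c. mon c 1) ` C')"
proof
  let ?S = "(\<lambda>c. mon c 0) ` C \<union> (\<lambda>c. mon c 1) ` C'"
  have CI: "C' \<subseteq> I" "C \<subseteq> \<mm>" using genideal_self[OF C(1)] genideal_self[OF C'(1)] C C' by auto
  have I1: "c \<in> Ip 1" if "c \<in> I" for c using ideal_pow_one[OF I that] by simp
  have S: "?S \<subseteq> carrier R" using CI C I1 mon_R[of _ 0] mon_R[of _ 1] by (auto simp del: One_nat_def)
  have "?S \<subseteq> rees_max A \<mm> I"
  proof
    fix s assume s: "s \<in> ?S"
    then have "s 0 \<in> \<mm>" using CI idealD(2)[OF m] by (auto simp: mon_def)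
    then show "s \<in> rees_max A \<mm> I" using s S unfolding rees_max_def by blast
  qed
  then show "Idl\<^bsub>R\<^esub> ?S \<subseteq> rees_max A \<mm> I" by (rule RR.genideal_minimal[OF rees_max_ideal[OF m]])
  let ?K = "Idl\<^bsub>R\<^esub> ?S"
  have K: "ideal ?K R" by (rule RR.genideal_ideal[OF S])
  have SK: "?S \<subseteq> ?K" by (rule RR.genideal_self[OF S])
  have mon0: "mon c 0 \<in> ?K" if "c \<in> \<mm>" for c
  proof -
    have "\<mm> \<subseteq> {c \<in> \<mm>. c \<in> Ip 0 \<and> mon c 0 \<in> ?K}"
      unfolding C(2) by (rule genideal_minimal[OF ideal_mon[OF K m[unfolded C(2)]]])
        (use SK C CI in \<open>auto simp: C(2)\<close>)
    then show ?thesis using that by blast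
  qed
  have mon1: "mon c 1 \<in> ?K" if "c \<in> I" for c
  proof -
    have "I \<subseteq> {c \<in> I. c \<in> Ip 1 \<and> mon c 1 \<in> ?K}"
      by (subst C'(2), rule genideal_minimal[OF ideal_mon[OF K I]])
        (use SK CI I1 in \<open>auto simp del: One_nat_def ideal_pow.simps\<close>)
    then show ?thesis using that by blast
  qed
  have monS: "mon a (Suc n) \<in> ?K" if "a \<in> Ip (Suc n)" for a n
  proof -
    have "a \<in> ideal_prod A I (Ip n)" using that by simp
    then have "a \<in> carrier A \<and> mon a (Suc n) \<in> ?K"
    proof (induction a rule: ideal_prod.induct)
      case (prod i j)
      have c: "i \<in> carrier A" "j \<in> carrier A" using idealD(1)[OF I prod(1)] IpD(1)[OF prod(2)] .
      have "mon i 1 \<otimes>\<^bsub>R\<^esub> mon j n \<in> ?K" by (rule RR.idealD(6)[OF K mon_R[OF prod(2)] mon1[OF prod(1)]])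
      then show ?case using mon_mult[OF c, of 1 n] c by simp
    next
      case (sum s1 s2)
      then show ?case using mon_add[of s1 s2 "Suc n"] RR.idealD(3)[OF K, of "mon s1 (Suc n)" "mon s2 (Suc n)"] by simp
    qed
    then show ?thesis by blast
  qed
  show "rees_max A \<mm> I \<subseteq> ?K"
  proof
    fix p assume "p \<in> rees_max A \<mm> I"
    then have p: "p \<in> carrier R" "p 0 \<in> \<mm>" by (auto simp: rees_max_def)
    have "p \<in> carrier (regular_module R G)" using p by simp
    then show "p \<in> ?K"
    proof (rule RG.sum_induct)
      fix n
      let ?g = "gcomp (regular_module R G) p n"
      show "?g \<in> ?K"
      proof (cases "n < 0")
        case True
        then show ?thesis using RG.gcomp(1)[of p n] p G_neg[of n] RR.idealD(2)[OF K] by simp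
      next
        case False
        then obtain k where k: "n = int k" by (metis nonneg_int_cases not_less)
        have gk: "?g = mon (?g k) k" "?g k \<in> Ip k" using G_mon[of ?g k] RG.gcomp(1)[of p n] p k by auto
        \<comment> \<open>\<open>gcomp\<close> is characterized only by uniqueness of the
          decomposition, so its agreement with the coefficient of \<open>t^k\<close> is proved by
          induction over homogeneous summands.\<close>
        have "?g k = p k"
        proof -
          have "gcomp (regular_module R G) q (int k) k = q k" if "q \<in> carrier (regular_module R G)" for q
            using that
          proof (induction rule: RG.graded_induct)
            case (hom i u)
            then show ?case using RG.gcomp_hom[of u i "int k"] by (auto simp: G_iff UP_zero_apply)
          next
            case (add u v)
            have "u \<in> carrier (UP A)" "v \<in> carrier (UP A)"
              "gcomp (regular_module R G) u (int k) \<in> carrier (UP A)" "gcomp (regular_module R G) v (int k) \<in> carrier (UP A)"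
              using add RG.gcomp_carrier[of u "int k"] RG.gcomp_carrier[of v "int k"] by (auto simp: R_carrier)
            moreover have "gcomp (regular_module R G) (u \<oplus>\<^bsub>UP A\<^esub> v) (int k)
                = gcomp (regular_module R G) u (int k) \<oplus>\<^bsub>UP A\<^esub> gcomp (regular_module R G) v (int k)"
              using RG.gcomp_add[OF add(1,2), of "int k"] by (simp only: regular_module_simps R_simps)
            ultimately show ?case
              using add(3,4) UP_add_apply[of u v k]
                UP_add_apply[of "gcomp (regular_module R G) u (int k)" "gcomp (regular_module R G) v (int k)" k]
              unfolding regular_module_simps R_simps by metis
          qed
          then show ?thesis using p k by simp
        qed
        then show ?thesis using gk(1) monS[of "p k"] mon0[OF p(2)] gk(2) by (cases k) metis+
      qed
    qed (use RR.idealD(2,3)[OF K] in auto)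
  qed
qed

end

section \<open>Modules of finite length over a local ring\<close>

lemma (in ring) exists_maximalideal:
  assumes J: "ideal J R" and proper: "\<one> \<notin> J"
  shows "\<exists>K. maximalideal K R \<and> J \<subseteq> K"
proof -
  let ?\<A> = "{K. ideal K R \<and> J \<subseteq> K \<and> \<one> \<notin> K}"
  have "\<exists>K\<in>?\<A>. \<forall>X\<in>?\<A>. K \<subseteq> X \<longrightarrow> X = K"
  proof (rule subset_Zorn_nonempty)
    show "?\<A> \<noteq> {}" using J proper by blast
    fix C assume ne: "C \<noteq> {}" and ch: "subset.chain ?\<A> C"
    have CA: "\<And>K. K \<in> C \<Longrightarrow> ideal K R \<and> J \<subseteq> K \<and> \<one> \<notin> K"
      and tot: "\<And>K K'. \<lbrakk>K \<in> C; K' \<in> C\<rbrakk> \<Longrightarrow> K \<subseteq> K' \<or> K' \<subseteq> K"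
      using ch unfolding subset_chain_def by blast+
    have "subset.chain {I. ideal I R} C" unfolding subset_chain_def using CA tot by blast
    then have "ideal (\<Union>C) R" using chain_Union_is_ideal[of C] ne by simp
    moreover have "J \<subseteq> \<Union>C" "\<one> \<notin> \<Union>C" using CA ne by blast+
    ultimately show "\<Union>C \<in> ?\<A>" by simp
  qed
  then obtain K where K: "ideal K R" "J \<subseteq> K" "\<one> \<notin> K"
    and max: "\<And>X. \<lbrakk>ideal X R; J \<subseteq> X; \<one> \<notin> X; K \<subseteq> X\<rbrakk> \<Longrightarrow> X = K" by auto
  have "maximalideal K R"
  proof (rule maximalidealI[OF K(1)])
    show "carrier R \<noteq> K" using K(3) by auto
    fix X assume X: "ideal X R" "K \<subseteq> X" "X \<subseteq> carrier R"
    show "X = K \<or> X = carrier R"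
    proof (cases "\<one> \<in> X")
      case True then show ?thesis using ideal.one_imp_carrier[OF X(1)] by blast
    next
      case False then show ?thesis using max[OF X(1)] K(2) X(2) by blast
    qed
  qed
  then show ?thesis using K(2) by blast
qed

text \<open>Otherwise \<open>1 - r a\<close> would lie in a maximal ideal, hence in
  \<open>\<mm>\<close>, and so would 1.\<close>

lemma local_ring_unit:
  assumes "noetherian_local A \<mm>" and a: "a \<in> \<mm>" and r: "r \<in> carrier A"
  shows "\<exists>u\<in>carrier A. u \<otimes>\<^bsub>A\<^esub> (\<one>\<^bsub>A\<^esub> \<ominus>\<^bsub>A\<^esub> r \<otimes>\<^bsub>A\<^esub> a) = \<one>\<^bsub>A\<^esub>"
proof -
  have A: "cring A" and m: "maximalideal \<mm> A" and uniq: "\<And>J. maximalideal J A \<Longrightarrow> J = \<mm>"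
    using assms(1) by (auto simp: noetherian_local_def)
  interpret cring A by (rule A)
  have mi: "ideal \<mm> A" using m by (simp add: maximalideal_def)
  note md = idealD[OF mi]
  have one: "\<one>\<^bsub>A\<^esub> \<notin> \<mm>" using ideal.one_imp_carrier[OF mi] maximalideal.I_notcarr[OF m] by blast
  let ?b = "\<one>\<^bsub>A\<^esub> \<ominus>\<^bsub>A\<^esub> r \<otimes>\<^bsub>A\<^esub> a"
  have ra: "r \<otimes>\<^bsub>A\<^esub> a \<in> \<mm>" by (rule md(5)[OF r a])
  have b: "?b \<in> carrier A" using r md(1)[OF a] by simp
  show ?thesis
  proof (cases "\<one>\<^bsub>A\<^esub> \<in> PIdl\<^bsub>A\<^esub> ?b")
    case True
    then show ?thesis unfolding cgenideal_def by (auto intro: sym)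
  next
    case False
    then obtain K where K: "maximalideal K A" "PIdl\<^bsub>A\<^esub> ?b \<subseteq> K"
      using exists_maximalideal[OF cgenideal_ideal[OF b]] by blast
    then have "?b \<in> \<mm>" using uniq[OF K(1)] cgenideal_self[OF b] by blast
    then have "?b \<oplus>\<^bsub>A\<^esub> r \<otimes>\<^bsub>A\<^esub> a \<in> \<mm>" using ra by (rule md(3))
    moreover have "?b \<oplus>\<^bsub>A\<^esub> r \<otimes>\<^bsub>A\<^esub> a = \<one>\<^bsub>A\<^esub>" using md(1)[OF ra] by (simp add: a_minus_def a_assoc l_neg)
    ultimately show ?thesis using one by simp
  qed
qed

text \<open>An element of \<open>\<mm>\<close> acts as zero on the simple factors of a composition
  series, so it moves each member into the preceding one; as many factors as there are steps
  annihilate the module.\<close>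

lemma finite_length_nilpotent:
  assumes local: "noetherian_local A \<mm>" and M: "module A M" and fl: "finite_length A M" and a: "a \<in> \<mm>"
  shows "\<exists>k::nat. \<forall>m\<in>carrier M. (a [^]\<^bsub>A\<^esub> k) \<odot>\<^bsub>M\<^esub> m = \<zero>\<^bsub>M\<^esub>"
proof -
  interpret module A M by (rule M)
  have "ideal \<mm> A" using local by (auto simp: noetherian_local_def maximalideal_def)
  then have ac: "a \<in> carrier A" using a R.idealD(1) by blast
  obtain Hs where *: "Hs \<noteq> [] \<and> hd Hs = {\<zero>\<^bsub>M\<^esub>} \<and> last Hs = carrier M \<and> (\<forall>H\<in>set Hs. submodule H A M) \<and>
       (\<forall>i. Suc i < length Hs \<longrightarrow> Hs ! i \<subset> Hs ! Suc i \<and>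
          (\<forall>K. submodule K A M \<longrightarrow> Hs ! i \<subseteq> K \<longrightarrow> K \<subseteq> Hs ! Suc i \<longrightarrow> K = Hs ! i \<or> K = Hs ! Suc i))"
    using fl unfolding finite_length_def by (elim exE) (rule that)
  note Hs = conjunct1[OF *] conjunct1[OF conjunct2[OF *]] conjunct1[OF conjunct2[OF conjunct2[OF *]]]
  note H4 = conjunct2[OF conjunct2[OF conjunct2[OF *]]]
  have sub: "submodule H A M" if "H \<in> set Hs" for H using conjunct1[OF H4] that by (rule bspec)
  have simple: "K = Hs ! i \<or> K = Hs ! Suc i"
    if "Suc i < length Hs" "submodule K A M" "Hs ! i \<subseteq> K" "K \<subseteq> Hs ! Suc i" for i K
    using conjunct2[OF H4] that by simp
  have inc: "Hs ! i \<subseteq> Hs ! Suc i" if "Suc i < length Hs" for i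
    using conjunct2[OF H4] that by (simp add: psubset_imp_subset)
  have step: "a \<odot>\<^bsub>M\<^esub> v \<in> Hs ! i" if i: "Suc i < length Hs" and v: "v \<in> Hs ! Suc i" for i v
  proof -
    have s1: "submodule (Hs ! i) A M" and s2: "submodule (Hs ! Suc i) A M" using sub i by auto
    note h1 = s1[unfolded submodule_iff[OF M]] and h2 = s2[unfolded submodule_iff[OF M]]
    have vc: "v \<in> carrier M" using h2 v by blast
    \<comment> \<open>\<open>?K\<close> lies between two neighbours of the series. If it equals the
      smaller one, \<open>a v\<close> is in there. If it equals the larger one, then
      \<open>v = h + r a v\<close>, and the unit \<open>1 - r a\<close> forces even \<open>v\<close>
      into the smaller one.\<close>
    let ?K = "{h \<oplus>\<^bsub>M\<^esub> (r \<otimes>\<^bsub>A\<^esub> a) \<odot>\<^bsub>M\<^esub> v | h r. h \<in> Hs ! i \<and> r \<in> carrier A}"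
    have "submodule ?K A M"
      unfolding submodule_iff[OF M]
    proof (intro conjI ballI)
      show "?K \<subseteq> carrier M" using h1 vc ac by auto
      have "\<zero>\<^bsub>M\<^esub> = \<zero>\<^bsub>M\<^esub> \<oplus>\<^bsub>M\<^esub> (\<zero>\<^bsub>A\<^esub> \<otimes>\<^bsub>A\<^esub> a) \<odot>\<^bsub>M\<^esub> v" using ac vc by simp
      then show "\<zero>\<^bsub>M\<^esub> \<in> ?K" using h1 R.zero_closed by blast
      fix p assume "p \<in> ?K"
      then obtain h r where p: "p = h \<oplus>\<^bsub>M\<^esub> (r \<otimes>\<^bsub>A\<^esub> a) \<odot>\<^bsub>M\<^esub> v" "h \<in> Hs ! i" "r \<in> carrier A" by blast
      have hc: "h \<in> carrier M" using h1 p by blast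
      { fix q assume "q \<in> ?K"
        then obtain h' r' where q: "q = h' \<oplus>\<^bsub>M\<^esub> (r' \<otimes>\<^bsub>A\<^esub> a) \<odot>\<^bsub>M\<^esub> v" "h' \<in> Hs ! i" "r' \<in> carrier A" by blast
        have hc': "h' \<in> carrier M" using h1 q by blast
        have "p \<oplus>\<^bsub>M\<^esub> q = (h \<oplus>\<^bsub>M\<^esub> h') \<oplus>\<^bsub>M\<^esub> ((r \<oplus>\<^bsub>A\<^esub> r') \<otimes>\<^bsub>A\<^esub> a) \<odot>\<^bsub>M\<^esub> v"
          using p q hc hc' ac vc by (simp add: R.l_distr smult_l_distr M.a_ac)
        then show "p \<oplus>\<^bsub>M\<^esub> q \<in> ?K" using h1 p q R.a_closed by blast }
      fix b assume b: "b \<in> carrier A"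
      have "b \<odot>\<^bsub>M\<^esub> p = b \<odot>\<^bsub>M\<^esub> h \<oplus>\<^bsub>M\<^esub> ((b \<otimes>\<^bsub>A\<^esub> r) \<otimes>\<^bsub>A\<^esub> a) \<odot>\<^bsub>M\<^esub> v"
        using p hc ac vc b by (simp add: smult_r_distr smult_assoc1 R.m_assoc)
      then show "b \<odot>\<^bsub>M\<^esub> p \<in> ?K" using h1 p b R.m_closed by blast
    qed
    moreover have iK: "Hs ! i \<subseteq> ?K"
    proof
      fix h assume h: "h \<in> Hs ! i"
      then have "h = h \<oplus>\<^bsub>M\<^esub> (\<zero>\<^bsub>A\<^esub> \<otimes>\<^bsub>A\<^esub> a) \<odot>\<^bsub>M\<^esub> v" using h1 ac vc by (auto simp: subset_iff)
      then show "h \<in> ?K" using h R.zero_closed by blast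
    qed
    moreover have "?K \<subseteq> Hs ! Suc i"
    proof
      fix p assume "p \<in> ?K"
      then obtain h r where p: "p = h \<oplus>\<^bsub>M\<^esub> (r \<otimes>\<^bsub>A\<^esub> a) \<odot>\<^bsub>M\<^esub> v" "h \<in> Hs ! i" "r \<in> carrier A" by blast
      have "(r \<otimes>\<^bsub>A\<^esub> a) \<odot>\<^bsub>M\<^esub> v \<in> Hs ! Suc i" "h \<in> Hs ! Suc i" using h2 v p inc[OF i] ac by auto
      then show "p \<in> Hs ! Suc i" using h2 p by blast
    qed
    ultimately consider "?K = Hs ! i" | "?K = Hs ! Suc i" using simple[OF i] by blast
    then show ?thesis
    proof cases
      case 1
      have "a \<odot>\<^bsub>M\<^esub> v = \<zero>\<^bsub>M\<^esub> \<oplus>\<^bsub>M\<^esub> (\<one>\<^bsub>A\<^esub> \<otimes>\<^bsub>A\<^esub> a) \<odot>\<^bsub>M\<^esub> v" using ac vc by simp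
      then have "a \<odot>\<^bsub>M\<^esub> v \<in> ?K" using h1 R.one_closed by blast
      then show ?thesis using 1 by simp
    next
      case 2
      then obtain h r where hr: "v = h \<oplus>\<^bsub>M\<^esub> (r \<otimes>\<^bsub>A\<^esub> a) \<odot>\<^bsub>M\<^esub> v" "h \<in> Hs ! i" "r \<in> carrier A" using v by blast
      obtain u where u: "u \<in> carrier A" "u \<otimes>\<^bsub>A\<^esub> (\<one>\<^bsub>A\<^esub> \<ominus>\<^bsub>A\<^esub> r \<otimes>\<^bsub>A\<^esub> a) = \<one>\<^bsub>A\<^esub>"
        using local_ring_unit[OF local a hr(3)] by blast
      have hc: "h \<in> carrier M" using h1 hr by blast
      have "(\<one>\<^bsub>A\<^esub> \<ominus>\<^bsub>A\<^esub> r \<otimes>\<^bsub>A\<^esub> a) \<odot>\<^bsub>M\<^esub> v = v \<oplus>\<^bsub>M\<^esub> \<ominus>\<^bsub>M\<^esub> ((r \<otimes>\<^bsub>A\<^esub> a) \<odot>\<^bsub>M\<^esub> v)"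
        using hr(3) ac vc by (simp add: a_minus_def smult_l_distr smult_l_minus)
      also have "\<dots> = h \<oplus>\<^bsub>M\<^esub> ((r \<otimes>\<^bsub>A\<^esub> a) \<odot>\<^bsub>M\<^esub> v \<oplus>\<^bsub>M\<^esub> \<ominus>\<^bsub>M\<^esub> ((r \<otimes>\<^bsub>A\<^esub> a) \<odot>\<^bsub>M\<^esub> v))"
        using hr ac vc hc by (metis M.a_assoc M.a_inv_closed R.m_closed smult_closed)
      also have "\<dots> = h" using hr(3) ac vc hc by (simp add: M.r_neg)
      finally have "(u \<otimes>\<^bsub>A\<^esub> (\<one>\<^bsub>A\<^esub> \<ominus>\<^bsub>A\<^esub> r \<otimes>\<^bsub>A\<^esub> a)) \<odot>\<^bsub>M\<^esub> v = u \<odot>\<^bsub>M\<^esub> h"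
        using u(1) hr(3) ac vc by (simp add: smult_assoc1)
      then have "v \<in> Hs ! i" using u vc h1 hr(2) by simp
      then show ?thesis using h1 ac by blast
    qed
  qed
  have "(a [^]\<^bsub>A\<^esub> i) \<odot>\<^bsub>M\<^esub> v = \<zero>\<^bsub>M\<^esub>" if "i < length Hs" "v \<in> Hs ! i" for i v
    using that
  proof (induction i arbitrary: v)
    case 0 then show ?case using Hs by (simp add: hd_conv_nth)
  next
    case (Suc i)
    have "v \<in> carrier M" using sub[of "Hs ! Suc i"] Suc.prems unfolding submodule_iff[OF M] by auto
    then have "(a [^]\<^bsub>A\<^esub> Suc i) \<odot>\<^bsub>M\<^esub> v = (a [^]\<^bsub>A\<^esub> i) \<odot>\<^bsub>M\<^esub> (a \<odot>\<^bsub>M\<^esub> v)" using ac by (simp add: smult_assoc1)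
    then show ?case using Suc.IH[OF _ step[OF Suc.prems]] Suc.prems by simp
  qed
  then show ?thesis using Hs by (intro exI[of _ "length Hs - 1"]) (simp add: last_conv_nth)
qed

section \<open>Products of an ideal with a module\<close>

context module begin

lemma span_submodule:
  assumes "S \<subseteq> carrier M"
  shows "submodule (module_span R M S) R M"
proof -
  have "submodule H R M \<Longrightarrow> \<zero>\<^bsub>M\<^esub> \<in> H" for H by (simp add: submodule_iff[OF module_axioms])
  moreover have "module_span R M S \<subseteq> carrier M" using assms carrier_is_submodule by (auto simp: module_span_def)
  ultimately show ?thesis unfolding submodule_iff[OF module_axioms] by (auto simp: module_span_def submodule_iff[OF module_axioms])
qed

lemma ideal_smult_submodule:
  assumes "J \<subseteq> carrier R"
  shows "submodule (ideal_smult R J M) R M"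
  unfolding ideal_smult_def by (rule span_submodule) (use assms in auto)

lemma ideal_smultI: "\<lbrakk>a \<in> J; m \<in> carrier M\<rbrakk> \<Longrightarrow> a \<odot>\<^bsub>M\<^esub> m \<in> ideal_smult R J M"
  unfolding ideal_smult_def module_span_def by blast

lemma ideal_smult_minimal:
  assumes "submodule H R M" "\<And>a m. \<lbrakk>a \<in> J; m \<in> carrier M\<rbrakk> \<Longrightarrow> a \<odot>\<^bsub>M\<^esub> m \<in> H"
  shows "ideal_smult R J M \<subseteq> H"
  unfolding ideal_smult_def module_span_def using assms by blast

lemma submodule_finsum:
  assumes H: "submodule H R M" and "finite S" "\<And>i. i \<in> S \<Longrightarrow> f i \<in> H"
  shows "finsum M f S \<in> H"
  using assms(2,3)
proof (induction S)
  case empty then show ?case using H by (simp add: submodule_iff[OF module_axioms])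
next
  case (insert x S)
  then have "f \<in> S \<rightarrow> carrier M" "f x \<in> carrier M" using H unfolding submodule_iff[OF module_axioms] by auto
  then show ?case using insert H by (simp add: submodule_iff[OF module_axioms])
qed

lemma submodule_vimage:
  assumes H: "submodule H R N" and N: "module R N"
    and q: "\<And>m. m \<in> carrier M \<Longrightarrow> q m \<in> carrier N"
    "\<And>m m'. \<lbrakk>m \<in> carrier M; m' \<in> carrier M\<rbrakk> \<Longrightarrow> q (m \<oplus>\<^bsub>M\<^esub> m') = q m \<oplus>\<^bsub>N\<^esub> q m'"
    "\<And>a m. \<lbrakk>a \<in> carrier R; m \<in> carrier M\<rbrakk> \<Longrightarrow> q (a \<odot>\<^bsub>M\<^esub> m) = a \<odot>\<^bsub>N\<^esub> q m"
  shows "submodule {m \<in> carrier M. q m \<in> H} R M"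
proof -
  interpret N: module R N by (rule N)
  have "q (\<zero> \<odot>\<^bsub>M\<^esub> \<zero>\<^bsub>M\<^esub>) = \<zero> \<odot>\<^bsub>N\<^esub> q \<zero>\<^bsub>M\<^esub>" by (rule q(3)) auto
  then have "q \<zero>\<^bsub>M\<^esub> = \<zero>\<^bsub>N\<^esub>" using q(1) by simp
  then show ?thesis using H q(2,3) unfolding submodule_iff[OF module_axioms] submodule_iff[OF N] by auto
qed

end

lemma (in module_quot) finsum_coset:
  assumes "finite S" "\<And>i. i \<in> S \<Longrightarrow> f i \<in> carrier M"
  shows "finsum Q (\<lambda>i. H +>\<^bsub>M\<^esub> f i) S = H +>\<^bsub>M\<^esub> finsum M f S"
proof -
  interpret Q: module R Q by (rule Q_module)
  show ?thesis
    using assms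
  proof (induction S)
    case empty then show ?case by (simp add: Q_zero coset_zero)
  next
    case (insert x S)
    then have "f \<in> S \<rightarrow> carrier M" "f x \<in> carrier M" "(\<lambda>i. H +>\<^bsub>M\<^esub> f i) \<in> S \<rightarrow> carrier Q" "H +>\<^bsub>M\<^esub> f x \<in> carrier Q"
      using Q_carrierI by auto
    then show ?case using insert by (simp add: Q_add)
  qed
qed

section \<open>Graded modules over the Rees ring\<close>

locale rees_module = rees A I + M?: module A M for A (structure) and I and M (structure)

locale rees_sum_data = rees_module +
  fixes U V :: "nat \<Rightarrow> 'c set"
  assumes U_sub: "submodule (U n) A M" and V_sub: "submodule (V n) A M" and VU: "V n \<subseteq> U n"
    and U_mult: "\<lbrakk>a \<in> ideal_pow A I k; m \<in> U j\<rbrakk> \<Longrightarrow> a \<odot>\<^bsub>M\<^esub> m \<in> U (k + j)"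
    and V_mult: "\<lbrakk>a \<in> ideal_pow A I k; m \<in> V j\<rbrakk> \<Longrightarrow> a \<odot>\<^bsub>M\<^esub> m \<in> V (k + j)"
begin

abbreviation E where "E \<equiv> rees_sum M U V"

lemma quot: "module_quot A M (V n)"
  by (rule module_quotI[OF M.module_axioms V_sub])

lemma Uc: "m \<in> U n \<Longrightarrow> m \<in> carrier M" and U0: "\<zero>\<^bsub>M\<^esub> \<in> U n"
  and Uadd: "\<lbrakk>m \<in> U n; m' \<in> U n\<rbrakk> \<Longrightarrow> m \<oplus>\<^bsub>M\<^esub> m' \<in> U n"
  using U_sub[of n] unfolding submodule_iff[OF M.module_axioms] by auto

lemma coset_zero: "V n +>\<^bsub>M\<^esub> \<zero>\<^bsub>M\<^esub> = V n"
  by (rule module_quot.coset_zero[OF quot])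

lemma coset_eq_V: "m \<in> carrier M \<Longrightarrow> V n +>\<^bsub>M\<^esub> m = V n \<longleftrightarrow> m \<in> V n"
  by (rule module_quot.coset_eq_H_iff[OF quot])

lemma E_simps: "zero E = V" "add E = (\<lambda>f g n. f n <+>\<^bsub>M\<^esub> g n)"
  by (simp_all add: rees_sum_def)

lemma E_carrier: "f \<in> carrier E \<longleftrightarrow> (\<forall>n. \<exists>m\<in>U n. f n = V n +>\<^bsub>M\<^esub> m) \<and> finite {n. f n \<noteq> V n}"
  by (simp add: rees_sum_def image_iff)

lemma E_hcomp: "f \<in> hcomp E n \<longleftrightarrow> (\<forall>j. \<exists>m\<in>U j. f j = V j +>\<^bsub>M\<^esub> m) \<and> (\<forall>j. int j \<noteq> n \<longrightarrow> f j = V j)"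
  by (simp add: rees_sum_def image_iff)

text \<open>Representing the trivial coset by 0 keeps the finite support visible on representatives;
  closure of the carrier under scalars depends on it.\<close>

lemma reps:
  assumes "\<And>n. \<exists>m\<in>U n. f n = V n +>\<^bsub>M\<^esub> m"
  obtains m where "\<And>n. m n \<in> U n" "\<And>n. f n = V n +>\<^bsub>M\<^esub> m n" "\<And>n. f n = V n \<Longrightarrow> m n = \<zero>\<^bsub>M\<^esub>"
proof -
  have "\<forall>n. \<exists>m\<in>U n. f n = V n +>\<^bsub>M\<^esub> m \<and> (f n = V n \<longrightarrow> m = \<zero>\<^bsub>M\<^esub>)"
  proof
    fix n show "\<exists>m\<in>U n. f n = V n +>\<^bsub>M\<^esub> m \<and> (f n = V n \<longrightarrow> m = \<zero>\<^bsub>M\<^esub>)"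
      using assms[of n] U0[of n] coset_zero[of n] by (cases "f n = V n") auto
  qed
  then show ?thesis using that by metis
qed

lemma act_coset:
  assumes a: "a \<in> Ip k" and m: "m \<in> carrier M" and n: "n = k + j"
  shows "(\<Union>x\<in>V j +>\<^bsub>M\<^esub> m. V n +>\<^bsub>M\<^esub> (a \<odot>\<^bsub>M\<^esub> x)) = V n +>\<^bsub>M\<^esub> (a \<odot>\<^bsub>M\<^esub> m)"
proof -
  interpret j: module_quot A M "V j" by (rule quot)
  interpret n: module_quot A M "V n" by (rule quot)
  have ac: "a \<in> carrier A" by (rule IpD(1)[OF a])
  show ?thesis
  proof (rule j.UN_coset[OF m])
    fix x assume x: "x \<in> V j +>\<^bsub>M\<^esub> m"
    obtain h where h: "h \<in> V j" "x = h \<oplus>\<^bsub>M\<^esub> m" using j.coset_memD(1)[OF m x] by blast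
    have hc: "h \<in> carrier M" by (rule j.H_sub[OF h(1)])
    have "a \<odot>\<^bsub>M\<^esub> x \<ominus>\<^bsub>M\<^esub> a \<odot>\<^bsub>M\<^esub> m = a \<odot>\<^bsub>M\<^esub> h"
      using h ac m hc by (simp add: smult_r_distr a_minus_def M.a_assoc M.r_neg)
    moreover have "a \<odot>\<^bsub>M\<^esub> h \<in> V n" unfolding n by (rule V_mult[OF a h(1)])
    ultimately show "V n +>\<^bsub>M\<^esub> (a \<odot>\<^bsub>M\<^esub> x) = V n +>\<^bsub>M\<^esub> (a \<odot>\<^bsub>M\<^esub> m)"
      using n.coset_eq_iff[of "a \<odot>\<^bsub>M\<^esub> x" "a \<odot>\<^bsub>M\<^esub> m"] ac m j.coset_memD(2)[OF m x] by simp
  qed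
qed

text \<open>One family of representatives for all degrees reduces the convolution of cosets to
  finite sums in \<open>M\<close>.\<close>

lemma smult_apply:
  assumes p: "p \<in> carrier R" and m: "\<And>n. m n \<in> carrier M" and f: "\<And>n. f n = V n +>\<^bsub>M\<^esub> m n"
  shows "(p \<odot>\<^bsub>E\<^esub> f) n = V n +>\<^bsub>M\<^esub> finsum M (\<lambda>k. p k \<odot>\<^bsub>M\<^esub> m (n - k)) {..n}"
proof -
  interpret Q: module_quot A M "V n" by (rule quot)
  interpret QM: module A Q.Q by (rule Q.Q_module)
  have pm: "p k \<odot>\<^bsub>M\<^esub> m j \<in> carrier M" for k j using R_apply(2)[OF p] m by simp
  have "(p \<odot>\<^bsub>E\<^esub> f) n = finsum Q.Q (\<lambda>k. \<Union>x\<in>f (n - k). V n +>\<^bsub>M\<^esub> (p k \<odot>\<^bsub>M\<^esub> x)) {..n}"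
    by (simp add: rees_sum_def)
  also have "\<dots> = finsum Q.Q (\<lambda>k. V n +>\<^bsub>M\<^esub> (p k \<odot>\<^bsub>M\<^esub> m (n - k))) {..n}"
  proof (rule QM.M.finsum_cong')
    fix k assume "k \<in> {..n}"
    then show "(\<Union>x\<in>f (n - k). V n +>\<^bsub>M\<^esub> (p k \<odot>\<^bsub>M\<^esub> x)) = V n +>\<^bsub>M\<^esub> (p k \<odot>\<^bsub>M\<^esub> m (n - k))"
      unfolding f by (intro act_coset[OF R_apply(1)[OF p] m]) simp
  qed (use pm Q.Q_carrierI in auto)
  also have "\<dots> = V n +>\<^bsub>M\<^esub> finsum M (\<lambda>k. p k \<odot>\<^bsub>M\<^esub> m (n - k)) {..n}"
    by (rule Q.finsum_coset) (use pm in auto)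
  finally show ?thesis .
qed

lemma mon_smult_apply:
  assumes a: "a \<in> Ip i" and m: "\<And>n. m n \<in> carrier M" and f: "\<And>n. f n = V n +>\<^bsub>M\<^esub> m n"
  shows "(mon a i \<odot>\<^bsub>E\<^esub> f) n = (if i \<le> n then V n +>\<^bsub>M\<^esub> (a \<odot>\<^bsub>M\<^esub> m (n - i)) else V n)"
proof -
  have ac: "a \<in> carrier A" by (rule IpD(1)[OF a])
  have "finsum M (\<lambda>k. mon a i k \<odot>\<^bsub>M\<^esub> m (n - k)) {..n} = finsum M (\<lambda>k. if i = k then a \<odot>\<^bsub>M\<^esub> m (n - k) else \<zero>\<^bsub>M\<^esub>) {..n}"
    by (rule M.finsum_cong') (use m ac in \<open>auto simp: mon_def\<close>)
  also have "\<dots> = (if i \<le> n then a \<odot>\<^bsub>M\<^esub> m (n - i) else \<zero>\<^bsub>M\<^esub>)"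
  proof (cases "i \<le> n")
    case True
    then show ?thesis using M.finsum_singleton[of i "{..n}" "\<lambda>k. a \<odot>\<^bsub>M\<^esub> m (n - k)"] m ac by simp
  next
    case False
    then have "finsum M (\<lambda>k. if i = k then a \<odot>\<^bsub>M\<^esub> m (n - k) else \<zero>\<^bsub>M\<^esub>) {..n} = finsum M (\<lambda>k. \<zero>\<^bsub>M\<^esub>) {..n}"
      by (intro M.finsum_cong') auto
    then show ?thesis using False by simp
  qed
  finally show ?thesis using smult_apply[OF mon_R[OF a] m f, of n] coset_zero by simp
qed

lemma E_zero_closed: "V \<in> carrier E"
  unfolding E_carrier using U0 coset_zero by (metis (mono_tags) Collect_empty_eq finite.emptyI)

lemma add_coset: "\<lbrakk>m \<in> carrier M; m' \<in> carrier M\<rbrakk> \<Longrightarrow>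
    (V n +>\<^bsub>M\<^esub> m) <+>\<^bsub>M\<^esub> (V n +>\<^bsub>M\<^esub> m') = V n +>\<^bsub>M\<^esub> (m \<oplus>\<^bsub>M\<^esub> m')"
  by (rule module_quot.set_add_coset[OF quot])

lemma V_add_V: "V n <+>\<^bsub>M\<^esub> V n = V n"
  using add_coset[of "\<zero>\<^bsub>M\<^esub>" "\<zero>\<^bsub>M\<^esub>" n] by (simp add: coset_zero)

lemma add_rep: 
  assumes "\<exists>m\<in>U n. f n = V n +>\<^bsub>M\<^esub> m" "\<exists>m\<in>U n. g n = V n +>\<^bsub>M\<^esub> m"
  shows "\<exists>m\<in>U n. (f \<oplus>\<^bsub>E\<^esub> g) n = V n +>\<^bsub>M\<^esub> m"
  using assms add_coset Uc Uadd by (auto simp: E_simps)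

lemma E_add_closed:
  assumes f: "f \<in> carrier E" and g: "g \<in> carrier E"
  shows "f \<oplus>\<^bsub>E\<^esub> g \<in> carrier E"
proof -
  have "{n. (f \<oplus>\<^bsub>E\<^esub> g) n \<noteq> V n} \<subseteq> {n. f n \<noteq> V n} \<union> {n. g n \<noteq> V n}" by (auto simp: E_simps V_add_V)
  moreover have "finite ({n. f n \<noteq> V n} \<union> {n. g n \<noteq> V n})" using f g by (auto simp: E_carrier)
  ultimately have "finite {n. (f \<oplus>\<^bsub>E\<^esub> g) n \<noteq> V n}" by (rule finite_subset)
  then show ?thesis using add_rep[of _ f g] f g by (simp add: E_carrier)
qed

lemma E_smult_closed:
  assumes p: "p \<in> carrier R" and f: "f \<in> carrier E"
  shows "p \<odot>\<^bsub>E\<^esub> f \<in> carrier E"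
proof -
  obtain m where m: "\<And>n. m n \<in> U n" "\<And>n. f n = V n +>\<^bsub>M\<^esub> m n" "\<And>n. f n = V n \<Longrightarrow> m n = \<zero>\<^bsub>M\<^esub>"
    using reps[of f] f by (auto simp: E_carrier)
  note pf = smult_apply[OF p Uc[OF m(1)] m(2)]
  have "finsum M (\<lambda>k. p k \<odot>\<^bsub>M\<^esub> m (n - k)) {..n} \<in> U n" for n
  proof (rule M.submodule_finsum[OF U_sub])
    fix k assume "k \<in> {..n}"
    then show "p k \<odot>\<^bsub>M\<^esub> m (n - k) \<in> U n" using U_mult[OF R_apply(1)[OF p] m(1), of k "n - k"] by simp
  qed simp
  moreover have "finite {n. (p \<odot>\<^bsub>E\<^esub> f) n \<noteq> V n}"
  proof -
    obtain N where N: "\<And>n. p n \<noteq> \<zero> \<Longrightarrow> n \<le> N" using R_finite[OF p] finite_nat_set_iff_bounded_le[of "{n. p n \<noteq> \<zero>}"] by auto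
    obtain N' where N': "\<And>n. f n \<noteq> V n \<Longrightarrow> n \<le> N'" using f finite_nat_set_iff_bounded_le[of "{n. f n \<noteq> V n}"] by (auto simp: E_carrier)
    have "(p \<odot>\<^bsub>E\<^esub> f) n = V n" if "n > N + N'" for n
    proof -
      have "p k \<odot>\<^bsub>M\<^esub> m (n - k) = \<zero>\<^bsub>M\<^esub>" for k
      proof (cases "p k = \<zero>")
        case True then show ?thesis using Uc[OF m(1)] by simp
      next
        case False
        then have "k \<le> N" by (rule N)
        then have "f (n - k) = V (n - k)" using N'[of "n - k"] that by fastforce
        then show ?thesis using m(3) R_apply(2)[OF p] by simp
      qed
      then show ?thesis using pf[of n] coset_zero by simp
    qed
    then have "{n. (p \<odot>\<^bsub>E\<^esub> f) n \<noteq> V n} \<subseteq> {..N + N'}" by (auto simp: not_less[symmetric])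
    then show ?thesis using finite_subset by blast
  qed
  ultimately show ?thesis using pf by (auto simp: E_carrier)
qed

lemma V_rep: "\<exists>m\<in>U j. V j = V j +>\<^bsub>M\<^esub> m"
  using U0 coset_zero by metis

lemma V_hcomp: "V \<in> hcomp E n"
  using V_rep by (simp add: E_hcomp)

definition single :: "nat \<Rightarrow> 'c \<Rightarrow> nat \<Rightarrow> 'c set" where
  "single n m = (\<lambda>j. if j = n then V n +>\<^bsub>M\<^esub> m else V j)"

lemma hcomp_single: "f \<in> hcomp E (int n) \<longleftrightarrow> (\<exists>m\<in>U n. f = single n m)"
proof
  assume f: "f \<in> hcomp E (int n)"
  then obtain m where "m \<in> U n" "f n = V n +>\<^bsub>M\<^esub> m" unfolding E_hcomp by blast
  then show "\<exists>m\<in>U n. f = single n m" using f by (intro bexI[of _ m]) (auto simp: single_def E_hcomp fun_eq_iff)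
next
  assume "\<exists>m\<in>U n. f = single n m"
  then show "f \<in> hcomp E (int n)" using V_rep by (auto simp: E_hcomp single_def)
qed

lemma hcomp_neg: "n < 0 \<Longrightarrow> hcomp E n = {V}"
  using V_rep by (auto simp: E_hcomp fun_eq_iff)

lemma single_eq_zero: "m \<in> carrier M \<Longrightarrow> single n m = V \<longleftrightarrow> m \<in> V n"
  using coset_eq_V[of m n] by (auto simp: single_def fun_eq_iff)

lemma single_eq: "\<lbrakk>m \<in> carrier M; m' \<in> carrier M\<rbrakk> \<Longrightarrow> single n m = single n m' \<longleftrightarrow> m \<ominus>\<^bsub>M\<^esub> m' \<in> V n"
  using module_quot.coset_eq_iff[OF quot, of m m' n] by (auto simp: single_def fun_eq_iff)

lemma mon_single:
  assumes a: "a \<in> Ip i" and m: "m \<in> carrier M"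
  shows "mon a i \<odot>\<^bsub>E\<^esub> single n m = single (i + n) (a \<odot>\<^bsub>M\<^esub> m)"
proof
  fix j
  have "(mon a i \<odot>\<^bsub>E\<^esub> single n m) j = (if i \<le> j then V j +>\<^bsub>M\<^esub> (a \<odot>\<^bsub>M\<^esub> (if j - i = n then m else \<zero>\<^bsub>M\<^esub>)) else V j)"
    by (rule mon_smult_apply[OF a]) (use m coset_zero in \<open>auto simp: single_def\<close>)
  then show "(mon a i \<odot>\<^bsub>E\<^esub> single n m) j = single (i + n) (a \<odot>\<^bsub>M\<^esub> m) j"
    using IpD(1)[OF a] coset_zero by (auto simp: single_def)
qed

text \<open>The axioms are pulled back along an injective linear map into a known module, so
  associativity of the convolution action is never computed. For \<open>L(M)\<close> and
  \<open>L(N)\<close> the maps are the augmentations of the given resolutions, for \<open>B\<close>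
  it is the inclusion into \<open>L(M)\<close>.\<close>

lemma E_module:
  assumes Y: "module R Y" and hc: "\<And>f. f \<in> carrier E \<Longrightarrow> h f \<in> carrier Y"
    and ha: "\<And>f g. \<lbrakk>f \<in> carrier E; g \<in> carrier E\<rbrakk> \<Longrightarrow> h (f \<oplus>\<^bsub>E\<^esub> g) = h f \<oplus>\<^bsub>Y\<^esub> h g"
    and hs: "\<And>p f. \<lbrakk>p \<in> carrier R; f \<in> carrier E\<rbrakk> \<Longrightarrow> h (p \<odot>\<^bsub>E\<^esub> f) = p \<odot>\<^bsub>Y\<^esub> h f"
    and inj: "inj_on h (carrier E)"
  shows "module R E"
proof -
  interpret Y: module R Y by (rule Y)
  note cl = E_add_closed E_smult_closed E_zero_closed
  have z: "V \<oplus>\<^bsub>E\<^esub> V = V" by (simp add: E_simps V_add_V)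
  have h0: "h V = \<zero>\<^bsub>Y\<^esub>" using ha[OF E_zero_closed E_zero_closed] hc[OF E_zero_closed] unfolding z
    by (metis Y.M.add.r_cancel_one' Y.M.zero_closed)
  have eq: "f = g" if "f \<in> carrier E" "g \<in> carrier E" "h f = h g" for f g
    using inj_onD[OF inj that(3,1,2)] .
  show ?thesis
  proof (rule moduleI)
    show "cring R" by (rule R_cring)
    show "abelian_group E"
    proof (rule abelian_groupI)
      fix f assume f: "f \<in> carrier E"
      let ?g = "(\<ominus>\<^bsub>R\<^esub> \<one>\<^bsub>R\<^esub>) \<odot>\<^bsub>E\<^esub> f"
      have o: "\<ominus>\<^bsub>R\<^esub> \<one>\<^bsub>R\<^esub> \<in> carrier R" by (rule RR.a_inv_closed[OF RR.one_closed])
      have g: "?g \<in> carrier E" by (rule cl(2)[OF o f])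
      have "h (?g \<oplus>\<^bsub>E\<^esub> f) = h V"
        unfolding ha[OF g f] hs[OF o f] h0 Y.smult_l_minus[OF RR.one_closed hc[OF f]] Y.smult_one[OF hc[OF f]]
        by (rule Y.M.l_neg[OF hc[OF f]])
      then have "?g \<oplus>\<^bsub>E\<^esub> f = V" by (rule eq[OF cl(1)[OF g f] cl(3)])
      then show "\<exists>g\<in>carrier E. g \<oplus>\<^bsub>E\<^esub> f = \<zero>\<^bsub>E\<^esub>" using g unfolding E_simps(1) by blast
      show "\<zero>\<^bsub>E\<^esub> \<oplus>\<^bsub>E\<^esub> f = f"
        unfolding E_simps(1) by (rule eq[OF cl(1)[OF cl(3) f] f]) (simp add: ha cl f h0 hc)
      fix g assume g: "g \<in> carrier E"
      show "f \<oplus>\<^bsub>E\<^esub> g = g \<oplus>\<^bsub>E\<^esub> f" by (rule eq) (simp_all add: ha cl f g hc Y.M.a_comm)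
      show "f \<oplus>\<^bsub>E\<^esub> g \<oplus>\<^bsub>E\<^esub> k = f \<oplus>\<^bsub>E\<^esub> (g \<oplus>\<^bsub>E\<^esub> k)" if "k \<in> carrier E" for k
        by (rule eq) (simp_all add: ha cl f g that hc Y.M.a_assoc)
    qed (use cl in \<open>auto simp: E_simps(1)\<close>)
  next
    show "a \<odot>\<^bsub>E\<^esub> f \<in> carrier E" if "a \<in> carrier R" "f \<in> carrier E" for a f by (rule cl(2)[OF that])
    show "(a \<oplus>\<^bsub>R\<^esub> b) \<odot>\<^bsub>E\<^esub> f = a \<odot>\<^bsub>E\<^esub> f \<oplus>\<^bsub>E\<^esub> b \<odot>\<^bsub>E\<^esub> f"
      if ab: "a \<in> carrier R" "b \<in> carrier R" and f: "f \<in> carrier E" for a b f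
      by (rule eq) (simp_all add: ha hs cl f ab RR.a_closed[OF ab] hc Y.smult_l_distr del: R_simps)
    show "(a \<otimes>\<^bsub>R\<^esub> b) \<odot>\<^bsub>E\<^esub> f = a \<odot>\<^bsub>E\<^esub> (b \<odot>\<^bsub>E\<^esub> f)"
      if ab: "a \<in> carrier R" "b \<in> carrier R" and f: "f \<in> carrier E" for a b f
      by (rule eq) (simp_all add: hs cl f ab RR.m_closed[OF ab] hc Y.smult_assoc1 del: R_simps)
    show "a \<odot>\<^bsub>E\<^esub> (f \<oplus>\<^bsub>E\<^esub> g) = a \<odot>\<^bsub>E\<^esub> f \<oplus>\<^bsub>E\<^esub> a \<odot>\<^bsub>E\<^esub> g"
      if a: "a \<in> carrier R" and f: "f \<in> carrier E" and g: "g \<in> carrier E" for a f g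
      by (rule eq) (simp_all add: ha hs cl f g a hc Y.smult_r_distr)
    show "\<one>\<^bsub>R\<^esub> \<odot>\<^bsub>E\<^esub> f = f" if f: "f \<in> carrier E" for f
      by (rule eq) (simp_all add: hs cl f hc RR.one_closed del: R_simps)
  qed
qed

lemma hcomp_carrier: "f \<in> hcomp E n \<Longrightarrow> f \<in> carrier E"
proof -
  assume f: "f \<in> hcomp E n"
  then have "{j. f j \<noteq> V j} \<subseteq> {nat n}" unfolding E_hcomp by force
  then have "finite {j. f j \<noteq> V j}" by (rule finite_subset) simp
  then show ?thesis using f by (simp add: E_carrier E_hcomp)
qed

lemma E_graded:
  assumes m: "module R E"
  shows "is_graded_module R G E"
proof -
  interpret E: module R E by (rule m)
  define pr where "pr n f = (\<lambda>j. if int j = n then f j else V j)" for n and f :: "nat \<Rightarrow> 'c set"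
  have sc: "a \<odot>\<^bsub>E\<^esub> e \<in> hcomp E (i + j)" if a: "a \<in> G i" and e: "e \<in> hcomp E j" for i j a e
  proof (cases "i < 0 \<or> j < 0")
    case True
    have ac: "a \<in> carrier R" using a by (simp add: G_iff)
    have "a = \<zero>\<^bsub>R\<^esub> \<or> e = \<zero>\<^bsub>E\<^esub>" using True G_neg[of i] hcomp_neg[of j] a e by (auto simp: E_simps)
    then have "a \<odot>\<^bsub>E\<^esub> e = \<zero>\<^bsub>E\<^esub>" using E.smult_l_null[OF hcomp_carrier[OF e]] E.smult_r_null[OF ac] by auto
    then show ?thesis using V_hcomp by (simp add: E_simps(1))
  next
    case False
    then obtain p q where pq: "i = int p" "j = int q" by (metis nonneg_int_cases not_less)
    have h: "a p \<in> Ip p" "a = mon (a p) p" using G_mon[of a p] a pq by auto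
    obtain m where m: "m \<in> U q" "e = single q m" using e hcomp_single pq by auto
    have "a \<odot>\<^bsub>E\<^esub> e = single (p + q) (a p \<odot>\<^bsub>M\<^esub> m)" using mon_single[OF h(1) Uc[OF m(1)], of q] h(2) m(2) by metis
    then show ?thesis using hcomp_single[of _ "p + q"] U_mult[OF h(1) m(1)] pq by auto
  qed
  have one: "\<ominus>\<^bsub>R\<^esub> \<one>\<^bsub>R\<^esub> \<in> G 0"
    using RG.hneg[of "\<one>\<^bsub>R\<^esub>" 0] mon_G[of \<one> 0] mon_one by (simp add: a_inv_def m_inv_def)
  have neg: "\<ominus>\<^bsub>E\<^esub> f \<in> hcomp E n" if "f \<in> hcomp E n" for f n
    using sc[OF one that] E.smult_l_minus[OF RR.one_closed hcomp_carrier[OF that]] E.smult_one[OF hcomp_carrier[OF that]] by simp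
  show ?thesis
  proof (rule graded_moduleI[OF m, where prj = pr])
    show "additive_subgroup (hcomp E n) E" for n
      unfolding additive_subgroup_iff[OF E.abelian_group_axioms]
    proof (intro conjI ballI)
      show "f \<oplus>\<^bsub>E\<^esub> g \<in> hcomp E n" if "f \<in> hcomp E n" "g \<in> hcomp E n" for f g
        using that add_rep[of _ f g] unfolding E_hcomp by (auto simp: E_simps V_add_V)
    qed (use hcomp_carrier V_hcomp neg in \<open>auto simp: E_simps(1)\<close>)
    show "a \<odot>\<^bsub>E\<^esub> e \<in> hcomp E (i + j)" if "a \<in> G i" "e \<in> hcomp E j" for i j a e by (rule sc[OF that])
    show "pr n e \<in> hcomp E n" if "e \<in> carrier E" for n e
      using that V_rep unfolding E_hcomp E_carrier pr_def by auto
    show "pr n (e \<oplus>\<^bsub>E\<^esub> f) = pr n e \<oplus>\<^bsub>E\<^esub> pr n f" for n e f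
      by (auto simp: pr_def E_simps V_add_V fun_eq_iff)
    show "pr k e = (if k = n then e else \<zero>\<^bsub>E\<^esub>)" if "e \<in> hcomp E n" for n k e
      using that by (auto simp: pr_def E_simps E_hcomp fun_eq_iff)
    show "finite {n. pr n e \<noteq> \<zero>\<^bsub>E\<^esub>}" if "e \<in> carrier E" for e
    proof -
      have "{n. pr n e \<noteq> \<zero>\<^bsub>E\<^esub>} \<subseteq> int ` {n. e n \<noteq> V n}"
        by (auto simp: pr_def E_simps fun_eq_iff split: if_splits)
      then show ?thesis using that finite_subset by (auto simp: E_carrier)
    qed
    show "e = \<zero>\<^bsub>E\<^esub>" if "e \<in> carrier E" "\<And>n. pr n e = \<zero>\<^bsub>E\<^esub>" for e
    proof
      fix j show "e j = \<zero>\<^bsub>E\<^esub> j" using fun_cong[OF that(2)[of "int j"], of j] by (simp add: pr_def)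
    qed
  qed
qed

end

section \<open>The filtration by the powers of the ideal\<close>

context rees_module begin

definition W :: "nat \<Rightarrow> 'c set" where "W n = ideal_smult A (ideal_pow A I n) M"

lemma W_sub: "submodule (W n) A M"
  unfolding W_def by (rule ideal_smult_submodule) (use IpD(1) in blast)

lemma Wc: "m \<in> W n \<Longrightarrow> m \<in> carrier M" and W_zero: "\<zero>\<^bsub>M\<^esub> \<in> W n"
  and W_add: "\<lbrakk>m \<in> W n; m' \<in> W n\<rbrakk> \<Longrightarrow> m \<oplus>\<^bsub>M\<^esub> m' \<in> W n"
  and W_smult: "\<lbrakk>a \<in> carrier A; m \<in> W n\<rbrakk> \<Longrightarrow> a \<odot>\<^bsub>M\<^esub> m \<in> W n"
  using W_sub[of n] unfolding submodule_iff[OF M.module_axioms] by auto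

lemma W_gen: "\<lbrakk>a \<in> ideal_pow A I n; m \<in> carrier M\<rbrakk> \<Longrightarrow> a \<odot>\<^bsub>M\<^esub> m \<in> W n"
  unfolding W_def by (rule ideal_smultI)

lemma W_0: "W 0 = carrier M"
  using W_gen[of \<one> 0] Wc[of _ 0] by auto

lemma W_le: "submodule H A M \<Longrightarrow> (\<And>a m. \<lbrakk>a \<in> ideal_pow A I n; m \<in> carrier M\<rbrakk> \<Longrightarrow> a \<odot>\<^bsub>M\<^esub> m \<in> H) \<Longrightarrow> W n \<subseteq> H"
  unfolding W_def by (rule ideal_smult_minimal)

lemma W_mult: assumes a: "a \<in> ideal_pow A I k" and m: "m \<in> W n" shows "a \<odot>\<^bsub>M\<^esub> m \<in> W (k + n)"
proof -
  have ac: "a \<in> carrier A" by (rule IpD(1)[OF a])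
  have "W n \<subseteq> {m \<in> carrier M. a \<odot>\<^bsub>M\<^esub> m \<in> W (k + n)}"
  proof (rule W_le)
    show "submodule {m \<in> carrier M. a \<odot>\<^bsub>M\<^esub> m \<in> W (k + n)} A M"
      by (rule submodule_vimage[OF W_sub M.module_axioms])
        (use ac in \<open>auto simp: smult_r_distr A.m_comm simp flip: smult_assoc1\<close>)
    fix b m assume b: "b \<in> ideal_pow A I n" and m: "m \<in> carrier M"
    have "(a \<otimes> b) \<odot>\<^bsub>M\<^esub> m \<in> W (k + n)" by (rule W_gen[OF ideal_pow_mult[OF I a b] m])
    then show "b \<odot>\<^bsub>M\<^esub> m \<in> {m \<in> carrier M. a \<odot>\<^bsub>M\<^esub> m \<in> W (k + n)}"
      using ac IpD(1)[OF b] m by (simp add: smult_assoc1)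
  qed
  then show ?thesis using m by blast
qed

lemma L_data: "rees_sum_data A I M (\<lambda>n. carrier M) (\<lambda>n. W (Suc n))"
proof (rule rees_sum_data.intro[OF rees_module_axioms], rule rees_sum_data_axioms.intro)
  show "submodule (carrier M) A M" by (rule carrier_is_submodule)
  show "submodule (W (Suc n)) A M" for n by (rule W_sub)
  show "W (Suc n) \<subseteq> carrier M" for n using Wc by blast
  show "a \<odot>\<^bsub>M\<^esub> m \<in> carrier M" if "a \<in> ideal_pow A I k" "m \<in> carrier M" for a k m
    using that IpD(1) by blast
  show "a \<odot>\<^bsub>M\<^esub> m \<in> W (Suc (k + j))" if "a \<in> ideal_pow A I k" "m \<in> W (Suc j)" for a k m j
    using W_mult[OF that] by simp
qed

lemma L_eq: "L_module A I M = rees_sum M (\<lambda>n. carrier M) (\<lambda>n. W (Suc n))"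
  unfolding L_module_def W_def Suc_eq_plus1 by (rule refl)

end

section \<open>Multiplication by x t and its kernel\<close>

locale xt_data = rees_module +
  fixes x
  assumes x: "x \<in> I"
begin

lemma xc: "x \<in> carrier A" by (rule idealD(1)[OF I x])
lemma x1: "x \<in> ideal_pow A I (Suc 0)" using ideal_pow_one[OF I x] by simp

lemma colon_sub: "submodule (colon M (W n) x) A M"
  unfolding colon_def
  by (rule submodule_vimage[OF W_sub M.module_axioms])
    (use xc in \<open>auto simp: smult_r_distr A.m_comm simp flip: smult_assoc1\<close>)

lemma W_colon: "W n \<subseteq> colon M (W (Suc n)) x"
  using Wc W_mult[OF x1, of _ n] by (auto simp: colon_def)

sublocale L: rees_sum_data A I M "\<lambda>n. carrier M" "\<lambda>n. W (Suc n)" by (rule L_data)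

sublocale B: rees_sum_data A I M "\<lambda>n. colon M (W (Suc n)) x" W
proof (rule rees_sum_data.intro[OF rees_module_axioms], rule rees_sum_data_axioms.intro)
  show "submodule (colon M (W (Suc n)) x) A M" for n by (rule colon_sub)
  show "submodule (W n) A M" for n by (rule W_sub)
  show "W n \<subseteq> colon M (W (Suc n)) x" for n by (rule W_colon)
  show "a \<odot>\<^bsub>M\<^esub> m \<in> W (k + j)" if "a \<in> ideal_pow A I k" "m \<in> W j" for a k m j by (rule W_mult[OF that])
  show "a \<odot>\<^bsub>M\<^esub> m \<in> colon M (W (Suc (k + j))) x" if a: "a \<in> ideal_pow A I k" and m: "m \<in> colon M (W (Suc j)) x" for a k m j
  proof -
    have mc: "m \<in> carrier M" "x \<odot>\<^bsub>M\<^esub> m \<in> W (Suc j)" using m by (auto simp: colon_def)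
    have ac: "a \<in> carrier A" by (rule IpD(1)[OF a])
    have "x \<odot>\<^bsub>M\<^esub> (a \<odot>\<^bsub>M\<^esub> m) = a \<odot>\<^bsub>M\<^esub> (x \<odot>\<^bsub>M\<^esub> m)"
      using ac xc mc(1) by (simp add: A.m_comm flip: smult_assoc1)
    then show ?thesis using W_mult[OF a mc(2)] ac mc(1) by (simp add: colon_def)
  qed
qed

lemma B_eq: "B_module A I x M = B.E"
  unfolding B_module_def W_def[abs_def] Suc_eq_plus1 by (rule refl)

lemma colonD: "m \<in> colon M H x \<Longrightarrow> m \<in> carrier M" "m \<in> colon M H x \<Longrightarrow> x \<odot>\<^bsub>M\<^esub> m \<in> H"
  by (auto simp: colon_def)

abbreviation xt where "xt \<equiv> mon x (Suc 0)"

lemma xt_single: "m \<in> carrier M \<Longrightarrow> xt \<odot>\<^bsub>L.E\<^esub> L.single n m = L.single (Suc n) (x \<odot>\<^bsub>M\<^esub> m)"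
  using L.mon_single[OF x1, of m n] by simp

text \<open>The inclusion of \<open>B\<close> into \<open>L(M)(-1)\<close>: a coset of
  \<open>I^n M\<close> has degree \<open>n\<close> in \<open>B\<close> but degree
  \<open>n - 1\<close> in \<open>L(M)\<close>. The entry in degree 0 is dropped, which loses nothing
  because \<open>I^0 M = M\<close>; see \<open>B_at_0\<close>.\<close>

definition sh :: "(nat \<Rightarrow> 'c set) \<Rightarrow> nat \<Rightarrow> 'c set" where "sh f = (\<lambda>j. f (Suc j))"

lemma sh_carrier:
  assumes f: "f \<in> carrier B.E"
  shows "sh f \<in> carrier L.E"
proof -
  have "{j. f (Suc j) \<noteq> W (Suc j)} = Suc -` {n. f n \<noteq> W n}" by auto
  moreover have "finite (Suc -` {n. f n \<noteq> W n})" by (rule finite_vimageI) (use f in \<open>auto simp: B.E_carrier\<close>)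
  ultimately have "finite {j. f (Suc j) \<noteq> W (Suc j)}" by simp
  moreover have "\<exists>m\<in>carrier M. f (Suc j) = W (Suc j) +>\<^bsub>M\<^esub> m" for j
    using f colonD(1) unfolding B.E_carrier by blast
  ultimately show ?thesis by (simp add: L.E_carrier sh_def)
qed

lemma sh_add: "sh (f \<oplus>\<^bsub>B.E\<^esub> g) = sh f \<oplus>\<^bsub>L.E\<^esub> sh g"
  by (simp add: sh_def B.E_simps L.E_simps)

lemma sh_smult:
  assumes p: "p \<in> carrier R" and f: "f \<in> carrier B.E"
  shows "sh (p \<odot>\<^bsub>B.E\<^esub> f) = p \<odot>\<^bsub>L.E\<^esub> sh f"
proof
  fix j
  obtain m where m: "\<And>n. m n \<in> colon M (W (Suc n)) x" "\<And>n. f n = W n +>\<^bsub>M\<^esub> m n"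
    using B.reps[of f] f unfolding B.E_carrier by metis
  have mc: "m n \<in> carrier M" for n using colonD(1)[OF m(1)] .
  have pm: "p k \<odot>\<^bsub>M\<^esub> m n \<in> carrier M" for k n using R_apply(2)[OF p] mc by simp
  interpret Q: module_quot A M "W (Suc j)" by (rule module_quotI[OF M.module_axioms W_sub])
  let ?s = "finsum M (\<lambda>k. p k \<odot>\<^bsub>M\<^esub> m (Suc (j - k))) {..j}"
  have sc: "?s \<in> carrier M" using pm by simp
  have "finsum M (\<lambda>k. p k \<odot>\<^bsub>M\<^esub> m (Suc j - k)) {..j} = ?s"
    by (rule M.finsum_cong') (use pm in \<open>auto simp: Suc_diff_le\<close>)
  \<comment> \<open>In degree \<open>j + 1\<close> the convolution for \<open>B\<close> has one term
    more than that for \<open>L(M)\<close> in degree \<open>j\<close>, the action on entry 0. That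
    term lies in \<open>I^(j+1) M\<close> and vanishes in the quotient.\<close>
  then have "finsum M (\<lambda>k. p k \<odot>\<^bsub>M\<^esub> m (Suc j - k)) {..Suc j} = p (Suc j) \<odot>\<^bsub>M\<^esub> m 0 \<oplus>\<^bsub>M\<^esub> ?s"
    using pm by (simp add: M.finsum_Suc)
  then have "(p \<odot>\<^bsub>B.E\<^esub> f) (Suc j) = W (Suc j) +>\<^bsub>M\<^esub> (p (Suc j) \<odot>\<^bsub>M\<^esub> m 0 \<oplus>\<^bsub>M\<^esub> ?s)"
    using B.smult_apply[OF p mc m(2), of "Suc j"] by simp
  moreover have "W (Suc j) +>\<^bsub>M\<^esub> (p (Suc j) \<odot>\<^bsub>M\<^esub> m 0 \<oplus>\<^bsub>M\<^esub> ?s) = W (Suc j) +>\<^bsub>M\<^esub> ?s"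
  proof -
    have "p (Suc j) \<odot>\<^bsub>M\<^esub> m 0 \<in> W (Suc j)" by (rule W_gen[OF R_apply(1)[OF p] mc])
    moreover have "(p (Suc j) \<odot>\<^bsub>M\<^esub> m 0 \<oplus>\<^bsub>M\<^esub> ?s) \<ominus>\<^bsub>M\<^esub> ?s = p (Suc j) \<odot>\<^bsub>M\<^esub> m 0"
      using pm[of "Suc j" 0] sc by (simp add: a_minus_def M.a_assoc M.r_neg)
    ultimately show ?thesis using Q.coset_eq_iff[of "p (Suc j) \<odot>\<^bsub>M\<^esub> m 0 \<oplus>\<^bsub>M\<^esub> ?s" ?s] pm[of "Suc j" 0] sc by simp
  qed
  moreover have "(p \<odot>\<^bsub>L.E\<^esub> sh f) j = W (Suc j) +>\<^bsub>M\<^esub> ?s"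
    by (rule L.smult_apply[OF p, of "\<lambda>n. m (Suc n)"]) (use mc m(2) in \<open>auto simp: sh_def\<close>)
  ultimately show "sh (p \<odot>\<^bsub>B.E\<^esub> f) j = (p \<odot>\<^bsub>L.E\<^esub> sh f) j" by (simp add: sh_def)
qed

lemma B_at_0: "f \<in> carrier B.E \<Longrightarrow> f 0 = W 0"
proof -
  assume "f \<in> carrier B.E"
  then obtain m where m: "m \<in> colon M (W (Suc 0)) x" "f 0 = W 0 +>\<^bsub>M\<^esub> m" unfolding B.E_carrier by blast
  then show ?thesis using B.coset_eq_V[of m 0] colonD(1)[OF m(1)] W_0 by simp
qed

lemma sh_inj: "inj_on sh (carrier B.E)"
proof (rule inj_onI)
  fix f g assume fg: "f \<in> carrier B.E" "g \<in> carrier B.E" "sh f = sh g"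
  show "f = g"
  proof
    fix n show "f n = g n"
      using B_at_0[OF fg(1)] B_at_0[OF fg(2)] fun_cong[OF fg(3), of "n - 1"] by (cases n) (auto simp: sh_def)
  qed
qed

lemma sh_single: "sh (B.single (Suc n) m) = L.single n m"
  by (auto simp: sh_def B.single_def L.single_def fun_eq_iff)

lemma sh_hcomp: "f \<in> hcomp B.E n \<Longrightarrow> sh f \<in> hcomp L.E (n - 1)"
proof -
  assume f: "f \<in> hcomp B.E n"
  have "\<exists>m\<in>carrier M. f (Suc j) = W (Suc j) +>\<^bsub>M\<^esub> m" for j
    using f colonD(1) unfolding B.E_hcomp by blast
  moreover have "f (Suc j) = W (Suc j)" if "int j \<noteq> n - 1" for j
    using f that unfolding B.E_hcomp by auto
  ultimately show ?thesis by (simp add: L.E_hcomp sh_def)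
qed

text \<open>The only element of negative degree is written as the class of 0 in degree 0, so that
  the formulas for \<open>L.single\<close> apply to it too.\<close>

lemma hcomp_cases:
  assumes "f \<in> hcomp L.E n"
  obtains "f = L.single 0 \<zero>\<^bsub>M\<^esub>" "n < 0" | k m where "n = int k" "m \<in> carrier M" "f = L.single k m"
proof (cases "n < 0")
  case True
  then have "f = L.single 0 \<zero>\<^bsub>M\<^esub>" using assms L.hcomp_neg[of n] L.single_eq_zero[of "\<zero>\<^bsub>M\<^esub>" 0] W_zero by auto
  then show ?thesis using that True by blast
next
  case False
  then obtain k where "n = int k" by (metis nonneg_int_cases not_less)
  then show ?thesis using that assms L.hcomp_single[of f k] by auto
qed

lemma xt_kernel:
  assumes f: "f \<in> hcomp L.E (n - 1)" and xf: "xt \<odot>\<^bsub>L.E\<^esub> f = \<zero>\<^bsub>L.E\<^esub>"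
  shows "\<exists>g\<in>hcomp B.E n. sh g = f"
  using f
proof (cases rule: hcomp_cases)
  case 1
  have "sh W = f" using 1 L.single_eq_zero[of "\<zero>\<^bsub>M\<^esub>" 0] W_zero by (simp add: sh_def)
  then show ?thesis using B.V_hcomp by blast
next
  case (2 k m)
  have "L.single (Suc k) (x \<odot>\<^bsub>M\<^esub> m) = (\<lambda>n. W (Suc n))" using xf xt_single[of m k] 2 by (simp add: L.E_simps)
  then have "x \<odot>\<^bsub>M\<^esub> m \<in> W (Suc (Suc k))" using L.single_eq_zero[of "x \<odot>\<^bsub>M\<^esub> m" "Suc k"] xc 2 by simp
  then have "m \<in> colon M (W (Suc (Suc k))) x" using 2 by (simp add: colon_def)
  then have "B.single (Suc k) m \<in> hcomp B.E (int (Suc k))" using B.hcomp_single[of _ "Suc k"] by blast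
  moreover have "int (Suc k) = n" using 2(1) by simp
  ultimately have "B.single (Suc k) m \<in> hcomp B.E n" by (simp only:)
  then show ?thesis using sh_single[of k m] 2(3) by (intro bexI[of _ "B.single (Suc k) m"]) simp_all
qed

lemma xt_sh:
  assumes f: "f \<in> hcomp B.E n"
  shows "xt \<odot>\<^bsub>L.E\<^esub> sh f = \<zero>\<^bsub>L.E\<^esub>"
proof -
  obtain m where m: "\<And>n. m n \<in> colon M (W (Suc n)) x" "\<And>n. f n = W n +>\<^bsub>M\<^esub> m n"
    using B.reps[of f] f unfolding B.E_hcomp by metis
  have mc: "m n \<in> carrier M" for n using colonD(1)[OF m(1)] .
  have "(xt \<odot>\<^bsub>L.E\<^esub> sh f) j = W (Suc j)" for j
  proof -
    have "(xt \<odot>\<^bsub>L.E\<^esub> sh f) j = (if Suc 0 \<le> j then W (Suc j) +>\<^bsub>M\<^esub> (x \<odot>\<^bsub>M\<^esub> m (Suc (j - Suc 0))) else W (Suc j))"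
      by (rule L.mon_smult_apply[OF x1, of "\<lambda>n. m (Suc n)"]) (use mc m(2) in \<open>auto simp: sh_def\<close>)
    then show ?thesis using L.coset_eq_V[of "x \<odot>\<^bsub>M\<^esub> m j" j] colonD(2)[OF m(1)[of j]] xc mc by (cases j) auto
  qed
  then show ?thesis by (simp add: L.E_simps fun_eq_iff)
qed

text \<open>Finite length of \<open>M/IM\<close> gives one \<open>k\<close> with
  \<open>c^k M \<subseteq> I M\<close>. Multiplying by \<open>I^n\<close> and iterating gives
  \<open>c^(k n) M \<subseteq> I^n M\<close>.\<close>

lemma smult_nilpotent:
  assumes local: "noetherian_local A \<mm>" and fl: "finite_length A (quot_module M (ideal_smult A I M))"
    and c: "c \<in> \<mm>" and m: "m \<in> carrier M"
  shows "\<exists>k::nat. (c [^] k) \<odot>\<^bsub>M\<^esub> m \<in> W n"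
proof -
  have "ideal \<mm> A" using local by (auto simp: noetherian_local_def maximalideal_def)
  then have cc: "c \<in> carrier A" using c idealD(1) by blast
  have IM: "submodule (ideal_smult A I M) A M" by (rule ideal_smult_submodule) (use idealD(1)[OF I] in blast)
  interpret Q: module_quot A M "ideal_smult A I M" by (rule module_quotI[OF M.module_axioms IM])
  obtain k :: nat where k: "\<And>C. C \<in> carrier Q.Q \<Longrightarrow> (c [^] k) \<odot>\<^bsub>Q.Q\<^esub> C = \<zero>\<^bsub>Q.Q\<^esub>"
    using finite_length_nilpotent[OF local Q.Q_module fl c] by blast
  have sub: "ideal_smult A I M \<subseteq> W (Suc 0)"
    by (rule ideal_smult_minimal[OF W_sub W_gen]) (use ideal_pow_one[OF I] in simp_all)
  have k1: "(c [^] k) \<odot>\<^bsub>M\<^esub> v \<in> W (Suc 0)" if v: "v \<in> carrier M" for v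
  proof -
    have "(c [^] k) \<odot>\<^bsub>Q.Q\<^esub> (ideal_smult A I M +>\<^bsub>M\<^esub> v) = \<zero>\<^bsub>Q.Q\<^esub>" by (rule k[OF Q.Q_carrierI[OF v]])
    then have "(c [^] k) \<odot>\<^bsub>M\<^esub> v \<in> ideal_smult A I M"
      using Q.Q_smult[of "c [^] k" v] Q.coset_eq_H_iff[of "(c [^] k) \<odot>\<^bsub>M\<^esub> v"] cc v by (simp add: Q.Q_zero)
    then show ?thesis using sub by blast
  qed
  have k2: "(c [^] k) \<odot>\<^bsub>M\<^esub> v \<in> W (Suc n)" if v: "v \<in> W n" for v n
  proof -
    have "W n \<subseteq> {v \<in> carrier M. (c [^] k) \<odot>\<^bsub>M\<^esub> v \<in> W (Suc n)}"
    proof (rule W_le)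
      show "submodule {v \<in> carrier M. (c [^] k) \<odot>\<^bsub>M\<^esub> v \<in> W (Suc n)} A M"
        by (rule submodule_vimage[OF W_sub M.module_axioms])
          (use cc in \<open>auto simp: smult_r_distr A.m_comm simp flip: smult_assoc1\<close>)
      fix b v assume b: "b \<in> ideal_pow A I n" and v: "v \<in> carrier M"
      have bc: "b \<in> carrier A" by (rule IpD(1)[OF b])
      have "(c [^] k) \<odot>\<^bsub>M\<^esub> (b \<odot>\<^bsub>M\<^esub> v) = b \<odot>\<^bsub>M\<^esub> ((c [^] k) \<odot>\<^bsub>M\<^esub> v)"
        using cc bc v by (simp add: A.m_comm flip: smult_assoc1)
      then show "b \<odot>\<^bsub>M\<^esub> v \<in> {v \<in> carrier M. (c [^] k) \<odot>\<^bsub>M\<^esub> v \<in> W (Suc n)}"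
        using W_mult[OF b k1[OF v]] bc v by simp
    qed
    then show ?thesis using v by blast
  qed
  have "(c [^] (k * n)) \<odot>\<^bsub>M\<^esub> m \<in> W n" for n
  proof (induction n)
    case 0 then show ?case using m W_0 cc by simp
  next
    case (Suc n)
    have "c [^] (k * Suc n) = c [^] k \<otimes> c [^] (k * n)" using cc by (simp add: nat_pow_mult)
    then show ?case using k2[OF Suc] cc m by (simp add: smult_assoc1)
  qed
  then show ?thesis by blast
qed

text \<open>The two kinds of generators are killed for different reasons. For \<open>c\<close> in
  \<open>\<mm>\<close>, in degree 0, finite length suffices, since each component of
  \<open>L(M)\<close> is a quotient by some \<open>I^n M\<close>. For \<open>c t\<close> with
  \<open>c\<close> in \<open>I\<close>, a power of \<open>c\<close> moves \<open>m\<close> into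
  \<open>I^k M\<close>, where the superficiality relation is available.\<close>

lemma xt_kernel_torsion:
  assumes local: "noetherian_local A \<mm>" and fl: "finite_length A (quot_module M (ideal_smult A I M))"
    and sup: "superficial A M I x"
    and f: "f \<in> hcomp L.E n" and xf: "xt \<odot>\<^bsub>L.E\<^esub> f = \<zero>\<^bsub>L.E\<^esub>"
    and s: "(\<exists>c\<in>\<mm>. s = mon c 0) \<or> (\<exists>c\<in>I. s = mon c (Suc 0))"
  shows "\<exists>k::nat. (s [^]\<^bsub>R\<^esub> k) \<odot>\<^bsub>L.E\<^esub> f = \<zero>\<^bsub>L.E\<^esub>"
  using f
proof (cases rule: hcomp_cases)
  case 1
  have "(s [^]\<^bsub>R\<^esub> (0::nat)) \<odot>\<^bsub>L.E\<^esub> f = mon \<one> 0 \<odot>\<^bsub>L.E\<^esub> L.single 0 \<zero>\<^bsub>M\<^esub>" by (simp add: mon_one 1)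
  also have "\<dots> = L.single 0 \<zero>\<^bsub>M\<^esub>" using L.mon_single[of \<one> 0 "\<zero>\<^bsub>M\<^esub>" 0] by simp
  also have "\<dots> = \<zero>\<^bsub>L.E\<^esub>" using L.single_eq_zero[of "\<zero>\<^bsub>M\<^esub>" 0] W_zero by (simp add: L.E_simps)
  finally show ?thesis by blast
next
  case (2 i m)
  have "L.single (Suc i) (x \<odot>\<^bsub>M\<^esub> m) = (\<lambda>n. W (Suc n))" using xf xt_single[of m i] 2 by (simp add: L.E_simps)
  then have xm: "x \<odot>\<^bsub>M\<^esub> m \<in> W (Suc (Suc i))" using L.single_eq_zero[of "x \<odot>\<^bsub>M\<^esub> m" "Suc i"] xc 2 by simp
  have mi: "ideal \<mm> A" using local by (auto simp: noetherian_local_def maximalideal_def)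
  from s show ?thesis
  proof (elim disjE bexE)
    fix c assume c: "c \<in> \<mm>" "s = mon c 0"
    then have cc: "c \<in> carrier A" using idealD(1)[OF mi] by blast
    obtain k :: nat where k: "(c [^] k) \<odot>\<^bsub>M\<^esub> m \<in> W (Suc i)" using smult_nilpotent[OF local fl c(1) 2(2)] by blast
    have "(s [^]\<^bsub>R\<^esub> k) \<odot>\<^bsub>L.E\<^esub> f = L.single i ((c [^] k) \<odot>\<^bsub>M\<^esub> m)"
      using mon_pow[OF cc, of 0 k] L.mon_single[of "c [^] k" 0 m i] cc 2 c by simp
    also have "\<dots> = \<zero>\<^bsub>L.E\<^esub>" using L.single_eq_zero[of "(c [^] k) \<odot>\<^bsub>M\<^esub> m" i] k cc 2 by (simp add: L.E_simps)
    finally show ?thesis by blast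
  next
    fix c assume c: "c \<in> I" "s = mon c (Suc 0)"
    have cc: "c \<in> carrier A" using idealD(1)[OF I c(1)] .
    from sup obtain k where k': "\<forall>n\<ge>k. colon M (ideal_smult A (ideal_pow A I (n + 1)) M) x
        \<inter> ideal_smult A (ideal_pow A I k) M = ideal_smult A (ideal_pow A I n) M"
      unfolding superficial_def by (elim conjE exE)
    have k: "colon M (W (Suc n)) x \<inter> W k = W n" if n: "n \<ge> k" for n
      using k'[rule_format, OF n] unfolding W_def Suc_eq_plus1 .
    have ck: "c [^] k \<in> ideal_pow A I k" using ideal_pow_nat_pow[OF I ideal_pow_one[OF I c(1)], of k] by simp
    have ckc: "c [^] k \<in> carrier A" using cc by simp
    have "(c [^] k) \<odot>\<^bsub>M\<^esub> (x \<odot>\<^bsub>M\<^esub> m) \<in> W (k + Suc (Suc i))" by (rule W_mult[OF ck xm])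
    moreover have "(c [^] k) \<odot>\<^bsub>M\<^esub> (x \<odot>\<^bsub>M\<^esub> m) = x \<odot>\<^bsub>M\<^esub> ((c [^] k) \<odot>\<^bsub>M\<^esub> m)"
      using ckc xc 2(2) by (simp add: A.m_comm flip: smult_assoc1)
    ultimately have "(c [^] k) \<odot>\<^bsub>M\<^esub> m \<in> colon M (W (Suc (Suc (k + i)))) x"
      using ckc 2(2) by (simp add: colon_def)
    moreover have "(c [^] k) \<odot>\<^bsub>M\<^esub> m \<in> W k" by (rule W_gen[OF ck 2(2)])
    \<comment> \<open>Superficiality is applied with \<open>n = k + i + 1\<close>, since
      \<open>x c^k m\<close> lies in \<open>I^(k+i+2) M\<close>. The submodule
      \<open>I^(k+i+1) M\<close> reached is the one that is zero in degree \<open>k + i\<close> of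
      \<open>L(M)\<close>.\<close>
    ultimately have "(c [^] k) \<odot>\<^bsub>M\<^esub> m \<in> W (Suc (k + i))" using k[of "Suc (k + i)"] by auto
    moreover have "(s [^]\<^bsub>R\<^esub> k) \<odot>\<^bsub>L.E\<^esub> f = L.single (k + i) ((c [^] k) \<odot>\<^bsub>M\<^esub> m)"
      using mon_pow[OF cc, of "Suc 0" k] L.mon_single[OF ck 2(2), of i] 2 c by simp
    ultimately have "(s [^]\<^bsub>R\<^esub> k) \<odot>\<^bsub>L.E\<^esub> f = \<zero>\<^bsub>L.E\<^esub>"
      using L.single_eq_zero[of "(c [^] k) \<odot>\<^bsub>M\<^esub> m" "k + i"] ckc 2 by (simp add: L.E_simps)
    then show ?thesis by blast
  qed
qed

section \<open>Reduction modulo x\<close>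

abbreviation X where "X \<equiv> (\<lambda>m. x \<odot>\<^bsub>M\<^esub> m) ` carrier M"

lemma X_sub: "submodule X A M"
  unfolding submodule_iff[OF M.module_axioms]
proof (intro conjI ballI)
  show "X \<subseteq> carrier M" using xc by auto
  show "\<zero>\<^bsub>M\<^esub> \<in> X" using xc by (auto intro!: image_eqI[of _ _ "\<zero>\<^bsub>M\<^esub>"])
  fix u assume "u \<in> X"
  then obtain a where a: "a \<in> carrier M" "u = x \<odot>\<^bsub>M\<^esub> a" by blast
  show "u \<oplus>\<^bsub>M\<^esub> v \<in> X" if v: "v \<in> X" for v
  proof -
    obtain b where b: "b \<in> carrier M" "v = x \<odot>\<^bsub>M\<^esub> b" using v by blast
    have "u \<oplus>\<^bsub>M\<^esub> v = x \<odot>\<^bsub>M\<^esub> (a \<oplus>\<^bsub>M\<^esub> b)" using a b xc by (simp add: smult_r_distr)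
    then show ?thesis using a b by blast
  qed
  show "r \<odot>\<^bsub>M\<^esub> u \<in> X" if r: "r \<in> carrier A" for r
  proof -
    have "r \<odot>\<^bsub>M\<^esub> u = x \<odot>\<^bsub>M\<^esub> (r \<odot>\<^bsub>M\<^esub> a)" using a r xc by (simp add: A.m_comm flip: smult_assoc1)
    then show ?thesis using a r by blast
  qed
qed

sublocale N: module_quot A M X by (rule module_quotI[OF M.module_axioms X_sub])

abbreviation Nq where "Nq \<equiv> quot_module M X"
abbreviation q where "q m \<equiv> X +>\<^bsub>M\<^esub> m"

sublocale NR: rees_module A I Nq
  using N.Q_module I by (simp add: rees_module_def rees_def rees_axioms_def cring_axioms)

sublocale LN: rees_sum_data A I Nq "\<lambda>n. carrier Nq" "\<lambda>n. NR.W (Suc n)" by (rule NR.L_data)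

text \<open>This is \<open>I^n (M/xM) = (I^n M + x M)/x M\<close>. Both inclusions come from
  minimality of a generated submodule, tested against an image in one direction and a preimage in
  the other.\<close>

lemma WN_iff:
  assumes m: "m \<in> carrier M"
  shows "q m \<in> NR.W n \<longleftrightarrow> (\<exists>w\<in>W n. \<exists>m'\<in>carrier M. m = w \<oplus>\<^bsub>M\<^esub> x \<odot>\<^bsub>M\<^esub> m')"
proof
  have "submodule (q ` W n) A Nq"
    unfolding submodule_iff[OF N.Q_module]
  proof (intro conjI ballI)
    show "q ` W n \<subseteq> carrier Nq" using Wc N.Q_carrierI by blast
    show "\<zero>\<^bsub>Nq\<^esub> \<in> q ` W n" using W_zero N.coset_zero by (force simp: N.Q_zero)
  qed (use Wc W_add W_smult in \<open>auto simp: N.Q_add N.Q_smult\<close>)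
  then have sub: "NR.W n \<subseteq> q ` W n"
  proof (rule NR.W_le)
    fix a C assume a: "a \<in> ideal_pow A I n" and C: "C \<in> carrier Nq"
    obtain v where v: "v \<in> carrier M" "C = q v" using N.Q_carrierE[OF C] by blast
    then have "a \<odot>\<^bsub>Nq\<^esub> C = q (a \<odot>\<^bsub>M\<^esub> v)" using N.Q_smult IpD(1)[OF a] by simp
    then show "a \<odot>\<^bsub>Nq\<^esub> C \<in> q ` W n" using W_gen[OF a v(1)] by blast
  qed
  assume "q m \<in> NR.W n"
  then obtain w where w: "w \<in> W n" "q m = q w" using sub by blast
  then have "m \<ominus>\<^bsub>M\<^esub> w \<in> X" using N.coset_eq_iff[OF m Wc[OF w(1)]] by simp
  then obtain m' where m': "m' \<in> carrier M" "m \<ominus>\<^bsub>M\<^esub> w = x \<odot>\<^bsub>M\<^esub> m'" by blast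
  have "m = w \<oplus>\<^bsub>M\<^esub> (m \<ominus>\<^bsub>M\<^esub> w)" using m Wc[OF w(1)] by (simp add: a_minus_def M.a_ac M.r_neg1 M.r_neg2 M.r_neg)
  then show "\<exists>w\<in>W n. \<exists>m'\<in>carrier M. m = w \<oplus>\<^bsub>M\<^esub> x \<odot>\<^bsub>M\<^esub> m'" using w m' by auto
next
  assume "\<exists>w\<in>W n. \<exists>m'\<in>carrier M. m = w \<oplus>\<^bsub>M\<^esub> x \<odot>\<^bsub>M\<^esub> m'"
  then obtain w m' where w: "w \<in> W n" "m' \<in> carrier M" "m = w \<oplus>\<^bsub>M\<^esub> x \<odot>\<^bsub>M\<^esub> m'" by blast
  have wc: "w \<in> carrier M" by (rule Wc[OF w(1)])
  have "m \<ominus>\<^bsub>M\<^esub> w = x \<odot>\<^bsub>M\<^esub> m'"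
    using w wc xc by (simp add: a_minus_def M.a_ac M.r_neg1 M.r_neg2 M.r_neg)
  then have "q m = q w" using N.coset_eq_iff[OF m wc] w by simp
  moreover have "W n \<subseteq> {v \<in> carrier M. q v \<in> NR.W n}"
  proof (rule W_le)
    show "submodule {v \<in> carrier M. q v \<in> NR.W n} A M"
      by (rule submodule_vimage[OF NR.W_sub N.Q_module]) (simp_all add: N.Q_carrierI N.Q_add N.Q_smult)
    fix a v assume a: "a \<in> ideal_pow A I n" and v: "v \<in> carrier M"
    show "a \<odot>\<^bsub>M\<^esub> v \<in> {v \<in> carrier M. q v \<in> NR.W n}"
      using NR.W_gen[OF a N.Q_carrierI[OF v]] IpD(1)[OF a] v by (simp add: N.Q_smult)
  qed
  ultimately show "q m \<in> NR.W n" using w(1) by auto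
qed

abbreviation proj where "proj \<equiv> L_map A I Nq (\<lambda>m. q m)"

lemma proj_single:
  assumes m: "m \<in> carrier M"
  shows "proj (L.single n m) = LN.single n (q m)"
proof
  fix j
  have coset: "(\<Union>v\<in>W (Suc j) +>\<^bsub>M\<^esub> m'. NR.W (Suc j) +>\<^bsub>Nq\<^esub> q v) = NR.W (Suc j) +>\<^bsub>Nq\<^esub> q m'"
    if m': "m' \<in> carrier M" for m'
  proof -
    interpret Q: module_quot A M "W (Suc j)" by (rule module_quotI[OF M.module_axioms W_sub])
    interpret QN: module_quot A Nq "NR.W (Suc j)" by (rule module_quotI[OF N.Q_module NR.W_sub])
    show ?thesis
    proof (rule Q.UN_coset[OF m'])
      fix v assume v: "v \<in> W (Suc j) +>\<^bsub>M\<^esub> m'"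
      obtain w where w: "w \<in> W (Suc j)" "v = w \<oplus>\<^bsub>M\<^esub> m'" using Q.coset_memD(1)[OF m' v] by blast
      have wc: "w \<in> carrier M" by (rule Wc[OF w(1)])
      have qw: "q w \<in> NR.W (Suc j)" using WN_iff[OF wc] w(1) wc xc by (intro iffD2[OF WN_iff[OF wc]] bexI[of _ w] bexI[of _ "\<zero>\<^bsub>M\<^esub>"]) simp_all
      have car: "q w \<in> carrier Nq" "q m' \<in> carrier Nq" using N.Q_carrierI wc m' by auto
      have "q v = q w \<oplus>\<^bsub>Nq\<^esub> q m'" using w wc m' by (simp add: N.Q_add)
      moreover have "(q w \<oplus>\<^bsub>Nq\<^esub> q m') \<ominus>\<^bsub>Nq\<^esub> q m' = q w"
        using car by (simp add: a_minus_def NR.M.a_assoc NR.M.r_neg)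
      ultimately show "NR.W (Suc j) +>\<^bsub>Nq\<^esub> q v = NR.W (Suc j) +>\<^bsub>Nq\<^esub> q m'"
        using QN.coset_eq_iff[of "q w \<oplus>\<^bsub>Nq\<^esub> q m'" "q m'"] qw car by simp
    qed
  qed
  have "proj (L.single n m) j = (\<Union>v\<in>L.single n m j. NR.W (Suc j) +>\<^bsub>Nq\<^esub> q v)"
    by (simp add: L_map_def NR.W_def)
  also have "\<dots> = LN.single n (q m) j"
  proof (cases "j = n")
    case True then show ?thesis using coset[OF m] by (simp add: L.single_def LN.single_def)
  next
    case False
    have "(\<Union>v\<in>W (Suc j). NR.W (Suc j) +>\<^bsub>Nq\<^esub> q v) = NR.W (Suc j) +>\<^bsub>Nq\<^esub> q \<zero>\<^bsub>M\<^esub>"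
      using coset[of "\<zero>\<^bsub>M\<^esub>"] L.coset_zero[of j] by simp
    also have "\<dots> = NR.W (Suc j)" using LN.coset_zero[of j] N.coset_zero by (simp add: N.Q_zero)
    finally show ?thesis using False by (simp add: L.single_def LN.single_def)
  qed
  finally show "proj (L.single n m) j = LN.single n (q m) j" .
qed

lemma proj_xt:
  assumes f: "f \<in> hcomp L.E n"
  shows "proj (xt \<odot>\<^bsub>L.E\<^esub> f) = \<zero>\<^bsub>LN.E\<^esub>"
proof -
  obtain k m where m: "m \<in> carrier M" "f = L.single k m" using f by (cases rule: hcomp_cases) auto
  have xm: "x \<odot>\<^bsub>M\<^esub> m \<in> carrier M" using xc m by simp
  have "q (x \<odot>\<^bsub>M\<^esub> m) = \<zero>\<^bsub>Nq\<^esub>" using N.coset_eq_H_iff[OF xm] m by (simp add: N.Q_zero)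
  then have "LN.single (Suc k) (q (x \<odot>\<^bsub>M\<^esub> m)) = \<zero>\<^bsub>LN.E\<^esub>"
    using LN.single_eq_zero[of "\<zero>\<^bsub>Nq\<^esub>" "Suc k"] NR.W_zero by (simp add: LN.E_simps)
  then show ?thesis using proj_single[OF xm, of "Suc k"] xt_single[OF m(1)] m(2) by simp
qed

text \<open>A kernel element of degree \<open>k\<close> is represented by some \<open>x m'\<close>.
  For \<open>k > 0\<close> it is \<open>x t\<close> times the class of \<open>m'\<close> in degree
  \<open>k - 1\<close>. For \<open>k = 0\<close> no lower degree is available, but
  \<open>x m'\<close> lies in \<open>I M\<close> and the class is already zero.\<close>

lemma proj_kernel:
  assumes g: "g \<in> hcomp L.E n" and pg: "proj g = \<zero>\<^bsub>LN.E\<^esub>"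
  shows "\<exists>f\<in>hcomp L.E (n - 1). xt \<odot>\<^bsub>L.E\<^esub> f = g"
  using g
proof (cases rule: hcomp_cases)
  case 1
  have "xt \<odot>\<^bsub>L.E\<^esub> g = L.single (Suc 0) (x \<odot>\<^bsub>M\<^esub> \<zero>\<^bsub>M\<^esub>)" using xt_single[of "\<zero>\<^bsub>M\<^esub>" 0] 1 by simp
  also have "\<dots> = g" using 1 L.single_eq_zero[of "\<zero>\<^bsub>M\<^esub>"] W_zero xc by simp
  finally have "xt \<odot>\<^bsub>L.E\<^esub> g = g" .
  moreover have "g \<in> hcomp L.E (n - 1)" using L.V_hcomp 1 L.single_eq_zero[of "\<zero>\<^bsub>M\<^esub>" 0] W_zero by simp
  ultimately show ?thesis by blast
next
  case (2 k m)
  have qm: "q m \<in> carrier Nq" by (rule N.Q_carrierI[OF 2(2)])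
  have "LN.single k (q m) = (\<lambda>n. NR.W (Suc n))" using pg proj_single[OF 2(2), of k] 2 by (simp add: LN.E_simps)
  then have "q m \<in> NR.W (Suc k)" using LN.single_eq_zero[OF qm, of k] by simp
  then obtain w m' where w: "w \<in> W (Suc k)" "m' \<in> carrier M" "m = w \<oplus>\<^bsub>M\<^esub> x \<odot>\<^bsub>M\<^esub> m'"
    using WN_iff[OF 2(2)] by blast
  have wc: "w \<in> carrier M" by (rule Wc[OF w(1)])
  have xm: "x \<odot>\<^bsub>M\<^esub> m' \<in> carrier M" using xc w by simp
  have "m \<ominus>\<^bsub>M\<^esub> x \<odot>\<^bsub>M\<^esub> m' = w" unfolding w(3) using wc xm by (simp add: a_minus_def M.a_assoc M.r_neg)
  then have gx: "g = L.single k (x \<odot>\<^bsub>M\<^esub> m')" using L.single_eq[OF 2(2) xm, of k] w(1) 2 by simp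
  show ?thesis
  proof (cases k)
    case 0
    have "x \<odot>\<^bsub>M\<^esub> m' \<in> W (Suc 0)" using W_gen[OF x1 w(2)] by simp
    then have g0: "g = L.single (Suc 0) (x \<odot>\<^bsub>M\<^esub> \<zero>\<^bsub>M\<^esub>)"
      using gx 0 L.single_eq_zero[OF xm, of 0] L.single_eq_zero[of "\<zero>\<^bsub>M\<^esub>" "Suc 0"] W_zero xc by simp
    have "L.single 0 \<zero>\<^bsub>M\<^esub> \<in> hcomp L.E (n - 1)"
      using L.V_hcomp L.single_eq_zero[of "\<zero>\<^bsub>M\<^esub>" 0] W_zero by simp
    then show ?thesis using xt_single[of "\<zero>\<^bsub>M\<^esub>" 0] g0 by auto
  next
    case (Suc j)
    have "L.single j m' \<in> hcomp L.E (int j)" using L.hcomp_single[of _ j] w(2) by blast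
    then show ?thesis using xt_single[OF w(2), of j] gx Suc 2(1) by (intro bexI[of _ "L.single j m'"]) auto
  qed
qed

lemma proj_surj:
  assumes h: "h \<in> hcomp LN.E n"
  shows "\<exists>f\<in>hcomp L.E n. proj f = h"
proof (cases "n < 0")
  case True
  have "proj (L.single 0 \<zero>\<^bsub>M\<^esub>) = LN.single 0 \<zero>\<^bsub>Nq\<^esub>"
    using proj_single[of "\<zero>\<^bsub>M\<^esub>" 0] N.coset_zero by (simp add: N.Q_zero)
  then have "proj (L.single 0 \<zero>\<^bsub>M\<^esub>) = h"
    using LN.hcomp_neg[OF True] h LN.single_eq_zero[of "\<zero>\<^bsub>Nq\<^esub>" 0] NR.W_zero by simp
  moreover have "L.single 0 \<zero>\<^bsub>M\<^esub> \<in> hcomp L.E n"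
    using L.V_hcomp L.single_eq_zero[of "\<zero>\<^bsub>M\<^esub>" 0] W_zero by simp
  ultimately show ?thesis by blast
next
  case False
  then obtain k where k: "n = int k" by (metis nonneg_int_cases not_less)
  then obtain C where C: "C \<in> carrier Nq" "h = LN.single k C" using h LN.hcomp_single[of h k] by auto
  obtain m where m: "m \<in> carrier M" "C = q m" using N.Q_carrierE[OF C(1)] by blast
  have "L.single k m \<in> hcomp L.E n" using L.hcomp_single[of _ k] m k by blast
  then show ?thesis using proj_single[OF m(1), of k] C m by auto
qed

end

section \<open>Local cohomology and the long exact sequence\<close>

lemma coset_gr_sub: "a_r_coset (gr_sub E H) = a_r_coset E"
  by (simp add: a_r_coset_def r_coset_def fun_eq_iff)

lemma gr_shift_0 [simp]: "gr_shift 0 E = E"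
  by (simp add: gr_shift_def)

section \<open>Cohomology of the torsion subcomplex\<close>

locale graded_complex = homogeneous_generators +
  fixes E :: "nat \<Rightarrow> ('a, 'e) graded_module" and d :: "nat \<Rightarrow> 'e \<Rightarrow> 'e"
  assumes E_graded: "is_graded_module R G (E i)"
    and d_graded: "d i \<in> graded_hom R (E i) (E (Suc i))"
    and d_d: "e \<in> carrier (E i) \<Longrightarrow> d (Suc i) (d i e) = \<zero>\<^bsub>E (Suc (Suc i))\<^esub>"
begin

abbreviation Z where "Z i \<equiv> lc_cocycles R J E d i"
abbreviation B where "B i \<equiv> lc_coboundaries R J E d i"
abbreviation HL where "HL i \<equiv> local_cohomology R J E d i"

lemma E_gm: "graded_mod R G (E i)" using E_graded by (simp add: graded_mod_def)
lemma E_mod: "module R (E i)" using E_graded by (simp add: is_graded_module_def)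
lemma E_hmod: "hmod R G (E i)" by (rule graded_mod.hmod[OF E_gm])

lemma tors_sub: "submodule (torsion R J (E i)) R (E i)"
  by (rule module.torsion_submodule[OF E_mod J_ideal])

lemma torsD: "e \<in> torsion R J (E i) \<Longrightarrow> e \<in> carrier (E i)" "\<zero>\<^bsub>E i\<^esub> \<in> torsion R J (E i)"
  "\<lbrakk>e \<in> torsion R J (E i); f \<in> torsion R J (E i)\<rbrakk> \<Longrightarrow> e \<oplus>\<^bsub>E i\<^esub> f \<in> torsion R J (E i)"
  "\<lbrakk>a \<in> carrier R; e \<in> torsion R J (E i)\<rbrakk> \<Longrightarrow> a \<odot>\<^bsub>E i\<^esub> e \<in> torsion R J (E i)"
  using tors_sub[of i] unfolding submodule_iff[OF E_mod] by auto

lemma d_zero: "d i \<zero>\<^bsub>E i\<^esub> = \<zero>\<^bsub>E (Suc i)\<^esub>"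
  by (rule module_hom_zero[OF E_mod E_mod d_graded])

lemma d_tors: "e \<in> torsion R J (E i) \<Longrightarrow> d i e \<in> torsion R J (E (Suc i))"
proof -
  assume e: "e \<in> torsion R J (E i)"
  then obtain n where n: "\<And>a. a \<in> ideal_pow R J n \<Longrightarrow> a \<odot>\<^bsub>E i\<^esub> e = \<zero>\<^bsub>E i\<^esub>" by (auto simp: torsion_iff)
  have "a \<odot>\<^bsub>E (Suc i)\<^esub> d i e = \<zero>\<^bsub>E (Suc i)\<^esub>" if a: "a \<in> ideal_pow R J n" for a
    using graded_homD(3)[OF d_graded idealD(1)[OF ideal_pow_ideal[OF J_ideal] a] torsD(1)[OF e]] n[OF a] d_zero by simp
  then show ?thesis unfolding torsion_iff using graded_homD(1)[OF d_graded torsD(1)[OF e]] by blast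
qed

lemma Z_sub: "submodule (Z i) R (E i)"
proof -
  interpret E1: module R "E (Suc i)" by (rule E_mod)
  show ?thesis
    unfolding submodule_iff[OF E_mod] lc_cocycles_def
    using torsD(1)[of _ i] torsD(2)[of i] torsD(3)[of _ i] torsD(4)[of _ _ i] graded_homD(2,3)[OF d_graded[of i]] d_zero[of i] by auto
qed

lemma Z_carrier: "e \<in> Z i \<Longrightarrow> e \<in> carrier (E i)"
  using torsD(1) by (auto simp: lc_cocycles_def)

lemma Z_gcomp: "e \<in> Z i \<Longrightarrow> gcomp (E i) e n \<in> Z i"
proof -
  assume e: "e \<in> Z i"
  interpret E1: graded_mod R G "E (Suc i)" by (rule E_gm)
  have "d i (gcomp (E i) e n) = gcomp (E (Suc i)) (d i e) n"
    using gcomp_graded_hom[OF E_graded E_graded d_graded Z_carrier[OF e]] by simp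
  then show ?thesis
    using e torsion_gcomp[OF E_graded, of e i n] E1.gcomp_zero by (simp add: lc_cocycles_def)
qed

lemma B_Z: "B i \<subseteq> Z i"
proof (cases i)
  case 0
  then show ?thesis using torsD(2)[of 0] d_zero[of 0] by (simp add: lc_cocycles_def lc_coboundaries_def)
next
  case (Suc j)
  then show ?thesis using d_tors[of _ j] d_d[of _ j] torsD(1)[of _ j]
    by (auto simp: lc_cocycles_def lc_coboundaries_def)
qed

lemma sub_graded: "is_graded_module R G (gr_sub (E i) (Z i))"
  by (rule gr_sub_graded[OF E_graded Z_sub Z_gcomp G_carrier])

lemma gcomp_sub: "e \<in> Z i \<Longrightarrow> gcomp (gr_sub (E i) (Z i)) e n = gcomp (E i) e n"
proof -
  assume e: "e \<in> Z i"
  have "(\<lambda>e. e) \<in> graded_hom R (gr_sub (E i) (Z i)) (E i)"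
    using Z_carrier by (auto simp: graded_hom_def)
  from gcomp_graded_hom[OF sub_graded E_graded this, of e n] show ?thesis using e by simp
qed

lemma B_sub: "submodule (B i) R (gr_sub (E i) (Z i))"
proof -
  have m: "module R (gr_sub (E i) (Z i))" using sub_graded by (simp add: is_graded_module_def)
  show ?thesis
  proof (cases i)
    case 0
    interpret E: module R "E 0" by (rule E_mod)
    show ?thesis using 0 B_Z[of i] unfolding submodule_iff[OF m] by (auto simp: lc_coboundaries_def)
  next
    case (Suc j)
    have "u \<oplus>\<^bsub>E i\<^esub> v \<in> B i" if uv: "u \<in> B i" "v \<in> B i" for u v
    proof -
      obtain t r where t: "t \<in> torsion R J (E j)" "u = d j t" "r \<in> torsion R J (E j)" "v = d j r"
        using uv Suc by (auto simp: lc_coboundaries_def)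
      then have "u \<oplus>\<^bsub>E i\<^esub> v = d j (t \<oplus>\<^bsub>E j\<^esub> r)" using graded_homD(2)[OF d_graded torsD(1) torsD(1), of t j r] Suc by simp
      then show ?thesis using torsD(3)[OF t(1,3)] Suc by (auto simp: lc_coboundaries_def)
    qed
    moreover have "a \<odot>\<^bsub>E i\<^esub> u \<in> B i" if au: "a \<in> carrier R" "u \<in> B i" for a u
    proof -
      obtain t where t: "t \<in> torsion R J (E j)" "u = d j t" using au Suc by (auto simp: lc_coboundaries_def)
      then have "a \<odot>\<^bsub>E i\<^esub> u = d j (a \<odot>\<^bsub>E j\<^esub> t)" using graded_homD(3)[OF d_graded au(1) torsD(1), of t j] Suc by simp
      then show ?thesis using torsD(4)[OF au(1) t(1)] Suc by (auto simp: lc_coboundaries_def)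
    qed
    moreover have "\<zero>\<^bsub>E i\<^esub> \<in> B i"
      using d_zero[of j] torsD(2)[of j] Suc unfolding lc_coboundaries_def by (auto intro!: image_eqI[of _ _ "\<zero>\<^bsub>E j\<^esub>"])
    ultimately show ?thesis unfolding submodule_iff[OF m] using B_Z[of i] by simp
  qed
qed

lemma B_gcomp: "e \<in> B i \<Longrightarrow> gcomp (gr_sub (E i) (Z i)) e n \<in> B i"
proof -
  assume e: "e \<in> B i"
  have "gcomp (E i) e n \<in> B i"
  proof (cases i)
    case 0
    interpret E: graded_mod R G "E 0" by (rule E_gm)
    show ?thesis using e 0 E.gcomp_zero by (simp add: lc_coboundaries_def)
  next
    case (Suc j)
    then obtain t where t: "t \<in> torsion R J (E j)" "e = d j t" using e by (auto simp: lc_coboundaries_def)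
    then have "gcomp (E i) e n = d j (gcomp (E j) t n)"
      using gcomp_graded_hom[OF E_graded E_graded d_graded torsD(1)[OF t(1)]] Suc by simp
    then show ?thesis using torsion_gcomp[OF E_graded t(1), of n] Suc by (auto simp: lc_coboundaries_def)
  qed
  then show ?thesis using gcomp_sub[OF subsetD[OF B_Z e], of n] by simp
qed

lemma HL_graded: "is_graded_module R G (HL i)"
  unfolding local_cohomology_def by (rule gr_quot_graded[OF sub_graded B_sub B_gcomp G_carrier])

lemma quotB: "module_quot R (gr_sub (E i) (Z i)) (B i)"
  by (rule module_quotI[OF _ B_sub]) (use sub_graded in \<open>simp add: is_graded_module_def\<close>)

abbreviation cls where "cls i e \<equiv> B i +>\<^bsub>E i\<^esub> e"

lemma HL_carrier: "C \<in> carrier (HL i) \<longleftrightarrow> (\<exists>e\<in>Z i. C = cls i e)"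
  using module_quot.Q_carrier[OF quotB] by (auto simp: local_cohomology_def coset_gr_sub)

lemma HL_hcomp: "C \<in> hcomp (HL i) n \<longleftrightarrow> (\<exists>e\<in>hcomp (E i) n \<inter> Z i. C = cls i e)"
  by (auto simp: local_cohomology_def coset_gr_sub)

lemma HL_zero: "\<zero>\<^bsub>HL i\<^esub> = B i"
  using module_quot.Q_zero[OF quotB] by (simp add: local_cohomology_def)

lemma HL_add: "\<lbrakk>e \<in> Z i; f \<in> Z i\<rbrakk> \<Longrightarrow> cls i e \<oplus>\<^bsub>HL i\<^esub> cls i f = cls i (e \<oplus>\<^bsub>E i\<^esub> f)"
  using module_quot.Q_add[OF quotB, of e i f] by (simp add: local_cohomology_def coset_gr_sub)

lemma HL_smult: "\<lbrakk>a \<in> carrier R; e \<in> Z i\<rbrakk> \<Longrightarrow> a \<odot>\<^bsub>HL i\<^esub> cls i e = cls i (a \<odot>\<^bsub>E i\<^esub> e)"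
  using module_quot.Q_smult[OF quotB, of a e i] by (simp add: local_cohomology_def coset_gr_sub)

lemma cls_zero_iff: "e \<in> Z i \<Longrightarrow> cls i e = B i \<longleftrightarrow> e \<in> B i"
  using module_quot.coset_eq_H_iff[OF quotB, of e i] by (simp add: coset_gr_sub)

lemma cls_eqI:
  assumes e: "e \<in> Z i" and b: "b \<in> B i"
  shows "cls i (e \<oplus>\<^bsub>E i\<^esub> b) = cls i e"
proof -
  interpret E: module R "E i" by (rule E_mod)
  have c: "e \<in> carrier (E i)" "b \<in> carrier (E i)" "b \<in> Z i" using e b B_Z Z_carrier by blast+
  interpret H: module R "HL i" using HL_graded by (simp add: is_graded_module_def)
  have "cls i (e \<oplus>\<^bsub>E i\<^esub> b) = cls i e \<oplus>\<^bsub>HL i\<^esub> cls i b" using HL_add e c by simp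
  also have "cls i b = \<zero>\<^bsub>HL i\<^esub>" using cls_zero_iff[OF c(3)] b HL_zero by simp
  also have "cls i e \<oplus>\<^bsub>HL i\<^esub> \<zero>\<^bsub>HL i\<^esub> = cls i e"
    by (rule H.M.r_zero) (use HL_carrier e in blast)
  finally show ?thesis .
qed

lemma Z_hom: "e \<in> hcomp (E i) n \<inter> Z i \<longleftrightarrow> e \<in> hcocycles E d i n"
  using torsion_hom_iff[OF E_hmod, of e i n] gam_sub[of e "E i" n] by (auto simp: hcocycles_def lc_cocycles_def)

text \<open>A component of a torsion element is torsion, so a homogeneous coboundary has a
  homogeneous torsion preimage. This matches \<open>lc_coboundaries\<close> with the degreewise sets
  used for the total complex.\<close>

lemma B_hom: "e \<in> hcomp (E i) n \<Longrightarrow> e \<in> B i \<longleftrightarrow> e \<in> hcobounds E d i n"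
proof (cases i)
  case 0 then show ?thesis by (simp add: lc_coboundaries_def hcobounds_def)
next
  case (Suc j)
  assume e: "e \<in> hcomp (E i) n"
  interpret Ej: graded_mod R G "E j" by (rule E_gm)
  interpret Ei: graded_mod R G "E i" by (rule E_gm)
  show ?thesis
  proof
    assume "e \<in> B i"
    then obtain t where t: "t \<in> torsion R J (E j)" "e = d j t" using Suc by (auto simp: lc_coboundaries_def)
    have "d j (gcomp (E j) t n) = e"
      using gcomp_graded_hom[OF E_graded E_graded d_graded torsD(1)[OF t(1)], of n] Ei.gcomp_hom[OF e] t Suc by simp
    moreover have "gcomp (E j) t n \<in> hcomp (gam R D (E j)) n"
      using torsion_gcomp[OF E_graded t(1), of n] torsion_hom_iff[OF E_hmod Ej.gcomp(1)[OF torsD(1)[OF t(1)]]] by blast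
    ultimately show "e \<in> hcobounds E d i n" using Suc by (auto simp: hcobounds_def)
  next
    assume "e \<in> hcobounds E d i n"
    then obtain t where "t \<in> hcomp (gam R D (E j)) n" "e = d j t" using Suc by (auto simp: hcobounds_def)
    then show "e \<in> B i" using torsion_hom_iff[OF E_hmod gam_sub] Suc by (auto simp: lc_coboundaries_def)
  qed
qed

lemma HL_hcompE:
  assumes "C \<in> hcomp (HL i) n"
  obtains e where "e \<in> hcocycles E d i n" "e \<in> Z i" "e \<in> hcomp (E i) n" "C = cls i e"
  using assms Z_hom by (auto simp: HL_hcomp)

lemma HL_hcompI: "e \<in> hcocycles E d i n \<Longrightarrow> cls i e \<in> hcomp (HL i) n" "e \<in> hcocycles E d i n \<Longrightarrow> e \<in> Z i"
  "e \<in> hcocycles E d i n \<Longrightarrow> e \<in> hcomp (E i) n"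
  using Z_hom[of e i n] by (auto simp: HL_hcomp)

end

text \<open>The shift \<open>k\<close> lets one development serve both lifts: \<open>-1\<close> for
  multiplication by \<open>x t\<close>, 0 for the projection.\<close>

locale complex_map = E: graded_complex R G D J E d + F: graded_complex R G D J F d'
  for R (structure) and G D J
    and E :: "nat \<Rightarrow> ('a, 'e) graded_module" and d and F :: "nat \<Rightarrow> ('a, 'f) graded_module" and d' +
  fixes k :: int and \<phi> :: "nat \<Rightarrow> 'e \<Rightarrow> 'f"
  assumes map_graded: "\<phi> i \<in> graded_hom R (gr_shift k (E i)) (F i)"
    and map_d: "e \<in> carrier (E i) \<Longrightarrow> \<phi> (Suc i) (d i e) = d' i (\<phi> i e)"
begin

lemma shift_mod: "module R (gr_shift k (E i))"
  using gr_shift_graded[OF E.E_graded] by (simp add: is_graded_module_def)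

lemma mapD: "u \<in> carrier (E i) \<Longrightarrow> \<phi> i u \<in> carrier (F i)"
  "\<lbrakk>u \<in> carrier (E i); v \<in> carrier (E i)\<rbrakk> \<Longrightarrow> \<phi> i (u \<oplus>\<^bsub>E i\<^esub> v) = \<phi> i u \<oplus>\<^bsub>F i\<^esub> \<phi> i v"
  "\<lbrakk>a \<in> carrier R; u \<in> carrier (E i)\<rbrakk> \<Longrightarrow> \<phi> i (a \<odot>\<^bsub>E i\<^esub> u) = a \<odot>\<^bsub>F i\<^esub> \<phi> i u"
  "u \<in> hcomp (E i) (n + k) \<Longrightarrow> \<phi> i u \<in> hcomp (F i) n"
  "\<phi> i \<zero>\<^bsub>E i\<^esub> = \<zero>\<^bsub>F i\<^esub>"
  using graded_homD[OF map_graded[of i]] module_hom_zero[OF shift_mod F.E_mod map_graded[of i]] by auto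

lemma map_tors: "e \<in> torsion R J (E i) \<Longrightarrow> \<phi> i e \<in> torsion R J (F i)"
proof -
  assume e: "e \<in> torsion R J (E i)"
  then obtain n where n: "\<And>a. a \<in> ideal_pow R J n \<Longrightarrow> a \<odot>\<^bsub>E i\<^esub> e = \<zero>\<^bsub>E i\<^esub>" by (auto simp: torsion_iff)
  have "a \<odot>\<^bsub>F i\<^esub> \<phi> i e = \<zero>\<^bsub>F i\<^esub>" if a: "a \<in> ideal_pow R J n" for a
    using mapD(3)[OF E.idealD(1)[OF E.ideal_pow_ideal[OF E.J_ideal] a] E.torsD(1)[OF e]] n[OF a] mapD(5)[of i] by simp
  then show ?thesis unfolding torsion_iff using mapD(1)[OF E.torsD(1)[OF e]] by blast
qed

lemma map_Z: "e \<in> E.Z i \<Longrightarrow> \<phi> i e \<in> F.Z i"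
  using map_tors[of e i] map_d[of e i] E.torsD(1)[of e i] mapD(5)[of "Suc i"] by (auto simp: lc_cocycles_def)

lemma map_B: "e \<in> E.B i \<Longrightarrow> \<phi> i e \<in> F.B i"
proof (cases i)
  case 0 then show "e \<in> E.B i \<Longrightarrow> ?thesis" using mapD(5)[of 0] by (simp add: lc_coboundaries_def)
next
  case (Suc j) then show "e \<in> E.B i \<Longrightarrow> ?thesis"
    using map_tors[of _ j] map_d[of _ j] E.torsD(1)[of _ j] by (auto simp: lc_coboundaries_def)
qed

lemma lc_map_cls:
  assumes e: "e \<in> E.Z i"
  shows "lc_map R J F d' \<phi> i (E.cls i e) = F.cls i (\<phi> i e)"
proof -
  interpret Q: module_quot R "gr_sub (E i) (E.Z i)" "E.B i" by (rule E.quotB)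
  have "(\<Union>z\<in>E.B i +>\<^bsub>gr_sub (E i) (E.Z i)\<^esub> e. F.cls i (\<phi> i z)) = F.cls i (\<phi> i e)"
  proof (rule Q.UN_coset)
    show "e \<in> carrier (gr_sub (E i) (E.Z i))" using e by simp
    fix z assume "z \<in> E.B i +>\<^bsub>gr_sub (E i) (E.Z i)\<^esub> e"
    then obtain b where b: "b \<in> E.B i" "z = b \<oplus>\<^bsub>E i\<^esub> e" using Q.coset_memD(1)[of e z] e by auto
    interpret F: module R "F i" by (rule F.E_mod)
    have c: "b \<in> carrier (E i)" "e \<in> carrier (E i)" using b(1) E.B_Z E.Z_carrier e by blast+
    have "\<phi> i z = \<phi> i e \<oplus>\<^bsub>F i\<^esub> \<phi> i b" using mapD(2)[OF c] b(2) F.M.a_comm mapD(1) c by simp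
    then show "F.cls i (\<phi> i z) = F.cls i (\<phi> i e)" using F.cls_eqI[OF map_Z[OF e] map_B[OF b(1)]] by simp
  qed
  then show ?thesis by (simp add: lc_map_def coset_gr_sub)
qed

lemma lc_map_graded: "lc_map R J F d' \<phi> i \<in> graded_hom R (gr_shift k (E.HL i)) (F.HL i)"
proof (rule graded_homI)
  show "lc_map R J F d' \<phi> i C \<in> carrier (F.HL i)" if "C \<in> carrier (gr_shift k (E.HL i))" for C
    using that map_Z by (auto simp: E.HL_carrier F.HL_carrier lc_map_cls)
  show "lc_map R J F d' \<phi> i (C \<oplus>\<^bsub>gr_shift k (E.HL i)\<^esub> C') = lc_map R J F d' \<phi> i C \<oplus>\<^bsub>F.HL i\<^esub> lc_map R J F d' \<phi> i C'"
    if C: "C \<in> carrier (gr_shift k (E.HL i))" "C' \<in> carrier (gr_shift k (E.HL i))" for C C'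
  proof -
    obtain e e' where e: "e \<in> E.Z i" "C = E.cls i e" "e' \<in> E.Z i" "C' = E.cls i e'" using C by (auto simp: E.HL_carrier)
    have "e \<oplus>\<^bsub>E i\<^esub> e' \<in> E.Z i" using E.Z_sub[of i] e unfolding submodule_iff[OF E.E_mod] by blast
    then show ?thesis using e map_Z mapD(2)[OF E.Z_carrier[OF e(1)] E.Z_carrier[OF e(3)]]
      by (simp add: E.HL_add lc_map_cls F.HL_add)
  qed
  show "lc_map R J F d' \<phi> i (a \<odot>\<^bsub>gr_shift k (E.HL i)\<^esub> C) = a \<odot>\<^bsub>F.HL i\<^esub> lc_map R J F d' \<phi> i C"
    if a: "a \<in> carrier R" and C: "C \<in> carrier (gr_shift k (E.HL i))" for a C
  proof -
    obtain e where e: "e \<in> E.Z i" "C = E.cls i e" using C by (auto simp: E.HL_carrier)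
    have "a \<odot>\<^bsub>E i\<^esub> e \<in> E.Z i" using E.Z_sub[of i] e a unfolding submodule_iff[OF E.E_mod] by blast
    then show ?thesis using e a map_Z mapD(3)[OF a E.Z_carrier[OF e(1)]]
      by (simp add: E.HL_smult lc_map_cls F.HL_smult)
  qed
  show "lc_map R J F d' \<phi> i C \<in> hcomp (F.HL i) n" if "C \<in> hcomp (gr_shift k (E.HL i)) n" for n C
    using that map_Z mapD(4)[of _ i n] by (auto simp: E.HL_hcomp F.HL_hcomp lc_map_cls)
qed

lemma lc_map_zero_iff: "e \<in> E.Z i \<Longrightarrow> lc_map R J F d' \<phi> i (E.cls i e) = \<zero>\<^bsub>F.HL i\<^esub> \<longleftrightarrow> \<phi> i e \<in> F.B i"
  using F.cls_zero_iff[OF map_Z] by (simp add: lc_map_cls F.HL_zero)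

end

section \<open>The long exact sequence of the two lifts\<close>

locale long_exact = homotopy_lift R G D E d F d' \<phi> \<psi> s +
    X: complex_map R G D J E d E d "-1" \<phi> + P: complex_map R G D J E d F d' 0 \<psi>
  for R (structure) and G D J
    and E :: "nat \<Rightarrow> ('a, 'e) graded_module" and d and F :: "nat \<Rightarrow> ('a, 'f) graded_module" and d' \<phi> \<psi> s
begin

abbreviation HE where "HE i \<equiv> local_cohomology R J E d i"
abbreviation HF where "HF i \<equiv> local_cohomology R J F d' i"
abbreviation mx where "mx i \<equiv> lc_map R J E d \<phi> i"
abbreviation mp where "mp i \<equiv> lc_map R J F d' \<psi> i"

lemma HE_graded: "is_graded_module R G (HE i)" by (rule X.E.HL_graded)
lemma HF_graded: "is_graded_module R G (HF i)" by (rule P.F.HL_graded)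
lemma HS_graded: "is_graded_module R G (gr_shift k (HE i))" by (rule gr_shift_graded[OF HE_graded])
lemma mx_graded: "mx i \<in> graded_hom R (gr_shift (-1) (HE i)) (HE i)" by (rule X.lc_map_graded)
lemma mp_graded: "mp i \<in> graded_hom R (HE i) (HF i)" using P.lc_map_graded[of i] by simp

lemma BE_iff: "e \<in> hcomp (E i) n \<Longrightarrow> e \<in> X.E.B i \<longleftrightarrow> e \<in> BE i n" by (rule X.E.B_hom)
lemma BF_iff: "e \<in> hcomp (F i) n \<Longrightarrow> e \<in> P.F.B i \<longleftrightarrow> e \<in> BF i n" by (rule P.F.B_hom)

lemma HE_E:
  assumes "C \<in> hcomp (HE i) n"
  obtains e where "e \<in> ZE i n" "e \<in> X.E.Z i" "e \<in> hcomp (E i) n" "C = X.E.cls i e"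
  by (rule X.E.HL_hcompE[OF assms])
lemma HF_E:
  assumes "C \<in> hcomp (HF i) n"
  obtains e where "e \<in> ZF i n" "e \<in> P.F.Z i" "e \<in> hcomp (F i) n" "C = P.F.cls i e"
  by (rule P.F.HL_hcompE[OF assms])

lemmas ZE_Z = X.E.HL_hcompI and ZF_Z = P.F.HL_hcompI

lemma BE_B: "b \<in> BE i n \<Longrightarrow> b \<in> X.E.B i"
proof -
  assume b: "b \<in> BE i n"
  have "b \<in> hcomp (E i) n"
    using b e1_in[of _ i n] gam_sub[of _ "E1 i" n] unfolding BE_eq by auto
  then show ?thesis using BE_iff b by blast
qed

lemma BF_B: "b \<in> BF i n \<Longrightarrow> b \<in> P.F.B i"
  using BF_iff[of b i n] gam_sub[OF BF_gam[of b i n]] by blast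

lemma exact_HE:
  "gr_exact R G (gr_shift (-1) (HE i)) (mx i) (HE i) (mp i) (HF i)"
proof (rule gr_exactI[OF HS_graded HE_graded HF_graded mx_graded mp_graded])
  fix n u assume "u \<in> hcomp (gr_shift (-1) (HE i)) n"
  then have "u \<in> hcomp (HE i) (n - 1)" by simp
  then obtain a where a: "a \<in> ZE i (n - 1)" "a \<in> X.E.Z i" "u = X.E.cls i a" by (rule HE_E)
  have "\<psi> i (\<phi> i a) \<in> P.F.B i" by (rule BF_B[OF comp_cobound[OF a(1)]])
  then show "mp i (mx i u) = \<zero>\<^bsub>HF i\<^esub>"
    using P.lc_map_zero_iff[OF X.map_Z[OF a(2)]] X.lc_map_cls[OF a(2)] a(3) by simp
next
  fix n y assume y: "y \<in> hcomp (HE i) n" and my: "mp i y = \<zero>\<^bsub>HF i\<^esub>"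
  from y obtain b where b: "b \<in> ZE i n" "b \<in> X.E.Z i" "b \<in> hcomp (E i) n" "y = X.E.cls i b" by (rule HE_E)
  have "\<psi> i b \<in> P.F.B i" using P.lc_map_zero_iff[OF b(2)] my b(4) by simp
  then have "\<psi> i b \<in> BF i n" using BF_iff[OF hhomD(1)[OF \<psi>_hom b(3)]] by blast
  then obtain a \<beta> where a: "a \<in> ZE i (n - 1)" "\<beta> \<in> BE i n" "b = \<phi> i a \<oplus>\<^bsub>E i\<^esub> \<beta>" using exact_middle[OF b(1)] by blast
  have "mx i (X.E.cls i a) = y"
    using X.lc_map_cls[OF ZE_Z(2)[OF a(1)]] X.E.cls_eqI[OF X.map_Z[OF ZE_Z(2)[OF a(1)]] BE_B[OF a(2)]] a(3) b(4) by simp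
  moreover have "X.E.cls i a \<in> hcomp (gr_shift (-1) (HE i)) n" using ZE_Z(1)[OF a(1)] by simp
  ultimately show "\<exists>u\<in>hcomp (gr_shift (-1) (HE i)) n. mx i u = y" by blast
qed

lemma connZ: "conn i n c a \<Longrightarrow> c \<in> ZF i n" "conn i n c a \<Longrightarrow> a \<in> ZE (Suc i) (n - 1)"
  unfolding conn_def by (elim conjE exE, assumption)+

text \<open>\<open>conn\<close> is compatible with sums and scalars, so the difference of two
  related pairs is related. As the difference of the \<open>c\<close> is a coboundary,
  \<open>conn_cobound\<close> makes the difference of the \<open>a\<close> one.\<close>

lemma conn_class_unique:
  assumes 1: "conn i n c a" and 2: "conn i n c' a'" and eq: "P.F.cls i c = P.F.cls i c'"
  shows "X.E.cls (Suc i) a = X.E.cls (Suc i) a'"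
proof -
  interpret Fi: module R "F i" by (rule P.F.E_mod)
  interpret Ei: module R "E (Suc i)" by (rule X.E.E_mod)
  have z: "c \<in> ZF i n" "c' \<in> ZF i n" "a \<in> ZE (Suc i) (n - 1)" "a' \<in> ZE (Suc i) (n - 1)"
    by (rule connZ[OF 1] connZ[OF 2])+
  have m1: "\<ominus> \<one> \<in> G 0" by (rule G_neg[OF G_one])
  have cc: "c \<in> carrier (F i)" "c' \<in> carrier (F i)" "a \<in> carrier (E (Suc i))" "a' \<in> carrier (E (Suc i))"
    using P.F.Z_carrier X.E.Z_carrier ZF_Z(2) ZE_Z(2) z by blast+
  have "conn i (0 + n) ((\<ominus> \<one>) \<odot>\<^bsub>F i\<^esub> c') ((\<ominus> \<one>) \<odot>\<^bsub>E (Suc i)\<^esub> a')" by (rule conn_smult[OF m1 2])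
  then have d: "conn i n (c \<oplus>\<^bsub>F i\<^esub> \<ominus>\<^bsub>F i\<^esub> c') (a \<oplus>\<^bsub>E (Suc i)\<^esub> \<ominus>\<^bsub>E (Suc i)\<^esub> a')"
    using conn_add[OF 1, of "\<ominus>\<^bsub>F i\<^esub> c'" "\<ominus>\<^bsub>E (Suc i)\<^esub> a'"] cc by (simp add: Fi.smult_l_minus Ei.smult_l_minus)
  have dz: "c \<oplus>\<^bsub>F i\<^esub> \<ominus>\<^bsub>F i\<^esub> c' \<in> ZF i n" "a \<oplus>\<^bsub>E (Suc i)\<^esub> \<ominus>\<^bsub>E (Suc i)\<^esub> a' \<in> ZE (Suc i) (n - 1)"
    by (rule connZ[OF d])+
  interpret H: module R "HF i" using HF_graded by (simp add: is_graded_module_def)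
  have c2: "c = (c \<oplus>\<^bsub>F i\<^esub> \<ominus>\<^bsub>F i\<^esub> c') \<oplus>\<^bsub>F i\<^esub> c'" using cc by (simp add: Fi.M.a_assoc Fi.M.l_neg)
  have "P.F.cls i c = P.F.cls i (c \<oplus>\<^bsub>F i\<^esub> \<ominus>\<^bsub>F i\<^esub> c') \<oplus>\<^bsub>HF i\<^esub> P.F.cls i c'"
    using P.F.HL_add[OF ZF_Z(2)[OF dz(1)] ZF_Z(2)[OF z(2)]] c2 by simp
  moreover have "P.F.cls i c' \<in> carrier (HF i)" "P.F.cls i (c \<oplus>\<^bsub>F i\<^esub> \<ominus>\<^bsub>F i\<^esub> c') \<in> carrier (HF i)"
    using P.F.HL_carrier ZF_Z(2) z(2) dz(1) by blast+
  ultimately have "P.F.cls i (c \<oplus>\<^bsub>F i\<^esub> \<ominus>\<^bsub>F i\<^esub> c') = \<zero>\<^bsub>HF i\<^esub>" using eq H.M.add.r_cancel_one'[of "P.F.cls i c'" "P.F.cls i (c \<oplus>\<^bsub>F i\<^esub> \<ominus>\<^bsub>F i\<^esub> c')"] by simp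
  then have "c \<oplus>\<^bsub>F i\<^esub> \<ominus>\<^bsub>F i\<^esub> c' \<in> BF i n"
    using P.F.cls_zero_iff[OF ZF_Z(2)[OF dz(1)]] BF_iff[OF ZF_Z(3)[OF dz(1)]] P.F.HL_zero by simp
  then have b: "a \<oplus>\<^bsub>E (Suc i)\<^esub> \<ominus>\<^bsub>E (Suc i)\<^esub> a' \<in> X.E.B (Suc i)" by (rule BE_B[OF conn_cobound[OF d]])
  have "a = a' \<oplus>\<^bsub>E (Suc i)\<^esub> (a \<oplus>\<^bsub>E (Suc i)\<^esub> \<ominus>\<^bsub>E (Suc i)\<^esub> a')"
    using cc by (simp add: Ei.M.a_lcomm Ei.M.r_neg)
  then show ?thesis using X.E.cls_eqI[OF ZE_Z(2)[OF z(4)] b] by simp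
qed

text \<open>\<open>conn\<close> relates homogeneous elements only, so the map is chosen degree by
  degree; \<open>graded_hom_extend\<close> assembles the pieces into a homomorphism on all
  classes.\<close>

lemma connecting_map:
  "\<exists>\<delta>\<in>graded_hom R (HF i) (gr_shift (-1) (HE (Suc i))).
     \<forall>n c a. conn i n c a \<longrightarrow> \<delta> (P.F.cls i c) = X.E.cls (Suc i) a"
proof -
  define h where "h n C = (SOME C'. \<exists>c a. conn i n c a \<and> C = P.F.cls i c \<and> C' = X.E.cls (Suc i) a)" for n C
  have h: "h n (P.F.cls i c) = X.E.cls (Suc i) a" if ca: "conn i n c a" for n c a
  proof -
    have "\<exists>c' a'. conn i n c' a' \<and> P.F.cls i c = P.F.cls i c' \<and> h n (P.F.cls i c) = X.E.cls (Suc i) a'"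
      unfolding h_def by (rule someI_ex) (use ca in blast)
    then obtain c' a' where "conn i n c' a'" "P.F.cls i c = P.F.cls i c'" "h n (P.F.cls i c) = X.E.cls (Suc i) a'" by blast
    then show ?thesis using conn_class_unique[OF ca] by simp
  qed
  have ex: "\<exists>c a. conn i n c a \<and> C = P.F.cls i c" if C: "C \<in> hcomp (HF i) n" for C n
  proof -
    obtain c where c: "c \<in> ZF i n" "C = P.F.cls i c" by (rule HF_E[OF C])
    obtain a where "conn i n c a" using conn_total[OF c(1)] by (elim exE)
    then show ?thesis using c(2) by (intro exI conjI)
  qed
  have "hhom G (HF i) (gr_shift (-1) (HE (Suc i))) h"
    unfolding hhom_def
  proof (intro conjI allI ballI)
    fix n C assume C: "C \<in> hcomp (HF i) n"
    obtain c a where ca: "conn i n c a" "C = P.F.cls i c" using ex[OF C] by (elim exE conjE)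
    show "h n C \<in> hcomp (gr_shift (-1) (HE (Suc i))) n" using h[OF ca(1)] ca ZE_Z(1)[OF connZ(2)[OF ca(1)]] by simp
    fix C' assume C': "C' \<in> hcomp (HF i) n"
    obtain c' a' where ca': "conn i n c' a'" "C' = P.F.cls i c'" using ex[OF C'] by (elim exE conjE)
    show "h n (C \<oplus>\<^bsub>HF i\<^esub> C') = h n C \<oplus>\<^bsub>gr_shift (-1) (HE (Suc i))\<^esub> h n C'"
      using h[OF ca(1)] h[OF ca'(1)] h[OF conn_add[OF ca(1) ca'(1)]] ca(2) ca'(2)
        P.F.HL_add[OF ZF_Z(2)[OF connZ(1)[OF ca(1)]] ZF_Z(2)[OF connZ(1)[OF ca'(1)]]]
        X.E.HL_add[OF ZE_Z(2)[OF connZ(2)[OF ca(1)]] ZE_Z(2)[OF connZ(2)[OF ca'(1)]]] by simp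
  next
    fix k n r C assume r: "r \<in> G k" and C: "C \<in> hcomp (HF i) n"
    obtain c a where ca: "conn i n c a" "C = P.F.cls i c" using ex[OF C] by (elim exE conjE)
    show "h (k + n) (r \<odot>\<^bsub>HF i\<^esub> C) = r \<odot>\<^bsub>gr_shift (-1) (HE (Suc i))\<^esub> h n C"
      using h[OF ca(1)] h[OF conn_smult[OF r ca(1)]] ca(2)
        P.F.HL_smult[OF Gc[OF r] ZF_Z(2)[OF connZ(1)[OF ca(1)]]]
        X.E.HL_smult[OF Gc[OF r] ZE_Z(2)[OF connZ(2)[OF ca(1)]]] by simp
  qed
  from graded_hom_extend[OF X.E.regular HF_graded HS_graded this]
  obtain \<delta> where \<delta>: "\<delta> \<in> graded_hom R (HF i) (gr_shift (-1) (HE (Suc i)))"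
    "\<forall>n. \<forall>C\<in>hcomp (HF i) n. \<delta> C = h n C"
    by (elim bexE)
  show ?thesis
  proof (intro bexI[OF _ \<delta>(1)] allI impI)
    fix n c a assume ca: "conn i n c a"
    show "\<delta> (P.F.cls i c) = X.E.cls (Suc i) a"
      using \<delta>(2)[rule_format, OF ZF_Z(1)[OF connZ(1)[OF ca]]] h[OF ca] by simp
  qed
qed

lemma long_exact_sequence:
  "\<exists>\<delta>. gr_exact R G (HE i) (mp i) (HF i) \<delta> (gr_shift (-1) (HE (Suc i))) \<and>
     gr_exact R G (HF i) \<delta> (gr_shift (-1) (HE (Suc i))) (mx (Suc i)) (HE (Suc i))"
proof -
  from connecting_map[of i] obtain \<delta> where \<delta>: "\<delta> \<in> graded_hom R (HF i) (gr_shift (-1) (HE (Suc i)))"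
    and \<delta>': "\<forall>n c a. conn i n c a \<longrightarrow> \<delta> (P.F.cls i c) = X.E.cls (Suc i) a"
    by (elim bexE)
  note \<delta>c = \<delta>'[rule_format]
  have "gr_exact R G (HE i) (mp i) (HF i) \<delta> (gr_shift (-1) (HE (Suc i)))"
  proof (rule gr_exactI[OF HE_graded HF_graded HS_graded mp_graded \<delta>])
    fix n u assume "u \<in> hcomp (HE i) n"
    then obtain b where b: "b \<in> ZE i n" "b \<in> X.E.Z i" "u = X.E.cls i b" by (rule HE_E)
    have "\<delta> (mp i u) = X.E.cls (Suc i) \<zero>\<^bsub>E (Suc i)\<^esub>" using \<delta>c[OF conn_\<psi>[OF b(1)]] P.lc_map_cls[OF b(2)] b(3) by simp
    also have "\<dots> = \<zero>\<^bsub>gr_shift (-1) (HE (Suc i))\<^esub>"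
    proof -
      have z: "\<zero>\<^bsub>E (Suc i)\<^esub> \<in> X.E.B (Suc i)"
        using X.E.B_sub[of "Suc i"] module_quot.H_zero[OF X.E.quotB[of "Suc i"]] by simp
      then show ?thesis using X.E.cls_zero_iff[of "\<zero>\<^bsub>E (Suc i)\<^esub>" "Suc i"] X.E.B_Z X.E.HL_zero by auto
    qed
    finally show "\<delta> (mp i u) = \<zero>\<^bsub>gr_shift (-1) (HE (Suc i))\<^esub>" .
  next
    fix n y assume y: "y \<in> hcomp (HF i) n" and \<delta>y: "\<delta> y = \<zero>\<^bsub>gr_shift (-1) (HE (Suc i))\<^esub>"
    from y obtain c where c: "c \<in> ZF i n" "c \<in> P.F.Z i" "y = P.F.cls i c" by (rule HF_E)
    obtain a where a: "conn i n c a" using conn_total[OF c(1)] by (elim exE)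
    note az = connZ(2)[OF a]
    have "X.E.cls (Suc i) a = X.E.B (Suc i)" using \<delta>c[OF a] \<delta>y c(3) X.E.HL_zero by simp
    then have "a \<in> BE (Suc i) (n - 1)" using X.E.cls_zero_iff[OF ZE_Z(2)[OF az]] BE_iff[OF ZE_Z(3)[OF az]] by simp
    then obtain b \<gamma> where b: "b \<in> ZE i n" "\<gamma> \<in> BF i n" "c = \<psi> i b \<oplus>\<^bsub>F i\<^esub> \<gamma>" using conn_kernel[OF a] by blast
    have "mp i (X.E.cls i b) = y"
      using P.lc_map_cls[OF ZE_Z(2)[OF b(1)]] P.F.cls_eqI[OF P.map_Z[OF ZE_Z(2)[OF b(1)]] BF_B[OF b(2)]] b(3) c(3) by simp
    then show "\<exists>u\<in>hcomp (HE i) n. mp i u = y" using ZE_Z(1)[OF b(1)] by blast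
  qed
  moreover have "gr_exact R G (HF i) \<delta> (gr_shift (-1) (HE (Suc i))) (mx (Suc i)) (HE (Suc i))"
  proof (rule gr_exactI[OF HF_graded HS_graded HE_graded \<delta> mx_graded])
    fix n u assume "u \<in> hcomp (HF i) n"
    then obtain c where c: "c \<in> ZF i n" "u = P.F.cls i c" by (rule HF_E)
    obtain a where a: "conn i n c a" using conn_total[OF c(1)] by (elim exE)
    have aZ: "a \<in> X.E.Z (Suc i)" by (rule ZE_Z(2)[OF connZ(2)[OF a]])
    show "mx (Suc i) (\<delta> u) = \<zero>\<^bsub>HE (Suc i)\<^esub>"
      using \<delta>c[OF a] X.lc_map_zero_iff[OF aZ] BE_B[OF conn_\<phi>[OF a]] c(2) by simp
  next
    fix n y assume y: "y \<in> hcomp (gr_shift (-1) (HE (Suc i))) n" and my: "mx (Suc i) y = \<zero>\<^bsub>HE (Suc i)\<^esub>"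
    from y have "y \<in> hcomp (HE (Suc i)) (n - 1)" by simp
    then obtain a where a: "a \<in> ZE (Suc i) (n - 1)" "a \<in> X.E.Z (Suc i)" "a \<in> hcomp (E (Suc i)) (n - 1)" "y = X.E.cls (Suc i) a"
      by (rule HE_E)
    have "\<phi> (Suc i) a \<in> BE (Suc i) n"
      using X.lc_map_zero_iff[OF a(2)] my a(4) BE_iff[OF \<phi>_in[OF a(3)]] by simp
    then obtain c where c: "conn i n c a" using conn_image[OF a(1)] by blast
    then show "\<exists>u\<in>hcomp (HF i) n. \<delta> u = y" using \<delta>c[OF c] a(4) ZF_Z(1)[OF connZ(1)[OF c]] by blast
  qed
  ultimately show ?thesis by blast
qed

end

text \<open>\<open>C\<close> and \<open>C'\<close> are finite generating sets of
  \<open>\<mm>\<close> and \<open>I\<close>. They are parameters because the set \<open>D\<close>,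
  and with it the componentwise torsion, is built from them.\<close>

locale rees_resolutions = xt_data A I M x for A (structure) and I and M (structure) and x +
  fixes \<mm> C C'
    and E :: "nat \<Rightarrow> (nat \<Rightarrow> 'a, 'e) graded_module" and d \<epsilon>
    and F :: "nat \<Rightarrow> (nat \<Rightarrow> 'a, 'f) graded_module" and d' \<eta> \<phi> \<psi>
  assumes local: "noetherian_local A \<mm>"
    and fl: "finite_length A (quot_module M (ideal_smult A I M))"
    and sup: "superficial A M I x"
    and C: "finite C" "C \<subseteq> carrier A" "\<mm> = Idl C"
    and C': "finite C'" "C' \<subseteq> carrier A" "I = Idl C'"
    and resM: "gr_injective_resolution R G L.E E d \<epsilon>"
    and resN: "gr_injective_resolution R G LN.E F d' \<eta>"
    and lift_xt: "gr_lift R (gr_shift (-1) L.E) (\<lambda>i. gr_shift (-1) (E i)) d \<epsilon> E d \<epsilon> (\<lambda>f. xt \<odot>\<^bsub>L.E\<^esub> f) \<phi>"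
    and lift_proj: "gr_lift R L.E E d \<epsilon> F d' \<eta> proj \<psi>"
begin

abbreviation MM where "MM \<equiv> rees_max A \<mm> I"

definition D :: "(int \<times> (nat \<Rightarrow> 'a)) set" where
  "D = (\<lambda>c. (0, mon c 0)) ` C \<union> (\<lambda>c. (1, mon c (Suc 0))) ` C'"

lemma \<mm>_ideal: "ideal \<mm> A" using local by (simp add: noetherian_local_def maximalideal_def)

lemma D_cases:
  assumes "(i, s) \<in> D"
  shows "i = 0 \<and> (\<exists>c\<in>\<mm>. s = mon c 0) \<or> i = 1 \<and> (\<exists>c\<in>I. s = mon c (Suc 0))"
proof -
  have "C \<subseteq> \<mm>" unfolding C(3) by (rule genideal_self[OF C(2)])
  moreover have "C' \<subseteq> I" using genideal_self[OF C'(2)] C'(3) by simp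
  ultimately show ?thesis using assms unfolding D_def by auto
qed

lemma D_G:
  assumes "(i, s) \<in> D"
  shows "s \<in> G i"
  using D_cases[OF assms]
proof (elim disjE conjE bexE)
  fix c assume c: "c \<in> \<mm>" "i = 0" "s = mon c 0"
  have "c \<in> ideal_pow A I 0" using idealD(1)[OF \<mm>_ideal c(1)] by simp
  from mon_G[OF this] show ?thesis using c by simp
next
  fix c assume c: "c \<in> I" "i = 1" "s = mon c (Suc 0)"
  have "c \<in> ideal_pow A I (Suc 0)" using ideal_pow_one[OF I c(1)] by simp
  from mon_G[OF this] show ?thesis using c by simp
qed

sublocale HG: homogeneous_generators R G D MM
proof (rule homogeneous_generators.intro)
  have N: "noetherian_ring A" using local by (simp add: noetherian_local_def)
  show "graded_scalars R G D" by (rule rees_graded_scalars[OF N D_G])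
  have "snd ` D = (\<lambda>c. mon c 0) ` C \<union> (\<lambda>c. mon c (Suc 0)) ` C'" by (simp add: D_def image_Un image_image)
  then have "MM = Idl\<^bsub>R\<^esub> (snd ` D)"
    using rees_max_generators[OF \<mm>_ideal C(2,3) C'(2,3)] by simp
  then show "homogeneous_generators_axioms R G D MM"
    by (intro homogeneous_generators_axioms.intro regular) (simp_all add: D_def C(1) C'(1))
qed

lemma resE: "gr_injective R G (E i)" "\<epsilon> \<in> graded_hom R L.E (E 0)" "inj_on \<epsilon> (carrier L.E)"
  "d i \<in> graded_hom R (E i) (E (Suc i))"
  "\<epsilon> ` carrier L.E = {e \<in> carrier (E 0). d 0 e = \<zero>\<^bsub>E (Suc 0)\<^esub>}"
  "d i ` carrier (E i) = {e \<in> carrier (E (Suc i)). d (Suc i) e = \<zero>\<^bsub>E (Suc (Suc i))\<^esub>}"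
  using resM unfolding gr_injective_resolution_def by blast+

lemma resF: "gr_injective R G (F i)" "\<eta> \<in> graded_hom R LN.E (F 0)" "inj_on \<eta> (carrier LN.E)"
  "d' i \<in> graded_hom R (F i) (F (Suc i))"
  "\<eta> ` carrier LN.E = {e \<in> carrier (F 0). d' 0 e = \<zero>\<^bsub>F (Suc 0)\<^esub>}"
  "d' i ` carrier (F i) = {e \<in> carrier (F (Suc i)). d' (Suc i) e = \<zero>\<^bsub>F (Suc (Suc i))\<^esub>}"
  using resN unfolding gr_injective_resolution_def by blast+

lemma lift_\<phi>: "\<phi> i \<in> graded_hom R (gr_shift (-1) (E i)) (E i)"
  "e \<in> carrier (E i) \<Longrightarrow> \<phi> (Suc i) (d i e) = d i (\<phi> i e)"
  "f \<in> carrier L.E \<Longrightarrow> \<phi> 0 (\<epsilon> f) = \<epsilon> (xt \<odot>\<^bsub>L.E\<^esub> f)"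
  using lift_xt by (simp_all add: gr_lift_def)

lemma lift_\<psi>: "\<psi> i \<in> graded_hom R (E i) (F i)"
  "e \<in> carrier (E i) \<Longrightarrow> \<psi> (Suc i) (d i e) = d' i (\<psi> i e)"
  "f \<in> carrier L.E \<Longrightarrow> \<psi> 0 (\<epsilon> f) = \<eta> (proj f)"
  using lift_proj by (simp_all add: gr_lift_def)

lemma E_graded: "is_graded_module R G (E i)" using resE(1) by (simp add: gr_injective_def)
lemma F_graded: "is_graded_module R G (F i)" using resF(1) by (simp add: gr_injective_def)
lemma E_module: "module R (E i)" using E_graded by (simp add: is_graded_module_def)
lemma F_module: "module R (F i)" using F_graded by (simp add: is_graded_module_def)

text \<open>Read off from the resolution: \<open>\<epsilon>\<close> is an injective linear map into
  the module \<open>E 0\<close>.\<close>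

lemma L_module: "module R L.E"
  by (rule L.E_module[OF E_module[of 0], of \<epsilon>]) (use graded_homD[OF resE(2)] resE(3) in simp_all)
lemma LN_module: "module R LN.E"
  by (rule LN.E_module[OF F_module[of 0], of \<eta>]) (use graded_homD[OF resF(2)] resF(3) in simp_all)
lemma B_module: "module R B.E"
  by (rule B.E_module[OF L_module sh_carrier sh_add sh_smult sh_inj])

lemmas L_graded = L.E_graded[OF L_module] and LN_graded = LN.E_graded[OF LN_module]
  and B_graded = B.E_graded[OF B_module]

lemma hc: "e \<in> hcomp (E i) n \<Longrightarrow> e \<in> carrier (E i)" "e' \<in> hcomp (F i) n \<Longrightarrow> e' \<in> carrier (F i)"
  "f \<in> hcomp L.E n \<Longrightarrow> f \<in> carrier L.E" "g \<in> hcomp B.E n \<Longrightarrow> g \<in> carrier B.E" "h \<in> hcomp LN.E n \<Longrightarrow> h \<in> carrier LN.E"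
  using graded_mod.hc[of R G "E i" e n] graded_mod.hc[of R G "F i" e' n] graded_mod.hc[of R G L.E f n]
    graded_mod.hc[of R G B.E g n] graded_mod.hc[of R G LN.E h n] E_graded F_graded L_graded B_graded LN_graded
  by (simp_all add: graded_mod_def)

lemma \<epsilon>_zero: "\<epsilon> \<zero>\<^bsub>L.E\<^esub> = \<zero>\<^bsub>E 0\<^esub>" by (rule module_hom_zero[OF L_module E_module resE(2)])
lemma \<eta>_zero: "\<eta> \<zero>\<^bsub>LN.E\<^esub> = \<zero>\<^bsub>F 0\<^esub>" by (rule module_hom_zero[OF LN_module F_module resF(2)])

lemma L_zero: "\<zero>\<^bsub>L.E\<^esub> \<in> carrier L.E" and LN_zero: "\<zero>\<^bsub>LN.E\<^esub> \<in> carrier LN.E"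
  using L.E_zero_closed LN.E_zero_closed by (simp_all add: L.E_simps LN.E_simps)

lemma \<epsilon>_zero_iff: "f \<in> carrier L.E \<Longrightarrow> \<epsilon> f = \<zero>\<^bsub>E 0\<^esub> \<longleftrightarrow> f = \<zero>\<^bsub>L.E\<^esub>"
  using inj_on_eq_iff[OF resE(3) _ L_zero, of f] \<epsilon>_zero by simp
lemma \<eta>_zero_iff: "h \<in> carrier LN.E \<Longrightarrow> \<eta> h = \<zero>\<^bsub>F 0\<^esub> \<longleftrightarrow> h = \<zero>\<^bsub>LN.E\<^esub>"
  using inj_on_eq_iff[OF resF(3) _ LN_zero, of h] \<eta>_zero by simp

lemma d_\<epsilon>: "f \<in> carrier L.E \<Longrightarrow> d 0 (\<epsilon> f) = \<zero>\<^bsub>E (Suc 0)\<^esub>"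
  using resE(5) by (metis (mono_tags, lifting) imageI mem_Collect_eq)

lemma kernel_E:
  assumes a: "a \<in> hcomp (E 0) n" "d 0 a = \<zero>\<^bsub>E (Suc 0)\<^esub>"
  shows "\<exists>f\<in>hcomp L.E n. \<epsilon> f = a"
proof (rule graded_hom_image[OF L_graded E_graded resE(2) a(1)])
  show "a \<in> \<epsilon> ` carrier L.E" unfolding resE(5) using hc(1)[OF a(1)] a(2) by simp
qed

lemma kernel_F:
  assumes a: "a \<in> hcomp (F 0) n" "d' 0 a = \<zero>\<^bsub>F (Suc 0)\<^esub>"
  shows "\<exists>f\<in>hcomp LN.E n. \<eta> f = a"
proof (rule graded_hom_image[OF LN_graded F_graded resF(2) a(1)])
  show "a \<in> \<eta> ` carrier LN.E" unfolding resF(5) using hc(2)[OF a(1)] a(2) by simp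
qed

lemma xt_R: "xt \<in> carrier R" by (rule mon_R[OF x1])

lemma xt_Lc: "f \<in> carrier L.E \<Longrightarrow> xt \<odot>\<^bsub>L.E\<^esub> f \<in> carrier L.E"
  by (rule module.smult_closed[OF L_module xt_R])

lemma \<phi>_\<epsilon>_zero_iff: "f \<in> carrier L.E \<Longrightarrow> \<phi> 0 (\<epsilon> f) = \<zero>\<^bsub>E 0\<^esub> \<longleftrightarrow> xt \<odot>\<^bsub>L.E\<^esub> f = \<zero>\<^bsub>L.E\<^esub>"
  using lift_\<phi>(3)[of f] \<epsilon>_zero_iff[OF xt_Lc, of f] by simp

lemma kernel_gam:
  assumes f: "f \<in> hcomp L.E n" and xf: "xt \<odot>\<^bsub>L.E\<^esub> f = \<zero>\<^bsub>L.E\<^esub>"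
  shows "\<epsilon> f \<in> hcomp (gam R D (E 0)) n"
  unfolding HG.gam_iff
proof (intro conjI allI impI)
  show "\<epsilon> f \<in> hcomp (E 0) n" by (rule graded_homD(4)[OF resE(2) f])
  fix i s assume iD: "(i, s) \<in> D"
  have "(\<exists>c\<in>\<mm>. s = mon c 0) \<or> (\<exists>c\<in>I. s = mon c (Suc 0))" using D_cases[OF iD] by blast
  from xt_kernel_torsion[OF local fl sup f xf this] obtain k :: nat where k: "(s [^]\<^bsub>R\<^esub> k) \<odot>\<^bsub>L.E\<^esub> f = \<zero>\<^bsub>L.E\<^esub>"
    by (elim exE)
  have "s \<in> carrier R" using HG.G_carrier D_G[OF iD] by blast
  then have "(s [^]\<^bsub>R\<^esub> k) \<odot>\<^bsub>E 0\<^esub> \<epsilon> f = \<epsilon> ((s [^]\<^bsub>R\<^esub> k) \<odot>\<^bsub>L.E\<^esub> f)"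
    using graded_homD(3)[OF resE(2) RR.nat_pow_closed hc(3)[OF f]] by simp
  then show "\<exists>k::nat. (s [^]\<^bsub>R\<^esub> k) \<odot>\<^bsub>E 0\<^esub> \<epsilon> f = \<zero>\<^bsub>E 0\<^esub>" using k \<epsilon>_zero by auto
qed

lemma proj_carrier:
  assumes g: "g \<in> hcomp L.E n"
  shows "proj g \<in> carrier LN.E"
proof -
  obtain k m where m: "m \<in> carrier M" "g = L.single k m" using g by (cases rule: hcomp_cases) auto
  have "LN.single k (q m) \<in> hcomp LN.E (int k)" using LN.hcomp_single[of _ k] N.Q_carrierI[OF m(1)] by blast
  then show ?thesis using hc(5) proj_single[OF m(1)] m(2) by simp
qed

text \<open>Through \<open>\<epsilon>\<close> and \<open>\<eta>\<close> the kernels of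
  \<open>d 0\<close> and \<open>d' 0\<close> are copies of \<open>L(M)\<close> and
  \<open>L(N)\<close>; this translates the facts on \<open>xt\<close> and \<open>proj\<close> into
  the base conditions.\<close>

sublocale DL: double_lift R G D E d F d' \<phi> \<psi>
proof (rule double_lift.intro[OF HG.graded_scalars_axioms], rule double_lift_axioms.intro)
  show "hinj R G (E i)" "hinj R G (F i)" for i by (rule HG.gr_injective_hinj resE(1) resF(1))+
  show "hhom G (E i) (E (Suc i)) (\<lambda>n. d i)" for i by (rule graded_hom_hhom[OF E_graded HG.G_carrier resE(4)])
  show "hhom G (F i) (F (Suc i)) (\<lambda>n. d' i)" for i by (rule graded_hom_hhom[OF F_graded HG.G_carrier resF(4)])
  show "hhom G (gr_shift (-1) (E i)) (E i) (\<lambda>n. \<phi> i)" for i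
    by (rule graded_hom_hhom[OF gr_shift_graded[OF E_graded] HG.G_carrier lift_\<phi>(1)])
  show "hhom G (E i) (F i) (\<lambda>n. \<psi> i)" for i by (rule graded_hom_hhom[OF E_graded HG.G_carrier lift_\<psi>(1)])
  show "d (Suc i) (d i e) = \<zero>\<^bsub>E (Suc (Suc i))\<^esub>" if e: "e \<in> hcomp (E i) n" for e i n
    using imageI[OF hc(1)[OF e], of "d i"] unfolding resE(6) by simp
  show "d' (Suc i) (d' i e) = \<zero>\<^bsub>F (Suc (Suc i))\<^esub>" if e: "e \<in> hcomp (F i) n" for e i n
    using imageI[OF hc(2)[OF e], of "d' i"] unfolding resF(6) by simp
  show "\<exists>u\<in>hcomp (E i) n. d i u = e"
    if e: "e \<in> hcomp (E (Suc i)) n" "d (Suc i) e = \<zero>\<^bsub>E (Suc (Suc i))\<^esub>" for e i n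
  proof (rule graded_hom_image[OF E_graded E_graded resE(4) e(1)])
    show "e \<in> d i ` carrier (E i)" unfolding resE(6) using hc(1)[OF e(1)] e(2) by simp
  qed
  show "\<exists>u\<in>hcomp (F i) n. d' i u = e"
    if e: "e \<in> hcomp (F (Suc i)) n" "d' (Suc i) e = \<zero>\<^bsub>F (Suc (Suc i))\<^esub>" for e i n
  proof (rule graded_hom_image[OF F_graded F_graded resF(4) e(1)])
    show "e \<in> d' i ` carrier (F i)" unfolding resF(6) using hc(2)[OF e(1)] e(2) by simp
  qed
  show "\<phi> (Suc i) (d i e) = d i (\<phi> i e)" if e: "e \<in> hcomp (E i) n" for e i n by (rule lift_\<phi>(2)[OF hc(1)[OF e]])
  show "\<psi> (Suc i) (d i e) = d' i (\<psi> i e)" if e: "e \<in> hcomp (E i) n" for e i n by (rule lift_\<psi>(2)[OF hc(1)[OF e]])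
  show "a \<in> hcomp (gam R D (E 0)) n"
    if a: "a \<in> hcomp (E 0) n" "d 0 a = \<zero>\<^bsub>E (Suc 0)\<^esub>" "\<phi> 0 a = \<zero>\<^bsub>E 0\<^esub>" for a n
  proof -
    obtain f where f: "f \<in> hcomp L.E n" "\<epsilon> f = a" using kernel_E[OF a(1,2)] by (elim bexE)
    have "xt \<odot>\<^bsub>L.E\<^esub> f = \<zero>\<^bsub>L.E\<^esub>" using \<phi>_\<epsilon>_zero_iff[OF hc(3)[OF f(1)]] f(2) a(3) by simp
    then show ?thesis using kernel_gam[OF f(1)] f(2) by simp
  qed
  show "\<psi> 0 (\<phi> 0 a) = \<zero>\<^bsub>F 0\<^esub>" if a: "a \<in> hcomp (E 0) n" "d 0 a = \<zero>\<^bsub>E (Suc 0)\<^esub>" for a n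
  proof -
    obtain f where f: "f \<in> hcomp L.E n" "\<epsilon> f = a" using kernel_E[OF a] by (elim bexE)
    show ?thesis
      using lift_\<phi>(3)[OF hc(3)[OF f(1)]] lift_\<psi>(3)[OF xt_Lc[OF hc(3)[OF f(1)]]] proj_xt[OF f(1)] \<eta>_zero f(2) by simp
  qed
  show "\<exists>a\<in>hcomp (E 0) (n - 1). d 0 a = \<zero>\<^bsub>E (Suc 0)\<^esub> \<and> \<phi> 0 a = b"
    if b: "b \<in> hcomp (E 0) n" "d 0 b = \<zero>\<^bsub>E (Suc 0)\<^esub>" "\<psi> 0 b = \<zero>\<^bsub>F 0\<^esub>" for b n
  proof -
    obtain g where g: "g \<in> hcomp L.E n" "\<epsilon> g = b" using kernel_E[OF b(1,2)] by (elim bexE)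
    have "proj g \<in> carrier LN.E" using proj_carrier[OF g(1)] .
    from \<eta>_zero_iff[OF this] have "proj g = \<zero>\<^bsub>LN.E\<^esub>" using lift_\<psi>(3)[OF hc(3)[OF g(1)]] g(2) b(3) by simp
    from proj_kernel[OF g(1) this] obtain f where f: "f \<in> hcomp L.E (n - 1)" "xt \<odot>\<^bsub>L.E\<^esub> f = g" by (elim bexE)
    show ?thesis
      using graded_homD(4)[OF resE(2) f(1)] d_\<epsilon>[OF hc(3)[OF f(1)]] lift_\<phi>(3)[OF hc(3)[OF f(1)]] f(2) g(2)
      by (intro bexI[of _ "\<epsilon> f"] conjI) simp_all
  qed
  show "\<exists>b\<in>hcomp (E 0) n. d 0 b = \<zero>\<^bsub>E (Suc 0)\<^esub> \<and> \<psi> 0 b = c"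
    if c: "c \<in> hcomp (F 0) n" "d' 0 c = \<zero>\<^bsub>F (Suc 0)\<^esub>" for c n
  proof -
    obtain h where h: "h \<in> hcomp LN.E n" "\<eta> h = c" using kernel_F[OF c] by (elim bexE)
    obtain f where f: "f \<in> hcomp L.E n" "proj f = h" using proj_surj[OF h(1)] by (elim bexE)
    show ?thesis
      using graded_homD(4)[OF resE(2) f(1)] d_\<epsilon>[OF hc(3)[OF f(1)]] lift_\<psi>(3)[OF hc(3)[OF f(1)]] f(2) h(2)
      by (intro bexI[of _ "\<epsilon> f"] conjI) simp_all
  qed
qed

sublocale CE: graded_complex R G D MM E d
proof (rule graded_complex.intro[OF HG.homogeneous_generators_axioms], rule graded_complex_axioms.intro)
  show "d (Suc i) (d i e) = \<zero>\<^bsub>E (Suc (Suc i))\<^esub>" if e: "e \<in> carrier (E i)" for e i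
    using imageI[OF e, of "d i"] unfolding resE(6) by simp
qed (rule E_graded resE(4))+

sublocale CF: graded_complex R G D MM F d'
proof (rule graded_complex.intro[OF HG.homogeneous_generators_axioms], rule graded_complex_axioms.intro)
  show "d' (Suc i) (d' i e) = \<zero>\<^bsub>F (Suc (Suc i))\<^esub>" if e: "e \<in> carrier (F i)" for e i
    using imageI[OF e, of "d' i"] unfolding resF(6) by simp
qed (rule F_graded resF(4))+

sublocale X: complex_map R G D MM E d E d "-1" \<phi>
  by (intro complex_map.intro[OF CE.graded_complex_axioms CE.graded_complex_axioms] complex_map_axioms.intro lift_\<phi>)

sublocale P: complex_map R G D MM E d F d' 0 \<psi>
  by (intro complex_map.intro[OF CE.graded_complex_axioms CF.graded_complex_axioms] complex_map_axioms.intro)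
    (simp_all add: lift_\<psi>)

text \<open>As \<open>B\<close> is torsion, \<open>\<epsilon>\<close> maps its copy in
  \<open>L(M)\<close> to torsion cocycles. In degree 0 the only coboundary is zero, so a class is a
  single element and nothing is lost.\<close>

definition incl :: "(nat \<Rightarrow> 'c set) \<Rightarrow> 'e set" where "incl f = CE.cls 0 (\<epsilon> (sh f))"

text \<open>Torsion is known for homogeneous elements; sums follow because the cocycles form a
  submodule.\<close>

lemma sh_Z:
  assumes f: "f \<in> carrier B.E"
  shows "\<epsilon> (sh f) \<in> CE.Z 0"
proof -
  interpret B: graded_mod R G B.E using B_graded by (simp add: graded_mod_def)
  show ?thesis
    using f
  proof (induction rule: B.graded_induct)
    case (hom n u)
    have "\<epsilon> (sh u) \<in> HG.hcocycles E d 0 (n - 1)"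
      using kernel_gam[OF sh_hcomp[OF hom] xt_sh[OF hom]] d_\<epsilon>[OF sh_carrier[OF hc(4)[OF hom]]] by (simp add: HG.hcocycles_def)
    then show ?case by (rule CE.HL_hcompI(2))
  next
    case (add a b)
    have "\<epsilon> (sh (a \<oplus>\<^bsub>B.E\<^esub> b)) = \<epsilon> (sh a) \<oplus>\<^bsub>E 0\<^esub> \<epsilon> (sh b)"
      using graded_homD(2)[OF resE(2) sh_carrier[OF add(1)] sh_carrier[OF add(2)]] by (simp add: sh_add)
    then show ?case using CE.Z_sub[of 0] add(3,4) unfolding submodule_iff[OF E_module] by simp
  qed
qed

lemma incl_graded: "incl \<in> graded_hom R B.E (gr_shift (-1) (CE.HL 0))"
proof (rule graded_homI)
  show "incl f \<in> carrier (gr_shift (-1) (CE.HL 0))" if f: "f \<in> carrier B.E" for f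
    using sh_Z[OF f] CE.HL_carrier[of "incl f" 0] by (auto simp: incl_def)
  show "incl (f \<oplus>\<^bsub>B.E\<^esub> g) = incl f \<oplus>\<^bsub>gr_shift (-1) (CE.HL 0)\<^esub> incl g"
    if f: "f \<in> carrier B.E" and g: "g \<in> carrier B.E" for f g
    using graded_homD(2)[OF resE(2) sh_carrier[OF f] sh_carrier[OF g]] CE.HL_add[OF sh_Z[OF f] sh_Z[OF g]]
    by (simp add: incl_def sh_add)
  show "incl (a \<odot>\<^bsub>B.E\<^esub> f) = a \<odot>\<^bsub>gr_shift (-1) (CE.HL 0)\<^esub> incl f"
    if a: "a \<in> carrier R" and f: "f \<in> carrier B.E" for a f
    using graded_homD(3)[OF resE(2) a sh_carrier[OF f]] CE.HL_smult[OF a sh_Z[OF f]]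
    by (simp add: incl_def sh_smult[OF a f])
  show "incl f \<in> hcomp (gr_shift (-1) (CE.HL 0)) n" if f: "f \<in> hcomp B.E n" for f n
    using graded_homD(4)[OF resE(2) sh_hcomp[OF f]] sh_Z[OF hc(4)[OF f]] by (auto simp: incl_def CE.HL_hcomp)
qed

lemma incl_inj: "inj_on incl (carrier B.E)"
proof (rule inj_onI)
  fix f g assume f: "f \<in> carrier B.E" and g: "g \<in> carrier B.E" and fg: "incl f = incl g"
  interpret E0: module R "E 0" by (rule E_module)
  have c: "\<epsilon> (sh f) \<in> carrier (E 0)" "\<epsilon> (sh g) \<in> carrier (E 0)"
    using graded_homD(1)[OF resE(2)] sh_carrier f g by auto
  have "{\<epsilon> (sh f)} = {\<epsilon> (sh g)}"
    using fg c by (simp add: incl_def lc_coboundaries_def a_r_coset_def r_coset_def)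
  then show "f = g" using inj_onD[OF sh_inj inj_onD[OF resE(3) _ sh_carrier[OF f] sh_carrier[OF g]] f g] by simp
qed

text \<open>No homotopy enters at this place: a cocycle in degree 0 comes from \<open>L(M)\<close>,
  and being killed by \<open>\<phi> 0\<close> means being killed by \<open>x t\<close>.\<close>

lemma incl_exact:
  "gr_exact R G B.E incl (gr_shift (-1) (CE.HL 0)) (lc_map R MM E d \<phi> 0) (CE.HL 0)"
proof (rule gr_exactI[OF B_graded gr_shift_graded[OF CE.HL_graded] CE.HL_graded incl_graded X.lc_map_graded])
  fix n u assume u: "u \<in> hcomp B.E n"
  have "\<phi> 0 (\<epsilon> (sh u)) = \<zero>\<^bsub>E 0\<^esub>"
    using \<phi>_\<epsilon>_zero_iff[OF sh_carrier[OF hc(4)[OF u]]] xt_sh[OF u] by simp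
  then show "lc_map R MM E d \<phi> 0 (incl u) = \<zero>\<^bsub>CE.HL 0\<^esub>"
    using X.lc_map_zero_iff[OF sh_Z[OF hc(4)[OF u]]] by (simp add: incl_def lc_coboundaries_def)
next
  fix n y assume y: "y \<in> hcomp (gr_shift (-1) (CE.HL 0)) n" and my: "lc_map R MM E d \<phi> 0 y = \<zero>\<^bsub>CE.HL 0\<^esub>"
  from y have "y \<in> hcomp (CE.HL 0) (n - 1)" by simp
  then obtain a where a: "a \<in> HG.hcocycles E d 0 (n - 1)" "a \<in> CE.Z 0" "a \<in> hcomp (E 0) (n - 1)" "y = CE.cls 0 a"
    by (rule CE.HL_hcompE)
  have "d 0 a = \<zero>\<^bsub>E (Suc 0)\<^esub>" using a(1) by (simp add: HG.hcocycles_def)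
  from kernel_E[OF a(3) this] obtain f where f: "f \<in> hcomp L.E (n - 1)" "\<epsilon> f = a" by (elim bexE)
  have "\<phi> 0 a = \<zero>\<^bsub>E 0\<^esub>" using X.lc_map_zero_iff[OF a(2)] my a(4) by (simp add: lc_coboundaries_def)
  then have "xt \<odot>\<^bsub>L.E\<^esub> f = \<zero>\<^bsub>L.E\<^esub>" using \<phi>_\<epsilon>_zero_iff[OF hc(3)[OF f(1)]] f(2) by simp
  from xt_kernel[OF f(1) this] obtain g where g: "g \<in> hcomp B.E n" "sh g = f" by (elim bexE)
  show "\<exists>u\<in>hcomp B.E n. incl u = y" using g f(2) a(4) by (intro bexI[of _ g]) (simp_all add: incl_def)
qed

text \<open>The homotopy is fixed once for all degrees, so that the connecting maps all come from
  the same total complex.\<close>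

lemma long_exact_sequence:
  "\<exists>\<delta>. (\<forall>i. gr_exact R G (gr_shift (-1) (CE.HL i)) (lc_map R MM E d \<phi> i)
                 (CE.HL i) (lc_map R MM F d' \<psi> i) (CF.HL i)) \<and>
     (\<forall>i. gr_exact R G (CE.HL i) (lc_map R MM F d' \<psi> i) (CF.HL i) (\<delta> i) (gr_shift (-1) (CE.HL (Suc i)))) \<and>
     (\<forall>i. gr_exact R G (CF.HL i) (\<delta> i)
                 (gr_shift (-1) (CE.HL (Suc i))) (lc_map R MM E d \<phi> (Suc i)) (CE.HL (Suc i)))"
  (is "\<exists>\<delta>. _ \<and> (\<forall>i. ?Q i (\<delta> i)) \<and> (\<forall>i. ?R i (\<delta> i))")
proof -
  obtain s where s: "\<And>i. hhom G (DL.S (Suc i)) (F i) (s i)"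
    "\<And>n a. a \<in> hcomp (DL.S 0) n \<Longrightarrow> \<psi> 0 (\<phi> 0 a) = s 0 n (d 0 a)"
    "\<And>i n a. a \<in> hcomp (DL.S (Suc i)) n \<Longrightarrow>
       \<psi> (Suc i) (\<phi> (Suc i) a) = s (Suc i) n (d (Suc i) a) \<oplus>\<^bsub>F (Suc i)\<^esub> d' i (s i n a)"
    using DL.homotopy by metis
  have "homotopy_lift R G D E d F d' \<phi> \<psi> s"
    by (rule homotopy_lift.intro[OF DL.double_lift_axioms], rule homotopy_lift_axioms.intro) (use s in blast)+
  then interpret LE: long_exact R G D MM E d F d' \<phi> \<psi> s
    by (rule long_exact.intro[OF _ X.complex_map_axioms P.complex_map_axioms])
  have "\<forall>i. \<exists>\<delta>. ?Q i \<delta> \<and> ?R i \<delta>" by (intro allI LE.long_exact_sequence)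
  from choice[OF this] obtain \<delta> where \<delta>: "\<forall>i. ?Q i (\<delta> i) \<and> ?R i (\<delta> i)" by (elim exE)
  show ?thesis
  proof (intro exI[of _ \<delta>] conjI allI)
    show "gr_exact R G (gr_shift (-1) (CE.HL i)) (lc_map R MM E d \<phi> i) (CE.HL i) (lc_map R MM F d' \<psi> i) (CF.HL i)" for i
      by (rule LE.exact_HE)
    show "?Q i (\<delta> i)" "?R i (\<delta> i)" for i using \<delta>[rule_format, of i] by (rule conjunct1 conjunct2)+
  qed
qed

end

theorem mainTheorem14:
  fixes A :: "'a ring" and \<mm> :: "'a set" and I :: "'a set" and x :: 'a
    and M :: "('a, 'm) module" and N :: "('a, 'm set) module"
    and R :: "('a, nat \<Rightarrow> 'a) up_ring" and G :: "int \<Rightarrow> (nat \<Rightarrow> 'a) set"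
    and MM :: "(nat \<Rightarrow> 'a) set"
    and LM :: "(nat \<Rightarrow> 'a, nat \<Rightarrow> 'm set) graded_module"
    and LN :: "(nat \<Rightarrow> 'a, nat \<Rightarrow> 'm set set) graded_module"
    and E :: "nat \<Rightarrow> (nat \<Rightarrow> 'a, 'e) graded_module"
    and d :: "nat \<Rightarrow> 'e \<Rightarrow> 'e" and \<epsilon> :: "(nat \<Rightarrow> 'm set) \<Rightarrow> 'e"
    and F :: "nat \<Rightarrow> (nat \<Rightarrow> 'a, 'f) graded_module"
    and d' :: "nat \<Rightarrow> 'f \<Rightarrow> 'f" and \<eta> :: "(nat \<Rightarrow> 'm set set) \<Rightarrow> 'f"
    and \<phi> :: "nat \<Rightarrow> 'e \<Rightarrow> 'e" and \<psi> :: "nat \<Rightarrow> 'e \<Rightarrow> 'f"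
    and HM :: "nat \<Rightarrow> (nat \<Rightarrow> 'a, 'e set) graded_module"
    and HN :: "nat \<Rightarrow> (nat \<Rightarrow> 'a, 'f set) graded_module"
  assumes local: "noetherian_local A \<mm>"
    and fg: "fin_gen_module A M"
    and depth: "depth A \<mm> M \<ge> 2"
    and ideal: "ideal_of_definition A M I"
    and superficial: "superficial A M I x"
    and N: "N = quot_module M ((\<lambda>m. x \<odot>\<^bsub>M\<^esub> m) ` carrier M)"
    and R: "R = rees_ring A I"
    and G: "G = rees_grading A I"
    and MM: "MM = rees_max A \<mm> I"
    and LM: "LM = L_module A I M"
    and LN: "LN = L_module A I N"
    and resM: "gr_injective_resolution R G LM E d \<epsilon>"
    and resN: "gr_injective_resolution R G LN F d' \<eta>"
    and HM: "\<And>i. HM i = local_cohomology R MM E d i"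
    and HN: "\<And>i. HN i = local_cohomology R MM F d' i"
    and lift_xt: "gr_lift R (gr_shift (-1) LM) (\<lambda>i. gr_shift (-1) (E i)) d \<epsilon> E d \<epsilon>
                    (\<lambda>f. up_ring.monom (UP A) x 1 \<odot>\<^bsub>LM\<^esub> f) \<phi>"
    and lift_proj: "gr_lift R LM E d \<epsilon> F d' \<eta>
                    (L_map A I N (\<lambda>m. ((\<lambda>m. x \<odot>\<^bsub>M\<^esub> m) ` carrier M) +>\<^bsub>M\<^esub> m)) \<psi>"
  shows "\<exists>(\<iota> :: (nat \<Rightarrow> 'm set) \<Rightarrow> 'e set) (\<delta> :: nat \<Rightarrow> 'f set \<Rightarrow> 'e set).
     inj_on \<iota> (carrier (B_module A I x M)) \<and>
     gr_exact R G (B_module A I x M) \<iota> (gr_shift (-1) (HM 0)) (lc_map R MM E d \<phi> 0) (HM 0) \<and>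
     (\<forall>i. gr_exact R G (gr_shift (-1) (HM i)) (lc_map R MM E d \<phi> i)
                       (HM i) (lc_map R MM F d' \<psi> i) (HN i)) \<and>
     (\<forall>i. gr_exact R G (HM i) (lc_map R MM F d' \<psi> i)
                       (HN i) (\<delta> i) (gr_shift (-1) (HM (i + 1)))) \<and>
     (\<forall>i. gr_exact R G (HN i) (\<delta> i)
                       (gr_shift (-1) (HM (i + 1))) (lc_map R MM E d \<phi> (i + 1)) (HM (i + 1)))"
proof -
  have Am: "cring A" "noetherian_ring A" "ideal \<mm> A"
    using local by (simp_all add: noetherian_local_def maximalideal_def)
  have Im: "ideal I A" "finite_length A (quot_module M (ideal_smult A I M))"
    using ideal by (simp_all add: ideal_of_definition_def)
  have Mm: "module A M" using fg by (simp add: fin_gen_module_def)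
  have xI: "x \<in> I" using superficial by (simp add: superficial_def)
  \<comment> \<open>Finite generation of \<open>\<mm>\<close> and \<open>I\<close> makes
    \<open>D\<close> finite, as the comparison of \<open>gam\<close> with \<open>torsion\<close>
    requires.\<close>
  obtain C where C: "C \<subseteq> carrier A" "finite C" "\<mm> = Idl\<^bsub>A\<^esub> C"
    using noetherian_ring.finetely_gen[OF Am(2,3)] by (elim bexE exE conjE)
  obtain C' where C': "C' \<subseteq> carrier A" "finite C'" "I = Idl\<^bsub>A\<^esub> C'"
    using noetherian_ring.finetely_gen[OF Am(2) Im(1)] by (elim bexE exE conjE)
  interpret xt_data A I M x
    by (intro xt_data.intro rees_module.intro rees.intro rees_axioms.intro xt_data_axioms.intro Am Im Mm xI)
  \<comment> \<open>Matches the monomial \<open>x t\<close> of the polynomial ring in the lifting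
    hypothesis with the unrestricted \<open>mon\<close>.\<close>
  have xm: "up_ring.monom (UP A) x 1 = mon x (Suc 0)" using monom_eq[OF xc, of 1] by simp
  interpret rees_resolutions A I M x \<mm> C C' E d \<epsilon> F d' \<eta> \<phi> \<psi>
  proof (rule rees_resolutions.intro[OF xt_data_axioms], rule rees_resolutions_axioms.intro)
    show "gr_injective_resolution (rees_ring A I) (rees_grading A I) L.E E d \<epsilon>"
      using resM unfolding R G LM L_eq .
    show "gr_injective_resolution (rees_ring A I) (rees_grading A I) LN.E F d' \<eta>"
      using resN unfolding R G LN N NR.L_eq .
    show "gr_lift (rees_ring A I) (gr_shift (-1) L.E) (\<lambda>i. gr_shift (-1) (E i)) d \<epsilon> E d \<epsilon> (\<lambda>f. xt \<odot>\<^bsub>L.E\<^esub> f) \<phi>"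
      using lift_xt unfolding R LM L_eq xm .
    show "gr_lift (rees_ring A I) L.E E d \<epsilon> F d' \<eta> proj \<psi>"
      using lift_proj unfolding R LM L_eq N .
  qed (rule local Im superficial C C')+
  have H: "HM = (\<lambda>i. local_cohomology R MM E d i)" "HN = (\<lambda>i. local_cohomology R MM F d' i)"
    using HM HN by auto
  obtain \<delta> where \<delta>: "\<forall>i. gr_exact R G (gr_shift (-1) (HM i)) (lc_map R MM E d \<phi> i) (HM i) (lc_map R MM F d' \<psi> i) (HN i)"
    "\<forall>i. gr_exact R G (HM i) (lc_map R MM F d' \<psi> i) (HN i) (\<delta> i) (gr_shift (-1) (HM (Suc i)))"
    "\<forall>i. gr_exact R G (HN i) (\<delta> i) (gr_shift (-1) (HM (Suc i))) (lc_map R MM E d \<phi> (Suc i)) (HM (Suc i))"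
    using long_exact_sequence unfolding H R G MM by (elim exE conjE)
  have \<iota>: "inj_on incl (carrier (B_module A I x M))"
    "gr_exact R G (B_module A I x M) incl (gr_shift (-1) (HM 0)) (lc_map R MM E d \<phi> 0) (HM 0)"
    using incl_inj incl_exact unfolding H R G MM B_eq .
  show ?thesis
    unfolding Suc_eq_plus1[symmetric] using \<iota> \<delta> by (intro exI[of _ incl] exI[of _ \<delta>] conjI)
qed

end
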